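(* Let $\gamma\in(0,1]$, $C>0$, and let $(H_x)_{x\in\mathbb{Z}}$ be i.i.d. $[0,\infty)$-valued random variables on a probability space $(\Omega,\mathcal{G},\mathbf{P})$ with $\lim_{z\to\infty} z^{\gamma}\,\mathbf{P}(H_0>z)=C$. Then for $\mathbf{P}$-almost every $\omega\in\Omega$: (1) if $\gamma>1/3$, the graph $\mathrm{Comb}(\mathbb{Z},H^\omega)$ has the infinite collision property; (2) if $\gamma<1/3$, the graph $\mathrm{Comb}(\mathbb{Z},H^\omega)$ has the finite collision property.
   Context: For a profile $H=(H_x)_{x\in\mathbb{Z}}\in[0,\infty)^{\mathbb{Z}}$, the comb graph $\mathrm{Comb}(\mathbb{Z},H)$ has vertex set $V=\{(x,\ell)\in\mathbb{Z}\times\mathbb{N}_0: 0\le \ell\le H_x\}$; its edges are $\{(x,0),(y,0)\}$ for $|x-y|=1$, and $\{(x,\ell),(x,k)\}$ for $x\in\mathbb{Z}$, $|\ell-k|=1$ (both endpoints in $V$). $H^\omega=(H_x(\omega))_{x\in\mathbb{Z}}$. A connected, locally finite graph $G=(V,E)$ has the infinite (resp. finite) collision property if, for some $x\in V$, two independent discrete-time simple random walks $(X^1_n)_{n\ge 0},(X^2_n)_{n\ge0}$ on $G$, both started at $x$, satisfy that the set $\{n: X^1_n=X^2_n\}$ is almost surely infinite (resp. finite). *)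

theory Defs
  imports "HOL-Probability.Probability"
begin

section \<open>Graphs\<close>

text \<open>A graph is a pair of a vertex set and a set of edges, each edge being an unordered pair.\<close>

type_synonym 'v graph = "'v set \<times> 'v set set"

definition verts :: "'v graph \<Rightarrow> 'v set" where
  "verts G = fst G"

definition edges :: "'v graph \<Rightarrow> 'v set set" where
  "edges G = snd G"

definition nbrs :: "'v graph \<Rightarrow> 'v \<Rightarrow> 'v set" where
  "nbrs G v = {w. {v, w} \<in> edges G}"

definition simple_graph :: "'v graph \<Rightarrow> bool" where
  "simple_graph G \<longleftrightarrow> (\<forall>e\<in>edges G. \<exists>u v. e = {u, v} \<and> u \<in> verts G \<and> v \<in> verts G \<and> u \<noteq> v)"

definition connected_graph :: "'v graph \<Rightarrow> bool" where
  "connected_graph G \<longleftrightarrow>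
     (\<forall>u\<in>verts G. \<forall>v\<in>verts G. (u, v) \<in> {(a, b). {a, b} \<in> edges G}\<^sup>*)"

definition locally_finite_graph :: "'v graph \<Rightarrow> bool" where
  "locally_finite_graph G \<longleftrightarrow> (\<forall>v\<in>verts G. finite (nbrs G v))"

definition Comb :: "(int \<Rightarrow> real) \<Rightarrow> (int \<times> nat) graph" where
  "Comb H =
     ({(x, l) |x l. real l \<le> H x},
      {{(x, 0), (y, 0)} |x y. \<bar>x - y\<bar> = 1} \<union>
      {{(x, l), (x, k)} |x l k. real l \<le> H x \<and> real k \<le> H x \<and> \<bar>int l - int k\<bar> = 1})"

section \<open>Simple random walk\<close>

text \<open>Conditional law of the \<open>n\<close>-th position given the earlier positions \<open>\<omega> 0, \<dots>, \<omega> (n - 1)\<close>.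
  The neighbour set has to be finite and nonempty for \<^const>\<open>pmf_of_set\<close> to be meaningful; in a
  connected locally finite graph this fails only if there is just one vertex.\<close>

definition srw_kernel :: "'v graph \<Rightarrow> 'v \<Rightarrow> nat \<Rightarrow> (nat \<Rightarrow> 'v) \<Rightarrow> 'v measure" where
  "srw_kernel G x n \<omega> =
     measure_pmf (if n = 0 then return_pmf x else pmf_of_set (nbrs G (\<omega> (n - 1))))"

text \<open>The law, on trajectories, of the simple random walk on \<open>G\<close> started at \<open>x\<close>, obtained from the
  kernels by the Ionescu-Tulcea theorem. Lemma \<open>emeasure_srw_cylinder\<close> below gives its
  finite-dimensional distributions.\<close>

definition srw :: "'v graph \<Rightarrow> 'v \<Rightarrow> (nat \<Rightarrow> 'v) measure" where
  "srw G x = projective_family.lim UNIV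
     (Ionescu_Tulcea.CI (srw_kernel G x) (\<lambda>_. count_space UNIV)) (\<lambda>_. count_space UNIV)"

section \<open>Collision properties\<close>

text \<open>The product measure \<open>srw G x \<Otimes>\<^sub>M srw G x\<close> is the joint law of two independent walks.\<close>

definition infinite_collision_property :: "'v graph \<Rightarrow> bool" where
  "infinite_collision_property G \<longleftrightarrow>
     simple_graph G \<and> connected_graph G \<and> locally_finite_graph G \<and>
     (\<exists>x\<in>verts G. AE X in srw G x \<Otimes>\<^sub>M srw G x. infinite {n. fst X n = snd X n})"

definition finite_collision_property :: "'v graph \<Rightarrow> bool" where
  "finite_collision_property G \<longleftrightarrow>
     simple_graph G \<and> connected_graph G \<and> locally_finite_graph G \<and>
     (\<exists>x\<in>verts G. AE X in srw G x \<Otimes>\<^sub>M srw G x. finite {n. fst X n = snd X n})"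

section \<open>Basic facts\<close>

lemma simple_graph_Comb:
  assumes "\<And>x. 0 \<le> H x"
  shows "simple_graph (Comb H)"
  unfolding simple_graph_def
proof
  fix e assume "e \<in> edges (Comb H)"
  then consider x y :: int where "e = {(x, 0), (y, 0)}" "\<bar>x - y\<bar> = 1"
    | x l k where "e = {(x, l), (x, k)}" "real l \<le> H x" "real k \<le> H x" "\<bar>int l - int k\<bar> = 1"
    unfolding edges_def Comb_def by auto
  then show "\<exists>u v. e = {u, v} \<and> u \<in> verts (Comb H) \<and> v \<in> verts (Comb H) \<and> u \<noteq> v"
  proof cases
    case 1
    then show ?thesis
      using assms by (intro exI[of _ "(x, 0)"] exI[of _ "(y, 0)"]) (auto simp: verts_def Comb_def)
  next
    case 2
    then show ?thesis
      by (intro exI[of _ "(x, l)"] exI[of _ "(x, k)"]) (auto simp: verts_def Comb_def)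
  qed
qed

lemma connected_graph_Comb: "connected_graph (Comb H)"
proof -
  let ?R = "{(a, b). {a, b} \<in> edges (Comb H)}"
  have sym: "sym (?R\<^sup>*)"
    by (intro sym_rtrancl) (auto simp: sym_def insert_commute)
  have up: "((x, 0), (x, l)) \<in> ?R\<^sup>*" if "real l \<le> H x" for x l
    using that
  proof (induction l)
    case (Suc l)
    have "{(x, l), (x, Suc l)} \<in> edges (Comb H)"
      unfolding edges_def Comb_def snd_conv
      using Suc.prems by (intro UnI2 CollectI exI[of _ x] exI[of _ l] exI[of _ "Suc l"]) auto
    then have "((x, l), (x, Suc l)) \<in> ?R"
      by simp
    moreover have "((x, 0), (x, l)) \<in> ?R\<^sup>*"
      by (rule Suc.IH) (use Suc.prems in simp)
    ultimately show ?case
      by (rule rtrancl_into_rtrancl[rotated])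
  qed simp
  have spine_step: "((x, 0), (x + 1, 0)) \<in> ?R" for x
    unfolding edges_def Comb_def snd_conv mem_Collect_eq prod.case
    by (intro UnI1 CollectI exI[of _ x] exI[of _ "x + 1"]) auto
  have "((x, 0), (x + int n, 0)) \<in> ?R\<^sup>*" for x n
  proof (induction n)
    case (Suc n)
    then show ?case
      using rtrancl_into_rtrancl[OF Suc spine_step] by (simp add: ac_simps)
  qed simp
  then have le: "((x, 0), (y, 0)) \<in> ?R\<^sup>*" if "x \<le> y" for x y
    using that by (metis zle_iff_zadd)
  have spine: "((x, 0), (y, 0)) \<in> ?R\<^sup>*" for x y
    using le[of x y] le[of y x] symD[OF sym] by (cases "x \<le> y") auto
  show ?thesis
    unfolding connected_graph_def
  proof (intro ballI)
    fix u v assume "u \<in> verts (Comb H)" "v \<in> verts (Comb H)"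
    then obtain x l y k where uv: "u = (x, l)" "real l \<le> H x" "v = (y, k)" "real k \<le> H y"
      by (auto simp: verts_def Comb_def)
    show "(u, v) \<in> ?R\<^sup>*"
      unfolding uv(1,3)
      using symD[OF sym up[OF uv(2)]] spine[of x y] up[OF uv(4)] by (meson rtrancl_trans)
  qed
qed

lemma locally_finite_graph_Comb: "locally_finite_graph (Comb H)"
  unfolding locally_finite_graph_def
proof
  fix v :: "int \<times> nat"
  obtain x l where v: "v = (x, l)" by (cases v)
  have "nbrs (Comb H) v \<subseteq> {x - 1..x + 1} \<times> {0..l + 1}"
    by (auto simp: v nbrs_def edges_def Comb_def doubleton_eq_iff)
  then show "finite (nbrs (Comb H) v)"
    by (rule finite_subset) auto
qed

lemma Ionescu_Tulcea_srw: "Ionescu_Tulcea (srw_kernel G x) (\<lambda>_. count_space UNIV)"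
proof (rule Ionescu_Tulcea.intro)
  fix n
  show "srw_kernel G x n \<in> measurable (PiM {0..<n} (\<lambda>_. count_space UNIV))
          (subprob_algebra (count_space UNIV))"
  proof (cases "n = 0")
    case True
    then show ?thesis
      by (auto simp: srw_kernel_def[abs_def] space_subprob_algebra measure_pmf.subprob_space_axioms)
  next
    case False
    have "(\<lambda>\<omega>. \<omega> (n - 1)) \<in> measurable (PiM {0..<n} (\<lambda>_. count_space UNIV)) (count_space UNIV)"
      using False by (intro measurable_component_singleton) auto
    moreover have "(\<lambda>v. measure_pmf (pmf_of_set (nbrs G v))) \<in>
        measurable (count_space UNIV) (subprob_algebra (count_space UNIV))"
      by (auto simp: space_subprob_algebra measure_pmf.subprob_space_axioms)
    ultimately show ?thesis
      using False by (simp add: srw_kernel_def[abs_def] measurable_compose)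
  qed
  show "prob_space (srw_kernel G x n \<omega>)" if "\<omega> \<in> space (PiM {0..<n} (\<lambda>_. count_space UNIV))" for \<omega>
    by (simp add: srw_kernel_def measure_pmf.prob_space_axioms)
qed

lemma sets_srw: "sets (srw G x) = sets (PiM UNIV (\<lambda>_. count_space UNIV))"
proof -
  interpret Ionescu_Tulcea "srw_kernel G x" "\<lambda>_. count_space UNIV"
    by (rule Ionescu_Tulcea_srw)
  show ?thesis
    unfolding srw_def by simp
qed

lemma prob_space_srw: "prob_space (srw G x)"
proof -
  interpret Ionescu_Tulcea "srw_kernel G x" "\<lambda>_. count_space UNIV"
    by (rule Ionescu_Tulcea_srw)
  have [simp]: "space PF.lim = UNIV"
    using sets_eq_imp_space_eq[OF PF.sets_lim] by (simp add: space_PiM)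
  have "emeasure PF.lim (PF.emb UNIV {} {\<lambda>_. undefined}) = emeasure (CI {}) {\<lambda>_. undefined}"
    by (intro lim) (auto simp: PiM_empty)
  also have "{\<lambda>_. undefined} = space (CI {})"
    by (simp add: CI_def space_PiM)
  also have "emeasure (CI {}) (space (CI {})) = 1"
    by (intro prob_space.emeasure_space_1 PF.prob_space_P) auto
  also have "PF.emb UNIV {} (space (CI {})) = UNIV"
    by (auto simp: CI_def space_PiM prod_emb_def)
  finally show ?thesis
    unfolding srw_def by (intro prob_spaceI) (simp add: space_PiM)
qed

lemma emeasure_srw_cylinder:
  assumes "\<And>i. i < n \<Longrightarrow> finite (nbrs G (v i)) \<and> nbrs G (v i) \<noteq> {}"
  shows "emeasure (srw G x) {\<omega>. \<forall>i\<le>n. \<omega> i = v i} =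
    (if v 0 = x \<and> (\<forall>i<n. {v i, v (Suc i)} \<in> edges G)
     then \<Prod>i<n. ennreal (1 / card (nbrs G (v i))) else 0)"
proof -
  interpret Ionescu_Tulcea "srw_kernel G x" "\<lambda>_. count_space UNIV"
    by (rule Ionescu_Tulcea_srw)
  let ?M = "\<lambda>_::nat. count_space (UNIV :: 'a set)"
  let ?S = "\<lambda>n. {restrict v {0..<n}}"
  have S: "?S m = PiE {0..<m} (\<lambda>i. {v i})" for m
    by (auto simp: PiE_iff extensional_def fun_eq_iff)
  have sets_S [measurable]: "?S m \<in> sets (PiM {0..<m} ?M)" for m
    unfolding S by (intro sets_PiM_I_finite) auto
  have space_0: "(\<lambda>_. undefined) \<in> space (PiM {0..<0} ?M)"
    by (simp add: space_PiM)
  have step: "emeasure (C 0 (Suc m) (\<lambda>_. undefined)) (?S (Suc m)) =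
      emeasure (srw_kernel G x m (restrict v {0..<m})) {v m} *
      emeasure (C 0 m (\<lambda>_. undefined)) (?S m)" for m
  proof -
    have "emeasure (C 0 (Suc m) (\<lambda>_. undefined)) (?S (Suc m)) =
        (\<integral>\<^sup>+\<omega>. emeasure (eP m \<omega>) (?S (Suc m)) \<partial>C 0 m (\<lambda>_. undefined))"
      unfolding C.simps add_0
    proof (rule emeasure_bind[OF _ _ sets_S])
      show "space (C 0 m (\<lambda>_. undefined)) \<noteq> {}"
        by (rule prob_space.not_empty[OF prob_space_C[OF space_0]])
      show "eP m \<in> measurable (C 0 m (\<lambda>_. undefined)) (subprob_algebra (PiM {0..<Suc m} ?M))"
        using measurable_eP[of m]
        unfolding measurable_cong_sets[OF sets_C[OF space_0, of m, unfolded add_0] refl] .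
    qed
    also have "\<dots> = (\<integral>\<^sup>+\<omega>. emeasure (srw_kernel G x m (restrict v {0..<m})) {v m} *
        indicator (?S m) \<omega> \<partial>C 0 m (\<lambda>_. undefined))"
    proof (intro nn_integral_cong)
      fix \<omega> assume "\<omega> \<in> space (C 0 m (\<lambda>_. undefined))"
      then have \<omega>: "\<omega> \<in> space (PiM {0..<m} ?M)"
        by (simp add: space_C[OF space_0, simplified])
      then have ext: "\<omega> \<in> extensional {0..<m}"
        by (simp add: space_PiM PiE_def)
      have "(fun_upd \<omega> m y = restrict v {0..<Suc m}) \<longleftrightarrow> \<omega> = restrict v {0..<m} \<and> y = v m" for y
      proof safe
        assume eq: "fun_upd \<omega> m y = restrict v {0..<Suc m}"
        show "y = v m" using fun_cong[OF eq, of m] by simp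
        show "\<omega> = restrict v {0..<m}"
        proof
          fix i show "\<omega> i = restrict v {0..<m} i"
            using fun_cong[OF eq, of i] ext by (cases "i < m") (auto simp: extensional_def)
        qed
      qed (auto simp: restrict_def fun_eq_iff)
      then have "(\<lambda>y. fun_upd \<omega> m y) -` ?S (Suc m) \<inter> space (?M m) =
          (if \<omega> = restrict v {0..<m} then {v m} else {})"
        by auto
      then show "emeasure (eP m \<omega>) (?S (Suc m)) =
          emeasure (srw_kernel G x m (restrict v {0..<m})) {v m} * indicator (?S m) \<omega>"
        by (simp add: emeasure_eP[OF \<omega> sets_S])
    qed
    also have "\<dots> = emeasure (srw_kernel G x m (restrict v {0..<m})) {v m} *
        emeasure (C 0 m (\<lambda>_. undefined)) (?S m)"
      using sets_S[of m] by (intro nn_integral_cmult_indicator)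
        (simp add: sets_C[OF space_0, simplified])
    finally show ?thesis .
  qed
  have "{\<omega>. \<forall>i\<le>n. \<omega> i = v i} = PF.emb UNIV {0..<Suc n} (?S (Suc n))"
    by (auto simp: prod_emb_def space_PiM restrict_def less_Suc_eq_le fun_eq_iff) metis
  then have "emeasure (srw G x) {\<omega>. \<forall>i\<le>n. \<omega> i = v i} = emeasure (CI {0..<Suc n}) (?S (Suc n))"
    unfolding srw_def using lim[OF _ sets_S] by simp
  also have "\<dots> = emeasure (C 0 (Suc n) (\<lambda>_. undefined)) (?S (Suc n))"
    using sets_S[of "Suc n"] emeasure_CI[of "{0..<Suc n}" "Suc n" "?S (Suc n)"]
      sets.sets_into_space[OF sets_S[of "Suc n"]]
    by (simp add: prod_emb_id space_PiM del: C.simps)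
  also have "\<dots> = (if v 0 = x \<and> (\<forall>i<n. {v i, v (Suc i)} \<in> edges G)
     then \<Prod>i<n. ennreal (1 / card (nbrs G (v i))) else 0)"
    using assms
  proof (induction n)
    case 0
    have "restrict v {} = (\<lambda>_. undefined)"
      by (simp add: restrict_def)
    then show ?case
      by (subst step) (auto simp: srw_kernel_def PiM_empty)
  next
    case (Suc n)
    have fin: "finite (nbrs G (v n))" "nbrs G (v n) \<noteq> {}"
      using Suc.prems[of n] by auto
    have kernel: "emeasure (srw_kernel G x (Suc n) (restrict v {0..<Suc n})) {v (Suc n)} =
        (if {v n, v (Suc n)} \<in> edges G then ennreal (1 / card (nbrs G (v n))) else 0)"
      using fin by (simp add: srw_kernel_def emeasure_pmf_single indicator_def) (simp add: nbrs_def)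
    have IH: "emeasure (C 0 (Suc n) (\<lambda>_. undefined)) (?S (Suc n)) =
        (if v 0 = x \<and> (\<forall>i<n. {v i, v (Suc i)} \<in> edges G)
         then \<Prod>i<n. ennreal (1 / card (nbrs G (v i))) else 0)"
      by (rule Suc.IH) (use Suc.prems in auto)
    show ?case
      unfolding step[of "Suc n"] kernel IH All_less_Suc prod.lessThan_Suc
      by (auto simp: mult.commute)
  qed
  finally show ?thesis .
qed

end

theory Submission
  imports Defs
begin

text \<open>Let \<open>u\<close> be the Green function of the walk killed at rate \<open>1 - s\<close>, \<open>s = 1 / cosh \<alpha>\<close>. On the spine it
  solves a one-dimensional Schroedinger equation whose potential at \<open>y\<close> is explicit in \<open>\<alpha>\<close> and \<open>H y\<close>.
  For \<open>\<alpha> = 2 ^ (- k)\<close> the mean potential \<open>e\<close> is roughly \<open>2 ^ (- k (1 + \<gamma>))\<close>, so \<open>u\<close>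
  is of order \<open>L = e ^ (- 1 / 2)\<close> and decays over distance \<open>L\<close>: each stretch of \<open>2 L\<close> sites in which
  the potential is not exceptionally small halves it, and disjoint stretches are independent.

  By \<open>p\<^sub>n(x, y)\<^sup>2 \<le> C p\<^sub>n(x, y) n\<^sup>-\<^sup>1 (u(x, x) + u(y, y))\<close> at the time scale \<open>n \<approx> 4 ^ k\<close>, the expected number
  of collisions on the spine at that scale is of order \<open>b\<^sub>k = L ^ 3 4 ^ (- k)\<close>, that is
  \<open>2 ^ (k (3 \<gamma> - 1) / 2)\<close>, and this also holds in second moment over the environment; a matching
  lower bound holds on every event of positive probability.

  Whether there are finitely many collisions is a zero-one event for a fixed environment, since
  bounded harmonic functions of the pair of walks are constant (Choquet--Deny and the Liouville
  property of the comb). If \<open>\<gamma> < 1/3\<close>, the \<open>b\<^sub>k\<close> are summable; a collision at height \<open>l\<close> of a tooth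
  entails of order \<open>l\<close> further ones in expectation, hence collisions in a tooth of height \<open>h\<close> cost a factor
  \<open>1 + 1/2 + \<dots> + 1/(h + 1)\<close> only, and they are finite in number. If \<open>\<gamma> > 1/3\<close>, the \<open>b\<^sub>k\<close> grow
  geometrically. On the event that collisions are finite, the second moment method compares
  \<open>b\<^sub>m\<close> with \<open>N + t b\<^sub>m\<^sup>2 + \<epsilon>\<^sub>N / t\<close>, where \<open>\<epsilon>\<^sub>N\<close> is the probability of a collision after time
  \<open>N\<close>; with \<open>t\<close> a small multiple of \<open>1 / b\<^sub>m\<close> this bounds \<open>b\<^sub>m\<close>, so the event has probability zero.
  Shift invariance of the environment replaces the sum over starting points on the spine by one starting point.\<close>

section \<open>Simple random walk on a graph\<close>

text \<open>The size L^3 4^(-k) arises from summing 4^(-k) u(x,y) (u(x,x) + u(y,y)) over the roughly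
  L sites y at which u(x,y) is still of order L. Killing is parametrised by 1 / cosh \<alpha>
  because along a tooth, counted from its tip, solutions are then exact multiples of cosh(\<alpha>
  j). The obstacle is the irregularity of a single environment, in which very high teeth occur: no
  bound uniform over one sample is attempted, and every estimate is a moment over the environment at
  a fixed site. Green functions at different sites, damping factors and tooth heights all depend on
  the same environment. Their products are therefore split by Cauchy-Schwarz or by the inequality of
  arithmetic and geometric means, and this is why moments up to order eight appear. The zero-one law
  has to hold for each fixed environment: ergodicity of the environment would not exclude a
  conditional probability of finitely many collisions strictly between 0 and 1, and the second
  moment method alone yields only a positive chance of colliding.\<close>

definition deg :: "'v graph \<Rightarrow> 'v \<Rightarrow> real" where
  "deg G v = card (nbrs G v)"

definition avg :: "'v graph \<Rightarrow> ('v \<Rightarrow> real) \<Rightarrow> 'v \<Rightarrow> real" where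
  "avg G g v = (\<Sum>w\<in>nbrs G v. g w) / deg G v"

definition tp :: "'v graph \<Rightarrow> nat \<Rightarrow> 'v \<Rightarrow> 'v \<Rightarrow> real" where
  "tp G n x t = (avg G ^^ n) (indicator {t}) x"

lemma tp_0: "tp G 0 x t = indicator {t} x"
  by (simp add: tp_def)

lemma tp_Suc: "tp G (Suc n) x t = avg G (\<lambda>y. tp G n y t) x"
  by (simp add: tp_def)

lemma nbrs_sym: "w \<in> nbrs G v \<longleftrightarrow> v \<in> nbrs G w"
  by (simp add: nbrs_def insert_commute)

lemma avg_mono: "(\<And>w. w \<in> nbrs G v \<Longrightarrow> f w \<le> g w) \<Longrightarrow> avg G f v \<le> avg G g v"
  unfolding avg_def by (intro divide_right_mono sum_mono) (auto simp: deg_def)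

lemma avg_cong: "(\<And>w. w \<in> nbrs G v \<Longrightarrow> f w = g w) \<Longrightarrow> avg G f v = avg G g v"
  unfolding avg_def by (metis sum.cong)

lemma avg_nonneg: "(\<And>w. w \<in> nbrs G v \<Longrightarrow> 0 \<le> g w) \<Longrightarrow> 0 \<le> avg G g v"
  unfolding avg_def by (intro divide_nonneg_nonneg sum_nonneg) (auto simp: deg_def)

lemma avg_add: "avg G (\<lambda>w. f w + g w) v = avg G f v + avg G g v"
  by (simp add: avg_def sum.distrib add_divide_distrib)

lemma avg_diff: "avg G (\<lambda>w. f w - g w) v = avg G f v - avg G g v"
  by (simp add: avg_def sum_subtractf diff_divide_distrib)

lemma avg_cmult: "avg G (\<lambda>w. c * g w) v = c * avg G g v"
  by (simp add: avg_def sum_distrib_left)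

lemma avg_sum: "avg G (\<lambda>w. \<Sum>i\<in>I. g i w) v = (\<Sum>i\<in>I. avg G (g i) v)"
  unfolding avg_def by (subst sum.swap) (simp add: sum_divide_distrib)

lemma avg_tendsto:
  assumes "\<And>w. w \<in> nbrs G v \<Longrightarrow> ((\<lambda>n. g n w) \<longlongrightarrow> h w) F"
  shows "((\<lambda>n. avg G (g n) v) \<longlongrightarrow> avg G h v) F"
  unfolding avg_def divide_inverse using assms by (intro tendsto_mult tendsto_sum tendsto_const) auto

lemma deg_nonneg [simp]: "0 \<le> deg G v"
  by (simp add: deg_def)

text \<open>The hypothesis on the sign of \<open>c\<close> covers points where \<open>deg\<close> is
  0 (no neighbours, or infinitely many): there division by zero makes the average 0.\<close>

lemma avg_le_const:
  assumes "\<And>w. w \<in> nbrs G v \<Longrightarrow> g w \<le> c" "0 \<le> c"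
  shows "avg G g v \<le> c"
proof -
  have "(\<Sum>w\<in>nbrs G v. g w) \<le> deg G v * c"
    using sum_bounded_above[of "nbrs G v" g c] assms by (simp add: deg_def)
  then show ?thesis
    unfolding avg_def using assms(2) deg_nonneg[of G v]
    by (cases "deg G v = 0") (auto simp: field_simps simp del: deg_nonneg)
qed

lemma tp_nonneg: "0 \<le> tp G n x t"
  by (induction n arbitrary: x) (auto simp: tp_0 tp_Suc intro: avg_nonneg)

lemma tp_le_1: "tp G n x t \<le> 1"
  by (induction n arbitrary: x) (auto simp: tp_0 tp_Suc indicator_def intro: avg_le_const)

locale walk_graph =
  fixes G :: "'v graph"
  assumes finite_nbrs [simp]: "finite (nbrs G v)"
    and nbrs_nonempty: "v \<in> verts G \<Longrightarrow> nbrs G v \<noteq> {}"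
    and nbrs_verts: "w \<in> nbrs G v \<Longrightarrow> w \<in> verts G"
begin

lemma deg_pos: "v \<in> verts G \<Longrightarrow> 0 < deg G v"
  using nbrs_nonempty by (simp add: deg_def card_gt_0_iff)

lemma avg_const: "v \<in> verts G \<Longrightarrow> avg G (\<lambda>_. c) v = c"
  using nbrs_nonempty[of v] by (simp add: avg_def deg_def)

fun reach :: "nat \<Rightarrow> 'v \<Rightarrow> 'v set" where
  "reach 0 x = {x}"
| "reach (Suc n) x = (\<Union>w\<in>nbrs G x. reach n w)"

lemma finite_reach [simp]: "finite (reach n x)"
  by (induction n arbitrary: x) auto

lemma tp_outside_reach: "z \<notin> reach n x \<Longrightarrow> tp G n x z = 0"
proof (induction n arbitrary: x)
  case (Suc n)
  then have "avg G (\<lambda>y. tp G n y z) x = avg G (\<lambda>y. 0) x"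
    by (intro avg_cong) auto
  then show ?case by (simp add: tp_Suc avg_def)
qed (auto simp: tp_0)

lemma avg_pow_eq_sum:
  assumes "finite S" "reach n x \<subseteq> S"
  shows "(avg G ^^ n) g x = (\<Sum>z\<in>S. tp G n x z * g z)"
  using assms(2)
proof (induction n arbitrary: x)
  case 0
  then have "(\<Sum>z\<in>S. tp G 0 x z * g z) = (\<Sum>z\<in>{x}. tp G 0 x z * g z)"
    using assms(1) by (intro sum.mono_neutral_right) (auto simp: tp_0 indicator_def)
  then show ?case by (simp add: tp_0)
next
  case (Suc n)
  have "(avg G ^^ Suc n) g x = avg G ((avg G ^^ n) g) x"
    by simp
  also have "\<dots> = avg G (\<lambda>w. \<Sum>z\<in>S. tp G n w z * g z) x"
    using Suc by (intro avg_cong Suc.IH) auto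
  also have "\<dots> = (\<Sum>z\<in>S. tp G (Suc n) x z * g z)"
    unfolding avg_sum tp_Suc avg_def by (simp add: sum_distrib_left sum_distrib_right)
  finally show ?case .
qed

lemma tp_add:
  assumes "finite S" "reach m x \<subseteq> S"
  shows "tp G (m + n) x t = (\<Sum>z\<in>S. tp G m x z * tp G n z t)"
  using avg_pow_eq_sum[OF assms, of "(avg G ^^ n) (indicator {t})"]
  by (simp add: tp_def funpow_add)

lemma tp_add_ge:
  assumes "finite S"
  shows "(\<Sum>z\<in>S. tp G m x z * tp G n z t) \<le> tp G (m + n) x t"
proof -
  have "(\<Sum>z\<in>S. tp G m x z * tp G n z t) \<le> (\<Sum>z\<in>S \<union> reach m x. tp G m x z * tp G n z t)"
    using assms by (intro sum_mono2) (auto intro!: mult_nonneg_nonneg tp_nonneg)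
  also have "\<dots> = tp G (m + n) x t"
    using assms by (intro tp_add[symmetric]) auto
  finally show ?thesis .
qed

lemma sum_tp_le_1:
  assumes "finite S"
  shows "(\<Sum>z\<in>S. tp G n x z) \<le> 1"
proof -
  have *: "(avg G ^^ n) (\<lambda>_. 1) x \<le> 1"
    by (induction n arbitrary: x) (auto intro: avg_le_const)
  have "(\<Sum>z\<in>S. tp G n x z) \<le> (\<Sum>z\<in>S \<union> reach n x. tp G n x z * 1)"
    using assms by (simp, intro sum_mono2) (auto intro!: tp_nonneg)
  also have "\<dots> = (avg G ^^ n) (\<lambda>_. 1) x"
    using assms by (intro avg_pow_eq_sum[symmetric]) auto
  finally show ?thesis using * by linarith
qed

lemma tp_reversible: "deg G x * tp G n x y = deg G y * tp G n y x"
proof (induction n arbitrary: x y)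
  case 0
  then show ?case by (auto simp: tp_0 indicator_def)
next
  case (Suc n)
  define S where "S = reach n y \<union> nbrs G x"
  have S: "finite S" by (simp add: S_def)
  have one: "tp G 1 z x = (if z \<in> nbrs G x then 1 / deg G z else 0)" for z
  proof -
    have "tp G 1 z x = (\<Sum>w\<in>nbrs G z. indicator {x} w) / deg G z"
      by (simp add: tp_def avg_def)
    also have "(\<Sum>w\<in>nbrs G z. indicator {x} w :: real) = (if x \<in> nbrs G z then 1 else 0)"
      by (simp add: indicator_def)
    finally show ?thesis using nbrs_sym[of x G z] by auto
  qed
  have "deg G x * tp G (Suc n) x y = (\<Sum>z\<in>nbrs G x. tp G n z y)"
    by (auto simp: tp_Suc avg_def deg_def)
  also have "\<dots> = (\<Sum>z\<in>nbrs G x. deg G z * tp G n z y * tp G 1 z x)"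
  proof (rule sum.cong)
    fix z assume z: "z \<in> nbrs G x"
    then have "0 < deg G z" by (intro deg_pos nbrs_verts)
    then show "tp G n z y = deg G z * tp G n z y * tp G 1 z x"
      using z one[of z] by simp
  qed simp
  also have "\<dots> = (\<Sum>z\<in>nbrs G x. deg G y * (tp G n y z * tp G 1 z x))"
    by (intro sum.cong) (auto simp: Suc.IH[of _ y] algebra_simps)
  also have "\<dots> = (\<Sum>z\<in>S. deg G y * (tp G n y z * tp G 1 z x))"
    using S by (intro sum.mono_neutral_left) (auto simp: S_def one[unfolded One_nat_def])
  also have "\<dots> = deg G y * tp G (n + 1) y x"
    using S tp_add[of S n y 1 x] by (simp add: S_def sum_distrib_left)
  finally show ?case by simp
qed

text \<open>Split the path at time \<open>a\<close> and apply Cauchy-Schwarz with weights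
  \<open>deg G z\<close>; reversibility turns the two resulting sums of squares into return
  probabilities at even times.\<close>

lemma tp_sq_le:
  assumes "x \<in> verts G" "y \<in> verts G"
  shows "deg G x * (tp G (a + b) x y)\<^sup>2
    \<le> deg G y * (tp G (a + a) x x * tp G (b + b) y y)"
proof -
  define S where "S = reach a x \<inter> verts G"
  have fin: "finite S" by (simp add: S_def)
  let ?d = "deg G"
  have reach_verts: "x \<in> verts G \<Longrightarrow> reach n x \<subseteq> verts G" for n x
    by (induction n arbitrary: x) (auto dest: nbrs_verts)
  have S: "S = reach a x" using reach_verts[OF assms(1)] by (auto simp: S_def)
  have d: "?d z > 0" if "z \<in> S \<or> z = x \<or> z = y" for z using that assms deg_pos by (auto simp: S_def)
  have "(tp G (a + b) x y)\<^sup>2 = (\<Sum>z\<in>S. (tp G a x z / sqrt (?d z)) * (sqrt (?d z) * tp G b z y))\<^sup>2"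
  proof -
    have "tp G a x z / sqrt (?d z) * (sqrt (?d z) * tp G b z y) = tp G a x z * tp G b z y"
      if "z \<in> S" for z using d[of z] that by auto
    then show ?thesis using tp_add[OF fin, of a x b y] S by simp
  qed
  also have "\<dots> \<le> (\<Sum>z\<in>S. (tp G a x z / sqrt (?d z))\<^sup>2) * (\<Sum>z\<in>S. (sqrt (?d z) * tp G b z y)\<^sup>2)"
    by (rule Cauchy_Schwarz_ineq_sum)
  also have "(\<Sum>z\<in>S. (tp G a x z / sqrt (?d z))\<^sup>2) = (\<Sum>z\<in>S. tp G a x z * tp G a z x / ?d x)"
  proof (rule sum.cong)
    fix z assume z: "z \<in> S"
    have "tp G a x z / ?d z = tp G a z x / ?d x"
      using tp_reversible[of x a z] d[of z] d[of x] z by (simp add: field_simps)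
    then show "(tp G a x z / sqrt (?d z))\<^sup>2 = tp G a x z * tp G a z x / ?d x"
      by (simp add: power_divide power2_eq_square flip: times_divide_eq_right)
  qed simp
  also have "\<dots> = tp G (a + a) x x / ?d x"
    using tp_add[OF fin, of a x a x] S by (simp add: sum_divide_distrib)
  also have "(\<Sum>z\<in>S. (sqrt (?d z) * tp G b z y)\<^sup>2) = (\<Sum>z\<in>S. ?d y * (tp G b y z * tp G b z y))"
  proof (rule sum.cong)
    fix z show "(sqrt (?d z) * tp G b z y)\<^sup>2 = ?d y * (tp G b y z * tp G b z y)"
    proof -
      have "(sqrt (deg G z) * tp G b z y)\<^sup>2 = deg G z * tp G b z y * tp G b z y"
        by (simp add: power_mult_distrib power2_eq_square)
      then show ?thesis by (simp add: tp_reversible[of z b y])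
    qed
  qed simp
  also have "\<dots> \<le> ?d y * tp G (b + b) y y"
    using tp_add_ge[OF fin, of b y b y] by (simp add: sum_distrib_left[symmetric] mult_left_mono)
  finally have "(tp G (a + b) x y)\<^sup>2 \<le> tp G (a + a) x x / ?d x * (?d y * tp G (b + b) y y)"
    using tp_nonneg[of G] by (simp add: mult_left_mono divide_right_mono)
  then show ?thesis
    using d[of x] by (simp add: field_simps)
qed

text \<open>Log-convexity together with boundedness forces the even return probabilities to decrease.\<close>

lemma tp_even_antimono:
  assumes x: "x \<in> verts G" and "m \<le> n"
  shows "tp G (n + n) x x \<le> tp G (m + m) x x"
proof -
  define c where "c n = tp G (n + n) x x" for n
  have c0: "0 \<le> c n" and c1: "c n \<le> 1" for n by (auto simp: c_def tp_nonneg tp_le_1)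
  have lc: "(c (Suc n))\<^sup>2 \<le> c n * c (Suc (Suc n))" for n
    using tp_sq_le[OF x x, of n "Suc (Suc n)"] deg_pos[OF x] by (simp add: c_def)
  have "c (Suc n) \<le> c n" for n
  proof (rule ccontr)
    assume a: "\<not> c (Suc n) \<le> c n"
    then have pos: "c (Suc n) > 0" using c0[of n] by linarith
    have cn: "c n > 0" using lc[of n] pos c0[of n]
      by (metis less_eq_real_def mult_zero_left not_less zero_less_power)
    define r where "r = c (Suc n) / c n"
    have r: "r > 1" using a cn by (simp add: r_def)
    have *: "c (n + k) > 0 \<and> r * c (n + k) \<le> c (Suc (n + k))" for k
    proof (induction k)
      case 0 then show ?case using cn by (simp add: r_def)
    next
      case (Suc k)
      let ?u = "c (n + k)" let ?v = "c (Suc (n + k))" let ?w = "c (Suc (Suc (n + k)))"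
      have v: "?v > 0" using Suc r by (smt (verit) mult_pos_pos)
      have "?v * (r * ?u) \<le> ?v * ?v" using Suc v by (intro mult_left_mono) auto
      also have "\<dots> \<le> ?u * ?w" using lc[of "n + k"] by (simp add: power2_eq_square)
      finally have "?u * (r * ?v) \<le> ?u * ?w" by (simp add: algebra_simps)
      then have "r * ?v \<le> ?w" using Suc by simp
      then show ?case using v by simp
    qed
    have "c (n + k) \<ge> r ^ k * c n" for k
    proof (induction k)
      case (Suc k)
      have "r ^ Suc k * c n = r * (r ^ k * c n)" by simp
      also have "\<dots> \<le> r * c (n + k)" using Suc r by (intro mult_left_mono) auto
      also have "\<dots> \<le> c (n + Suc k)" using *[of k] by simp
      finally show ?case .
    qed simp
    moreover obtain k where "r ^ k > 1 / c n" using real_arch_pow[OF r] by blast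
    ultimately show False using c1[of "n + k"] cn
      by (smt (verit) divide_less_eq)
  qed
  then have "c n \<le> c m" using \<open>m \<le> n\<close> by (rule lift_Suc_antimono_le)
  then show ?thesis by (simp add: c_def)
qed

end

section \<open>Two independent walks\<close>

definition avg2 :: "'v graph \<Rightarrow> ('v \<times> 'v \<Rightarrow> real) \<Rightarrow> 'v \<times> 'v \<Rightarrow> real" where
  "avg2 G g p = avg G (\<lambda>x. avg G (\<lambda>y. g (x, y)) (snd p)) (fst p)"

definition step_prob :: "'v graph \<Rightarrow> 'v \<Rightarrow> 'v \<Rightarrow> real" where
  "step_prob G v w = (if w \<in> nbrs G v then 1 / deg G v else 0)"

text \<open>The probability that a chain with transition operator \<open>T\<close> satisfies \<open>Y i \<in> A i\<close> for all
  \<open>i \<le> m\<close>, as a function of the starting point.\<close>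

primrec stay :: "(('s \<Rightarrow> real) \<Rightarrow> 's \<Rightarrow> real) \<Rightarrow> nat \<Rightarrow> (nat \<Rightarrow> 's set) \<Rightarrow> 's \<Rightarrow> real" where
  "stay T 0 A = indicator (A 0)"
| "stay T (Suc m) A = (\<lambda>x. indicator (A 0) x * T (stay T m (\<lambda>i. A (Suc i))) x)"

lemma stay_UNIV_prefix:
  assumes "\<And>i. i < n \<Longrightarrow> A i = UNIV"
  shows "stay T (n + m) A = (T ^^ n) (stay T m (\<lambda>i. A (n + i)))"
  using assms
proof (induction n arbitrary: A)
  case (Suc n)
  then have "stay T (n + m) (\<lambda>i. A (Suc i)) = (T ^^ n) (stay T m (\<lambda>i. A (Suc (n + i))))"
    by (subst Suc.IH) auto
  then show ?case using Suc.prems[of 0] by simp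
qed simp

text \<open>Only cylinder probabilities are known, so the Markov property is replaced by an
  induction over events that prescribe an initial path exactly and constrain what follows by
  \<open>A\<close>. Conditioning on the next state is then a countable disjoint union.\<close>

lemma markov_chain_stay:
  fixes Y :: "nat \<Rightarrow> 'm \<Rightarrow> 's :: countable" and K :: "'s \<Rightarrow> 's \<Rightarrow> real"
  assumes meas [measurable]: "\<And>i. Y i \<in> M \<rightarrow>\<^sub>M count_space UNIV"
    and cyl: "\<And>n v. v 0 = x \<Longrightarrow> emeasure M {\<omega> \<in> space M. \<forall>i\<le>n. Y i \<omega> = v i} =
      ennreal (\<Prod>i<n. K (v i) (v (Suc i)))"
    and start: "AE \<omega> in M. Y 0 \<omega> = x"
    and K: "\<And>v w. 0 \<le> K v w" "\<And>v. finite (N v)" "\<And>v w. w \<notin> N v \<Longrightarrow> K v w = 0"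
    and T: "\<And>g v. T g v = (\<Sum>w\<in>N v. K v w * g w)"
  shows "emeasure M {\<omega> \<in> space M. \<forall>i\<le>m. Y i \<omega> \<in> A i} = ennreal (stay T m A x)"
proof -
  have stay_nonneg: "0 \<le> stay T m A v" for m A v
    by (induction m arbitrary: A v) (auto simp: T intro!: sum_nonneg mult_nonneg_nonneg K)
  have prefix: "emeasure M {\<omega> \<in> space M. (\<forall>i\<le>n. Y i \<omega> = v i) \<and> (\<forall>i\<le>m. Y (n + i) \<omega> \<in> A i)} =
      ennreal ((\<Prod>i<n. K (v i) (v (Suc i))) * stay T m A (v n))" if "v 0 = x" for n m v A
    using that
  proof (induction m arbitrary: n v A)
    case 0
    show ?case
    proof (cases "v n \<in> A 0")
      case True
      then have "{\<omega> \<in> space M. (\<forall>i\<le>n. Y i \<omega> = v i) \<and> (\<forall>i\<le>0. Y (n + i) \<omega> \<in> A i)} =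
          {\<omega> \<in> space M. \<forall>i\<le>n. Y i \<omega> = v i}" by auto
      then show ?thesis using True cyl[where n=n and v=v, OF 0] by simp
    next
      case False
      then have *: "{\<omega> \<in> space M. (\<forall>i\<le>n. Y i \<omega> = v i) \<and> (\<forall>i\<le>0. Y (n + i) \<omega> \<in> A i)} = {}"
        by (auto dest: spec[of _ n])
      show ?thesis unfolding * using False by simp
    qed
  next
    case (Suc m)
    let ?w = "\<Prod>i<n. K (v i) (v (Suc i))"
    show ?case
    proof (cases "v n \<in> A 0")
      case False
      then have *: "{\<omega> \<in> space M. (\<forall>i\<le>n. Y i \<omega> = v i) \<and> (\<forall>i\<le>Suc m. Y (n + i) \<omega> \<in> A i)} = {}"
      proof -
        have False if 1: "\<forall>i\<le>n. Y i \<omega> = v i" "\<forall>i\<le>Suc m. Y (n + i) \<omega> \<in> A i" for \<omega>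
          using 1(1)[rule_format, of n] 1(2)[rule_format, of 0] False by simp
        then show ?thesis by blast
      qed
      show ?thesis unfolding * using False by simp
    next
      case True
      define E where "E q = {\<omega> \<in> space M. (\<forall>i\<le>Suc n. Y i \<omega> = (v(Suc n := q)) i) \<and>
          (\<forall>i\<le>m. Y (Suc n + i) \<omega> \<in> A (Suc i))}" for q
      have "{\<omega> \<in> space M. (\<forall>i\<le>n. Y i \<omega> = v i) \<and> (\<forall>i\<le>Suc m. Y (n + i) \<omega> \<in> A i)} = (\<Union>q. E q)"
      proof safe
        fix \<omega> assume w: "\<omega> \<in> space M" "\<forall>i\<le>n. Y i \<omega> = v i" "\<forall>i\<le>Suc m. Y (n + i) \<omega> \<in> A i"
        have "Y (Suc n + i) \<omega> \<in> A (Suc i)" if "i \<le> m" for i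
          using w(3)[rule_format, of "Suc i"] that by simp
        then have "\<omega> \<in> E (Y (Suc n) \<omega>)"
          using w(1,2) unfolding E_def by (intro CollectI conjI allI impI) (auto simp: le_Suc_eq)
        then show "\<omega> \<in> (\<Union>q. E q)" by blast
      next
        fix q \<omega> assume w: "\<omega> \<in> E q"
        from w have w: "\<omega> \<in> space M" "\<And>i. i \<le> Suc n \<Longrightarrow> Y i \<omega> = (v(Suc n := q)) i"
          "\<And>i. i \<le> m \<Longrightarrow> Y (Suc n + i) \<omega> \<in> A (Suc i)"
          unfolding E_def by blast+
        show "\<omega> \<in> space M" by fact
        show eq: "Y i \<omega> = v i" if "i \<le> n" for i
          using w(2)[of i] that by simp
        show "Y (n + i) \<omega> \<in> A i" if "i \<le> Suc m" for i
        proof (cases i)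
          case 0 then show ?thesis using eq[of n] True by simp
        next
          case (Suc j)
          then show ?thesis using w(3)[of j] that by simp
        qed
      qed
      moreover have "disjoint_family E"
      proof -
        have "Y (Suc n) \<omega> = q" if "\<omega> \<in> E q" for \<omega> q using that by (simp add: E_def)
        then show ?thesis unfolding disjoint_family_on_def by blast
      qed
      moreover have "E q \<in> sets M" for q unfolding E_def by measurable
      ultimately have "emeasure M {\<omega> \<in> space M. (\<forall>i\<le>n. Y i \<omega> = v i) \<and> (\<forall>i\<le>Suc m. Y (n + i) \<omega> \<in> A i)} =
          (\<integral>\<^sup>+q. emeasure M (E q) \<partial>count_space UNIV)"
        by (simp add: emeasure_UN_countable)
      also have "\<dots> = (\<integral>\<^sup>+q. ennreal (?w * (K (v n) q * stay T m (\<lambda>i. A (Suc i)) q)) \<partial>count_space UNIV)"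
      proof (rule nn_integral_cong)
        fix q
        have "(\<Prod>i<n. K ((v(Suc n := q)) i) ((v(Suc n := q)) (Suc i))) = ?w"
          by (intro prod.cong) auto
        then show "emeasure M (E q) = ennreal (?w * (K (v n) q * stay T m (\<lambda>i. A (Suc i)) q))"
          unfolding E_def using Suc.prems by (subst Suc.IH) (auto simp: mult.assoc)
      qed
      also have "\<dots> = (\<Sum>q\<in>N (v n). ennreal (?w * (K (v n) q * stay T m (\<lambda>i. A (Suc i)) q)))"
        using K by (intro nn_integral_count_space') simp_all
      also have "\<dots> = ennreal (\<Sum>q\<in>N (v n). ?w * (K (v n) q * stay T m (\<lambda>i. A (Suc i)) q))"
        by (intro sum_ennreal mult_nonneg_nonneg prod_nonneg stay_nonneg K)
      also have "\<dots> = ennreal (?w * stay T (Suc m) A (v n))"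
        using True by (simp add: T sum_distrib_left)
      finally show ?thesis .
    qed
  qed
  have "emeasure M {\<omega> \<in> space M. \<forall>i\<le>m. Y i \<omega> \<in> A i} =
      emeasure M {\<omega> \<in> space M. (\<forall>i\<le>0. Y i \<omega> = x) \<and> (\<forall>i\<le>m. Y (0 + i) \<omega> \<in> A i)}"
  proof (rule emeasure_eq_AE)
    show "AE \<omega> in M. (\<omega> \<in> {\<omega> \<in> space M. \<forall>i\<le>m. Y i \<omega> \<in> A i}) =
        (\<omega> \<in> {\<omega> \<in> space M. (\<forall>i\<le>0. Y i \<omega> = x) \<and> (\<forall>i\<le>m. Y (0 + i) \<omega> \<in> A i)})"
      using start by eventually_elim auto
  qed auto
  also have "\<dots> = ennreal (stay T m A x)"
    using prefix[of "\<lambda>_. x" 0 m A] by simp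
  finally show ?thesis .
qed

context walk_graph begin

text \<open>The cylinder formula needs nonempty neighbour sets along the path. At the first index
  where the set is empty, the path cannot have followed edges all the way, because edges lead to
  vertices and vertices have neighbours; so both sides are already 0.\<close>

lemma emeasure_srw_cylinder_general:
  assumes "x \<in> verts G" "v 0 = x"
  shows "emeasure (srw G x) {\<omega>. \<forall>i\<le>n. \<omega> i = v i} = ennreal (\<Prod>i<n. step_prob G (v i) (v (Suc i)))"
proof (cases "\<forall>i<n. nbrs G (v i) \<noteq> {}")
  case True
  then have "emeasure (srw G x) {\<omega>. \<forall>i\<le>n. \<omega> i = v i} = (if v 0 = x \<and> (\<forall>i<n. {v i, v (Suc i)} \<in> edges G)
     then \<Prod>i<n. ennreal (1 / card (nbrs G (v i))) else 0)"
    by (intro emeasure_srw_cylinder) auto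
  also have "\<dots> = ennreal (\<Prod>i<n. step_prob G (v i) (v (Suc i)))"
  proof (cases "\<forall>i<n. {v i, v (Suc i)} \<in> edges G")
    case True
    then show ?thesis using assms by (simp add: step_prob_def deg_def nbrs_def prod_ennreal)
  next
    case False
    then obtain i where i: "i < n" "{v i, v (Suc i)} \<notin> edges G" by blast
    then have "step_prob G (v i) (v (Suc i)) = 0"
      by (simp add: step_prob_def nbrs_def)
    then have p0: "(\<Prod>i<n. step_prob G (v i) (v (Suc i))) = 0"
      using i(1) by (intro prod_zero) auto
    show ?thesis unfolding p0 using i by auto
  qed
  finally show ?thesis .
next
  case False
  define k where "k = (LEAST i. i < n \<and> nbrs G (v i) = {})"
  have k: "k < n" "nbrs G (v k) = {}"
    using False LeastI_ex[of "\<lambda>i. i < n \<and> nbrs G (v i) = {}"] by (auto simp: k_def)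
  have before: "nbrs G (v i) \<noteq> {}" if "i < k" for i
    using not_less_Least[of i "\<lambda>i. i < n \<and> nbrs G (v i) = {}"] that k(1) by (auto simp: k_def)
  have "\<not> (\<forall>i<k. {v i, v (Suc i)} \<in> edges G)"
  proof
    assume *: "\<forall>i<k. {v i, v (Suc i)} \<in> edges G"
    have "v k \<in> verts G"
    proof (cases k)
      case (Suc j)
      then have "v k \<in> nbrs G (v j)" using * by (auto simp: nbrs_def)
      then show ?thesis by (rule nbrs_verts)
    qed (use assms in auto)
    then show False using k nbrs_nonempty by auto
  qed
  then have "emeasure (srw G x) {\<omega>. \<forall>i\<le>k. \<omega> i = v i} = 0"
    by (subst emeasure_srw_cylinder) (use before in auto)
  moreover have "{\<omega>. \<forall>i\<le>n. \<omega> i = v i} \<subseteq> {\<omega>. \<forall>i\<le>k. \<omega> i = v i}" using k by auto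
  moreover have "{\<omega>. \<forall>i\<le>k. \<omega> i = v i} \<in> sets (srw G x)"
  proof -
    have "{\<omega>. \<forall>i\<le>k. \<omega> i = v i} = {\<omega> \<in> space (PiM UNIV (\<lambda>_. count_space UNIV)). \<forall>i\<le>k. \<omega> i = v i}"
      by (simp add: space_PiM)
    also have "\<dots> \<in> sets (PiM UNIV (\<lambda>_. count_space UNIV))" by measurable
    finally show ?thesis by (simp add: sets_srw)
  qed
  ultimately have "emeasure (srw G x) {\<omega>. \<forall>i\<le>n. \<omega> i = v i} = 0"
    using emeasure_mono[of "{\<omega>. \<forall>i\<le>n. \<omega> i = v i}" "{\<omega>. \<forall>i\<le>k. \<omega> i = v i}" "srw G x"]
    by simp
  moreover have "(\<Prod>i<n. step_prob G (v i) (v (Suc i))) = 0"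
    using k(1) by (intro prod_zero) (auto intro!: bexI[of _ k] simp: step_prob_def k(2))
  ultimately show ?thesis by (simp only: ennreal_0)
qed

end

lemma avg_eq_sum_step_prob: "avg G g v = (\<Sum>w\<in>nbrs G v. step_prob G v w * g w)"
  by (simp add: avg_def step_prob_def sum_divide_distrib)

locale countable_walk_graph = walk_graph G for G :: "'v :: countable graph"
begin

definition pair_walk :: "'v \<Rightarrow> ((nat \<Rightarrow> 'v) \<times> (nat \<Rightarrow> 'v)) measure" where
  "pair_walk x = srw G x \<Otimes>\<^sub>M srw G x"

lemma prob_space_pair_walk: "prob_space (pair_walk x)"
  unfolding pair_walk_def by (intro prob_space_pair prob_space_srw)

lemma measurable_srw [measurable]: "(\<lambda>X. X n) \<in> srw G x \<rightarrow>\<^sub>M count_space UNIV"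
  unfolding measurable_cong_sets[OF sets_srw refl] by measurable

lemma measurable_pair_walk [measurable]:
  "(\<lambda>X. (fst X n, snd X n)) \<in> pair_walk x \<rightarrow>\<^sub>M count_space UNIV"
proof -
  have "(\<lambda>X. (fst X n, snd X n)) \<in> pair_walk x \<rightarrow>\<^sub>M count_space UNIV \<Otimes>\<^sub>M count_space UNIV"
    unfolding pair_walk_def by measurable
  then show ?thesis by (simp add: pair_measure_countable)
qed

lemma space_srw [simp]: "space (srw G x) = UNIV"
  using sets_eq_imp_space_eq[OF sets_srw] by (simp add: space_PiM)

lemma space_pair_walk [simp]: "space (pair_walk x) = UNIV"
  by (simp add: pair_walk_def space_pair_measure)

lemma emeasure_pair_walk_stay:
  assumes x: "x \<in> verts G"
  shows "emeasure (pair_walk x) {X. \<forall>i\<le>m. (fst X i, snd X i) \<in> A i} = ennreal (stay (avg2 G) m A (x, x))"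
proof -
  interpret S: prob_space "srw G x" by (rule prob_space_srw)
  define K where "K p q = step_prob G (fst p) (fst q) * step_prob G (snd p) (snd q)" for p q
  define N where "N p = nbrs G (fst p) \<times> nbrs G (snd p)" for p
  have cyl: "emeasure (pair_walk x) {X \<in> space (pair_walk x). \<forall>i\<le>n. (fst X i, snd X i) = v i} =
      ennreal (\<Prod>i<n. K (v i) (v (Suc i)))" if v: "v 0 = (x, x)" for n v
  proof -
    let ?A = "\<lambda>f. {\<omega>. \<forall>i\<le>n. \<omega> i = f (v i)}"
    have sets: "?A f \<in> sets (srw G x)" for f
    proof -
      have "?A f = {\<omega> \<in> space (srw G x). \<forall>i\<le>n. \<omega> i = f (v i)}" by simp
      also have "\<dots> \<in> sets (srw G x)" by measurable
      finally show ?thesis .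
    qed
    have "{X \<in> space (pair_walk x). \<forall>i\<le>n. (fst X i, snd X i) = v i} = ?A fst \<times> ?A snd"
      by (auto simp: prod_eq_iff)
    then have "emeasure (pair_walk x) {X \<in> space (pair_walk x). \<forall>i\<le>n. (fst X i, snd X i) = v i} =
        emeasure (srw G x) (?A fst) * emeasure (srw G x) (?A snd)"
      using sets by (simp add: pair_walk_def S.emeasure_pair_measure_Times)
    also have "\<dots> = ennreal (\<Prod>i<n. step_prob G (fst (v i)) (fst (v (Suc i)))) *
        ennreal (\<Prod>i<n. step_prob G (snd (v i)) (snd (v (Suc i))))"
      using v x emeasure_srw_cylinder_general[of x "\<lambda>i. fst (v i)" n]
        emeasure_srw_cylinder_general[of x "\<lambda>i. snd (v i)" n] by simp
    also have "\<dots> = ennreal (\<Prod>i<n. K (v i) (v (Suc i)))"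
      by (subst ennreal_mult[symmetric]) (auto simp: K_def prod.distrib step_prob_def intro!: prod_nonneg)
    finally show ?thesis .
  qed
  have "emeasure (pair_walk x) {X \<in> space (pair_walk x). (fst X 0, snd X 0) = (x, x)} = 1"
    using cyl[of "\<lambda>_. (x, x)" 0] by simp
  then have start: "AE X in pair_walk x. (fst X 0, snd X 0) = (x, x)"
    by (subst prob_space.AE_iff_emeasure_eq_1[OF prob_space_pair_walk]) measurable
  have "emeasure (pair_walk x) {X \<in> space (pair_walk x). \<forall>i\<le>m. (fst X i, snd X i) \<in> A i} =
      ennreal (stay (avg2 G) m A (x, x))"
  proof (rule markov_chain_stay[where K=K and N=N, OF measurable_pair_walk cyl start])
    show "avg2 G g v = (\<Sum>w\<in>N v. K v w * g w)" for g v
    proof -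
      have "avg2 G g v = (\<Sum>x\<in>nbrs G (fst v). \<Sum>y\<in>nbrs G (snd v).
          step_prob G (fst v) x * step_prob G (snd v) y * g (x, y))"
        unfolding avg2_def avg_eq_sum_step_prob by (simp only: sum_distrib_left mult.assoc)
      also have "\<dots> = (\<Sum>(x, y)\<in>N v. step_prob G (fst v) x * step_prob G (snd v) y * g (x, y))"
        unfolding N_def by (rule sum.cartesian_product)
      finally show ?thesis unfolding K_def by (simp add: split_beta)
    qed
  qed (auto simp: K_def N_def step_prob_def)
  then show ?thesis by simp
qed

end

lemma borel_measurable_nn_integral_count_space:
  assumes S: "countable S" and f: "\<And>y. y \<in> S \<Longrightarrow> f y \<in> borel_measurable M"
  shows "(\<lambda>x. \<integral>\<^sup>+y. f y x \<partial>count_space S) \<in> borel_measurable M"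
proof -
  interpret sigma_finite_measure "count_space S"
    by (rule sigma_finite_measure_count_space_countable[OF S])
  have "(\<lambda>p. f (fst p) (snd p)) \<in> borel_measurable (count_space S \<Otimes>\<^sub>M M)"
    by (rule measurable_pair_measure_countable1[OF S]) (simp add: f)
  from measurable_pair_swap[OF this] show ?thesis
    by (intro borel_measurable_nn_integral) simp
qed

text \<open>Expected number of meetings at \<open>y\<close> of two independent walks from
  \<open>x\<close>, a meeting at time \<open>n\<close> being discounted by
  \<open>s ^ n\<close>.\<close>

definition coll_sum :: "'v graph \<Rightarrow> real \<Rightarrow> 'v \<Rightarrow> 'v \<Rightarrow> ennreal" where
  "coll_sum G s x y = (\<integral>\<^sup>+n. ennreal (s ^ n * (tp G n x y)\<^sup>2) \<partial>count_space UNIV)"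

section \<open>Collision probabilities and the second moment of the number of collisions\<close>

context countable_walk_graph begin

abbreviation no_collision :: "nat \<Rightarrow> 'v \<times> 'v \<Rightarrow> real" where
  "no_collision m \<equiv> stay (avg2 G) m (\<lambda>_. {p. fst p \<noteq> snd p})"

lemma emeasure_no_collision:
  assumes "x \<in> verts G"
  shows "emeasure (pair_walk x) {X. \<forall>i. n \<le> i \<and> i \<le> n + m \<longrightarrow> fst X i \<noteq> snd X i} =
    ennreal ((avg2 G ^^ n) (no_collision m) (x, x))"
proof -
  let ?A = "\<lambda>i. if i < n then UNIV else {p :: 'v \<times> 'v. fst p \<noteq> snd p}"
  have "{X. \<forall>i. n \<le> i \<and> i \<le> n + m \<longrightarrow> fst X i \<noteq> snd X i} =
      {X :: (nat \<Rightarrow> 'v) \<times> (nat \<Rightarrow> 'v). \<forall>i\<le>n + m. (fst X i, snd X i) \<in> ?A i}"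
  proof -
    have "(fst X i, snd X i) \<in> ?A i \<longleftrightarrow> (n \<le> i \<longrightarrow> fst X i \<noteq> snd X i)"
      for X :: "(nat \<Rightarrow> 'v) \<times> (nat \<Rightarrow> 'v)" and i by simp
    then show ?thesis by (simp only:) blast
  qed
  then have "emeasure (pair_walk x) {X. \<forall>i. n \<le> i \<and> i \<le> n + m \<longrightarrow> fst X i \<noteq> snd X i} =
      ennreal (stay (avg2 G) (n + m) ?A (x, x))"
    by (simp only: emeasure_pair_walk_stay[OF assms])
  also have "stay (avg2 G) (n + m) ?A = (avg2 G ^^ n) (no_collision m)"
    by (subst stay_UNIV_prefix) auto
  finally show ?thesis .
qed

lemma avg2_pow_prod:
  "(avg2 G ^^ n) (\<lambda>p. c * (f (fst p) * g (snd p))) = (\<lambda>p. c * ((avg G ^^ n) f (fst p) * (avg G ^^ n) g (snd p)))"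
proof (induction n)
  case (Suc n)
  have "avg2 G (\<lambda>p. c * (F (fst p) * H (snd p))) p = c * (avg G F (fst p) * avg G H (snd p))" for F H p
  proof -
    have "avg2 G (\<lambda>p. c * (F (fst p) * H (snd p))) p = avg G (\<lambda>x. avg G (\<lambda>y. (c * F x) * H y) (snd p)) (fst p)"
      by (simp add: avg2_def mult.assoc)
    also have "\<dots> = avg G (\<lambda>x. (c * avg G H (snd p)) * F x) (fst p)"
      by (simp only: avg_cmult mult_ac)
    finally show ?thesis by (simp add: avg_cmult)
  qed
  then show ?case by (simp add: Suc fun_eq_iff)
qed simp

lemma emeasure_two_collisions:
  assumes x: "x \<in> verts G"
  shows "emeasure (pair_walk x) {X. fst X n = v \<and> snd X n = v \<and> fst X (n + k) = w \<and> snd X (n + k) = w} =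
    ennreal ((tp G n x v)\<^sup>2 * (tp G k v w)\<^sup>2)"
proof -
  let ?A = "\<lambda>i. (if i = n then {(v, v)} else UNIV) \<inter> (if i = n + k then {(w, w)} else UNIV)"
  have ind: "indicator {(v, v)} p = (indicator {v} (fst p) * indicator {v} (snd p) :: real)" for v :: 'v and p
    by (cases p) (auto simp: indicator_def)
  have pow: "(avg2 G ^^ n) (\<lambda>p. c * indicator {(v, v)} p) (x, y) = c * (tp G n x v * tp G n y v)" for n c v x y
    unfolding ind avg2_pow_prod by (simp add: tp_def)
  have "{X. fst X n = v \<and> snd X n = v \<and> fst X (n + k) = w \<and> snd X (n + k) = w} =
      {X :: (nat \<Rightarrow> 'v) \<times> (nat \<Rightarrow> 'v). \<forall>i\<le>n + k. (fst X i, snd X i) \<in> ?A i}"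
  proof -
    have "(fst X i, snd X i) \<in> ?A i \<longleftrightarrow>
        (i = n \<longrightarrow> fst X i = v \<and> snd X i = v) \<and> (i = n + k \<longrightarrow> fst X i = w \<and> snd X i = w)"
      for X :: "(nat \<Rightarrow> 'v) \<times> (nat \<Rightarrow> 'v)" and i by auto
    moreover have "n \<le> n + k" by simp
    ultimately show ?thesis by (simp only:) blast
  qed
  then have "emeasure (pair_walk x) {X. fst X n = v \<and> snd X n = v \<and> fst X (n + k) = w \<and> snd X (n + k) = w} =
      ennreal (stay (avg2 G) (n + k) ?A (x, x))"
    by (simp only: emeasure_pair_walk_stay[OF x])
  also have "stay (avg2 G) (n + k) ?A = (avg2 G ^^ n) (stay (avg2 G) k (\<lambda>i. ?A (n + i)))"
    by (subst stay_UNIV_prefix) auto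
  also have "stay (avg2 G) k (\<lambda>i. ?A (n + i)) = (\<lambda>p. (tp G k v w)\<^sup>2 * indicator {(v, v)} p)"
  \<comment> \<open>For \<open>k = 0\<close> both constraints fall on the same time, so the two sets
    have to be intersected.\<close>
  proof (cases k)
    case 0
    then show ?thesis by (auto simp: tp_0 indicator_def fun_eq_iff)
  next
    case (Suc j)
    have "stay (avg2 G) j (\<lambda>i. ?A (n + Suc i)) = (avg2 G ^^ j) (stay (avg2 G) 0 (\<lambda>i. ?A (n + Suc (j + i))))"
      using stay_UNIV_prefix[of j "\<lambda>i. ?A (n + Suc i)" "avg2 G" 0] Suc by simp
    also have "stay (avg2 G) 0 (\<lambda>i. ?A (n + Suc (j + i))) = (\<lambda>p. 1 * indicator {(w, w)} p)"
      using Suc by simp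
    finally have "avg2 G (stay (avg2 G) j (\<lambda>i. ?A (n + Suc i))) (v, v) = (avg2 G ^^ k) (\<lambda>p. 1 * indicator {(w, w)} p) (v, v)"
      by (simp add: Suc)
    also have "\<dots> = (tp G k v w)\<^sup>2"
      unfolding pow by (simp add: power2_eq_square)
    finally have *: "avg2 G (stay (avg2 G) j (\<lambda>i. ?A (n + Suc i))) (v, v) = (tp G k v w)\<^sup>2" .
    show ?thesis
    proof
      fix p :: "'v \<times> 'v"
      show "stay (avg2 G) k (\<lambda>i. ?A (n + i)) p = (tp G k v w)\<^sup>2 * indicator {(v, v)} p"
        using * Suc by (cases "p = (v, v)") auto
    qed
  qed
  also have "(avg2 G ^^ n) (\<lambda>p. (tp G k v w)\<^sup>2 * indicator {(v, v)} p) (x, x) = (tp G n x v)\<^sup>2 * (tp G k v w)\<^sup>2"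
    unfolding pow by (simp add: power2_eq_square)
  finally show ?thesis .
qed

text \<open>For the number \<open>Z\<close> of collisions after time \<open>N\<close> use \<open>Z \<le> (t * Z\<^sup>2 + [Z > 0] / t) / 2\<close> and expand the square.\<close>

lemma collisions_second_moment:
  assumes x: "x \<in> verts G" and s: "0 \<le> s" "s \<le> 1" and t: "0 < t"
  shows "(\<integral>\<^sup>+y. coll_sum G s x y \<partial>count_space S) \<le> of_nat N
    + ennreal t * (\<integral>\<^sup>+y. coll_sum G s x y * (\<integral>\<^sup>+z. coll_sum G s y z \<partial>count_space S) \<partial>count_space S)
    + ennreal (1 / (2 * t)) * emeasure (pair_walk x) {X. \<exists>i\<ge>N. fst X i = snd X i}"
proof -
  let ?M = "pair_walk x" and ?C = "count_space (UNIV :: nat set)" and ?S = "count_space S"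
  interpret M: prob_space ?M by (rule prob_space_pair_walk)
  define c :: "nat \<Rightarrow> 'v \<Rightarrow> (nat \<Rightarrow> 'v) \<times> (nat \<Rightarrow> 'v) \<Rightarrow> ennreal"
    where "c n y X = indicator {X. fst X n = y \<and> snd X n = y} X" for n y X
  have ev [measurable]: "{X. fst X n = y \<and> snd X n = y} \<in> sets ?M" for n y
  proof -
    have "{X \<in> space ?M. (fst X n, snd X n) = (y, y)} \<in> sets ?M" by measurable
    then show ?thesis by simp
  qed
  have c_meas [measurable]: "c n y \<in> borel_measurable ?M" for n y
    unfolding c_def by measurable
  have c2: "(\<integral>\<^sup>+X. c n y X * c (n + k) z X \<partial>?M) = ennreal ((tp G n x y)\<^sup>2) * ennreal ((tp G k y z)\<^sup>2)" for n k y z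
  proof -
    have "(\<integral>\<^sup>+X. c n y X * c (n + k) z X \<partial>?M) =
        (\<integral>\<^sup>+X. indicator ({X. fst X n = y \<and> snd X n = y} \<inter> {X. fst X (n + k) = z \<and> snd X (n + k) = z}) X \<partial>?M)"
      by (simp add: c_def indicator_inter_arith)
    also have "\<dots> = emeasure ?M ({X. fst X n = y \<and> snd X n = y} \<inter> {X. fst X (n + k) = z \<and> snd X (n + k) = z})"
      by (intro nn_integral_indicator) measurable
    also have "{X. fst X n = y \<and> snd X n = y} \<inter> {X. fst X (n + k) = z \<and> snd X (n + k) = z} =
        {X. fst X n = y \<and> snd X n = y \<and> fst X (n + k) = z \<and> snd X (n + k) = z}" by auto
    finally show ?thesis
      using emeasure_two_collisions[OF x] by (simp add: ennreal_mult)
  qed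
  have c1: "(\<integral>\<^sup>+X. c n y X \<partial>?M) = ennreal ((tp G n x y)\<^sup>2)" for n y
  proof -
    have "c n y X * c (n + 0) y X = c n y X" for X
      by (auto simp: c_def indicator_def)
    then show ?thesis using c2[of n y 0 y] by (simp add: tp_0)
  qed
  have m1 [measurable, simp]: "(\<lambda>X. \<integral>\<^sup>+y. c n y X \<partial>?S) \<in> borel_measurable ?M" for n
    by (intro borel_measurable_nn_integral_count_space) auto
  have m2 [measurable, simp]: "(\<lambda>X. \<integral>\<^sup>+z. c n y X * c m z X \<partial>?S) \<in> borel_measurable ?M" for n m y
    by (intro borel_measurable_nn_integral_count_space) auto
  have m3 [measurable, simp]: "(\<lambda>X. \<integral>\<^sup>+y. \<integral>\<^sup>+z. c n y X * c m z X \<partial>?S \<partial>?S) \<in> borel_measurable ?M" for n m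
    by (intro borel_measurable_nn_integral_count_space m2) auto
  define d where "d n X = ennreal (s ^ n) * (\<integral>\<^sup>+y. c n y X \<partial>?S)" for n X
  have [measurable]: "d n \<in> borel_measurable ?M" for n
    unfolding d_def by measurable
  have m4 [measurable, simp]: "(\<lambda>X. \<integral>\<^sup>+k. d n X * d (n + k) X \<partial>?C) \<in> borel_measurable ?M" for n
    by (intro borel_measurable_nn_integral_count_space) auto
  have m5 [measurable, simp]: "(\<lambda>X. \<integral>\<^sup>+n. d n X \<partial>?C) \<in> borel_measurable ?M"
    by (intro borel_measurable_nn_integral_count_space) auto
  have m6 [measurable, simp]: "(\<lambda>X. \<integral>\<^sup>+n. \<integral>\<^sup>+k. d n X * d (n + k) X \<partial>?C \<partial>?C) \<in> borel_measurable ?M"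
    by (intro borel_measurable_nn_integral_count_space m4) auto
  have d_le: "(\<integral>\<^sup>+y. c n y X \<partial>?S) \<le> indicator {X. fst X n = snd X n} X" for n X
  proof (cases "fst X n = snd X n")
    case True
    have "(\<integral>\<^sup>+y. c n y X \<partial>?S) \<le> (\<integral>\<^sup>+y. c n y X \<partial>count_space UNIV)"
      by (subst nn_integral_count_space_indicator) (auto intro!: nn_integral_mono split: split_indicator)
    also have "\<dots> = (\<integral>\<^sup>+y. indicator {fst X n} y \<partial>count_space UNIV)"
      using True by (intro nn_integral_cong) (auto simp: c_def indicator_def)
    finally show ?thesis using True by simp
  next
    case False
    then have "c n y X = 0" for y by (auto simp: c_def indicator_def)
    then show ?thesis by simp
  qed
  define Z where "Z X = (\<integral>\<^sup>+n. d n X \<partial>?C)" for X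
  have Zm: "Z \<in> borel_measurable ?M"
    unfolding Z_def[abs_def] by (rule m5)
  have EZ: "(\<integral>\<^sup>+X. Z X \<partial>?M) = (\<integral>\<^sup>+y. coll_sum G s x y \<partial>?S)"
  proof -
    have "(\<integral>\<^sup>+X. Z X \<partial>?M) = (\<integral>\<^sup>+n. \<integral>\<^sup>+X. d n X \<partial>?M \<partial>?C)"
      unfolding Z_def by (intro nn_integral_count_space_nn_integral) auto
    also have "\<dots> = (\<integral>\<^sup>+n. ennreal (s ^ n) * (\<integral>\<^sup>+y. \<integral>\<^sup>+X. c n y X \<partial>?M \<partial>?S) \<partial>?C)"
      unfolding d_def by (simp add: nn_integral_cmult nn_integral_count_space_nn_integral)
    also have "\<dots> = (\<integral>\<^sup>+n. \<integral>\<^sup>+y. ennreal (s ^ n * (tp G n x y)\<^sup>2) \<partial>?S \<partial>?C)"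
      using s by (simp add: c1 nn_integral_cmult ennreal_mult)
    also have "\<dots> = (\<integral>\<^sup>+y. coll_sum G s x y \<partial>?S)"
      unfolding coll_sum_def by (intro nn_integral_count_space_nn_integral) auto
    finally show ?thesis .
  qed
  have dd: "(\<integral>\<^sup>+X. d n X * d (n + k) X \<partial>?M) \<le> (\<integral>\<^sup>+y. \<integral>\<^sup>+z. ennreal (s ^ n * (tp G n x y)\<^sup>2) * ennreal (s ^ k * (tp G k y z)\<^sup>2) \<partial>?S \<partial>?S)" for n k
  proof -
    have D: "d n X * d (n + k) X = ennreal (s ^ n) * ennreal (s ^ (n + k)) * (\<integral>\<^sup>+y. \<integral>\<^sup>+z. c n y X * c (n + k) z X \<partial>?S \<partial>?S)" for X
      by (simp add: d_def nn_integral_cmult nn_integral_multc mult_ac)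
    have "(\<integral>\<^sup>+X. d n X * d (n + k) X \<partial>?M) = ennreal (s ^ n) * ennreal (s ^ (n + k)) *
        (\<integral>\<^sup>+X. \<integral>\<^sup>+y. \<integral>\<^sup>+z. c n y X * c (n + k) z X \<partial>?S \<partial>?S \<partial>?M)"
      unfolding D by (rule nn_integral_cmult[OF m3])
    also have "(\<integral>\<^sup>+X. \<integral>\<^sup>+y. \<integral>\<^sup>+z. c n y X * c (n + k) z X \<partial>?S \<partial>?S \<partial>?M) =
        (\<integral>\<^sup>+y. \<integral>\<^sup>+X. \<integral>\<^sup>+z. c n y X * c (n + k) z X \<partial>?S \<partial>?M \<partial>?S)"
      by (intro nn_integral_count_space_nn_integral m2) auto
    also have "\<dots> = (\<integral>\<^sup>+y. \<integral>\<^sup>+z. \<integral>\<^sup>+X. c n y X * c (n + k) z X \<partial>?M \<partial>?S \<partial>?S)"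
      by (intro nn_integral_cong nn_integral_count_space_nn_integral) auto
    also have "ennreal (s ^ n) * ennreal (s ^ (n + k)) *
        (\<integral>\<^sup>+y. \<integral>\<^sup>+z. \<integral>\<^sup>+X. c n y X * c (n + k) z X \<partial>?M \<partial>?S \<partial>?S) = (\<integral>\<^sup>+y. \<integral>\<^sup>+z. ennreal (s ^ n) * ennreal (s ^ (n + k)) * (ennreal ((tp G n x y)\<^sup>2) * ennreal ((tp G k y z)\<^sup>2)) \<partial>?S \<partial>?S)"
      by (simp add: c2 nn_integral_cmult)
    also have "\<dots> \<le> (\<integral>\<^sup>+y. \<integral>\<^sup>+z. ennreal (s ^ n * (tp G n x y)\<^sup>2) * ennreal (s ^ k * (tp G k y z)\<^sup>2) \<partial>?S \<partial>?S)"
    proof (intro nn_integral_mono)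
      fix y z
      \<comment> \<open>Giving up the factor \<open>s ^ n\<close> here leaves exactly the weight of
        a fresh collision sum started at \<open>y\<close>.\<close>
      have "s ^ (n + k) \<le> s ^ k" using s by (intro power_decreasing) auto
      then have "ennreal (s ^ n) * ennreal (s ^ (n + k)) * (ennreal ((tp G n x y)\<^sup>2) * ennreal ((tp G k y z)\<^sup>2))
         \<le> ennreal (s ^ n) * ennreal (s ^ k) * (ennreal ((tp G n x y)\<^sup>2) * ennreal ((tp G k y z)\<^sup>2))"
        by (intro mult_mono ennreal_leI) auto
      then show "ennreal (s ^ n) * ennreal (s ^ (n + k)) * (ennreal ((tp G n x y)\<^sup>2) * ennreal ((tp G k y z)\<^sup>2))
         \<le> ennreal (s ^ n * (tp G n x y)\<^sup>2) * ennreal (s ^ k * (tp G k y z)\<^sup>2)"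
        using s by (simp add: ennreal_mult mult_ac)
    qed
    finally show ?thesis .
  qed
  have EZ2: "(\<integral>\<^sup>+X. Z X * Z X \<partial>?M) \<le> 2 * (\<integral>\<^sup>+y. coll_sum G s x y * (\<integral>\<^sup>+z. coll_sum G s y z \<partial>?S) \<partial>?S)"
  proof -
    define U where "U X = (\<integral>\<^sup>+n. \<integral>\<^sup>+k. d n X * d (n + k) X \<partial>?C \<partial>?C)" for X
    have tri: "(\<integral>\<^sup>+n. \<integral>\<^sup>+m. (if n \<le> m then d n X * d m X else 0) \<partial>?C \<partial>?C) = U X" for X
    proof -
      have "(\<integral>\<^sup>+m. (if n \<le> m then d n X * d m X else 0) \<partial>?C) = (\<integral>\<^sup>+k. d n X * d (n + k) X \<partial>?C)" for n
      proof -
        have "(\<integral>\<^sup>+m. (if n \<le> m then d n X * d m X else 0) \<partial>?C) = (\<integral>\<^sup>+m. d n X * d m X \<partial>count_space {n..})"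
          by (subst nn_integral_count_space_indicator[where X="{n..}"]) (auto intro!: nn_integral_cong split: split_indicator)
        also have "\<dots> = (\<integral>\<^sup>+k. d n X * d (n + k) X \<partial>?C)"
          by (rule nn_integral_bij_count_space[symmetric])
            (auto simp: bij_betw_def inj_on_def image_iff intro: le_Suc_ex)
        finally show ?thesis .
      qed
      then show ?thesis by (simp add: U_def)
    qed
    \<comment> \<open>Pairs of times are counted as n <= m or m <= n; by symmetry both halves equal
      \<open>U X\<close>.\<close>
    have "Z X * Z X \<le> 2 * U X" for X
    proof -
      have "Z X * Z X = (\<integral>\<^sup>+n. \<integral>\<^sup>+m. d n X * d m X \<partial>?C \<partial>?C)"
        by (simp add: Z_def nn_integral_cmult nn_integral_multc)
      also have "\<dots> \<le> (\<integral>\<^sup>+n. \<integral>\<^sup>+m. (if n \<le> m then d n X * d m X else 0) + (if m \<le> n then d n X * d m X else 0) \<partial>?C \<partial>?C)"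
        by (intro nn_integral_mono) auto
      also have "\<dots> = U X + (\<integral>\<^sup>+n. \<integral>\<^sup>+m. (if m \<le> n then d n X * d m X else 0) \<partial>?C \<partial>?C)"
        by (simp add: nn_integral_add tri)
      also have "(\<integral>\<^sup>+n. \<integral>\<^sup>+m. (if m \<le> n then d n X * d m X else 0) \<partial>?C \<partial>?C) =
         (\<integral>\<^sup>+m. \<integral>\<^sup>+n. (if m \<le> n then d n X * d m X else 0) \<partial>?C \<partial>?C)"
        by (intro nn_integral_count_space_nn_integral) auto
      also have "\<dots> = U X"
        unfolding tri[symmetric] by (intro nn_integral_cong) (simp add: mult.commute)
      finally show ?thesis by (simp add: mult_2)
    qed
    then have "(\<integral>\<^sup>+X. Z X * Z X \<partial>?M) \<le> (\<integral>\<^sup>+X. 2 * U X \<partial>?M)"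
      by (intro nn_integral_mono) auto
    also have "\<dots> = 2 * (\<integral>\<^sup>+X. U X \<partial>?M)"
      unfolding U_def by (rule nn_integral_cmult[OF m6])
    also have "(\<integral>\<^sup>+X. U X \<partial>?M) = (\<integral>\<^sup>+n. \<integral>\<^sup>+X. \<integral>\<^sup>+k. d n X * d (n + k) X \<partial>?C \<partial>?M \<partial>?C)"
      unfolding U_def by (intro nn_integral_count_space_nn_integral m4) auto
    also have "\<dots> = (\<integral>\<^sup>+n. \<integral>\<^sup>+k. \<integral>\<^sup>+X. d n X * d (n + k) X \<partial>?M \<partial>?C \<partial>?C)"
      by (intro nn_integral_cong nn_integral_count_space_nn_integral) auto
    also have "2 * \<dots> \<le> 2 * (\<integral>\<^sup>+n. \<integral>\<^sup>+k. \<integral>\<^sup>+y. \<integral>\<^sup>+z. ennreal (s ^ n * (tp G n x y)\<^sup>2) * ennreal (s ^ k * (tp G k y z)\<^sup>2) \<partial>?S \<partial>?S \<partial>?C \<partial>?C)"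
      by (intro mult_left_mono nn_integral_mono dd) auto
    also have "(\<integral>\<^sup>+n. \<integral>\<^sup>+k. \<integral>\<^sup>+y. \<integral>\<^sup>+z. ennreal (s ^ n * (tp G n x y)\<^sup>2) * ennreal (s ^ k * (tp G k y z)\<^sup>2) \<partial>?S \<partial>?S \<partial>?C \<partial>?C) =
        (\<integral>\<^sup>+n. \<integral>\<^sup>+y. \<integral>\<^sup>+z. ennreal (s ^ n * (tp G n x y)\<^sup>2) * coll_sum G s y z \<partial>?S \<partial>?S \<partial>?C)"
    proof (rule nn_integral_cong)
      fix n
      have "(\<integral>\<^sup>+k. \<integral>\<^sup>+y. \<integral>\<^sup>+z. ennreal (s ^ n * (tp G n x y)\<^sup>2) * ennreal (s ^ k * (tp G k y z)\<^sup>2) \<partial>?S \<partial>?S \<partial>?C) =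
        (\<integral>\<^sup>+y. \<integral>\<^sup>+k. \<integral>\<^sup>+z. ennreal (s ^ n * (tp G n x y)\<^sup>2) * ennreal (s ^ k * (tp G k y z)\<^sup>2) \<partial>?S \<partial>?C \<partial>?S)"
        by (intro nn_integral_count_space_nn_integral) auto
      also have "\<dots> = (\<integral>\<^sup>+y. \<integral>\<^sup>+z. \<integral>\<^sup>+k. ennreal (s ^ n * (tp G n x y)\<^sup>2) * ennreal (s ^ k * (tp G k y z)\<^sup>2) \<partial>?C \<partial>?S \<partial>?S)"
        by (intro nn_integral_cong nn_integral_count_space_nn_integral) auto
      finally show "(\<integral>\<^sup>+k. \<integral>\<^sup>+y. \<integral>\<^sup>+z. ennreal (s ^ n * (tp G n x y)\<^sup>2) * ennreal (s ^ k * (tp G k y z)\<^sup>2) \<partial>?S \<partial>?S \<partial>?C) =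
        (\<integral>\<^sup>+y. \<integral>\<^sup>+z. ennreal (s ^ n * (tp G n x y)\<^sup>2) * coll_sum G s y z \<partial>?S \<partial>?S)"
        by (simp add: nn_integral_cmult coll_sum_def)
    qed
    also have "\<dots> = (\<integral>\<^sup>+n. \<integral>\<^sup>+y. ennreal (s ^ n * (tp G n x y)\<^sup>2) * (\<integral>\<^sup>+z. coll_sum G s y z \<partial>?S) \<partial>?S \<partial>?C)"
      by (simp add: nn_integral_cmult)
    also have "\<dots> = (\<integral>\<^sup>+y. \<integral>\<^sup>+n. ennreal (s ^ n * (tp G n x y)\<^sup>2) * (\<integral>\<^sup>+z. coll_sum G s y z \<partial>?S) \<partial>?C \<partial>?S)"
      by (intro nn_integral_count_space_nn_integral) auto
    also have "\<dots> = (\<integral>\<^sup>+y. coll_sum G s x y * (\<integral>\<^sup>+z. coll_sum G s y z \<partial>?S) \<partial>?S)"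
      by (simp add: nn_integral_multc coll_sum_def)
    finally show ?thesis .
  qed
  let ?B = "{X. \<exists>i\<ge>N. fst X i = snd X i}"
  have [measurable]: "?B \<in> sets ?M"
  proof -
    have "{X \<in> space ?M. \<exists>i\<ge>N. (fst X i, snd X i) \<in> {p. fst p = snd p}} \<in> sets ?M" by measurable
    then show ?thesis by simp
  qed
  \<comment> \<open>Without a collision from time \<open>N\<close> on, at most \<open>N\<close>
    collisions occur. Otherwise the square of t r - 1 is nonnegative.\<close>
  have pt: "Z X \<le> of_nat N + ennreal (t / 2) * (Z X * Z X) + ennreal (1 / (2 * t)) * indicator ?B X" for X
  proof (cases "X \<in> ?B")
    case False
    have "Z X \<le> (\<integral>\<^sup>+n. indicator {..<N} n \<partial>?C)"
      unfolding Z_def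
    proof (rule nn_integral_mono)
      fix n
      have "d n X \<le> 1 * indicator {X. fst X n = snd X n} X"
        unfolding d_def using s by (intro mult_mono d_le) (auto simp: power_le_one ennreal_le_1)
      also have "\<dots> \<le> indicator {..<N} n"
        using False by (auto simp: indicator_def not_less) (meson not_less)
      finally show "d n X \<le> indicator {..<N} n" .
    qed
    also have "\<dots> = of_nat N" by simp
    finally show ?thesis by (simp add: add_increasing2 False)
  next
    case True
    have "Z X \<le> ennreal (t / 2) * (Z X * Z X) + ennreal (1 / (2 * t))"
    proof (cases "Z X")
      case (real r)
      have "r \<le> t / 2 * (r * r) + 1 / (2 * t)"
      proof -
        have "0 \<le> (t * r - 1)\<^sup>2 / (2 * t)" using t by simp
        also have "\<dots> = t / 2 * (r * r) + 1 / (2 * t) - r"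
          using t by (simp add: power2_eq_square field_simps)
        finally show ?thesis by simp
      qed
      then show ?thesis
        using real t by (simp add: ennreal_mult[symmetric] ennreal_plus[symmetric] ennreal_leI del: ennreal_plus)
    next
      case top
      then show ?thesis using t by (simp add: ennreal_mult_top)
    qed
    then show ?thesis using True by (simp add: add.assoc add_increasing)
  qed
  define a b :: ennreal where "a = ennreal (t / 2)" and "b = ennreal (1 / (2 * t))"
  have mZ: "(\<lambda>X. Z X * Z X) \<in> borel_measurable ?M"
    by (intro borel_measurable_times_ennreal Zm)
  have maZ: "(\<lambda>X. a * (Z X * Z X)) \<in> borel_measurable ?M"
    by (intro borel_measurable_times_ennreal borel_measurable_const Zm)
  have mB: "(\<lambda>X. b * indicator ?B X) \<in> borel_measurable ?M"
    by (intro borel_measurable_times_ennreal borel_measurable_const borel_measurable_indicator) fact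
  have "(\<integral>\<^sup>+X. Z X \<partial>?M) \<le> (\<integral>\<^sup>+X. of_nat N + a * (Z X * Z X) + b * indicator ?B X \<partial>?M)"
    unfolding a_def b_def by (intro nn_integral_mono pt)
  also have "\<dots> = (\<integral>\<^sup>+X. of_nat N + a * (Z X * Z X) \<partial>?M) + (\<integral>\<^sup>+X. b * indicator ?B X \<partial>?M)"
    by (intro nn_integral_add mB maZ borel_measurable_add borel_measurable_const)
  also have "(\<integral>\<^sup>+X. of_nat N + a * (Z X * Z X) \<partial>?M) = (\<integral>\<^sup>+X. of_nat N \<partial>?M) + (\<integral>\<^sup>+X. a * (Z X * Z X) \<partial>?M)"
    by (intro nn_integral_add mB maZ borel_measurable_add borel_measurable_const)
  also have "(\<integral>\<^sup>+X. of_nat N \<partial>?M) = of_nat N"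
    using M.emeasure_space_1 by simp
  also have "(\<integral>\<^sup>+X. a * (Z X * Z X) \<partial>?M) = a * (\<integral>\<^sup>+X. Z X * Z X \<partial>?M)"
    by (intro nn_integral_cmult mZ)
  also have "(\<integral>\<^sup>+X. b * indicator ?B X \<partial>?M) = b * emeasure ?M ?B"
    by (intro nn_integral_cmult_indicator) fact
  also have "of_nat N + a * (\<integral>\<^sup>+X. Z X * Z X \<partial>?M) + b * emeasure ?M ?B
      \<le> of_nat N + a * (2 * (\<integral>\<^sup>+y. coll_sum G s x y * (\<integral>\<^sup>+z. coll_sum G s y z \<partial>?S) \<partial>?S)) + b * emeasure ?M ?B"
    by (intro add_mono mult_left_mono EZ2) auto
  also have "a * (2 * q) = ennreal t * q" for q
  proof -
    have "a * 2 = ennreal t"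
      unfolding a_def using t ennreal_mult[of "t / 2" 2] by simp
    then show ?thesis by (simp add: mult.assoc[symmetric])
  qed
  finally show ?thesis unfolding EZ b_def .
qed

end

section \<open>The zero-one law for collisions\<close>

subsection \<open>The Choquet--Deny argument\<close>

text \<open>If \<open>h\<close> is bounded and \<open>h = A (S h)\<close> with \<open>A = d I + (1 - d) B\<close> lazy and \<open>B\<close>, \<open>S\<close> commuting
  averaging operators, then \<open>B h = h\<close>: near a point where \<open>k = B h - h\<close> is almost maximal,
  every \<open>B ^ i (S ^ n k)\<close> with \<open>i \<le> n\<close> is almost maximal too, and the sum over \<open>i\<close> telescopes.\<close>

lemma choquet_deny_le:
  fixes h :: "'s \<Rightarrow> real" and B S :: "('s \<Rightarrow> real) \<Rightarrow> 's \<Rightarrow> real"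
  assumes bdd: "\<And>x. \<bar>h x\<bar> \<le> H" and d: "0 < d" "d < 1"
    and lazy: "\<And>x. x \<in> V \<Longrightarrow> h x = d * S h x + (1 - d) * B (S h) x"
    and comm: "\<And>g x. x \<in> V \<Longrightarrow> B (S g) x = S (B g) x"
    and Bdiff: "\<And>f g x. x \<in> V \<Longrightarrow> B (\<lambda>y. f y - g y) x = B f x - B g x"
    and Sdiff: "\<And>f g x. x \<in> V \<Longrightarrow> S (\<lambda>y. f y - g y) x = S f x - S g x"
    and Blin: "\<And>f g a b x. x \<in> V \<Longrightarrow> B (\<lambda>y. a * f y + b * g y) x = a * B f x + b * B g x"
    and Slin: "\<And>f g a b x. x \<in> V \<Longrightarrow> S (\<lambda>y. a * f y + b * g y) x = a * S f x + b * S g x"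
    and Bcong: "\<And>f g x. x \<in> V \<Longrightarrow> (\<And>y. y \<in> V \<Longrightarrow> f y = g y) \<Longrightarrow> B f x = B g x"
    and Scong: "\<And>f g x. x \<in> V \<Longrightarrow> (\<And>y. y \<in> V \<Longrightarrow> f y = g y) \<Longrightarrow> S f x = S g x"
    and Ble: "\<And>f c x. x \<in> V \<Longrightarrow> (\<And>y. y \<in> V \<Longrightarrow> f y \<le> c) \<Longrightarrow> B f x \<le> c"
    and Sle: "\<And>f c x. x \<in> V \<Longrightarrow> (\<And>y. y \<in> V \<Longrightarrow> f y \<le> c) \<Longrightarrow> S f x \<le> c"
    and x: "x \<in> V"
  shows "B h x \<le> h x"
proof (rule ccontr)
  assume "\<not> B h x \<le> h x"
  define k where "k y = B h y - h y" for y
  define M where "M = (SUP y\<in>V. k y)"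
  have kx: "k x > 0" using \<open>\<not> _\<close> by (simp add: k_def)
  have absB: "\<bar>B f y\<bar> \<le> c" if "y \<in> V" "\<And>y. y \<in> V \<Longrightarrow> \<bar>f y\<bar> \<le> c" for f c y
  proof -
    have "B f y \<le> c" using that by (intro Ble) (auto simp: abs_le_iff)
    moreover have "B (\<lambda>y. 0 * f y + (-1) * f y) y \<le> c" using that by (intro Ble) (auto simp: abs_le_iff)
    ultimately show ?thesis using Blin[OF that(1), of 0 f "-1" f] by simp
  qed
  have absS: "\<bar>S f y\<bar> \<le> c" if "y \<in> V" "\<And>y. y \<in> V \<Longrightarrow> \<bar>f y\<bar> \<le> c" for f c y
  proof -
    have "S f y \<le> c" using that by (intro Sle) (auto simp: abs_le_iff)
    moreover have "S (\<lambda>y. 0 * f y + (-1) * f y) y \<le> c" using that by (intro Sle) (auto simp: abs_le_iff)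
    ultimately show ?thesis using Slin[OF that(1), of 0 f "-1" f] by simp
  qed
  have kle: "k y \<le> 2 * H" if "y \<in> V" for y
  proof -
    have "\<bar>B h y\<bar> \<le> H" using absB[OF that] bdd by simp
    then show ?thesis using bdd[of y] by (simp add: k_def)
  qed
  have bdd_above: "bdd_above (k ` V)" using kle by (auto simp: bdd_above_def)
  have kM: "k y \<le> M" if "y \<in> V" for y
    unfolding M_def using that bdd_above by (rule cSUP_upper)
  have M: "M > 0" using kM[OF x] kx by simp
  have klazy: "k y = d * S k y + (1 - d) * B (S k) y" if y: "y \<in> V" for y
  proof -
    have "B h y = B (\<lambda>y. d * S h y + (1 - d) * B (S h) y) y"
      using y by (intro Bcong lazy)
    also have "\<dots> = d * B (S h) y + (1 - d) * B (B (S h)) y"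
      by (rule Blin[OF y])
    also have "B (S h) y = S (B h) y" by (rule comm[OF y])
    also have "B (B (S h)) y = B (S (B h)) y" using y comm by (intro Bcong) auto
    finally have 1: "B h y = d * S (B h) y + (1 - d) * B (S (B h)) y" .
    have 2: "S k y = S (B h) y - S h y" if "y \<in> V" for y
      using Sdiff[OF that, of "B h" h] by (simp add: k_def[abs_def])
    have "B (S k) y = B (\<lambda>y. S (B h) y - S h y) y" using y 2 by (intro Bcong) auto
    also have "\<dots> = B (S (B h)) y - B (S h) y" by (rule Bdiff[OF y])
    finally have 3: "B (S k) y = B (S (B h)) y - B (S h) y" .
    have "k y = B h y - h y" by (simp add: k_def)
    also have "\<dots> = d * (S (B h) y - S h y) + (1 - d) * (B (S (B h)) y - B (S h) y)"
      unfolding 1 lazy[OF y] by (simp add: algebra_simps)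
    finally show ?thesis unfolding 3 2[OF y] .
  qed
  define D where "D i n = (B ^^ i) ((S ^^ n) k)" for i n
  have DM: "D i n y \<le> M" if "y \<in> V" for i n y
  proof -
    have "(S ^^ n) k y \<le> M" if "y \<in> V" for n y
      using that by (induction n arbitrary: y) (auto intro: Sle kM)
    then show ?thesis using that unfolding D_def
      by (induction i arbitrary: y) (auto intro: Ble)
  qed
  have BS: "(B ^^ i) (S g) y = S ((B ^^ i) g) y" if "y \<in> V" for i g y
    using that
  proof (induction i arbitrary: y)
    case (Suc i)
    then have "B ((B ^^ i) (S g)) y = B (S ((B ^^ i) g)) y" by (intro Bcong) auto
    then show ?case using comm[OF Suc.prems] by simp
  qed simp
  have Dlazy: "D i n y = d * D i (Suc n) y + (1 - d) * D (Suc i) (Suc n) y" if "y \<in> V" for i n y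
  proof -
    have 1: "(S ^^ n) k y = d * (S ^^ Suc n) k y + (1 - d) * B ((S ^^ Suc n) k) y" if "y \<in> V" for n y
      using that
    proof (induction n arbitrary: y)
      case 0 then show ?case using klazy by simp
    next
      case (Suc n)
      have "(S ^^ Suc n) k y = S (\<lambda>y. d * (S ^^ Suc n) k y + (1 - d) * B ((S ^^ Suc n) k) y) y"
        using Suc by (simp, intro Scong) auto
      also have "\<dots> = d * S ((S ^^ Suc n) k) y + (1 - d) * S (B ((S ^^ Suc n) k)) y"
        by (rule Slin[OF Suc.prems])
      finally show ?case using comm[OF Suc.prems] by simp
    qed
    show ?thesis using that
    proof (induction i arbitrary: y)
      case 0 then show ?case using 1 by (simp add: D_def)
    next
      case (Suc i)
      have "D (Suc i) n y = B (D i n) y" by (simp add: D_def)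
      also have "\<dots> = B (\<lambda>y. d * D i (Suc n) y + (1 - d) * D (Suc i) (Suc n) y) y"
        using Suc by (intro Bcong) auto
      also have "\<dots> = d * B (D i (Suc n)) y + (1 - d) * B (D (Suc i) (Suc n)) y"
        by (rule Blin[OF Suc.prems])
      finally show ?case by (simp add: D_def)
    qed
  qed
  define m where "m = min d (1 - d)"
  have m: "0 < m" "m \<le> d" "m \<le> 1 - d" using d by (auto simp: m_def)
  \<comment> \<open>\<open>D j n\<close> is a convex combination of \<open>D j (Suc n)\<close> and
    \<open>D (Suc j) (Suc n)\<close>, neither of which exceeds \<open>M\<close>. So each of their
    deficits is at most that of \<open>D j n\<close> divided by its weight, hence by
    \<open>m\<close>.\<close>
  have near: "D i n y \<ge> M - e / m ^ n" if "y \<in> V" "k y \<ge> M - e" "i \<le> n" for i n y e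
    using that(3)
  proof (induction n arbitrary: i)
    case 0
    then show ?case using that by (simp add: D_def)
  next
    case (Suc n)
    obtain j where j: "j \<le> n" "i = j \<or> i = Suc j"
      using Suc.prems by (cases i) auto
    have l: "d * (M - D j (Suc n) y) + (1 - d) * (M - D (Suc j) (Suc n) y) = M - D j n y"
      using Dlazy[OF that(1), of j n] by (simp add: algebra_simps)
    have IH: "M - D j n y \<le> e / m ^ n" using Suc.IH[OF j(1)] by simp
    have p: "0 \<le> M - D j (Suc n) y" "0 \<le> M - D (Suc j) (Suc n) y" using DM[OF that(1)] by auto
    have "m * (M - D i (Suc n) y) \<le> e / m ^ n"
      using j(2)
    proof
      assume "i = j"
      have "m * (M - D j (Suc n) y) \<le> d * (M - D j (Suc n) y)" using m p by (intro mult_right_mono) auto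
      also have "\<dots> \<le> e / m ^ n" using l IH p d by (smt (verit) mult_nonneg_nonneg)
      finally show ?thesis using \<open>i = j\<close> by simp
    next
      assume "i = Suc j"
      have "m * (M - D (Suc j) (Suc n) y) \<le> (1 - d) * (M - D (Suc j) (Suc n) y)" using m p by (intro mult_right_mono) auto
      also have "\<dots> \<le> e / m ^ n" using l IH p d by (smt (verit) mult_nonneg_nonneg)
      finally show ?thesis using \<open>i = Suc j\<close> by simp
    qed
    then have "M - D i (Suc n) y \<le> e / m ^ n / m" using m by (simp add: pos_le_divide_eq mult_ac)
    then show ?case by (simp add: mult.commute)
  qed
  have tele: "(\<Sum>i<N. D i n y) = (B ^^ N) ((S ^^ n) h) y - (S ^^ n) h y" if "y \<in> V" for N n y
  proof -
    have Dd: "D i n y = (B ^^ Suc i) ((S ^^ n) h) y - (B ^^ i) ((S ^^ n) h) y" if "y \<in> V" for i y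
    proof -
      have S1: "(S ^^ n) k y = B ((S ^^ n) h) y - (S ^^ n) h y" if "y \<in> V" for y
        using that
      proof (induction n arbitrary: y)
        case 0 then show ?case by (simp add: k_def)
      next
        case (Suc n)
        have "(S ^^ Suc n) k y = S (\<lambda>y. B ((S ^^ n) h) y - (S ^^ n) h y) y"
          using Suc by (simp, intro Scong) auto
        also have "\<dots> = S (B ((S ^^ n) h)) y - S ((S ^^ n) h) y" by (rule Sdiff[OF Suc.prems])
        finally show ?case using comm[OF Suc.prems] by simp
      qed
      show ?thesis using that
      proof (induction i arbitrary: y)
        case 0 then show ?case using S1 by (simp add: D_def)
      next
        case (Suc i)
        have "D (Suc i) n y = B (D i n) y" by (simp add: D_def)
        also have "\<dots> = B (\<lambda>y. (B ^^ Suc i) ((S ^^ n) h) y - (B ^^ i) ((S ^^ n) h) y) y"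
          using Suc by (intro Bcong) auto
        also have "\<dots> = B ((B ^^ Suc i) ((S ^^ n) h)) y - B ((B ^^ i) ((S ^^ n) h)) y"
          by (rule Bdiff[OF Suc.prems])
        finally show ?case by simp
      qed
    qed
    have "(\<Sum>i<N. D i n y) = (\<Sum>i<N. (B ^^ Suc i) ((S ^^ n) h) y - (B ^^ i) ((S ^^ n) h) y)"
      using that Dd by (intro sum.cong) auto
    also have "\<dots> = (B ^^ N) ((S ^^ n) h) y - (B ^^ 0) ((S ^^ n) h) y"
      by (rule sum_lessThan_telescope)
    finally show ?thesis by simp
  qed
  have bound: "\<bar>(B ^^ N) ((S ^^ n) h) y\<bar> \<le> H" if "y \<in> V" for N n y
  proof -
    have "\<bar>(S ^^ n) h y\<bar> \<le> H" if "y \<in> V" for n y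
      using that by (induction n arbitrary: y) (auto intro: absS bdd)
    then show ?thesis using that by (induction N arbitrary: y) (auto intro: absB)
  qed
  \<comment> \<open>After \<open>N\<close> steps the deficit \<open>e / m ^ N\<close> is
    \<open>M / 2\<close>, so the \<open>N\<close> telescoping terms add up to more than 2 H, while
    their sum is a difference of two values bounded by \<open>H\<close>.\<close>
  obtain N :: nat where N: "real N * (M / 2) > 2 * H"
    using reals_Archimedean3[of "M / 2"] M by (meson half_gt_zero)
  define e where "e = M / 2 * m ^ N"
  have e: "e > 0" using M m by (simp add: e_def)
  have "\<exists>y\<in>V. k y > M - e"
  proof (rule ccontr)
    assume "\<not> ?thesis"
    then have "(SUP y\<in>V. k y) \<le> M - e" using x by (intro cSUP_least) (auto simp: not_less)
    then show False using e by (simp add: M_def)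
  qed
  then obtain y where y: "y \<in> V" "k y \<ge> M - e" by force
  have "real N * (M / 2) = (\<Sum>i<N. M / 2)" by simp
  also have "\<dots> \<le> (\<Sum>i<N. D i N y)"
  proof (rule sum_mono)
    fix i assume "i \<in> {..<N}"
    then have "D i N y \<ge> M - e / m ^ N" using y by (intro near) auto
    then show "M / 2 \<le> D i N y" using m by (simp add: e_def)
  qed
  also have "\<dots> \<le> 2 * H"
    unfolding tele[OF y(1)] using bound[OF y(1), of N N] bound[OF y(1), of 0 N] by simp
  finally show False using N by simp
qed

section \<open>Bounded harmonic functions of the pair of walks\<close>

context walk_graph begin

lemma avg2_bound:
  assumes "\<And>v w. v \<in> nbrs G (fst p) \<Longrightarrow> w \<in> nbrs G (snd p) \<Longrightarrow> \<bar>h (v, w)\<bar> \<le> c" "0 \<le> c"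
  shows "\<bar>avg2 G h p\<bar> \<le> c"
proof -
  have abs_avg: "\<bar>avg G g v\<bar> \<le> c" if "\<And>w. w \<in> nbrs G v \<Longrightarrow> \<bar>g w\<bar> \<le> c" for g v
  proof -
    have "avg G g v \<le> c" using that assms(2) by (intro avg_le_const) (auto simp: abs_le_iff)
    moreover have "avg G (\<lambda>w. (-1) * g w) v \<le> c"
      using that assms(2) by (intro avg_le_const) (auto simp: abs_le_iff)
    ultimately show ?thesis unfolding avg_cmult by simp
  qed
  show ?thesis unfolding avg2_def using assms(1) by (intro abs_avg) auto
qed

end

text \<open>The degree bound makes the two-step walk lazy, as the Choquet--Deny argument requires.
  \<open>sgnv\<close> is a bipartite colouring: a joint step flips both colours, so whether the two
  walkers have equal colours never changes, and constancy is claimed only among pairs of equal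
  colour.\<close>

locale liouville_graph = countable_walk_graph G for G :: "'v :: countable graph" +
  fixes sgnv :: "'v \<Rightarrow> real"
  assumes deg_le_3: "deg G v \<le> 3"
    and sgnv: "sgnv v = 1 \<or> sgnv v = -1"
    and sgnv_flip: "w \<in> nbrs G v \<Longrightarrow> sgnv w = - sgnv v"
    and liouville: "\<And>g c. (\<And>v. \<bar>g v\<bar> \<le> c) \<Longrightarrow> (\<And>v. v \<in> verts G \<Longrightarrow> avg G g v = g v) \<Longrightarrow>
      v \<in> verts G \<Longrightarrow> w \<in> verts G \<Longrightarrow> g v = g w"
begin

text \<open>From any neighbour the walk steps back with probability at least 1/3.\<close>

lemma avg_avg_lazy:
  assumes "v \<in> verts G" "\<And>w. w \<in> verts G \<Longrightarrow> 0 \<le> g w"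
  shows "g v / 3 \<le> avg G (avg G g) v"
proof -
  have "g v / 3 = avg G (\<lambda>_. g v / 3) v" using assms(1) by (simp add: avg_const)
  also have "\<dots> \<le> avg G (avg G g) v"
  proof (rule avg_mono)
    fix w assume w: "w \<in> nbrs G v"
    have d: "0 < deg G w" using w by (intro deg_pos nbrs_verts)
    have "g v / 3 \<le> g v / deg G w"
      using d deg_le_3[of w] assms by (intro divide_left_mono) auto
    also have "g v \<le> (\<Sum>u\<in>nbrs G w. g u)"
      using w nbrs_sym[of w G v] assms(2) nbrs_verts by (intro member_le_sum) auto
    then have "g v / deg G w \<le> avg G g w"
      unfolding avg_def using d by (intro divide_right_mono) auto
    finally show "g v / 3 \<le> avg G g w" .
  qed
  finally show ?thesis .
qed

text \<open>Let A and S average over two steps of the first and of the second walk. They commute,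
  and two joint steps give h = A (S h). By \<open>avg_avg_lazy\<close>, A = I/3 + 2B/3 with B again
  an averaging operator, so \<open>choquet_deny_le\<close> applies with d = 1/3, and B h <= h is the
  same as A h <= h.\<close>

lemma harmonic_pair_le:
  assumes bdd: "\<And>p. \<bar>h p\<bar> \<le> H" and harm: "\<And>x y. x \<in> verts G \<Longrightarrow> y \<in> verts G \<Longrightarrow> avg2 G h (x, y) = h (x, y)"
    and xy: "x \<in> verts G" "y \<in> verts G"
  shows "avg G (avg G (\<lambda>u. h (u, y))) x \<le> h (x, y)"
proof -
  define A where "A g = (\<lambda>(x, y). avg G (avg G (\<lambda>u. g (u, y))) x)" for g :: "'v \<times> 'v \<Rightarrow> real"
  define S where "S g = (\<lambda>(x, y). avg G (avg G (\<lambda>w. g (x, w))) y)" for g :: "'v \<times> 'v \<Rightarrow> real"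
  define B where "B g p = 3 / 2 * A g p - g p / 2" for g p
  have swap: "avg G (\<lambda>u. avg G (\<lambda>w. f u w) b) a = avg G (\<lambda>w. avg G (\<lambda>u. f u w) a) b" for f a b
    unfolding avg_def by (simp add: sum_divide_distrib sum.swap[of _ "nbrs G a"] divide_divide_eq_left mult.commute)
  have AS: "A (S g) p = S (A g) p" for g p
  proof (cases p)
    case (Pair x y)
    have "A (S g) p = avg G (\<lambda>a. avg G (\<lambda>b. avg G (\<lambda>c. avg G (\<lambda>d. g (b, d)) c) y) a) x"
      by (simp add: A_def S_def Pair)
    also have "\<dots> = avg G (\<lambda>a. avg G (\<lambda>c. avg G (\<lambda>b. avg G (\<lambda>d. g (b, d)) c) a) y) x"
      by (subst (2) swap) simp
    also have "\<dots> = avg G (\<lambda>c. avg G (\<lambda>a. avg G (\<lambda>b. avg G (\<lambda>d. g (b, d)) c) a) x) y"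
      by (rule swap)
    also have "\<dots> = avg G (\<lambda>c. avg G (\<lambda>a. avg G (\<lambda>d. avg G (\<lambda>b. g (b, d)) a) c) x) y"
      by (subst (3) swap) simp
    also have "\<dots> = avg G (\<lambda>c. avg G (\<lambda>d. avg G (\<lambda>a. avg G (\<lambda>b. g (b, d)) a) x) c) y"
      by (subst (2) swap) simp
    finally show ?thesis by (simp add: A_def S_def Pair)
  qed
  have hAS: "h p = A (S h) p" if p: "p \<in> verts G \<times> verts G" for p
  proof -
    obtain x y where [simp]: "p = (x, y)" by (cases p)
    have "h (x, y) = avg2 G (avg2 G h) (x, y)"
    proof -
      have "avg2 G (avg2 G h) (x, y) = avg2 G h (x, y)"
        unfolding avg2_def[of G _ "(x, y)"] using harm
        by (intro avg_cong) (auto intro!: avg_cong dest: nbrs_verts)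
      then show ?thesis using harm p by simp
    qed
    also have "\<dots> = avg G (\<lambda>a. avg G (\<lambda>c. avg G (\<lambda>b. avg G (\<lambda>d. h (b, d)) c) a) y) x"
      by (simp add: avg2_def)
    also have "\<dots> = avg G (\<lambda>a. avg G (\<lambda>b. avg G (\<lambda>c. avg G (\<lambda>d. h (b, d)) c) y) a) x"
      by (subst (2) swap) simp
    finally show ?thesis by (simp add: A_def S_def)
  qed
  have Alin: "A (\<lambda>y. a * f y + b * g y) p = a * A f p + b * A g p" for a f b g p
    unfolding A_def by (simp add: split_beta avg_add avg_cmult[abs_def] avg_add[abs_def] avg_cmult)
  have Slin: "S (\<lambda>y. a * f y + b * g y) p = a * S f p + b * S g p" for a f b g p
    unfolding S_def by (simp add: split_beta avg_add avg_cmult[abs_def] avg_add[abs_def] avg_cmult)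
  have Adiff: "A (\<lambda>y. f y - g y) p = A f p - A g p" for f g p
    using Alin[of 1 f "-1" g p] by simp
  have Sdiff: "S (\<lambda>y. f y - g y) p = S f p - S g p" for f g p
    using Slin[of 1 f "-1" g p] by simp
  have Acong: "A f p = A g p" if "p \<in> verts G \<times> verts G" "\<And>q. q \<in> verts G \<times> verts G \<Longrightarrow> f q = g q" for f g p
    unfolding A_def split_beta using that by (intro avg_cong) (auto dest: nbrs_verts)
  have Scong: "S f p = S g p" if "p \<in> verts G \<times> verts G" "\<And>q. q \<in> verts G \<times> verts G \<Longrightarrow> f q = g q" for f g p
    unfolding S_def split_beta using that by (intro avg_cong) (auto dest: nbrs_verts)
  have Sle: "S f p \<le> c" if "p \<in> verts G \<times> verts G" "\<And>q. q \<in> verts G \<times> verts G \<Longrightarrow> f q \<le> c" for f c p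
  proof -
    have "S f p \<le> S (\<lambda>_. c) p"
      unfolding S_def split_beta using that by (intro avg_mono) (auto dest: nbrs_verts)
    also have "\<dots> = avg G (\<lambda>_. c) (snd p)"
      unfolding S_def split_beta by (intro avg_cong avg_const nbrs_verts) auto
    also have "\<dots> = c" using that by (intro avg_const) auto
    finally show ?thesis .
  qed
  have Ble: "B f p \<le> c" if p: "p \<in> verts G \<times> verts G" and f: "\<And>q. q \<in> verts G \<times> verts G \<Longrightarrow> f q \<le> c" for f c p
  proof -
    have "(c - f (fst p, snd p)) / 3 \<le> avg G (avg G (\<lambda>u. c - f (u, snd p))) (fst p)"
      using p f by (intro avg_avg_lazy[of "fst p" "\<lambda>u. c - f (u, snd p)"]) (auto simp: mem_Times_iff)
    also have "\<dots> = A (\<lambda>q. c - f q) p"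
      by (simp add: A_def split_beta)
    also have "\<dots> = A (\<lambda>_. c) p - A f p" by (rule Adiff)
    also have "A (\<lambda>_. c) p = avg G (\<lambda>_. c) (fst p)"
      unfolding A_def split_beta by (intro avg_cong avg_const nbrs_verts) auto
    also have "\<dots> = c" using p by (intro avg_const) auto
    finally show ?thesis by (simp add: B_def)
  qed
  have "B h (x, y) \<le> h (x, y)"
  proof (rule choquet_deny_le[where V="verts G \<times> verts G" and S=S and d="1/3" and B=B and H=H])
    show "\<bar>h q\<bar> \<le> H" for q by (rule bdd)
    show "h q = 1 / 3 * S h q + (1 - 1 / 3) * B (S h) q" if "q \<in> verts G \<times> verts G" for q
      using hAS[OF that] by (simp add: B_def field_simps)
    show "B (S g) q = S (B g) q" for g q
    proof -
      have "S (B g) q = S (\<lambda>p. 3 / 2 * A g p + (-1/2) * g p) q" by (simp add: B_def[abs_def])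
      also have "\<dots> = 3 / 2 * S (A g) q + (-1/2) * S g q" by (rule Slin)
      finally show ?thesis by (simp add: B_def AS)
    qed
    show "B (\<lambda>y. f y - g y) q = B f q - B g q" for f g q
      by (simp add: B_def Adiff field_simps)
    show "B (\<lambda>y. a * f y + b * g y) q = a * B f q + b * B g q" for a f b g q
      by (simp add: B_def Alin field_simps)
    show "B f q = B g q" if "q \<in> verts G \<times> verts G" "\<And>q. q \<in> verts G \<times> verts G \<Longrightarrow> f q = g q" for f g q
      unfolding B_def using that Acong[OF that] by simp
    show "S (\<lambda>y. f y - g y) q = S f q - S g q" for f g q by (rule Sdiff)
    show "S (\<lambda>y. a * f y + b * g y) q = a * S f q + b * S g q" for a f b g q by (rule Slin)
    show "S f q = S g q" if "q \<in> verts G \<times> verts G" "\<And>q. q \<in> verts G \<times> verts G \<Longrightarrow> f q = g q" for f g q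
      by (rule Scong[OF that])
    show "B f q \<le> c" if "q \<in> verts G \<times> verts G" "\<And>q. q \<in> verts G \<times> verts G \<Longrightarrow> f q \<le> c" for f c q
      by (rule Ble[OF that])
    show "S f q \<le> c" if "q \<in> verts G \<times> verts G" "\<And>q. q \<in> verts G \<times> verts G \<Longrightarrow> f q \<le> c" for f c q
      by (rule Sle[OF that])
    show "(x, y) \<in> verts G \<times> verts G" using xy by simp
  qed simp_all
  then show ?thesis by (simp add: B_def A_def)
qed

text \<open>g + avg g is harmonic, and g - avg g is reversed by \<open>avg\<close>, hence becomes
  harmonic after multiplication by the colouring. The Liouville property for both determines g on
  each colour class.\<close>

lemma harmonic_two_step:
  assumes bdd: "\<And>v. \<bar>g v\<bar> \<le> c" and harm: "\<And>v. v \<in> verts G \<Longrightarrow> avg G (avg G g) v = g v"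
    and "v \<in> verts G" "w \<in> verts G" "sgnv v = sgnv w"
  shows "g v = g w"
proof -
  have c: "0 \<le> c" using bdd[of v] by linarith
  have b1: "\<bar>avg G g v\<bar> \<le> c" for v
  proof -
    have "avg G g v \<le> c" using bdd c by (intro avg_le_const) (auto simp: abs_le_iff)
    moreover have "avg G (\<lambda>w. (-1) * g w) v \<le> c" using bdd c by (intro avg_le_const) (auto simp: abs_le_iff)
    ultimately show ?thesis unfolding avg_cmult by simp
  qed
  have 1: "g v + avg G g v = g w + avg G g w"
  proof (rule liouville[of "\<lambda>v. g v + avg G g v" "2 * c"])
    show "\<bar>g v + avg G g v\<bar> \<le> 2 * c" for v using bdd[of v] b1[of v] by linarith
    show "avg G (\<lambda>v. g v + avg G g v) v = g v + avg G g v" if "v \<in> verts G" for v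
      using harm[OF that] by (simp add: avg_add)
  qed fact+
  have 2: "sgnv v * (g v - avg G g v) = sgnv w * (g w - avg G g w)"
  proof (rule liouville[of "\<lambda>v. sgnv v * (g v - avg G g v)" "2 * c"])
    show "\<bar>sgnv v * (g v - avg G g v)\<bar> \<le> 2 * c" for v
      using bdd[of v] b1[of v] sgnv[of v] by (auto simp: abs_mult)
    show "avg G (\<lambda>v. sgnv v * (g v - avg G g v)) v = sgnv v * (g v - avg G g v)" if "v \<in> verts G" for v
    proof -
      have "avg G (\<lambda>w. sgnv w * (g w - avg G g w)) v = avg G (\<lambda>w. (- sgnv v) * (g w - avg G g w)) v"
        by (intro avg_cong) (auto dest: sgnv_flip)
      also have "\<dots> = - sgnv v * (avg G g v - avg G (avg G g) v)"
        unfolding avg_cmult avg_diff by simp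
      finally show ?thesis using harm[OF that] by (simp add: algebra_simps)
    qed
  qed fact+
  have "g v - avg G g v = g w - avg G g w" using 2 \<open>sgnv v = sgnv w\<close> sgnv[of w] by auto
  then show ?thesis using 1 by linarith
qed

text \<open>Applying \<open>harmonic_pair_le\<close> to h and to - h, with either order of the
  coordinates, makes h two-step harmonic in each coordinate, hence constant on each colour pattern.
  The two patterns of equal colours are joined by one joint step from (x, x).\<close>

lemma harmonic_pair_const:
  assumes bdd: "\<And>p. \<bar>h p\<bar> \<le> H" and harm: "\<And>x y. x \<in> verts G \<Longrightarrow> y \<in> verts G \<Longrightarrow> avg2 G h (x, y) = h (x, y)"
    and V: "x \<in> verts G" "y \<in> verts G" "x' \<in> verts G" "y' \<in> verts G" "sgnv x = sgnv y" "sgnv x' = sgnv y'"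
  shows "h (x, y) = h (x', y')"
proof -
  have swap: "avg2 G (\<lambda>(x, y). f (y, x)) (x, y) = avg2 G f (y, x)" for f x y
    unfolding avg2_def avg_def
    by (simp add: sum_divide_distrib sum.swap[of _ "nbrs G x"] divide_divide_eq_left mult.commute)
  have fst_harm: "avg G (avg G (\<lambda>u. f (u, y))) x = f (x, y)"
    if bdd: "\<And>p. \<bar>f p\<bar> \<le> H" and harm: "\<And>x y. x \<in> verts G \<Longrightarrow> y \<in> verts G \<Longrightarrow> avg2 G f (x, y) = f (x, y)"
      and xy: "x \<in> verts G" "y \<in> verts G" for f x y
  proof (rule antisym)
    show "avg G (avg G (\<lambda>u. f (u, y))) x \<le> f (x, y)"
      by (rule harmonic_pair_le[OF bdd harm xy])
    have neg: "avg2 G (\<lambda>p. - f p) p = - avg2 G f p" for p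
      using avg_cmult[of G "-1"] by (simp add: avg2_def)
    have "avg G (avg G (\<lambda>u. - f (u, y))) x \<le> - f (x, y)"
      using harmonic_pair_le[of "\<lambda>p. - f p" H x y] bdd harm xy by (simp add: neg)
    also have "avg G (avg G (\<lambda>u. - f (u, y))) x = - avg G (avg G (\<lambda>u. f (u, y))) x"
      using avg_cmult[of G "-1"] by (simp add: fun_eq_iff[symmetric] cong: avg_cong)
    finally show "f (x, y) \<le> avg G (avg G (\<lambda>u. f (u, y))) x" by simp
  qed
  have h1: "h (x, y) = h (x', y)" if "x \<in> verts G" "x' \<in> verts G" "y \<in> verts G" "sgnv x = sgnv x'" for x x' y
    using that fst_harm[OF bdd harm] bdd by (intro harmonic_two_step[of "\<lambda>u. h (u, y)" H]) auto
  have h2: "h (x, y) = h (x, y')" if "x \<in> verts G" "y \<in> verts G" "y' \<in> verts G" "sgnv y = sgnv y'" for x y y'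
  proof (rule harmonic_two_step[of "\<lambda>u. h (x, u)" H])
    fix v assume "v \<in> verts G"
    then show "avg G (avg G (\<lambda>u. h (x, u))) v = h (x, v)"
      using fst_harm[of "\<lambda>(x, y). h (y, x)" v x] bdd harm that by (simp add: swap split_beta)
  qed (use that bdd in auto)
  have h3: "h (x, y) = h (x', y')" if "x \<in> verts G" "y \<in> verts G" "x' \<in> verts G" "y' \<in> verts G"
    "sgnv x = sgnv x'" "sgnv y = sgnv y'" for x y x' y'
    using h1[of x x' y] h2[of x' y y'] that by simp
  show ?thesis
  proof (cases "sgnv x = sgnv x'")
    case True
    then show ?thesis using V by (intro h3) auto
  next
    case False
    obtain w where w: "w \<in> nbrs G x" using nbrs_nonempty[OF V(1)] by blast
    have sw: "sgnv w = sgnv x'" using sgnv_flip[OF w] False sgnv[of x] sgnv[of x'] by auto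
    have "h (x, y) = h (x, x)" using V by (intro h3) auto
    also have "\<dots> = avg2 G h (x, x)" using harm V by simp
    also have "\<dots> = avg G (\<lambda>_. avg G (\<lambda>_. h (w, w)) x) x"
      unfolding avg2_def fst_conv snd_conv using w sgnv_flip nbrs_verts
      by (intro avg_cong h3) auto
    also have "\<dots> = h (w, w)" using V by (simp add: avg_const)
    also have "\<dots> = h (x', y')" using V sw w nbrs_verts by (intro h3) auto
    finally show ?thesis .
  qed
qed

end

section \<open>Never colliding and colliding only finitely often, as limits of iterated
  averages\<close>

context countable_walk_graph begin

lemma avg2_mono:
  assumes "\<And>v w. v \<in> nbrs G (fst p) \<Longrightarrow> w \<in> nbrs G (snd p) \<Longrightarrow> f (v, w) \<le> g (v, w)"
  shows "avg2 G f p \<le> avg2 G g p"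
  unfolding avg2_def using assms by (intro avg_mono) auto

lemma avg2_tendsto:
  assumes "\<And>q. (\<lambda>n. f n q) \<longlonglongrightarrow> g q"
  shows "(\<lambda>n. avg2 G (f n) p) \<longlonglongrightarrow> avg2 G g p"
  unfolding avg2_def using assms by (intro avg_tendsto) auto

lemma avg2_pow_tendsto:
  assumes "\<And>q. (\<lambda>n. f n q) \<longlonglongrightarrow> g q"
  shows "(\<lambda>n. (avg2 G ^^ k) (f n) p) \<longlonglongrightarrow> (avg2 G ^^ k) g p"
proof (induction k arbitrary: p)
  case (Suc k)
  then show ?case using avg2_tendsto[of "\<lambda>n. (avg2 G ^^ k) (f n)" "(avg2 G ^^ k) g" p] by simp
qed (use assms in simp)

lemma avg2_pow_mono:
  assumes "\<And>q. f q \<le> g q"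
  shows "(avg2 G ^^ k) f p \<le> (avg2 G ^^ k) g p"
proof (induction k arbitrary: p)
  case (Suc k)
  then show ?case using avg2_mono[of p "(avg2 G ^^ k) f" "(avg2 G ^^ k) g"] by simp
qed (use assms in simp)

lemma avg2_pow_01:
  assumes "\<And>q. 0 \<le> f q \<and> f q \<le> 1"
  shows "0 \<le> (avg2 G ^^ k) f p \<and> (avg2 G ^^ k) f p \<le> 1"
proof (induction k arbitrary: p)
  case (Suc k)
  have "\<bar>avg2 G ((avg2 G ^^ k) f) p\<bar> \<le> 1"
    using Suc by (intro avg2_bound) (simp_all add: abs_of_nonneg)
  moreover have "0 \<le> avg2 G ((avg2 G ^^ k) f) p"
    unfolding avg2_def[of G _ p] using Suc by (intro avg_nonneg) auto
  ultimately show ?case by simp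
qed (use assms in auto)

lemma no_collision_01: "0 \<le> no_collision m p \<and> no_collision m p \<le> 1"
proof (induction m arbitrary: p)
  case (Suc m)
  have "0 \<le> avg2 G (no_collision m) p \<and> avg2 G (no_collision m) p \<le> 1"
    using avg2_pow_01[of "no_collision m" 1 p] Suc by simp
  then show ?case by (auto simp: indicator_def)
qed (auto simp: indicator_def)

lemma no_collision_decseq: "decseq (\<lambda>m. no_collision m p)"
proof (rule decseq_SucI)
  fix m show "no_collision (Suc m) p \<le> no_collision m p"
  proof (induction m arbitrary: p)
    case 0
    show ?case using avg2_pow_01[of "no_collision 0" 1 p] no_collision_01[of 0]
      by (simp add: indicator_def)
  next
    case (Suc m)
    have "avg2 G (no_collision (Suc m)) p \<le> avg2 G (no_collision m) p"
      using Suc by (intro avg2_mono) auto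
    then show ?case by (simp add: indicator_def)
  qed
qed

definition never_collide :: "'v \<times> 'v \<Rightarrow> real" where
  "never_collide p = lim (\<lambda>m. no_collision m p)"

lemma no_collision_tendsto: "(\<lambda>m. no_collision m p) \<longlonglongrightarrow> never_collide p"
proof -
  have "convergent (\<lambda>m. no_collision m p)"
  proof (rule decseq_convergent[OF no_collision_decseq[of p], of 0])
    show "\<forall>m. 0 \<le> no_collision m p" using no_collision_01[of _ p] by simp
  qed (auto simp: convergent_def)
  then show ?thesis unfolding never_collide_def by (simp add: convergent_LIMSEQ_iff)
qed

lemma never_collide_01: "0 \<le> never_collide p \<and> never_collide p \<le> 1"
  using LIMSEQ_le_const[OF no_collision_tendsto[of p], of 0]
    LIMSEQ_le_const2[OF no_collision_tendsto[of p], of 1] no_collision_01[of _ p] by blast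

lemma never_collide_step:
  "never_collide p = (if fst p \<noteq> snd p then avg2 G never_collide p else 0)"
proof -
  have "(\<lambda>m. no_collision (Suc m) p) \<longlonglongrightarrow> (if fst p \<noteq> snd p then avg2 G never_collide p else 0)"
    using avg2_tendsto[of no_collision never_collide p] no_collision_tendsto by (auto simp: indicator_def)
  moreover have "(\<lambda>m. no_collision (Suc m) p) \<longlonglongrightarrow> never_collide p"
    using no_collision_tendsto by (rule LIMSEQ_Suc)
  ultimately show ?thesis by (rule LIMSEQ_unique[symmetric])
qed

lemma never_collide_pow_incseq: "incseq (\<lambda>n. (avg2 G ^^ n) never_collide p)"
proof (rule incseq_SucI)
  fix n
  have "never_collide q \<le> avg2 G never_collide q" for q
    using never_collide_step[of q] avg2_pow_01[of never_collide 1 q] never_collide_01 by (auto split: if_splits)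
  then have "(avg2 G ^^ n) never_collide p \<le> (avg2 G ^^ n) (avg2 G never_collide) p"
    by (intro avg2_pow_mono)
  then show "(avg2 G ^^ n) never_collide p \<le> (avg2 G ^^ Suc n) never_collide p"
    by (simp add: funpow_swap1)
qed

text \<open>Probability that the pair started at \<open>p\<close> collides only finitely often. It
  is built from averages, not from the trajectory measure, so that it makes sense for all pairs,
  also off the diagonal, and its harmonicity is immediate.\<close>

definition fin_prob :: "'v \<times> 'v \<Rightarrow> real" where
  "fin_prob p = lim (\<lambda>n. (avg2 G ^^ n) never_collide p)"

lemma fin_prob_tendsto: "(\<lambda>n. (avg2 G ^^ n) never_collide p) \<longlonglongrightarrow> fin_prob p"
proof -
  have "convergent (\<lambda>n. (avg2 G ^^ n) never_collide p)"
  proof (rule incseq_convergent[OF never_collide_pow_incseq[of p], of 1])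
    show "\<forall>n. (avg2 G ^^ n) never_collide p \<le> 1"
      using avg2_pow_01[of never_collide _ p] never_collide_01 by simp
  qed (auto simp: convergent_def)
  then show ?thesis unfolding fin_prob_def by (simp add: convergent_LIMSEQ_iff)
qed

lemma fin_prob_01: "0 \<le> fin_prob p \<and> fin_prob p \<le> 1"
  using LIMSEQ_le_const[OF fin_prob_tendsto[of p], of 0]
    LIMSEQ_le_const2[OF fin_prob_tendsto[of p], of 1] avg2_pow_01[of never_collide _ p, OF never_collide_01]
  by blast

lemma never_collide_pow_le_fin_prob: "(avg2 G ^^ n) never_collide p \<le> fin_prob p"
  using incseq_le[OF never_collide_pow_incseq fin_prob_tendsto] .

lemma avg2_fin_prob: "avg2 G fin_prob p = fin_prob p"
proof -
  have "(\<lambda>n. (avg2 G ^^ Suc n) never_collide p) \<longlonglongrightarrow> avg2 G fin_prob p"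
    using avg2_tendsto[of "\<lambda>n. (avg2 G ^^ n) never_collide" fin_prob p] fin_prob_tendsto by simp
  then show ?thesis
    using LIMSEQ_unique LIMSEQ_Suc[OF fin_prob_tendsto[of p]] by blast
qed

lemma sets_no_collision_from: "{X. \<forall>i\<ge>n. fst X i \<noteq> snd X i} \<in> sets (pair_walk x)"
proof -
  have "{X \<in> space (pair_walk x). \<forall>i\<ge>n. (fst X i, snd X i) \<in> {p. fst p \<noteq> snd p}} \<in> sets (pair_walk x)"
    by measurable
  then show ?thesis by simp
qed

lemma emeasure_no_collision_from:
  assumes "x \<in> verts G"
  shows "emeasure (pair_walk x) {X. \<forall>i\<ge>n. fst X i \<noteq> snd X i} = ennreal ((avg2 G ^^ n) never_collide (x, x))"
proof -
  interpret M: prob_space "pair_walk x" by (rule prob_space_pair_walk)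
  let ?E = "\<lambda>m. {X. \<forall>i. n \<le> i \<and> i \<le> n + m \<longrightarrow> fst X i \<noteq> snd X i}"
  have sets: "?E m \<in> sets (pair_walk x)" for m
  proof -
    have "{X \<in> space (pair_walk x). \<forall>i. n \<le> i \<and> i \<le> n + m \<longrightarrow> (fst X i, snd X i) \<in> {p. fst p \<noteq> snd p}} \<in> sets (pair_walk x)"
      by measurable
    then show ?thesis by simp
  qed
  have "(\<lambda>m. emeasure (pair_walk x) (?E m)) \<longlonglongrightarrow> emeasure (pair_walk x) (\<Inter>m. ?E m)"
    using sets by (intro Lim_emeasure_decseq) (auto simp: decseq_def)
  also have "(\<Inter>m. ?E m) = {X. \<forall>i\<ge>n. fst X i \<noteq> snd X i}"
    by (auto, metis le_add2)
  finally have "(\<lambda>m. ennreal ((avg2 G ^^ n) (no_collision m) (x, x))) \<longlonglongrightarrow>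
      emeasure (pair_walk x) {X. \<forall>i\<ge>n. fst X i \<noteq> snd X i}"
    unfolding emeasure_no_collision[OF assms] .
  moreover have "(\<lambda>m. ennreal ((avg2 G ^^ n) (no_collision m) (x, x))) \<longlonglongrightarrow> ennreal ((avg2 G ^^ n) never_collide (x, x))"
    using no_collision_tendsto by (intro tendsto_ennrealI avg2_pow_tendsto)
  ultimately show ?thesis by (rule LIMSEQ_unique)
qed

lemma emeasure_collision_from:
  assumes "x \<in> verts G"
  shows "emeasure (pair_walk x) {X. \<exists>i\<ge>n. fst X i = snd X i} = ennreal (1 - (avg2 G ^^ n) never_collide (x, x))"
proof -
  interpret M: prob_space "pair_walk x" by (rule prob_space_pair_walk)
  have "{X. \<exists>i\<ge>n. fst X i = snd X i} = space (pair_walk x) - {X. \<forall>i\<ge>n. fst X i \<noteq> snd X i}" by auto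
  then have "emeasure (pair_walk x) {X. \<exists>i\<ge>n. fst X i = snd X i} = 1 - ennreal ((avg2 G ^^ n) never_collide (x, x))"
    using emeasure_compl[OF sets_no_collision_from[of n x]] emeasure_no_collision_from[OF assms, of n] M.emeasure_space_1
    by simp
  then show ?thesis
    using avg2_pow_01[of never_collide n, OF never_collide_01] by (simp add: ennreal_minus[symmetric])
qed

lemma AE_finite_collisions:
  assumes x: "x \<in> verts G" and "fin_prob (x, x) = 1"
  shows "AE X in srw G x \<Otimes>\<^sub>M srw G x. finite {n. fst X n = snd X n}"
proof -
  interpret M: prob_space "pair_walk x" by (rule prob_space_pair_walk)
  let ?E = "\<lambda>n. {X. \<forall>i\<ge>n. fst X i \<noteq> snd X i}"
  have "(\<lambda>n. emeasure (pair_walk x) (?E n)) \<longlonglongrightarrow> emeasure (pair_walk x) (\<Union>n. ?E n)"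
    using sets_no_collision_from by (intro Lim_emeasure_incseq) (auto simp: incseq_def)
  moreover have "(\<lambda>n. emeasure (pair_walk x) (?E n)) \<longlonglongrightarrow> ennreal 1"
    unfolding emeasure_no_collision_from[OF x] assms(2)[symmetric] by (intro tendsto_ennrealI fin_prob_tendsto)
  ultimately have "emeasure (pair_walk x) (\<Union>n. ?E n) = 1"
    using LIMSEQ_unique by fastforce
  then have "AE X in pair_walk x. X \<in> (\<Union>n. ?E n)"
    using sets_no_collision_from by (subst M.AE_in_set_eq_1) (auto simp: M.emeasure_eq_measure)
  then show ?thesis unfolding pair_walk_def
  proof eventually_elim
    case (elim X)
    then obtain n where "\<forall>i\<ge>n. fst X i \<noteq> snd X i" by auto
    then have "{n. fst X n = snd X n} \<subseteq> {..<n}" by (auto simp: not_le[symmetric])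
    then show ?case by (rule finite_subset) simp
  qed
qed

lemma AE_infinite_collisions:
  assumes x: "x \<in> verts G" and "fin_prob (x, x) = 0"
  shows "AE X in srw G x \<Otimes>\<^sub>M srw G x. infinite {n. fst X n = snd X n}"
proof -
  have "AE X in pair_walk x. X \<notin> {X. \<forall>i\<ge>n. fst X i \<noteq> snd X i}" for n
  proof (rule AE_not_in)
    have "(avg2 G ^^ n) never_collide (x, x) = 0"
      using never_collide_pow_le_fin_prob[of n "(x, x)"] avg2_pow_01[of never_collide n, OF never_collide_01] assms(2)
      by (simp add: antisym)
    then show "{X. \<forall>i\<ge>n. fst X i \<noteq> snd X i} \<in> null_sets (pair_walk x)"
      using sets_no_collision_from emeasure_no_collision_from[OF x, of n] by (intro null_setsI) auto
  qed
  then have "AE X in pair_walk x. \<forall>n. X \<notin> {X. \<forall>i\<ge>n. fst X i \<noteq> snd X i}"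
    by (simp add: AE_all_countable)
  then show ?thesis unfolding pair_walk_def
  proof eventually_elim
    case (elim X)
    then show ?case unfolding infinite_nat_iff_unbounded_le by auto
  qed
qed

end

context liouville_graph begin

lemma fin_prob_const:
  assumes "x \<in> verts G" "y \<in> verts G" "x' \<in> verts G" "y' \<in> verts G" "sgnv x = sgnv y" "sgnv x' = sgnv y'"
  shows "fin_prob (x, y) = fin_prob (x', y')"
  using assms by (intro harmonic_pair_const[of fin_prob 1]) (auto simp: avg2_fin_prob fin_prob_01)

text \<open>On the event that no collision happens up to time \<open>m\<close>, the chance of never colliding is
  at most the constant value \<open>c\<close> of \<^const>\<open>fin_prob\<close>; hence \<open>a \<le> c * a\<close> for \<open>a\<close> the probability of
  never colliding, so \<open>c < 1\<close> forces \<open>a = 0\<close> and then \<open>c = 0\<close>.\<close>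

theorem fin_prob_0_or_1:
  assumes x: "x \<in> verts G"
  shows "fin_prob (x, x) = 0 \<or> fin_prob (x, x) = 1"
proof (rule disjCI)
  define c where "c = fin_prob (x, x)"
  assume "fin_prob (x, x) \<noteq> 1"
  then have c: "0 \<le> c" "c < 1" using fin_prob_01[of "(x, x)"] by (auto simp: c_def)
  have fc: "fin_prob (u, v) = c" if "u \<in> verts G" "v \<in> verts G" "sgnv u = sgnv v" for u v
    unfolding c_def using that x by (intro fin_prob_const) auto
  have le: "never_collide (u, v) \<le> c * no_collision m (u, v)"
    if "u \<in> verts G" "v \<in> verts G" "sgnv u = sgnv v" for u v m
    using that
  proof (induction m arbitrary: u v)
    case 0
    show ?case
      using never_collide_pow_le_fin_prob[of 0 "(u, v)"] fc[OF 0] never_collide_step[of "(u, v)"]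
      by (auto simp: indicator_def)
  next
    case (Suc m)
    show ?case
    proof (cases "u = v")
      case True
      then show ?thesis using never_collide_step[of "(u, v)"] by simp
    next
      case False
      have "never_collide (u, v) = avg2 G never_collide (u, v)"
        using never_collide_step[of "(u, v)"] False by simp
      also have "\<dots> \<le> avg2 G (\<lambda>p. c * no_collision m p) (u, v)"
        using Suc.prems by (intro avg2_mono Suc.IH) (auto simp: nbrs_verts sgnv_flip[of _ u] sgnv_flip[of _ v])
      also have "\<dots> = c * avg2 G (no_collision m) (u, v)"
        by (simp add: avg2_def avg_cmult)
      finally show ?thesis using False by simp
    qed
  qed
  have zero: "never_collide (u, v) = 0" if "u \<in> verts G" "v \<in> verts G" "sgnv u = sgnv v" for u v
  proof -
    have "never_collide (u, v) \<le> c * never_collide (u, v)"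
      using le[OF that] by (intro LIMSEQ_le_const[OF tendsto_mult[OF tendsto_const no_collision_tendsto]]) auto
    then have "(1 - c) * never_collide (u, v) \<le> 0" by (simp add: algebra_simps)
    then show ?thesis using c never_collide_01[of "(u, v)"]
      by (smt (verit) mult_pos_pos)
  qed
  have "(avg2 G ^^ n) never_collide (u, v) = 0" if "u \<in> verts G" "v \<in> verts G" "sgnv u = sgnv v" for u v n
    using that
  proof (induction n arbitrary: u v)
    case (Suc n)
    have "avg2 G ((avg2 G ^^ n) never_collide) (u, v) \<le> avg2 G (\<lambda>_. 0) (u, v)"
      using Suc by (intro avg2_mono) (auto simp: nbrs_verts sgnv_flip[of _ u] sgnv_flip[of _ v])
    also have "\<dots> = 0" by (simp add: avg2_def avg_def)
    finally show ?case using avg2_pow_01[of never_collide "Suc n", OF never_collide_01] by (simp add: antisym)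
  qed (use zero in simp)
  then have "(\<lambda>n. (avg2 G ^^ n) never_collide (x, x)) \<longlonglongrightarrow> 0" using x by simp
  then show "fin_prob (x, x) = 0" using fin_prob_tendsto LIMSEQ_unique by blast
qed

end

section \<open>Combs\<close>

abbreviation comb :: "(int \<Rightarrow> nat) \<Rightarrow> (int \<times> nat) graph" where
  "comb \<eta> \<equiv> Comb (\<lambda>x. real (\<eta> x))"

text \<open>Heights matter only through their integer parts. This makes the one-site law of the
  environment a \<open>pmf\<close> on the natural numbers.\<close>

lemma Comb_eq_comb: "(\<And>x. 0 \<le> H x) \<Longrightarrow> Comb H = comb (\<lambda>x. nat \<lfloor>H x\<rfloor>)"
proof -
  assume H: "\<And>x. 0 \<le> H x"
  have "real l \<le> H x \<longleftrightarrow> real l \<le> real (nat \<lfloor>H x\<rfloor>)" for l x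
  proof -
    have "real l \<le> H x \<longleftrightarrow> int l \<le> \<lfloor>H x\<rfloor>" by (simp add: le_floor_iff)
    also have "\<dots> \<longleftrightarrow> real l \<le> real (nat \<lfloor>H x\<rfloor>)"
      unfolding of_nat_le_iff using H[of x] by (simp add: le_nat_iff)
    finally show ?thesis .
  qed
  then show ?thesis by (simp add: Comb_def)
qed

lemma verts_comb: "verts (comb \<eta>) = {(y, l). l \<le> \<eta> y}"
  by (auto simp: verts_def Comb_def)

lemma nbrs_comb: "nbrs (comb \<eta>) (y, l) =
  (if \<eta> y < l then {} else (if l = 0 then {(y + 1, 0), (y - 1, 0)} else {(y, l - 1)}) \<union>
    (if l < \<eta> y then {(y, l + 1)} else {}))" (is "_ = ?R")
proof -
  have "(z, k) \<in> nbrs (comb \<eta>) (y, l) \<longleftrightarrow> (z, k) \<in> ?R" for z k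
  proof -
    have "(z, k) \<in> nbrs (comb \<eta>) (y, l) \<longleftrightarrow>
      (l = 0 \<and> k = 0 \<and> \<bar>y - z\<bar> = 1) \<or> (z = y \<and> l \<le> \<eta> y \<and> k \<le> \<eta> y \<and> \<bar>int l - int k\<bar> = 1)"
      (is "?l \<longleftrightarrow> ?r1 \<or> ?r2")
    proof
      show "?l \<Longrightarrow> ?r1 \<or> ?r2"
        unfolding nbrs_def edges_def Comb_def by (auto simp: doubleton_eq_iff)
      assume "?r1 \<or> ?r2"
      then show ?l
      proof
        assume ?r1
        then show ?l unfolding nbrs_def edges_def Comb_def snd_conv mem_Collect_eq
          by (intro UnI1 CollectI exI[of _ y] exI[of _ z]) auto
      next
        assume ?r2
        then show ?l unfolding nbrs_def edges_def Comb_def snd_conv mem_Collect_eq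
          by (intro UnI2 CollectI exI[of _ y] exI[of _ l] exI[of _ k]) auto
      qed
    qed
    also have "\<dots> \<longleftrightarrow> (z, k) \<in> ?R" by auto
    finally show ?thesis .
  qed
  then show ?thesis by (metis subset_antisym subrelI)
qed

lemma deg_comb_spine: "deg (comb \<eta>) (y, 0) = (if 0 < \<eta> y then 3 else 2)"
  by (simp add: deg_def nbrs_comb)

lemma avg_comb_spine:
  "avg (comb \<eta>) g (y, 0) = (g (y + 1, 0) + g (y - 1, 0) + (if 0 < \<eta> y then g (y, 1) else 0)) /
    (if 0 < \<eta> y then 3 else 2)"
  by (simp add: avg_def deg_comb_spine nbrs_comb)

lemma avg_comb_tooth:
  "avg (comb \<eta>) g (y, Suc l) = (if Suc l < \<eta> y then (g (y, l) + g (y, l + 2)) / 2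
    else if Suc l = \<eta> y then g (y, l) else 0)"
proof -
  have "nbrs (comb \<eta>) (y, Suc l) = (if Suc l < \<eta> y then {(y, l), (y, l + 2)}
      else if Suc l = \<eta> y then {(y, l)} else {})"
    by (auto simp: nbrs_comb)
  then show ?thesis by (simp add: avg_def deg_def)
qed

definition csgn :: "int \<times> nat \<Rightarrow> real" where
  "csgn v = (if even (fst v + int (snd v)) then 1 else -1)"

lemma cosh_recursion:
  fixes \<alpha> :: real
  shows "cosh (\<alpha> * real (Suc (Suc j))) = 2 * cosh \<alpha> * cosh (\<alpha> * real (Suc j)) - cosh (\<alpha> * real j)"
proof -
  have 1: "\<alpha> * real (Suc (Suc j)) = \<alpha> * real (Suc j) + \<alpha>" and 2: "\<alpha> * real j = \<alpha> * real (Suc j) - \<alpha>"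
    by (simp_all add: algebra_simps)
  show ?thesis unfolding 1 2 cosh_add cosh_diff by simp
qed

text \<open>Counted from the tip, the recursion is that of cosh(\<alpha> j), and the reflecting tip
  fixes the first step. For \<alpha> = 0 it says that harmonic functions are constant along a
  tooth.\<close>

lemma tooth_solution:
  fixes w :: "nat \<Rightarrow> real"
  assumes top: "0 < h \<Longrightarrow> cosh \<alpha> * w h = w (h - 1)"
    and mid: "\<And>l. 0 < l \<Longrightarrow> l < h \<Longrightarrow> 2 * cosh \<alpha> * w l = w (l - 1) + w (l + 1)"
    and "j \<le> h"
  shows "w (h - j) = w h * cosh (\<alpha> * j)"
  using \<open>j \<le> h\<close>
proof (induction j rule: induct_nat_012)
  case 0 then show ?case by simp
next
  case 1 then show ?case using top by (simp add: mult.commute)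
next
  case (ge2 j)
  let ?l = "h - Suc j"
  have "w (h - Suc (Suc j)) = 2 * cosh \<alpha> * w ?l - w (h - j)"
    using mid[of ?l] ge2.prems by (simp add: Suc_diff_Suc)
  also have "\<dots> = w h * (2 * cosh \<alpha> * cosh (\<alpha> * real (Suc j)) - cosh (\<alpha> * real j))"
    using ge2.IH ge2.prems by (simp add: algebra_simps)
  finally show ?case unfolding cosh_recursion .
qed

interpretation comb: walk_graph "comb \<eta>" for \<eta>
proof
  show "finite (nbrs (comb \<eta>) v)" for v by (cases v) (simp add: nbrs_comb)
  show "nbrs (comb \<eta>) v \<noteq> {}" if "v \<in> verts (comb \<eta>)" for v
    using that by (cases v) (auto simp: nbrs_comb verts_comb)
  show "w \<in> verts (comb \<eta>)" if "w \<in> nbrs (comb \<eta>) v" for v w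
    using that by (cases v) (auto simp: nbrs_comb verts_comb split: if_splits)
qed

text \<open>Being constant on teeth, a harmonic function is harmonic on the integers when restricted
  to the spine, so it is affine there, and bounded affine functions are constant.\<close>

lemma liouville_comb:
  assumes bdd: "\<And>v. \<bar>g v\<bar> \<le> c"
    and harm: "\<And>v. v \<in> verts (comb \<eta>) \<Longrightarrow> avg (comb \<eta>) g v = g v"
    and vw: "v \<in> verts (comb \<eta>)" "w \<in> verts (comb \<eta>)"
  shows "g v = g w"
proof -
  have tooth: "g (y, l) = g (y, 0)" if "l \<le> \<eta> y" for y l
  proof -
    have "g (y, \<eta> y - j) = g (y, \<eta> y)" if "j \<le> \<eta> y" for j
    proof -
      have "(\<lambda>l. g (y, l)) (\<eta> y - j) = (\<lambda>l. g (y, l)) (\<eta> y) * cosh (0 * real j)"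
      proof (rule tooth_solution[OF _ _ that])
        show "cosh 0 * g (y, \<eta> y) = g (y, \<eta> y - 1)" if "0 < \<eta> y"
          using harm[of "(y, \<eta> y)"] avg_comb_tooth[of \<eta> g y "\<eta> y - 1"] that by (simp add: verts_comb)
        show "2 * cosh 0 * g (y, l) = g (y, l - 1) + g (y, l + 1)" if "0 < l" "l < \<eta> y" for l
          using harm[of "(y, l)"] avg_comb_tooth[of \<eta> g y "l - 1"] that by (simp add: verts_comb)
      qed
      then show ?thesis by simp
    qed
    from this[of "\<eta> y - l"] this[of "\<eta> y"] show ?thesis using that by simp
  qed
  define u where "u y = g (y, 0)" for y
  have u2: "u (y + 1) - u y = u y - u (y - 1)" for y
    using harm[of "(y, 0)"] tooth[of 1 y]
    by (cases "0 < \<eta> y") (auto simp: u_def avg_comb_spine verts_comb field_simps)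
  have D: "u (y + 1) - u y = u 1 - u 0" for y
  proof (induction y rule: int_induct[of _ 0])
    case (step1 i) then show ?case using u2[of "i + 1"] by simp
  next
    case (step2 i) then show ?case using u2[of i] by simp
  qed simp
  have lin: "u (int n) = u 0 + real n * (u 1 - u 0)" for n
  proof (induction n)
    case (Suc n)
    then show ?case using D[of "int n"] by (simp add: algebra_simps)
  qed simp
  have "u 1 - u 0 = 0"
  proof (rule ccontr)
    assume "u 1 - u 0 \<noteq> 0"
    then obtain n :: nat where n: "2 * c < real n * \<bar>u 1 - u 0\<bar>"
      using reals_Archimedean3[of "\<bar>u 1 - u 0\<bar>"] by auto
    have "real n * \<bar>u 1 - u 0\<bar> = \<bar>u (int n) - u 0\<bar>" using lin[of n] by (simp add: abs_mult)
    also have "\<dots> \<le> 2 * c" using bdd[of "(int n, 0)"] bdd[of "(0, 0)"] by (simp add: u_def)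
    finally show False using n by simp
  qed
  then have D0: "u (y + 1) = u y" for y using D[of y] by simp
  have "u y = u 0" for y
  proof (induction y rule: int_induct[of _ 0])
    case (step1 i) then show ?case using D0[of i] by simp
  next
    case (step2 i) then show ?case using D0[of "i - 1"] by simp
  qed simp
  then have "g (y, l) = u 0" if "(y, l) \<in> verts (comb \<eta>)" for y l
    using tooth[of l y] that by (simp add: u_def verts_comb)
  from this[of "fst v" "snd v"] this[of "fst w" "snd w"] show ?thesis using vw by simp
qed

interpretation comb: liouville_graph "comb \<eta>" csgn for \<eta>
proof
  show "deg (comb \<eta>) v \<le> 3" for v
    by (cases v) (auto simp: deg_def nbrs_comb card_insert_if)
  show "csgn v = 1 \<or> csgn v = -1" for v by (simp add: csgn_def)
  show "csgn w = - csgn v" if "w \<in> nbrs (comb \<eta>) v" for v w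
    using that by (cases v) (auto simp: nbrs_comb csgn_def split: if_splits)
  show "g v = g w" if "\<And>v. \<bar>g v\<bar> \<le> c" "\<And>v. v \<in> verts (comb \<eta>) \<Longrightarrow> avg (comb \<eta>) g v = g v"
    "v \<in> verts (comb \<eta>)" "w \<in> verts (comb \<eta>)" for g c v w
    by (rule liouville_comb[OF that])
qed

subsection \<open>The Green function\<close>

definition green :: "'v graph \<Rightarrow> real \<Rightarrow> 'v \<Rightarrow> 'v \<Rightarrow> real" where
  "green G s x t = (\<Sum>n. s ^ n * tp G n x t)"

lemma summable_green: "0 \<le> s \<Longrightarrow> s < 1 \<Longrightarrow> summable (\<lambda>n. s ^ n * tp G n x t)"
  by (rule summable_comparison_test'[of "\<lambda>n. s ^ n" 0])
    (auto simp: abs_mult tp_nonneg tp_le_1 mult_left_le)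

lemma green_nonneg: "0 \<le> s \<Longrightarrow> s < 1 \<Longrightarrow> 0 \<le> green G s x t"
  unfolding green_def by (intro suminf_nonneg summable_green) (auto simp: tp_nonneg)

lemma green_le: 
  assumes "0 \<le> s" "s < 1" shows "green G s x t \<le> 1 / (1 - s)"
proof -
  have "green G s x t \<le> (\<Sum>n. s ^ n)"
    unfolding green_def using assms by (intro suminf_le summable_green summable_geometric)
      (auto simp: tp_nonneg tp_le_1 mult_left_le)
  then show ?thesis using assms by (simp add: suminf_geometric)
qed

lemma (in walk_graph) green_step:
  assumes "0 \<le> s" "s < 1"
  shows "green G s x t = indicator {t} x + s * avg G (\<lambda>w. green G s w t) x"
proof -
  have "green G s x t = indicator {t} x + (\<Sum>n. s ^ Suc n * tp G (Suc n) x t)"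
    using suminf_split_head[OF summable_green[OF assms, of G x t]] by (simp add: green_def tp_0)
  also have "(\<Sum>n. s ^ Suc n * tp G (Suc n) x t) = (\<Sum>n. s * avg G (\<lambda>w. s ^ n * tp G n w t) x)"
    by (simp add: tp_Suc avg_cmult mult.assoc)
  also have "\<dots> = s * (\<Sum>n. avg G (\<lambda>w. s ^ n * tp G n w t) x)"
    by (intro suminf_mult) (auto simp: avg_def intro!: summable_divide summable_sum summable_green assms)
  also have "(\<Sum>n. avg G (\<lambda>w. s ^ n * tp G n w t) x) = avg G (\<lambda>w. green G s w t) x"
  proof -
    have "(\<lambda>n. avg G (\<lambda>w. s ^ n * tp G n w t) x) sums avg G (\<lambda>w. green G s w t) x"
      unfolding avg_def green_def by (intro sums_divide sums_sum summable_sums summable_green assms)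
    then show ?thesis by (rule sums_unique[symmetric])
  qed
  finally show ?thesis .
qed

lemma (in walk_graph) green_reversible:
  assumes "0 \<le> s" "s < 1"
  shows "deg G x * green G s x t = deg G t * green G s t x"
proof -
  have "deg G x * green G s x t = (\<Sum>n. deg G x * (s ^ n * tp G n x t))"
    unfolding green_def by (intro suminf_mult[symmetric] summable_green assms)
  also have "\<dots> = (\<Sum>n. deg G t * (s ^ n * tp G n t x))"
    using tp_reversible[of x _ t] by (simp add: mult.left_commute[of "deg G _"])
  also have "\<dots> = deg G t * green G s t x"
    unfolding green_def by (intro suminf_mult summable_green assms)
  finally show ?thesis .
qed

text \<open>Eliminating the teeth turns the resolvent equation on the comb, at killing parameter
  \<open>s = 1 / cosh \<alpha>\<close>, into a one-dimensional equation on the spine whose potential at a tooth of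
  height \<open>h\<close> is \<open>pot \<alpha> h\<close>.\<close>

definition pot :: "real \<Rightarrow> nat \<Rightarrow> real" where
  "pot \<alpha> h = 2 * (cosh \<alpha> - 1) + sinh \<alpha> * tanh (\<alpha> * real h)"

definition gs :: "(int \<Rightarrow> nat) \<Rightarrow> real \<Rightarrow> int \<Rightarrow> int \<Rightarrow> real" where
  "gs \<eta> \<alpha> y t = green (comb \<eta>) (1 / cosh \<alpha>) (y, 0) (t, 0)"

lemma cosh_gt_1: "0 < \<alpha> \<Longrightarrow> 1 < cosh (\<alpha> :: real)"
  using cosh_real_ge_1[of \<alpha>] cosh_real_one_iff[of \<alpha>] by linarith

lemma gs_equation:
  assumes \<alpha>: "0 < \<alpha>"
  shows "(2 + pot \<alpha> (\<eta> y)) * gs \<eta> \<alpha> y t = gs \<eta> \<alpha> (y + 1) t + gs \<eta> \<alpha> (y - 1) t +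
    (if y = t then cosh \<alpha> * deg (comb \<eta>) (t, 0) else 0)"
proof -
  define s where "s = 1 / cosh \<alpha>"
  have s: "0 \<le> s" "s < 1" using cosh_gt_1[OF \<alpha>] by (auto simp: s_def)
  define w where "w v = green (comb \<eta>) s v (t, 0)" for v
  have gs: "gs \<eta> \<alpha> y t = w (y, 0)" for y by (simp add: gs_def w_def s_def)
  have step: "cosh \<alpha> * w v = cosh \<alpha> * indicator {(t, 0)} v + avg (comb \<eta>) w v" for v
    using comb.green_step[OF s, of \<eta> v "(t, 0)"] unfolding w_def
    by (simp add: s_def field_simps)
  define h where "h = \<eta> y"
  have tooth: "w (y, h - j) = w (y, h) * cosh (\<alpha> * real j)" if "j \<le> h" for j
  proof (rule tooth_solution[of h \<alpha> "\<lambda>l. w (y, l)", OF _ _ that])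
    show "cosh \<alpha> * w (y, h) = w (y, h - 1)" if "0 < h"
      using step[of "(y, h)"] avg_comb_tooth[of \<eta> w y "h - 1"] that by (simp add: h_def)
    show "2 * cosh \<alpha> * w (y, l) = w (y, l - 1) + w (y, l + 1)" if "0 < l" "l < h" for l
      using step[of "(y, l)"] avg_comb_tooth[of \<eta> w y "l - 1"] that by (simp add: h_def)
  qed
  have w0: "w (y, 0) = w (y, h) * cosh (\<alpha> * real h)" using tooth[of h] by simp
  define b where "b = (if y = t then cosh \<alpha> * deg (comb \<eta>) (t, 0) else 0)"
  show ?thesis
  proof (cases "h = 0")
    case True
    then show ?thesis
      using step[of "(y, 0)"] by (auto simp: gs pot_def h_def avg_comb_spine deg_comb_spine field_simps)
  next
    case False
    have w1: "w (y, 1) = w (y, h) * (cosh (\<alpha> * real h) * cosh \<alpha> - sinh (\<alpha> * real h) * sinh \<alpha>)"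
    proof -
      have "\<alpha> * real (h - 1) = \<alpha> * real h - \<alpha>" using False by (simp add: algebra_simps of_nat_diff)
      then show ?thesis using tooth[of "h - 1"] False by (simp add: cosh_diff)
    qed
    have 1: "3 * cosh \<alpha> * w (y, 0) = b + w (y + 1, 0) + w (y - 1, 0) + w (y, 1)"
      using step[of "(y, 0)"] False by (auto simp: b_def h_def avg_comb_spine deg_comb_spine field_simps)
    have "sinh \<alpha> * tanh (\<alpha> * real h) * w (y, 0) = sinh \<alpha> * sinh (\<alpha> * real h) * w (y, h)"
      unfolding w0 by (simp add: tanh_def)
    then have "(2 + pot \<alpha> h) * w (y, 0) = 2 * cosh \<alpha> * w (y, 0) + sinh \<alpha> * sinh (\<alpha> * real h) * w (y, h)"
      by (simp add: pot_def algebra_simps)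
    also have "\<dots> = 3 * cosh \<alpha> * w (y, 0) - w (y, 1)"
      unfolding w1 w0 by (simp add: algebra_simps)
    finally show ?thesis using 1 by (simp add: gs h_def b_def)
  qed
qed

text \<open>Discrete form of w'' = V w on a half-line with w, V >= 0 and w bounded. The equation is
  required only from index 1 on, so that the source of a Green function may sit at 0.\<close>

locale decaying_solution =
  fixes w V :: "nat \<Rightarrow> real"
  assumes w_nonneg: "0 \<le> w i" and V_nonneg: "0 \<le> V i"
    and w_bounded: "\<exists>B. \<forall>i. w i \<le> B"
    and w_eq: "(2 + V (Suc i)) * w (Suc i) = w i + w (Suc (Suc i))"
begin

definition drop :: "nat \<Rightarrow> real" where "drop i = w i - w (Suc i)"

lemma drop_Suc: "drop i = drop (Suc i) + V (Suc i) * w (Suc i)"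
  using w_eq[of i] by (simp add: drop_def algebra_simps)

lemma drop_antimono: "i \<le> j \<Longrightarrow> drop j \<le> drop i"
proof (rule lift_Suc_antimono_le[of drop])
  show "drop (Suc n) \<le> drop n" for n
    using drop_Suc[of n] mult_nonneg_nonneg[OF V_nonneg w_nonneg, of "Suc n" "Suc n"] by linarith
qed

lemma w_sub: "w i - w (i + n) = (\<Sum>j<n. drop (i + j))"
  by (induction n) (auto simp: drop_def)

text \<open>Drops decrease along the half-line, so a negative drop would persist and make w grow
  linearly.\<close>

lemma drop_nonneg: "0 \<le> drop i"
proof (rule ccontr)
  assume neg: "\<not> 0 \<le> drop i"
  obtain B where B: "w i \<le> B" for i using w_bounded by blast
  obtain n :: nat where n: "B < real n * (- drop i)"
    using reals_Archimedean3[of "- drop i"] neg by auto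
  have "w i - w (i + n) \<le> (\<Sum>j<n. drop i)"
    unfolding w_sub by (intro sum_mono drop_antimono) auto
  then have "real n * (- drop i) \<le> w (i + n) - w i" by simp
  then show False using B[of "i + n"] w_nonneg[of i] n by linarith
qed

lemma w_antimono: "i \<le> j \<Longrightarrow> w j \<le> w i"
proof (rule lift_Suc_antimono_le[of w])
  show "w (Suc n) \<le> w n" for n
    using drop_nonneg[of n] by (simp add: drop_def)
qed

lemma drop_sum: "drop i = drop (i + n) + (\<Sum>j=1..n. V (i + j) * w (i + j))"
proof (induction n)
  case (Suc n)
  then show ?case using drop_Suc[of "i + n"] by simp
qed simp

text \<open>The potential in the right half forces a drop of at least
  \<open>w (a + 2 * L) / L\<close> in the middle of the block. The \<open>L\<close> drops before it
  are at least as large, so already the left half loses \<open>w (a + 2 * L)\<close>.\<close>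

lemma block_halves:
  assumes L: "0 < L" and block: "1 / real L \<le> (\<Sum>j=1..L. V (a + L + j))"
  shows "w (a + 2 * L) \<le> w a / 2"
proof -
  have "w (a + 2 * L) * (1 / real L) \<le> drop (a + L)"
  proof -
    have "w (a + 2 * L) * (1 / real L) \<le> w (a + 2 * L) * (\<Sum>j=1..L. V (a + L + j))"
      using block w_nonneg by (intro mult_left_mono) auto
    also have "\<dots> \<le> (\<Sum>j=1..L. V (a + L + j) * w (a + L + j))"
      unfolding sum_distrib_left mult.commute[of "w (a + 2 * L)"]
      using V_nonneg by (intro sum_mono mult_left_mono w_antimono) auto
    also have "\<dots> \<le> drop (a + L)" using drop_sum[of "a + L" L] drop_nonneg[of "a + L + L"] by simp
    finally show ?thesis .
  qed
  then have "w (a + 2 * L) \<le> real L * drop (a + L)" using L by (simp add: field_simps)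
  also have "\<dots> = (\<Sum>j<L. drop (a + L))" by simp
  also have "\<dots> \<le> (\<Sum>j<L. drop (a + j))" by (intro sum_mono drop_antimono) auto
  also have "\<dots> = w a - w (a + L)" by (simp add: w_sub)
  also have "\<dots> \<le> w a - w (a + 2 * L)" using w_antimono[of "a + L" "a + 2 * L"] by simp
  finally show ?thesis by simp
qed

text \<open>Half of \<open>w 0\<close> is lost within \<open>n\<close> sites, each of which loses at
  most the first drop.\<close>

lemma w0_le:
  assumes "w n \<le> w 0 / 2" "drop 0 \<le> b"
  shows "w 0 \<le> 2 * b * real n"
proof -
  have "w 0 - w n = (\<Sum>j<n. drop j)"
    using w_sub[of 0 n] by simp
  also have "\<dots> \<le> (\<Sum>j<n. b)"
    using drop_antimono[of 0] assms(2) by (intro sum_mono) (auto intro: order_trans)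
  finally have "w 0 - w n \<le> (\<Sum>j<n. b)" .
  then show ?thesis using assms(1) by (simp add: algebra_simps)
qed

lemma w_ge: "w 0 - real i * drop 0 \<le> w i"
proof -
  have "w 0 - w i \<le> (\<Sum>j<i. drop 0)"
    using w_sub[of 0 i] drop_antimono[of 0] by (simp, intro order_trans[OF sum_bounded_above]) auto
  then show ?thesis by simp
qed

text \<open>Turned around, a lower bound for \<open>w 0\<close> given the source strength: the first
  drop is consumed by the potential on \<open>R\<close> sites, except for \<open>drop R\<close>, and
  this is at most \<open>w 0 / R\<close> because the \<open>R\<close> drops before it are not
  smaller.\<close>

lemma drop_le:
  assumes "0 < R"
  shows "drop 0 \<le> w 0 * ((\<Sum>j=1..R. V j) + 1 / real R)"
proof -
  have "(\<Sum>j<R. drop R) \<le> (\<Sum>j<R. drop j)" by (intro sum_mono drop_antimono) auto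
  also have "\<dots> \<le> w 0" using w_sub[of 0 R] w_nonneg[of R] by simp
  finally have 1: "drop R \<le> w 0 * (1 / real R)" using assms by (simp add: field_simps)
  have "(\<Sum>j=1..R. V j * w j) \<le> (\<Sum>j=1..R. V j * w 0)"
    using V_nonneg by (intro sum_mono mult_left_mono w_antimono) auto
  then show ?thesis using drop_sum[of 0 R] 1 by (simp add: sum_distrib_left algebra_simps)
qed

end

lemma pot_nonneg: "0 \<le> \<alpha> \<Longrightarrow> 0 \<le> pot \<alpha> h"
  unfolding pot_def using cosh_real_ge_1[of \<alpha>] by (intro add_nonneg_nonneg mult_nonneg_nonneg) auto

lemma gs_nonneg: "0 < \<alpha> \<Longrightarrow> 0 \<le> gs \<eta> \<alpha> y t"
  unfolding gs_def using cosh_gt_1[of \<alpha>] by (intro green_nonneg) auto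

lemma gs_decaying:
  assumes \<alpha>: "0 < \<alpha>"
  shows "decaying_solution (\<lambda>i. gs \<eta> \<alpha> (t + int i) t) (\<lambda>i. pot \<alpha> (\<eta> (t + int i)))"
    and "decaying_solution (\<lambda>i. gs \<eta> \<alpha> (t - int i) t) (\<lambda>i. pot \<alpha> (\<eta> (t - int i)))"
proof -
  have b: "\<exists>B. \<forall>i. gs \<eta> \<alpha> (f i) t \<le> B" for f :: "nat \<Rightarrow> int"
    unfolding gs_def using cosh_gt_1[OF \<alpha>] by (intro exI[of _ "1 / (1 - 1 / cosh \<alpha>)"] allI green_le) auto
  show "decaying_solution (\<lambda>i. gs \<eta> \<alpha> (t + int i) t) (\<lambda>i. pot \<alpha> (\<eta> (t + int i)))"
  proof
    fix i
    have e: "t + int (Suc i) + 1 = t + int (Suc (Suc i))" "t + int (Suc i) - 1 = t + int i" by auto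
    show "(2 + pot \<alpha> (\<eta> (t + int (Suc i)))) * gs \<eta> \<alpha> (t + int (Suc i)) t =
        gs \<eta> \<alpha> (t + int i) t + gs \<eta> \<alpha> (t + int (Suc (Suc i))) t"
      unfolding gs_equation[OF \<alpha>, of \<eta> "t + int (Suc i)" t] e by simp
  qed (use \<alpha> gs_nonneg pot_nonneg b in auto)
  show "decaying_solution (\<lambda>i. gs \<eta> \<alpha> (t - int i) t) (\<lambda>i. pot \<alpha> (\<eta> (t - int i)))"
  proof
    fix i
    have e: "t - int (Suc i) + 1 = t - int i" "t - int (Suc i) - 1 = t - int (Suc (Suc i))" by auto
    show "(2 + pot \<alpha> (\<eta> (t - int (Suc i)))) * gs \<eta> \<alpha> (t - int (Suc i)) t =
        gs \<eta> \<alpha> (t - int i) t + gs \<eta> \<alpha> (t - int (Suc (Suc i))) t"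
      unfolding gs_equation[OF \<alpha>, of \<eta> "t - int (Suc i)" t] e by simp
  qed (use \<alpha> gs_nonneg pot_nonneg b in auto)
qed

subsection \<open>Hyperbolic estimates\<close>

lemma cosh_ge: "1 + x\<^sup>2 / 2 \<le> cosh (x :: real)"
proof -
  have "\<bar>x / 2\<bar> \<le> \<bar>sinh (x / 2)\<bar>" 
    using real_le_abs_sinh[of "x / 2"] by (simp add: sinh_field_def exp_minus)
  then have "(x / 2)\<^sup>2 \<le> (sinh (x / 2))\<^sup>2" using abs_le_square_iff by blast
  moreover have "cosh x = 1 + 2 * (sinh (x / 2))\<^sup>2"
    using cosh_double[of "x / 2"] cosh_square_eq[of "x / 2"] by simp
  ultimately show ?thesis by (simp add: power2_eq_square)
qed

lemma exp_minus_le: "0 \<le> x \<Longrightarrow> exp (- x) \<le> 1 - x + x\<^sup>2" for x :: real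
proof -
  assume x: "0 \<le> x"
  have "1 \<le> (1 + x) * (1 - x + x\<^sup>2)" using x by (simp add: algebra_simps power2_eq_square power3_eq_cube[symmetric])
  also have "\<dots> \<le> exp x * (1 - x + x\<^sup>2)"
  proof (intro mult_right_mono)
    show "1 + x \<le> exp x" by (rule exp_ge_add_one_self)
    show "0 \<le> 1 - x + x\<^sup>2"
      using zero_le_power2[of "x - 1 / 2"] by (simp add: power2_eq_square algebra_simps)
  qed
  finally show ?thesis by (simp add: exp_minus field_simps)
qed

lemma cosh_le: "0 \<le> x \<Longrightarrow> x \<le> 1 \<Longrightarrow> cosh x \<le> 1 + x\<^sup>2" for x :: real
  using exp_minus_le[of x] exp_bound[of x] by (simp add: cosh_field_def)

lemma sinh_le:
  fixes x :: real
  assumes x: "0 \<le> x" "x \<le> 1"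
  shows "sinh x \<le> 2 * x"
proof -
  have "2 * sinh x = exp x - exp (- x)" by (simp add: sinh_field_def)
  moreover have "exp x \<le> 1 + x + x\<^sup>2" using x by (rule exp_bound)
  moreover have "1 - x \<le> exp (- x)" using exp_ge_add_one_self[of "- x"] by simp
  moreover have "x\<^sup>2 \<le> x" using x by (simp add: power2_eq_square mult_left_le)
  ultimately show ?thesis using x by linarith
qed

text \<open>With killing parameter \<open>sk k\<close> the walk lives for about \<open>4 ^ k\<close> steps.\<close>

definition sc :: "nat \<Rightarrow> real" where "sc k = (1 / 2) ^ k"

lemma sc: "0 < sc k" "sc k \<le> 1" "(sc k)\<^sup>2 = (1 / 4) ^ k"
proof -
  show "0 < sc k" unfolding sc_def by (rule zero_less_power) simp
  show "sc k \<le> 1" unfolding sc_def by (rule power_le_one) simp_all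
  have "(sc k)\<^sup>2 = (1 / 2 * (1 / 2)) ^ k"
    unfolding sc_def power2_eq_square by (rule power_mult_distrib[symmetric])
  also have "1 / 2 * (1 / 2) = (1 / 4 :: real)" by simp
  finally show "(sc k)\<^sup>2 = (1 / 4) ^ k" .
qed

definition sk :: "nat \<Rightarrow> real" where "sk k = 1 / cosh (sc k)"

lemma gs_eq_green: "gs \<eta> (sc k) y t = green (comb \<eta>) (sk k) (y, 0) (t, 0)"
  by (simp add: gs_def sk_def)

lemma sk: "0 < sk k" "sk k < 1"
  using cosh_gt_1[OF sc(1)[of k]] by (auto simp: sk_def)

text \<open>cosh a <= 1 + a^2 <= exp(a^2) at a^2 = 4^(-k): up to \<open>j * 4 ^ k\<close> steps the
  killing costs at most a constant factor.\<close>

lemma sk_power_ge: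
  assumes "n \<le> j * 4 ^ k"
  shows "exp (- real j) \<le> sk k ^ n"
proof -
  have "cosh (sc k) \<le> 1 + (sc k)\<^sup>2" using sc[of k] by (intro cosh_le) auto
  also have "\<dots> \<le> exp ((sc k)\<^sup>2)" by (rule exp_ge_add_one_self)
  finally have "cosh (sc k) ^ (j * 4 ^ k) \<le> exp ((1 / 4) ^ k) ^ (j * 4 ^ k)"
    using sc(3) by (intro power_mono) auto
  also have "\<dots> = exp (real (j * 4 ^ k) * (1 / 4) ^ k)" by (simp only: exp_of_nat_mult)
  also have "real (j * 4 ^ k) * (1 / 4) ^ k = real j" by (simp add: power_divide)
  finally have "cosh (sc k) ^ (j * 4 ^ k) \<le> exp (real j)" .
  then have "exp (- real j) \<le> sk k ^ (j * 4 ^ k)"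
    by (simp add: sk_def exp_minus power_divide inverse_eq_divide frac_le)
  also have "\<dots> \<le> sk k ^ n" using assms sk[of k] by (intro power_decreasing) auto
  finally show ?thesis .
qed

subsection \<open>Bounding collision sums by Green functions\<close>

abbreviation cp :: "(int \<Rightarrow> nat) \<Rightarrow> nat \<Rightarrow> int \<Rightarrow> int \<Rightarrow> real" where
  "cp \<eta> n x y \<equiv> tp (comb \<eta>) n (x, 0) (y, 0)"

lemma spine_vert [simp]: "(y, 0) \<in> verts (comb \<eta>)"
  by (simp add: verts_comb)

lemma deg_spine_bounds: "2 \<le> deg (comb \<eta>) (y, 0)" "deg (comb \<eta>) (y, 0) \<le> 3"
  by (auto simp: deg_comb_spine)

text \<open>The Green function contains 4^k / 2 terms at even times before 4^k, each of weight at
  least exp(-1) and with a return probability not below the one at time 2 j.\<close>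

lemma return_prob_le:
  assumes k: "1 \<le> k" and j: "4 ^ k div 2 \<le> j"
  shows "cp \<eta> (j + j) x x \<le> 2 * exp 1 * (1 / 4) ^ k * gs \<eta> (sc k) x x"
proof -
  define J :: nat where "J = 4 ^ k div 2"
  have J: "2 * J = 4 ^ k" using k by (cases k) (auto simp: J_def)
  have "real J * exp (- 1) * cp \<eta> (j + j) x x = (\<Sum>i<J. exp (- 1) * cp \<eta> (j + j) x x)"
    by simp
  also have "\<dots> \<le> (\<Sum>i<J. sk k ^ (i + i) * cp \<eta> (i + i) x x)"
  proof (intro sum_mono mult_mono)
    fix i assume i: "i \<in> {..<J}"
    show "exp (- 1) \<le> sk k ^ (i + i)" using sk_power_ge[of "i + i" 1 k] i J by simp
    show "cp \<eta> (j + j) x x \<le> cp \<eta> (i + i) x x"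
      using i j by (intro comb.tp_even_antimono) (auto simp: J_def)
  qed (auto simp: tp_nonneg sk[THEN less_imp_le] intro!: zero_le_power)
  also have "\<dots> = (\<Sum>i\<in>(\<lambda>i. i + i) ` {..<J}. sk k ^ i * cp \<eta> i x x)"
    by (subst sum.reindex) (auto simp: inj_on_def)
  also have "\<dots> \<le> gs \<eta> (sc k) x x"
    unfolding gs_eq_green green_def using sk[of k] by (intro sum_le_suminf summable_green) (auto simp: tp_nonneg)
  finally have "real J * exp (- 1) * cp \<eta> (j + j) x x \<le> gs \<eta> (sc k) x x" .
  moreover have "real J = 4 ^ k / 2" using J by (metis nonzero_mult_div_cancel_left of_nat_mult of_nat_numeral of_nat_power zero_neq_numeral)
  ultimately show ?thesis by (simp add: exp_minus field_simps power_divide)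
qed

text \<open>\<open>tp_sq_le\<close> with \<open>n\<close> cut in the middle. Spine degrees lie
  between 2 and 3, and exp 1 <= 3 gives 108 / 4 = 27, below the 32 allowed by the constant
  4.\<close>

lemma spine_prob_le:
  assumes k: "1 \<le> k" and n: "4 ^ k \<le> n"
  shows "cp \<eta> n x y \<le> 4 * (1 / 4) ^ k * (gs \<eta> (sc k) x x + gs \<eta> (sc k) y y)"
proof -
  define a b where "a = n div 2" and "b = n - a"
  have ab: "n = a + b" "4 ^ k div 2 \<le> a" "4 ^ k div 2 \<le> b"
    using n div_le_mono[OF n, of 2] by (auto simp: a_def b_def)
  let ?u = "gs \<eta> (sc k) x x" and ?v = "gs \<eta> (sc k) y y" and ?q = "(1 / 4 :: real) ^ k"
  have uv: "0 \<le> ?u" "0 \<le> ?v" using gs_nonneg[OF sc(1)] by auto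
  have "2 * (cp \<eta> n x y)\<^sup>2 \<le> deg (comb \<eta>) (x, 0) * (cp \<eta> (a + b) x y)\<^sup>2"
    using deg_spine_bounds[where \<eta>=\<eta>] ab by (intro mult_mono) auto
  also have "\<dots> \<le> deg (comb \<eta>) (y, 0) * (cp \<eta> (a + a) x x * cp \<eta> (b + b) y y)"
    by (intro comb.tp_sq_le) auto
  also have "\<dots> \<le> 3 * ((2 * exp 1 * ?q * ?u) * (2 * exp 1 * ?q * ?v))"
    using deg_spine_bounds[where \<eta>=\<eta>] uv tp_nonneg[of "comb \<eta>"]
    by (intro mult_mono return_prob_le k ab) (auto intro!: mult_nonneg_nonneg)
  also have "\<dots> \<le> 3 * ((2 * 3 * ?q * ?u) * (2 * 3 * ?q * ?v))"
    using uv exp_le by (intro mult_left_mono mult_mono) (auto intro!: mult_nonneg_nonneg)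
  also have "\<dots> = 108 * ?q\<^sup>2 * (?u * ?v)" by (simp add: power2_eq_square)
  also have "?u * ?v \<le> (?u + ?v)\<^sup>2 / 4"
    using sum_squares_bound[of ?u ?v] by (simp add: power2_eq_square algebra_simps)
  finally have "2 * (cp \<eta> n x y)\<^sup>2 \<le> 108 * ?q\<^sup>2 * ((?u + ?v)\<^sup>2 / 4)"
    by (simp add: mult_left_mono)
  also have "\<dots> \<le> 2 * (4 * ?q * (?u + ?v))\<^sup>2" by (simp add: power_mult_distrib)
  finally have "(cp \<eta> n x y)\<^sup>2 \<le> (4 * ?q * (?u + ?v))\<^sup>2" by simp
  moreover have "0 \<le> 4 * ?q * (?u + ?v)" using uv by simp
  ultimately show ?thesis by (rule power2_le_imp_le)
qed

text \<open>The last scale takes all later times, since the killing at that scale controls them by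
  itself.\<close>

lemma dyadic_index:
  fixes n m :: nat
  assumes n: "4 \<le> n"
  shows "\<exists>k. 1 \<le> k \<and> k \<le> Suc m \<and> 4 ^ k \<le> n \<and> (k = Suc m \<or> n < 4 ^ Suc k)"
proof (induction m)
  case 0
  show ?case using n by (rule_tac exI[of _ 1]) simp
next
  case (Suc m)
  then obtain k where k: "1 \<le> k" "k \<le> Suc m" "4 ^ k \<le> n" "k = Suc m \<or> n < 4 ^ Suc k" by metis
  show ?case
  proof (cases "n < 4 ^ Suc k")
    case True
    show ?thesis by (rule exI[of _ k]) (use k True in simp)
  next
    case False
    then have "k = Suc m" using k(4) by blast
    moreover have "4 ^ Suc k \<le> n" using False by (simp only: not_less)
    ultimately show ?thesis by (rule_tac exI[of _ "Suc k"]) simp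
  qed
qed

definition csum :: "(int \<Rightarrow> nat) \<Rightarrow> real \<Rightarrow> int \<Rightarrow> int \<Rightarrow> ennreal" where
  "csum \<eta> s x y = coll_sum (comb \<eta>) s (x, 0) (y, 0)"

text \<open>Bound for the expected collisions at \<open>y\<close>, starting from \<open>x\<close>,
  at times of order 4^k: one factor of the squared transition probability is estimated by
  \<open>spine_prob_le\<close>, the other one sums to the Green function. The factor exp 4 pays for
  inserting the killing at scale \<open>k\<close> up to time 4^(k+1).\<close>

definition gterm :: "(int \<Rightarrow> nat) \<Rightarrow> nat \<Rightarrow> int \<Rightarrow> int \<Rightarrow> real" where
  "gterm \<eta> k x y = 4 * exp 4 * (1 / 4) ^ k * gs \<eta> (sc k) x y * (gs \<eta> (sc k) x x + gs \<eta> (sc k) y y)"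

lemma gterm_nonneg: "0 \<le> gterm \<eta> k x y"
  unfolding gterm_def by (intro mult_nonneg_nonneg add_nonneg_nonneg zero_le_power gs_nonneg sc(1)) simp_all

text \<open>Each time n >= 4 is charged to its scale. At each of the times 0 to 3 the expected
  number of collisions on the spine is at most 1, whence the 4.\<close>

lemma csum_le:
  assumes m: "1 \<le> m"
  shows "(\<integral>\<^sup>+y. csum \<eta> (sk m) x y \<partial>count_space UNIV) \<le>
    4 + (\<integral>\<^sup>+k. \<integral>\<^sup>+y. ennreal (gterm \<eta> k x y) \<partial>count_space UNIV \<partial>count_space {1..m})"
proof -
  define F where "F k n y = 4 * exp 4 * (1 / 4) ^ k * (gs \<eta> (sc k) x x + gs \<eta> (sc k) y y) * (sk k ^ n * cp \<eta> n x y)"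
    for k n y
  have F0: "0 \<le> F k n y" for k n y
    unfolding F_def using gs_nonneg[OF sc(1)] sk(1)[THEN less_imp_le]
    by (intro mult_nonneg_nonneg add_nonneg_nonneg zero_le_power tp_nonneg) auto
  have pt: "sk m ^ n * (cp \<eta> n x y)\<^sup>2 \<le> (if n < 4 then cp \<eta> n x y else 0) + (\<Sum>k=1..m. F k n y)" for n y
  proof (cases "n < 4")
    case True
    have "sk m ^ n * (cp \<eta> n x y)\<^sup>2 \<le> 1 * (1 * cp \<eta> n x y)"
      unfolding power2_eq_square using sk[of m] by (intro mult_mono power_le_one) (auto simp: tp_nonneg tp_le_1)
    moreover have "0 \<le> (\<Sum>k=1..m. F k n y)" by (intro sum_nonneg F0)
    ultimately show ?thesis using True by simp
  next
    case False
    then obtain k where k: "1 \<le> k" "k \<le> m" "4 ^ k \<le> n" "k = m \<or> n < 4 ^ Suc k"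
      using dyadic_index[of n "m - 1"] m by (auto simp del: power_Suc)
    let ?g = "gs \<eta> (sc k) x x + gs \<eta> (sc k) y y"
    have g0: "0 \<le> ?g" using gs_nonneg[OF sc(1)] by (intro add_nonneg_nonneg) auto
    have s: "sk m ^ n \<le> exp 4 * sk k ^ n"
    proof (cases "k = m")
      case True
      have "1 * sk m ^ n \<le> exp 4 * sk k ^ n"
        using True sk(1)[of k] by (intro mult_mono) auto
      then show ?thesis by simp
    next
      case False
      then have "exp (- 4) \<le> sk k ^ n" using k(4) sk_power_ge[of n 4 k] by simp
      then have "exp 4 * exp (- 4) \<le> exp 4 * sk k ^ n" by (rule mult_left_mono) simp
      moreover have "sk m ^ n \<le> 1" using sk[of m] by (intro power_le_one) auto
      moreover have "exp 4 * exp (- 4) = (1 :: real)" by (simp add: exp_minus)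
      ultimately show ?thesis by linarith
    qed
    have "sk m ^ n * (cp \<eta> n x y)\<^sup>2 \<le> (exp 4 * sk k ^ n) * ((4 * (1 / 4) ^ k * ?g) * cp \<eta> n x y)"
      unfolding power2_eq_square using sk(1)[of k] g0
      by (intro mult_mono s spine_prob_le k) (auto simp: tp_nonneg intro!: mult_nonneg_nonneg)
    also have "\<dots> = F k n y" by (simp add: F_def)
    also have "\<dots> \<le> (\<Sum>k=1..m. F k n y)" using k F0 by (intro member_le_sum) auto
    finally show ?thesis using False by simp
  qed
  have sumF: "(\<integral>\<^sup>+n. ennreal (F k n y) \<partial>count_space UNIV) = ennreal (gterm \<eta> k x y)" for k y
  proof -
    have "(\<lambda>n. F k n y) sums (4 * exp 4 * (1 / 4) ^ k * (gs \<eta> (sc k) x x + gs \<eta> (sc k) y y) * gs \<eta> (sc k) x y)"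
      unfolding F_def gs_eq_green[of \<eta> k x y] green_def
      using sk[of k] by (intro sums_mult summable_sums summable_green) auto
    then have "(\<Sum>n. ennreal (F k n y)) = ennreal (4 * exp 4 * (1 / 4) ^ k * (gs \<eta> (sc k) x x + gs \<eta> (sc k) y y) * gs \<eta> (sc k) x y)"
      using F0 by (intro suminf_ennreal_eq) auto
    then show ?thesis by (simp add: nn_integral_count_space_nat gterm_def mult_ac)
  qed
  let ?C = "count_space (UNIV :: nat set)" and ?Y = "count_space (UNIV :: int set)"
  have "(\<integral>\<^sup>+y. csum \<eta> (sk m) x y \<partial>?Y) \<le>
      (\<integral>\<^sup>+y. (\<integral>\<^sup>+n. ennreal (if n < 4 then cp \<eta> n x y else 0) + (\<integral>\<^sup>+k. ennreal (F k n y) \<partial>count_space {1..m}) \<partial>?C) \<partial>?Y)"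
    unfolding csum_def coll_sum_def
  proof (intro nn_integral_mono)
    fix y n
    have "ennreal (sk m ^ n * (cp \<eta> n x y)\<^sup>2) \<le> ennreal ((if n < 4 then cp \<eta> n x y else 0) + (\<Sum>k=1..m. F k n y))"
      by (intro ennreal_leI pt)
    also have "\<dots> = ennreal (if n < 4 then cp \<eta> n x y else 0) + (\<Sum>k=1..m. ennreal (F k n y))"
      using F0 by (subst ennreal_plus) (auto simp: tp_nonneg sum_nonneg)
    finally show "ennreal (sk m ^ n * (cp \<eta> n x y)\<^sup>2) \<le>
       ennreal (if n < 4 then cp \<eta> n x y else 0) + (\<integral>\<^sup>+k. ennreal (F k n y) \<partial>count_space {1..m})"
      by (simp add: nn_integral_count_space_finite)
  qed
  also have "\<dots> = (\<integral>\<^sup>+y. (\<integral>\<^sup>+n. ennreal (if n < 4 then cp \<eta> n x y else 0) \<partial>?C) + (\<integral>\<^sup>+n. \<integral>\<^sup>+k. ennreal (F k n y) \<partial>count_space {1..m} \<partial>?C) \<partial>?Y)"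
    by (intro nn_integral_cong nn_integral_add) auto
  also have "\<dots> = (\<integral>\<^sup>+y. \<integral>\<^sup>+n. ennreal (if n < 4 then cp \<eta> n x y else 0) \<partial>?C \<partial>?Y) +
      (\<integral>\<^sup>+y. \<integral>\<^sup>+n. \<integral>\<^sup>+k. ennreal (F k n y) \<partial>count_space {1..m} \<partial>?C \<partial>?Y)"
    by (intro nn_integral_add) auto
  also have "(\<integral>\<^sup>+y. \<integral>\<^sup>+n. ennreal (if n < 4 then cp \<eta> n x y else 0) \<partial>?C \<partial>?Y) =
      (\<integral>\<^sup>+n. \<integral>\<^sup>+y. ennreal (if n < 4 then cp \<eta> n x y else 0) \<partial>?Y \<partial>?C)"
    by (intro nn_integral_count_space_nn_integral) auto
  also have "\<dots> \<le> (\<integral>\<^sup>+n. indicator {..<4} n \<partial>?C)"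
  proof (intro nn_integral_mono)
    fix n :: nat
    have "(\<integral>\<^sup>+y. ennreal (cp \<eta> n x y) \<partial>?Y) \<le> 1"
    proof -
      define S where "S = {y. (y, 0) \<in> comb.reach \<eta> n (x, 0)}"
      have S: "finite S" unfolding S_def
        by (rule finite_imageD[of "\<lambda>y. (y, 0)"]) (auto simp: inj_on_def intro: finite_subset[OF _ comb.finite_reach[of \<eta> n "(x, 0)"]])
      have "(\<integral>\<^sup>+y. ennreal (cp \<eta> n x y) \<partial>?Y) = (\<Sum>y\<in>S. ennreal (cp \<eta> n x y))"
        using S comb.tp_outside_reach[of _ \<eta> n "(x, 0)"] by (intro nn_integral_count_space') (auto simp: S_def)
      also have "\<dots> = ennreal (\<Sum>y\<in>S. cp \<eta> n x y)" by (intro sum_ennreal tp_nonneg)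
      also have "\<dots> = ennreal (\<Sum>v\<in>(\<lambda>y. (y, 0)) ` S. tp (comb \<eta>) n (x, 0) v)"
        by (subst sum.reindex) (auto simp: inj_on_def)
      also have "\<dots> \<le> ennreal 1" using S by (intro ennreal_leI comb.sum_tp_le_1) auto
      finally show ?thesis by simp
    qed
    then show "(\<integral>\<^sup>+y. ennreal (if n < 4 then cp \<eta> n x y else 0) \<partial>?Y) \<le> indicator {..<4} n"
      by (auto simp: indicator_def)
  qed
  also have "\<dots> = 4" by simp
  also have "(\<integral>\<^sup>+y. \<integral>\<^sup>+n. \<integral>\<^sup>+k. ennreal (F k n y) \<partial>count_space {1..m} \<partial>?C \<partial>?Y) =
      (\<integral>\<^sup>+y. \<integral>\<^sup>+k. \<integral>\<^sup>+n. ennreal (F k n y) \<partial>?C \<partial>count_space {1..m} \<partial>?Y)"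
    by (intro nn_integral_cong nn_integral_count_space_nn_integral) auto
  also have "\<dots> = (\<integral>\<^sup>+k. \<integral>\<^sup>+y. \<integral>\<^sup>+n. ennreal (F k n y) \<partial>?C \<partial>?Y \<partial>count_space {1..m})"
    by (intro nn_integral_count_space_nn_integral) auto
  also have "\<dots> = (\<integral>\<^sup>+k. \<integral>\<^sup>+y. ennreal (gterm \<eta> k x y) \<partial>?Y \<partial>count_space {1..m})"
    by (simp add: sumF)
  finally show ?thesis by (simp add: add_right_mono)
qed

text \<open>Cauchy-Schwarz in time: the weights \<open>sk m ^ n\<close> sum to
  \<open>1 / (1 - sk m)\<close>.\<close>

lemma csum_ge: "ennreal ((1 - sk m) * (gs \<eta> (sc m) x y)\<^sup>2) \<le> csum \<eta> (sk m) x y"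
proof -
  have s: "0 \<le> sk m" "sk m < 1" using sk[of m] by auto
  let ?C = "count_space (UNIV :: nat set)"
  have "(\<integral>\<^sup>+n. ennreal (sqrt (sk m ^ n)) * ennreal (sqrt (sk m ^ n) * cp \<eta> n x y) \<partial>?C)\<^sup>2 \<le>
      (\<integral>\<^sup>+n. (ennreal (sqrt (sk m ^ n)))\<^sup>2 \<partial>?C) * (\<integral>\<^sup>+n. (ennreal (sqrt (sk m ^ n) * cp \<eta> n x y))\<^sup>2 \<partial>?C)"
    by (intro Cauchy_Schwarz_nn_integral) auto
  also have "(\<integral>\<^sup>+n. ennreal (sqrt (sk m ^ n)) * ennreal (sqrt (sk m ^ n) * cp \<eta> n x y) \<partial>?C) =
      (\<integral>\<^sup>+n. ennreal (sk m ^ n * cp \<eta> n x y) \<partial>?C)"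
    using s by (intro nn_integral_cong) (simp add: ennreal_mult[symmetric] tp_nonneg mult.assoc[symmetric])
  also have "\<dots> = ennreal (gs \<eta> (sc m) x y)"
    unfolding nn_integral_count_space_nat gs_eq_green green_def using s
    by (intro suminf_ennreal_eq summable_sums summable_green) (auto simp: tp_nonneg)
  also have "(\<integral>\<^sup>+n. (ennreal (sqrt (sk m ^ n)))\<^sup>2 \<partial>?C) = ennreal (1 / (1 - sk m))"
    unfolding nn_integral_count_space_nat using s
    by (subst suminf_ennreal_eq[symmetric, OF _ geometric_sums]) (auto simp: ennreal_power)
  also have "(\<integral>\<^sup>+n. (ennreal (sqrt (sk m ^ n) * cp \<eta> n x y))\<^sup>2 \<partial>?C) = csum \<eta> (sk m) x y"
    unfolding csum_def coll_sum_def using s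
    by (intro nn_integral_cong) (simp add: ennreal_power tp_nonneg power_mult_distrib)
  finally have *: "(ennreal (gs \<eta> (sc m) x y))\<^sup>2 \<le> ennreal (1 / (1 - sk m)) * csum \<eta> (sk m) x y" .
  have "ennreal ((1 - sk m) * (gs \<eta> (sc m) x y)\<^sup>2) = ennreal (1 - sk m) * (ennreal (gs \<eta> (sc m) x y))\<^sup>2"
    using s gs_nonneg[OF sc(1)] by (simp add: ennreal_mult ennreal_power)
  also have "\<dots> \<le> ennreal (1 - sk m) * (ennreal (1 / (1 - sk m)) * csum \<eta> (sk m) x y)"
    by (intro mult_left_mono *) auto
  also have "\<dots> = csum \<eta> (sk m) x y"
    using s by (simp add: mult.assoc[symmetric] ennreal_mult[symmetric])
  finally show ?thesis .
qed

context walk_graph begin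

lemma avg2_pow_eq_sum:
  assumes "finite S" "reach n x \<subseteq> S" "finite S'" "reach n y \<subseteq> S'"
  shows "(avg2 G ^^ n) g (x, y) = (\<Sum>u\<in>S. \<Sum>v\<in>S'. tp G n x u * tp G n y v * g (u, v))"
  using assms(2,4)
proof (induction n arbitrary: x y)
  case 0
  have "(\<Sum>u\<in>S. \<Sum>v\<in>S'. tp G 0 x u * tp G 0 y v * g (u, v)) = (\<Sum>u\<in>S. \<Sum>v\<in>S'. if u = x \<and> v = y then g (u, v) else 0)"
    by (intro sum.cong refl) (auto simp: tp_0 indicator_def)
  also have "\<dots> = (\<Sum>u\<in>S. if u = x then \<Sum>v\<in>S'. if v = y then g (u, v) else 0 else 0)"
    by (intro sum.cong refl) auto
  also have "\<dots> = g (x, y)" using 0 assms(1,3) by simp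
  finally show ?case by simp
next
  case (Suc n)
  have "(avg2 G ^^ Suc n) g (x, y) = avg G (\<lambda>a. avg G (\<lambda>b. (avg2 G ^^ n) g (a, b)) y) x"
    by (simp add: avg2_def)
  also have "\<dots> = avg G (\<lambda>a. avg G (\<lambda>b. \<Sum>u\<in>S. \<Sum>v\<in>S'. (tp G n a u * g (u, v)) * tp G n b v) y) x"
    using Suc.prems by (intro avg_cong, subst Suc.IH) (auto intro!: sum.cong)
  also have "\<dots> = avg G (\<lambda>a. \<Sum>u\<in>S. \<Sum>v\<in>S'. (tp G (Suc n) y v * g (u, v)) * tp G n a u) x"
    by (intro avg_cong) (simp only: avg_sum avg_cmult tp_Suc[symmetric] mult_ac)
  also have "\<dots> = (\<Sum>u\<in>S. \<Sum>v\<in>S'. (tp G (Suc n) y v * g (u, v)) * tp G (Suc n) x u)"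
    unfolding avg_sum avg_cmult tp_Suc[symmetric] ..
  finally show ?case by (simp add: mult_ac)
qed

lemma avg2_pow_diag:
  assumes "finite S" "reach n x \<subseteq> S"
  shows "(avg2 G ^^ n) (\<lambda>p. if fst p = snd p then q (fst p) else 0) (x, x) = (\<Sum>u\<in>S. (tp G n x u)\<^sup>2 * q u)"
proof -
  have "(avg2 G ^^ n) (\<lambda>p. if fst p = snd p then q (fst p) else 0) (x, x) =
      (\<Sum>u\<in>S. \<Sum>v\<in>S. tp G n x u * tp G n x v * (if u = v then q u else 0))"
    by (subst avg2_pow_eq_sum[OF assms assms]) (auto intro!: sum.cong)
  also have "\<dots> = (\<Sum>u\<in>S. \<Sum>v\<in>S. if u = v then (tp G n x u)\<^sup>2 * q u else 0)"
    by (intro sum.cong refl) (auto simp: power2_eq_square)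
  also have "\<dots> = (\<Sum>u\<in>S. (tp G n x u)\<^sup>2 * q u)" using assms by simp
  finally show ?thesis .
qed

lemma sum_tp_eq_1:
  assumes "x \<in> verts G" "finite S" "reach n x \<subseteq> S"
  shows "(\<Sum>z\<in>S. tp G n x z) = 1"
proof -
  have "(avg G ^^ n) (\<lambda>_. 1) v = 1" if "v \<in> verts G" for v
    using that
  proof (induction n arbitrary: v)
    case (Suc n)
    then have "avg G ((avg G ^^ n) (\<lambda>_. 1)) v = avg G (\<lambda>_. 1) v"
      by (intro avg_cong) (auto dest: nbrs_verts)
    then show ?case using avg_const[OF Suc.prems] by simp
  qed simp
  then show ?thesis using avg_pow_eq_sum[OF assms(2,3), of "\<lambda>_. 1"] assms(1) by simp
qed

end

subsection \<open>Collisions high up in a tooth come in long runs\<close>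

text \<open>A collision at height \<open>l\<close> gets weight of order \<open>1 / l\<close>; as it is followed by about \<open>l\<close> collisions on
  the same tooth, the expected total weight of the collisions after it is bounded below.\<close>

definition hw :: "(int \<times> nat) \<times> (int \<times> nat) \<Rightarrow> real" where
  "hw p = (if fst p = snd p then 1 / real (Suc (snd (fst p))) else 0)"

definition hw_sum :: "(int \<Rightarrow> nat) \<Rightarrow> nat \<Rightarrow> (int \<times> nat) \<times> (int \<times> nat) \<Rightarrow> real" where
  "hw_sum \<eta> N p = (\<Sum>k<N. (avg2 (comb \<eta>) ^^ k) hw p)"

lemma hw_pow_diag:
  assumes "finite S" "comb.reach \<eta> k x \<subseteq> S"
  shows "(avg2 (comb \<eta>) ^^ k) hw (x, x) = (\<Sum>u\<in>S. (tp (comb \<eta>) k x u)\<^sup>2 * (1 / real (Suc (snd u))))"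
  using comb.avg2_pow_diag[OF assms, of "\<lambda>u. 1 / real (Suc (snd u))"]
  by (simp add: hw_def[abs_def])

lemma hw_pow_nonneg: "0 \<le> (avg2 (comb \<eta>) ^^ k) hw p"
proof (induction k arbitrary: p)
  case (Suc k)
  then show ?case unfolding funpow.simps comp_def avg2_def[of _ _ p] by (intro avg_nonneg) auto
qed (auto simp: hw_def)

text \<open>Started at height \<open>l\<close>, the walk stays within distance \<open>l\<close> on its tooth for about
  \<open>l\<^sup>2\<close> steps, since the truncated squared displacement grows by at most one per step.\<close>

lemma tooth_stay:
  assumes l: "1 \<le> l" "l \<le> \<eta> y" and k: "2 * k \<le> l\<^sup>2"
  shows "1 / (16 * (real l)\<^sup>2) \<le> (avg2 (comb \<eta>) ^^ k) hw ((y, l), (y, l))"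
proof -
  define \<phi> :: "int \<times> nat \<Rightarrow> real" where
    "\<phi> v = (if fst v = y then min ((real (snd v) - real l)\<^sup>2) ((real l)\<^sup>2) else (real l)\<^sup>2)" for v
  have \<phi>_le: "\<phi> v \<le> (real l)\<^sup>2" for v by (simp add: \<phi>_def)
  have \<phi>_nonneg: "0 \<le> \<phi> v" for v by (simp add: \<phi>_def)
  have step: "avg (comb \<eta>) \<phi> v \<le> \<phi> v + 1" for v
  proof (cases "\<phi> v = (real l)\<^sup>2")
    case True
    have "avg (comb \<eta>) \<phi> v \<le> (real l)\<^sup>2" by (intro avg_le_const \<phi>_le) auto
    then show ?thesis using True by simp
  next
    case False
    obtain j where v: "v = (y, Suc j)" and \<phi>v: "\<phi> v = (real (Suc j) - real l)\<^sup>2"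
      using False by (cases v; cases "snd v") (auto simp: \<phi>_def min_def split: if_splits)
    have d: "\<phi> (y, i) \<le> (real i - real l)\<^sup>2" for i by (simp add: \<phi>_def)
    consider "Suc j < \<eta> y" | "Suc j = \<eta> y" | "\<eta> y < Suc j" by linarith
    then show ?thesis
    proof cases
      case 1
      have "avg (comb \<eta>) \<phi> v = (\<phi> (y, j) + \<phi> (y, j + 2)) / 2" using 1 by (simp add: v avg_comb_tooth)
      also have "\<dots> \<le> ((real j - real l)\<^sup>2 + (real (j + 2) - real l)\<^sup>2) / 2"
        using d[of j] d[of "j + 2"] by simp
      also have "\<dots> = \<phi> v + 1" unfolding \<phi>v by (simp add: power2_eq_square field_simps)
      finally show ?thesis .
    next
      case 2
      have "avg (comb \<eta>) \<phi> v = \<phi> (y, j)" unfolding v avg_comb_tooth using 2 by simp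
      also have "\<dots> \<le> (real j - real l)\<^sup>2" by (rule d)
      \<comment> \<open>The tip is at height at least \<open>l\<close>, so stepping down from it
        raises the squared displacement by at most 1, with equality if the walk started at the
        tip.\<close>
      also have "\<dots> \<le> \<phi> v + 1"
      proof -
        have "real l \<le> real j + 1" using l(2) 2 by linarith
        then show ?thesis unfolding \<phi>v by (simp add: power2_eq_square algebra_simps)
      qed
      finally show ?thesis .
    next
      case 3
      then show ?thesis using \<phi>_nonneg[of v] by (simp add: v avg_comb_tooth)
    qed
  qed
  have pow: "(avg (comb \<eta>) ^^ n) \<phi> v \<le> \<phi> v + real n" for n v
  proof (induction n arbitrary: v)
    case (Suc n)
    have "(avg (comb \<eta>) ^^ Suc n) \<phi> v \<le> avg (comb \<eta>) (\<lambda>w. \<phi> w + real n) v"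
      using Suc by (simp add: avg_mono)
    also have "\<dots> \<le> avg (comb \<eta>) \<phi> v + real n"
      unfolding avg_add by (intro add_left_mono avg_le_const) auto
    also have "\<dots> \<le> \<phi> v + real (Suc n)" using step[of v] by simp
    finally show ?case .
  qed simp
  define x where "x = (y, l)"
  define I where "I = (\<lambda>i. (y, i)) ` {1..<2 * l}"
  define S where "S = comb.reach \<eta> k x \<union> I"
  have S: "finite S" "comb.reach \<eta> k x \<subseteq> S" "I \<subseteq> S" by (auto simp: S_def I_def)
  let ?p = "tp (comb \<eta>) k x"
  have I_card: "real (card I) \<le> 2 * real l" using l by (simp add: I_def card_image inj_on_def)
  have out: "\<phi> v = (real l)\<^sup>2" if "v \<notin> I" for v
  proof (cases "fst v = y")
    case True
    then have "snd v = 0 \<or> 2 * l \<le> snd v" using that by (cases v) (auto simp: I_def image_iff)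
    then have "(real l)\<^sup>2 \<le> (real (snd v) - real l)\<^sup>2"
    proof
      assume "2 * l \<le> snd v"
      then have "real l \<le> real (snd v) - real l" by simp
      then show ?thesis by (intro power_mono) auto
    qed simp
    then show ?thesis using True by (simp add: \<phi>_def)
  qed (simp add: \<phi>_def)
  have total: "(\<Sum>v\<in>S. ?p v) = 1" using l S by (intro comb.sum_tp_eq_1) (auto simp: x_def verts_comb)
  \<comment> \<open>Markov's inequality: outside \<open>I\<close> the function \<phi> has its
    maximal value, and its mean after \<open>k\<close> steps is at most half of that.\<close>
  have "(real l)\<^sup>2 * (\<Sum>v\<in>S - I. ?p v) = (\<Sum>v\<in>S - I. ?p v * \<phi> v)"
    by (simp add: out sum_distrib_left mult.commute)
  also have "\<dots> \<le> (\<Sum>v\<in>S. ?p v * \<phi> v)"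
    using S by (intro sum_mono2) (auto intro!: mult_nonneg_nonneg tp_nonneg \<phi>_nonneg)
  also have "\<dots> = (avg (comb \<eta>) ^^ k) \<phi> x" using S by (intro comb.avg_pow_eq_sum[symmetric]) auto
  also have "\<dots> \<le> real k" using pow[of k x] by (simp add: x_def \<phi>_def)
  also have "\<dots> \<le> (real l)\<^sup>2 / 2"
    using of_nat_mono[OF k, where 'a=real] by simp
  finally have "(real l)\<^sup>2 * (\<Sum>v\<in>S - I. ?p v) \<le> (real l)\<^sup>2 * (1 / 2)" by simp
  moreover have "0 < (real l)\<^sup>2" using l by simp
  ultimately have "(\<Sum>v\<in>S - I. ?p v) \<le> 1 / 2" by (simp only: mult_le_cancel_left_pos)
  moreover have "(\<Sum>v\<in>S. ?p v) = (\<Sum>v\<in>I. ?p v) + (\<Sum>v\<in>S - I. ?p v)"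
    using S by (metis add.commute sum.subset_diff)
  ultimately have half: "1 / 2 \<le> (\<Sum>v\<in>I. ?p v)" using total by linarith
  \<comment> \<open>Cauchy-Schwarz over the fewer than 2 l sites of \<open>I\<close> bounds the sum
    of squares from below; the weight \<open>hw\<close> at these sites is at least 1 / (2
    l).\<close>
  have "1 / 4 \<le> (\<Sum>v\<in>I. ?p v)\<^sup>2" using power_mono[OF half, of 2] by (simp add: power2_eq_square)
  also have "\<dots> \<le> (\<Sum>v\<in>I. (?p v)\<^sup>2) * (\<Sum>v\<in>I. 1\<^sup>2)"
    using Cauchy_Schwarz_ineq_sum[of ?p "\<lambda>_. 1" I] by simp
  also have "\<dots> \<le> (\<Sum>v\<in>I. (?p v)\<^sup>2) * (2 * real l)"
    using I_card by (intro mult_left_mono sum_nonneg) auto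
  finally have "1 / 4 \<le> (\<Sum>v\<in>I. (?p v)\<^sup>2) * (2 * real l)" .
  then have sq: "1 / (8 * real l) \<le> (\<Sum>v\<in>I. (?p v)\<^sup>2)"
    using l by (subst pos_divide_le_eq) simp_all
  have "1 / (16 * (real l)\<^sup>2) = 1 / (8 * real l) * (1 / (2 * real l))" by (simp add: power2_eq_square)
  also have "\<dots> \<le> (\<Sum>v\<in>I. (?p v)\<^sup>2) * (1 / (2 * real l))" using sq by (intro mult_right_mono) auto
  also have "\<dots> = (\<Sum>v\<in>I. (?p v)\<^sup>2 * (1 / (2 * real l)))" by (rule sum_distrib_right)
  also have "\<dots> \<le> (\<Sum>v\<in>I. (?p v)\<^sup>2 * (1 / real (Suc (snd v))))"
    using l by (intro sum_mono mult_left_mono) (auto simp: I_def frac_le)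
  also have "\<dots> \<le> (\<Sum>v\<in>S. (?p v)\<^sup>2 * (1 / real (Suc (snd v))))"
    using S by (intro sum_mono2) auto
  also have "\<dots> = (avg2 (comb \<eta>) ^^ k) hw (x, x)" using S by (intro hw_pow_diag[symmetric]) auto
  finally show ?thesis by (simp add: x_def)
qed

text \<open>More than l^2 / 2 times contribute at least 1 / (16 l^2) each, hence the 32. The horizon
  depends on the height \<open>l\<close>, so the statement is only eventual in
  \<open>N\<close>.\<close>

lemma hw_sum_diag:
  assumes "x \<in> verts (comb \<eta>)"
  shows "\<forall>\<^sub>F N in sequentially. 1 \<le> 32 * hw_sum \<eta> N (x, x)"
proof -
  obtain y l where x: "x = (y, l)" and l: "l \<le> \<eta> y" using assms by (cases x) (auto simp: verts_comb)
  have "1 \<le> 32 * hw_sum \<eta> N (x, x)" if N: "Suc (l\<^sup>2) \<le> N" for N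
  proof (cases "l = 0")
    case True
    have "hw (x, x) = (\<Sum>k<1. (avg2 (comb \<eta>) ^^ k) hw (x, x))" by simp
    also have "\<dots> \<le> hw_sum \<eta> N (x, x)"
      unfolding hw_sum_def using N by (intro sum_mono2) (auto simp: hw_pow_nonneg)
    finally show ?thesis using True by (simp add: x hw_def)
  next
    case False
    define J where "J = Suc (l\<^sup>2 div 2)"
    have "l\<^sup>2 \<le> 2 * J" by (simp add: J_def)
    then have J: "(real l)\<^sup>2 \<le> 2 * real J"
      using of_nat_mono[of "l\<^sup>2" "2 * J", where 'a=real] by simp
    have "1 / 32 \<le> real J * (1 / (16 * (real l)\<^sup>2))"
      using J False by (simp add: field_simps)
    also have "\<dots> = (\<Sum>k<J. 1 / (16 * (real l)\<^sup>2))" by simp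
    also have "\<dots> \<le> (\<Sum>k<J. (avg2 (comb \<eta>) ^^ k) hw (x, x))"
      unfolding x using False l by (intro sum_mono tooth_stay) (auto simp: J_def)
    also have "\<dots> \<le> hw_sum \<eta> N (x, x)"
      unfolding hw_sum_def using N by (intro sum_mono2) (auto simp: hw_pow_nonneg J_def)
    finally show ?thesis by simp
  qed
  then show ?thesis unfolding eventually_sequentially by blast
qed

abbreviation "nc \<eta> \<equiv> stay (avg2 (comb \<eta>))"

lemma eventually_avg2_le:
  assumes "\<And>v w. v \<in> verts (comb \<eta>) \<Longrightarrow> w \<in> verts (comb \<eta>) \<Longrightarrow> \<forall>\<^sub>F N in sequentially. f (v, w) \<le> g N (v, w)"
  shows "\<forall>\<^sub>F N in sequentially. avg2 (comb \<eta>) f p \<le> avg2 (comb \<eta>) (g N) p"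
proof -
  have "\<forall>\<^sub>F N in sequentially. \<forall>v\<in>nbrs (comb \<eta>) (fst p). \<forall>w\<in>nbrs (comb \<eta>) (snd p). f (v, w) \<le> g N (v, w)"
    using assms comb.nbrs_verts by (intro eventually_ball_finite ballI) auto
  then show ?thesis
  proof eventually_elim
    case (elim N)
    then show ?case by (intro comb.avg2_mono) blast
  qed
qed

abbreviation ncoll :: "(int \<Rightarrow> nat) \<Rightarrow> nat \<Rightarrow> (int \<times> nat) \<times> (int \<times> nat) \<Rightarrow> real" where
  "ncoll \<eta> m \<equiv> stay (avg2 (comb \<eta>)) m (\<lambda>_. {p. fst p \<noteq> snd p})"

lemma avg2_one_minus:
  assumes "v \<in> verts (comb \<eta>)" "w \<in> verts (comb \<eta>)"
  shows "avg2 (comb \<eta>) (\<lambda>p. 1 - f p) (v, w) = 1 - avg2 (comb \<eta>) f (v, w)"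
  using assms by (simp add: avg2_def avg_diff comb.avg_const)

lemma hw_sum_Suc: "hw_sum \<eta> (Suc N) p = hw p + avg2 (comb \<eta>) (hw_sum \<eta> N) p"
proof -
  have "avg2 (comb \<eta>) (hw_sum \<eta> N) p = (\<Sum>k<N. avg2 (comb \<eta>) ((avg2 (comb \<eta>) ^^ k) hw) p)"
    unfolding avg2_def[of _ _ p] hw_sum_def avg_sum ..
  then show ?thesis unfolding hw_sum_def by (subst sum.lessThan_Suc_shift) simp
qed

text \<open>Stopping at the first collision, after which weight at least 1/32 is still expected. The
  induction on \<open>m\<close> performs this step by step, and the eventual form absorbs the shift
  of the horizon.\<close>

lemma collision_le_hw_sum:
  assumes "v \<in> verts (comb \<eta>)" "w \<in> verts (comb \<eta>)"
  shows "\<forall>\<^sub>F N in sequentially. 1 - ncoll \<eta> m (v, w) \<le> 32 * hw_sum \<eta> N (v, w)"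
  using assms
proof (induction m arbitrary: v w)
  case 0
  show ?case
  proof (cases "v = w")
    case True then show ?thesis using hw_sum_diag[OF 0(1)] by simp
  next
    case False
    then show ?thesis by (auto simp: hw_sum_def intro!: always_eventually sum_nonneg hw_pow_nonneg)
  qed
next
  case (Suc m)
  show ?case
  proof (cases "v = w")
    case True then show ?thesis using hw_sum_diag[OF Suc.prems(1)] by simp
  next
    case False
    have "\<forall>\<^sub>F N in sequentially. avg2 (comb \<eta>) (\<lambda>p. 1 - ncoll \<eta> m p) (v, w) \<le> avg2 (comb \<eta>) (\<lambda>p. 32 * hw_sum \<eta> N p) (v, w)"
      by (intro eventually_avg2_le Suc.IH)
    then have "\<forall>\<^sub>F N in sequentially. 1 - ncoll \<eta> (Suc m) (v, w) \<le> 32 * hw_sum \<eta> (Suc N) (v, w)"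
    proof eventually_elim
      case (elim N)
      have "avg2 (comb \<eta>) (\<lambda>p. 32 * hw_sum \<eta> N p) (v, w) = 32 * avg2 (comb \<eta>) (hw_sum \<eta> N) (v, w)"
        by (simp add: avg2_def avg_cmult)
      then show ?case using elim False avg2_one_minus[OF Suc.prems, of "ncoll \<eta> m"]
        by (simp add: hw_sum_Suc hw_def)
    qed
    then show ?thesis by (subst (asm) eventually_sequentially_Suc)
  qed
qed

lemma collision_after_le:
  assumes "v \<in> verts (comb \<eta>)" "w \<in> verts (comb \<eta>)"
  shows "\<forall>\<^sub>F N in sequentially. 1 - (avg2 (comb \<eta>) ^^ n) (ncoll \<eta> m) (v, w) \<le>
    32 * (\<Sum>k<N. (avg2 (comb \<eta>) ^^ (n + k)) hw (v, w))"
  using assms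
proof (induction n arbitrary: v w)
  case 0
  then show ?case using collision_le_hw_sum by (simp add: hw_sum_def)
next
  case (Suc n)
  have "\<forall>\<^sub>F N in sequentially. avg2 (comb \<eta>) (\<lambda>p. 1 - (avg2 (comb \<eta>) ^^ n) (ncoll \<eta> m) p) (v, w) \<le>
      avg2 (comb \<eta>) (\<lambda>p. 32 * (\<Sum>k<N. (avg2 (comb \<eta>) ^^ (n + k)) hw p)) (v, w)"
    by (intro eventually_avg2_le Suc.IH)
  then show ?case
  proof eventually_elim
    case (elim N)
    have "avg2 (comb \<eta>) (\<lambda>p. 32 * (\<Sum>k<N. (avg2 (comb \<eta>) ^^ (n + k)) hw p)) (v, w) =
        32 * (\<Sum>k<N. avg2 (comb \<eta>) ((avg2 (comb \<eta>) ^^ (n + k)) hw) (v, w))"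
      by (simp add: avg2_def avg_cmult avg_sum)
    then show ?case using elim avg2_one_minus[OF Suc.prems, of "(avg2 (comb \<eta>) ^^ n) (ncoll \<eta> m)"] by simp
  qed
qed

abbreviation finp :: "(int \<Rightarrow> nat) \<Rightarrow> real" where
  "finp \<eta> \<equiv> countable_walk_graph.fin_prob (comb \<eta>) ((0, 0), (0, 0))"

text \<open>The probability of a collision after time \<open>n\<close> is at most 32 times a tail of
  the convergent expected total weight.\<close>

lemma finp_eq_1_if_summable:
  assumes "summable (\<lambda>k. (avg2 (comb \<eta>) ^^ k) hw ((0, 0), (0, 0)))"
  shows "finp \<eta> = 1"
proof -
  define a where "a k = (avg2 (comb \<eta>) ^^ k) hw ((0, 0), (0, 0))" for k
  have a: "summable a" "0 \<le> a k" for k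
    unfolding a_def using assms hw_pow_nonneg by blast+
  let ?o = "((0, 0), (0, 0)) :: (int \<times> nat) \<times> (int \<times> nat)"
  have bound: "1 - (avg2 (comb \<eta>) ^^ n) (ncoll \<eta> m) ?o \<le> 32 * (\<Sum>k. a (k + n))" for n m
  proof -
    obtain N where "1 - (avg2 (comb \<eta>) ^^ n) (ncoll \<eta> m) ?o \<le> 32 * (\<Sum>k<N. a (n + k))"
      using eventually_happens[OF collision_after_le[of "(0,0)" \<eta> "(0,0)" n m]] by (auto simp: a_def)
    also have "(\<Sum>k<N. a (n + k)) \<le> (\<Sum>k. a (k + n))"
      unfolding add.commute[of n] using a by (intro sum_le_suminf summable_ignore_initial_segment) auto
    finally show ?thesis by simp
  qed
  have "1 - (avg2 (comb \<eta>) ^^ n) (countable_walk_graph.never_collide (comb \<eta>)) ?o \<le> 32 * (\<Sum>k. a (k + n))" for n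
  proof (rule LIMSEQ_le_const2)
    show "(\<lambda>m. 1 - (avg2 (comb \<eta>) ^^ n) (ncoll \<eta> m) ?o) \<longlonglongrightarrow>
        1 - (avg2 (comb \<eta>) ^^ n) (countable_walk_graph.never_collide (comb \<eta>)) ?o"
      by (intro tendsto_intros comb.avg2_pow_tendsto comb.no_collision_tendsto)
  qed (use bound in auto)
  then have "1 - finp \<eta> \<le> 0"
    by (intro LIMSEQ_le[OF tendsto_diff[OF tendsto_const comb.fin_prob_tendsto]
          tendsto_mult_right_zero[OF suminf_exist_split2[OF a(1)]]]) auto
  then show ?thesis using comb.fin_prob_01[of \<eta> ?o] by simp
qed

text \<open>Squaring is convex, so \<psi> is subharmonic above the spine: the time-0 term vanishes
  there, as the target lies on the spine. Hence \<psi> is convex along the tooth, and the reflecting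
  tip forces it to grow towards the spine.\<close>

lemma tooth_sum_antimono:
  assumes "l \<le> \<eta> y"
  shows "(\<Sum>n<N. (tp (comb \<eta>) n (y, l) (0, 0))\<^sup>2) \<le> (\<Sum>n<N. (cp \<eta> n y 0)\<^sup>2)"
proof -
  define \<psi> where "\<psi> v = (\<Sum>n<N. (tp (comb \<eta>) n v (0, 0))\<^sup>2)" for v
  have sub: "\<psi> (y, l) \<le> avg (comb \<eta>) \<psi> (y, l)" if "0 < l" for l
  proof -
    have sq: "(tp (comb \<eta>) (Suc n) v (0, 0))\<^sup>2 \<le> avg (comb \<eta>) (\<lambda>w. (tp (comb \<eta>) n w (0, 0))\<^sup>2) v" for n v
    proof -
      let ?N = "nbrs (comb \<eta>) v" and ?f = "\<lambda>w. tp (comb \<eta>) n w (0, 0)"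
      have "(\<Sum>w\<in>?N. ?f w)\<^sup>2 \<le> deg (comb \<eta>) v * (\<Sum>w\<in>?N. (?f w)\<^sup>2)"
        using Cauchy_Schwarz_ineq_sum[of ?f "\<lambda>_. 1" ?N] by (simp add: deg_def mult.commute)
      then have "(\<Sum>w\<in>?N. ?f w)\<^sup>2 / (deg (comb \<eta>) v)\<^sup>2 \<le>
          deg (comb \<eta>) v * (\<Sum>w\<in>?N. (?f w)\<^sup>2) / (deg (comb \<eta>) v)\<^sup>2"
        by (rule divide_right_mono) simp
      also have "\<dots> = (\<Sum>w\<in>?N. (?f w)\<^sup>2) / deg (comb \<eta>) v"
        by (simp add: power2_eq_square)
      finally show ?thesis by (simp add: tp_Suc avg_def power_divide)
    qed
    have "\<psi> (y, l) \<le> (\<Sum>n<Suc N. (tp (comb \<eta>) n (y, l) (0, 0))\<^sup>2)"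
      unfolding \<psi>_def by simp
    also have "\<dots> = (\<Sum>n<N. (tp (comb \<eta>) (Suc n) (y, l) (0, 0))\<^sup>2)"
      using that by (subst sum.lessThan_Suc_shift) (simp add: tp_0)
    also have "\<dots> \<le> (\<Sum>n<N. avg (comb \<eta>) (\<lambda>w. (tp (comb \<eta>) n w (0, 0))\<^sup>2) (y, l))"
      by (intro sum_mono sq)
    also have "\<dots> = avg (comb \<eta>) \<psi> (y, l)" unfolding \<psi>_def avg_sum ..
    finally show ?thesis .
  qed
  have dec: "\<psi> (y, \<eta> y - j) \<le> \<psi> (y, \<eta> y - Suc j)" if "Suc j \<le> \<eta> y" for j
    using that
  proof (induction j)
    case 0
    then show ?case using sub[of "\<eta> y"] avg_comb_tooth[of \<eta> \<psi> y "\<eta> y - 1"] by simp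
  next
    case (Suc j)
    let ?l = "\<eta> y - Suc (Suc j)"
    have l: "\<eta> y - Suc j = Suc ?l" "\<eta> y - j = ?l + 2" "Suc ?l < \<eta> y" using Suc.prems by auto
    have "2 * \<psi> (y, Suc ?l) \<le> \<psi> (y, ?l) + \<psi> (y, ?l + 2)"
      using sub[of "Suc ?l"] avg_comb_tooth[of \<eta> \<psi> y ?l] l(3) by simp
    also have "\<psi> (y, ?l + 2) \<le> \<psi> (y, Suc ?l)"
      using Suc by (simp only: l)
    finally show ?case by (simp only: l) simp
  qed
  have "\<psi> (y, l) \<le> \<psi> (y, 0)"
    using assms
  proof (induction l)
    case (Suc l)
    then have "\<psi> (y, Suc l) \<le> \<psi> (y, l)" using dec[of "\<eta> y - Suc l"] by (simp add: Suc_diff_Suc)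
    then show ?case using Suc by simp
  qed simp
  then show ?thesis by (simp add: \<psi>_def)
qed

definition hsum :: "nat \<Rightarrow> ennreal" where
  "hsum h = (\<Sum>l\<le>h. ennreal (1 / real (Suc l)))"

text \<open>Reversing time makes the origin the target, at the price (3/2)^2 = 9/4. Then
  \<open>tooth_sum_antimono\<close> replaces each point of a tooth by its foot, and the weights on
  the tooth add up to \<open>hsum\<close>.\<close>

lemma finp_eq_1:
  assumes "(\<integral>\<^sup>+y. csum \<eta> 1 y 0 * hsum (\<eta> y) \<partial>count_space UNIV) < \<infinity>"
  shows "finp \<eta> = 1"
proof (rule finp_eq_1_if_summable)
  let ?V = "count_space (verts (comb \<eta>))" and ?C = "count_space (UNIV :: nat set)"
  let ?o = "(0, 0) :: int \<times> nat"
  let ?a = "\<lambda>k. (avg2 (comb \<eta>) ^^ k) hw (?o, ?o)"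
  have reach: "comb.reach \<eta> k v \<subseteq> verts (comb \<eta>)" if "v \<in> verts (comb \<eta>)" for k v
    using that by (induction k arbitrary: v) (auto dest: comb.nbrs_verts)
  have a: "ennreal (?a k) = (\<integral>\<^sup>+v. ennreal ((tp (comb \<eta>) k ?o v)\<^sup>2 * (1 / real (Suc (snd v)))) \<partial>?V)" for k
  proof -
    have "(\<integral>\<^sup>+v. ennreal ((tp (comb \<eta>) k ?o v)\<^sup>2 * (1 / real (Suc (snd v)))) \<partial>?V) =
        (\<Sum>v\<in>comb.reach \<eta> k ?o. ennreal ((tp (comb \<eta>) k ?o v)\<^sup>2 * (1 / real (Suc (snd v)))))"
      using reach[of ?o k] comb.tp_outside_reach[of _ \<eta> k ?o]
      by (intro nn_integral_count_space') auto
    then show ?thesis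
      by (simp add: hw_pow_diag[of "comb.reach \<eta> k ?o"] sum_ennreal)
  qed
  have "(\<Sum>k. ennreal (?a k)) = (\<integral>\<^sup>+k. \<integral>\<^sup>+v. ennreal ((tp (comb \<eta>) k ?o v)\<^sup>2 * (1 / real (Suc (snd v)))) \<partial>?V \<partial>?C)"
    unfolding a nn_integral_count_space_nat ..
  also have "\<dots> = (\<integral>\<^sup>+v. \<integral>\<^sup>+k. ennreal ((tp (comb \<eta>) k ?o v)\<^sup>2 * (1 / real (Suc (snd v)))) \<partial>?C \<partial>?V)"
    by (intro nn_integral_count_space_nn_integral) auto
  also have "\<dots> \<le> (\<integral>\<^sup>+v. ennreal (9 / 4) * csum \<eta> 1 (fst v) 0 * ennreal (1 / real (Suc (snd v))) \<partial>?V)"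
  proof (intro nn_integral_mono)
    fix v assume "v \<in> space ?V"
    then obtain y l where v: "v = (y, l)" "l \<le> \<eta> y" by (cases v) (auto simp: verts_comb)
    have rev: "tp (comb \<eta>) k ?o v \<le> 3 / 2 * tp (comb \<eta>) k v ?o" for k
    proof -
      have "2 * tp (comb \<eta>) k ?o v \<le> deg (comb \<eta>) ?o * tp (comb \<eta>) k ?o v"
        using deg_spine_bounds by (intro mult_right_mono) (auto simp: tp_nonneg)
      also have "\<dots> = deg (comb \<eta>) v * tp (comb \<eta>) k v ?o" by (rule comb.tp_reversible)
      also have "\<dots> \<le> 3 * tp (comb \<eta>) k v ?o"
        using comb.deg_le_3 by (intro mult_right_mono) (auto simp: tp_nonneg)
      finally show ?thesis by simp
    qed
    have sq: "(tp (comb \<eta>) k ?o v)\<^sup>2 \<le> 9 / 4 * (tp (comb \<eta>) k v ?o)\<^sup>2" for k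
      using power_mono[OF rev[of k], of 2] by (simp add: tp_nonneg power_mult_distrib power2_eq_square)
    have "(\<integral>\<^sup>+k. ennreal ((tp (comb \<eta>) k ?o v)\<^sup>2) \<partial>?C) \<le> ennreal (9 / 4) * csum \<eta> 1 y 0"
    proof -
      have "(\<integral>\<^sup>+k. ennreal ((tp (comb \<eta>) k ?o v)\<^sup>2) \<partial>?C) = (\<Sum>k. ennreal ((tp (comb \<eta>) k ?o v)\<^sup>2))"
        by (rule nn_integral_count_space_nat)
      also have "\<dots> = (SUP N. \<Sum>k<N. ennreal ((tp (comb \<eta>) k ?o v)\<^sup>2))"
        by (rule suminf_eq_SUP)
      also have "\<dots> \<le> ennreal (9 / 4) * csum \<eta> 1 y 0"
      proof (rule SUP_least)
        fix N
        have "(\<Sum>k<N. ennreal ((tp (comb \<eta>) k ?o v)\<^sup>2)) = ennreal (\<Sum>k<N. (tp (comb \<eta>) k ?o v)\<^sup>2)"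
          by (intro sum_ennreal) auto
        also have "\<dots> \<le> ennreal (9 / 4 * (\<Sum>k<N. (cp \<eta> k y 0)\<^sup>2))"
        proof (intro ennreal_leI)
          have "(\<Sum>k<N. (tp (comb \<eta>) k ?o v)\<^sup>2) \<le> (\<Sum>k<N. 9 / 4 * (tp (comb \<eta>) k v ?o)\<^sup>2)"
            by (intro sum_mono sq)
          also have "\<dots> \<le> 9 / 4 * (\<Sum>k<N. (cp \<eta> k y 0)\<^sup>2)"
            unfolding sum_distrib_left[symmetric] v(1) by (intro mult_left_mono tooth_sum_antimono v) auto
          finally show "(\<Sum>k<N. (tp (comb \<eta>) k ?o v)\<^sup>2) \<le> 9 / 4 * (\<Sum>k<N. (cp \<eta> k y 0)\<^sup>2)" .
        qed
        also have "\<dots> = ennreal (9 / 4) * (\<Sum>k<N. ennreal ((cp \<eta> k y 0)\<^sup>2))"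
          by (subst ennreal_mult) (auto intro: sum_nonneg simp: sum_ennreal)
        also have "(\<Sum>k<N. ennreal ((cp \<eta> k y 0)\<^sup>2)) \<le> csum \<eta> 1 y 0"
          unfolding csum_def coll_sum_def nn_integral_count_space_nat power_one mult_1
          by (intro sum_le_suminf) auto
        finally show "(\<Sum>k<N. ennreal ((tp (comb \<eta>) k ?o v)\<^sup>2)) \<le> ennreal (9 / 4) * csum \<eta> 1 y 0"
          by (simp add: mult_left_mono)
      qed
      finally show ?thesis .
    qed
    then show "(\<integral>\<^sup>+k. ennreal ((tp (comb \<eta>) k ?o v)\<^sup>2 * (1 / real (Suc (snd v)))) \<partial>?C) \<le>
        ennreal (9 / 4) * csum \<eta> 1 (fst v) 0 * ennreal (1 / real (Suc (snd v)))"
      by (subst ennreal_mult) (auto simp: nn_integral_multc v intro!: mult_right_mono)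
  qed
  also have "\<dots> = ennreal (9 / 4) * (\<integral>\<^sup>+y. csum \<eta> 1 y 0 * hsum (\<eta> y) \<partial>count_space UNIV)"
  proof -
    have "(\<integral>\<^sup>+v. ennreal (9 / 4) * csum \<eta> 1 (fst v) 0 * ennreal (1 / real (Suc (snd v))) \<partial>?V) =
        (\<integral>\<^sup>+v. ennreal (9 / 4) * csum \<eta> 1 (fst v) 0 * (ennreal (1 / real (Suc (snd v))) * indicator {..\<eta> (fst v)} (snd v)) \<partial>count_space UNIV)"
      by (subst nn_integral_count_space_indicator)
        (auto intro!: nn_integral_cong simp: verts_comb indicator_def)
    also have "\<dots> = (\<integral>\<^sup>+y. \<integral>\<^sup>+l. ennreal (9 / 4) * csum \<eta> 1 y 0 * (ennreal (1 / real (Suc l)) * indicator {..\<eta> y} l) \<partial>?C \<partial>count_space UNIV)"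
      by (subst nn_integral_fst_count_space[symmetric]) simp
    also have "\<dots> = (\<integral>\<^sup>+y. ennreal (9 / 4) * csum \<eta> 1 y 0 * hsum (\<eta> y) \<partial>count_space UNIV)"
    proof (intro nn_integral_cong)
      fix y
      have "(\<integral>\<^sup>+l. ennreal (1 / real (Suc l)) * indicator {..\<eta> y} l \<partial>?C) = (\<Sum>l\<in>{..\<eta> y}. ennreal (1 / real (Suc l)) * indicator {..\<eta> y} l)"
        by (intro nn_integral_count_space') auto
      also have "\<dots> = hsum (\<eta> y)" unfolding hsum_def by (intro sum.cong) auto
      finally show "(\<integral>\<^sup>+l. ennreal (9 / 4) * csum \<eta> 1 y 0 * (ennreal (1 / real (Suc l)) * indicator {..\<eta> y} l) \<partial>?C) =
          ennreal (9 / 4) * csum \<eta> 1 y 0 * hsum (\<eta> y)"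
        by (simp add: nn_integral_cmult)
    qed
    finally show ?thesis by (simp add: nn_integral_cmult mult.assoc)
  qed
  also have "\<dots> < \<infinity>" using assms by (simp add: ennreal_mult_less_top)
  finally have "(\<Sum>k. ennreal (?a k)) \<noteq> top" by simp
  then show "summable ?a" using hw_pow_nonneg by (intro summable_suminf_not_top) auto
qed

section \<open>Random combs\<close>

definition shift :: "int \<Rightarrow> (int \<Rightarrow> 'b) \<Rightarrow> int \<Rightarrow> 'b" where
  "shift a \<eta> y = \<eta> (y + a)"

definition vshift :: "int \<Rightarrow> int \<times> nat \<Rightarrow> int \<times> nat" where
  "vshift a v = (fst v + a, snd v)"

lemma avg_shift: "avg (comb (shift a \<eta>)) (\<lambda>v. g (vshift a v)) v = avg (comb \<eta>) g (vshift a v)"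
proof -
  obtain y l where v: "v = (y, l)" by (cases v)
  have e: "y + 1 + a = y + a + 1" "y - 1 + a = y + a - 1" by auto
  show ?thesis
    by (cases l) (simp_all add: v vshift_def avg_comb_spine avg_comb_tooth shift_def e)
qed

lemma avg_shift': "avg (comb (shift a \<eta>)) f v = avg (comb \<eta>) g (vshift a v)"
  if "\<And>v. f v = g (vshift a v)"
proof -
  have "f = (\<lambda>v. g (vshift a v))" using that by auto
  then show ?thesis by (simp add: avg_shift)
qed

lemma tp_shift: "tp (comb (shift a \<eta>)) n v t = tp (comb \<eta>) n (vshift a v) (vshift a t)"
proof (induction n arbitrary: v)
  case 0
  have "v = t \<longleftrightarrow> vshift a v = vshift a t" by (auto simp: vshift_def prod_eq_iff)
  then show ?case by (simp add: tp_0 indicator_def)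
next
  case (Suc n)
  show ?case unfolding tp_Suc by (rule avg_shift') (rule Suc)
qed

lemma gs_shift: "gs (shift a \<eta>) \<alpha> x t = gs \<eta> \<alpha> (x + a) (t + a)"
  by (simp add: gs_def green_def tp_shift vshift_def)

lemma gterm_shift: "gterm (shift a \<eta>) k x y = gterm \<eta> k (x + a) (y + a)"
  by (simp add: gterm_def gs_shift)

lemma csum_shift: "csum (shift a \<eta>) s x y = csum \<eta> s (x + a) (y + a)"
  by (simp add: csum_def coll_sum_def tp_shift vshift_def)

abbreviation "nevc \<eta> \<equiv> countable_walk_graph.never_collide (comb \<eta>)"
abbreviation "fpr \<eta> \<equiv> countable_walk_graph.fin_prob (comb \<eta>)"

lemma nevc_def: "nevc \<eta> p = lim (\<lambda>m. ncoll \<eta> m p)"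
  by (rule comb.never_collide_def)

lemma fpr_def: "fpr \<eta> p = lim (\<lambda>n. (avg2 (comb \<eta>) ^^ n) (nevc \<eta>) p)"
  by (rule comb.fin_prob_def)

section \<open>The i.i.d. environment: measurability, shift invariance, independence of
  blocks\<close>

locale iid_env =
  fixes D :: "nat pmf"
begin

definition Q :: "(int \<Rightarrow> nat) measure" where
  "Q = PiM UNIV (\<lambda>_. measure_pmf D)"

sublocale Q: prob_space Q
  unfolding Q_def by (intro prob_space_PiM measure_pmf.prob_space_axioms)

lemma space_Q [simp]: "space Q = UNIV"
  by (simp add: Q_def space_PiM)

lemma measurable_coord_pmf: "(\<lambda>\<eta>. \<eta> y) \<in> Q \<rightarrow>\<^sub>M measure_pmf D"
  unfolding Q_def by (rule measurable_component_singleton) simp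

lemma measurable_coord [measurable]: "(\<lambda>\<eta>. \<eta> y) \<in> Q \<rightarrow>\<^sub>M count_space UNIV"
  using measurable_coord_pmf by (simp cong: measurable_cong_sets)

text \<open>The neighbour set itself varies with the environment, so measurability is read off from
  the explicit averages on the spine and on a tooth.\<close>

lemma measurable_avg:
  assumes [measurable]: "\<And>v. (\<lambda>\<eta>. g \<eta> v) \<in> borel_measurable Q"
  shows "(\<lambda>\<eta>. avg (comb \<eta>) (g \<eta>) v) \<in> borel_measurable Q"
proof -
  obtain y l where v: "v = (y, l)" by (cases v)
  show ?thesis
  proof (cases l)
    case 0
    show ?thesis unfolding v 0 avg_comb_spine by measurable
  next
    case (Suc j)
    show ?thesis unfolding v Suc avg_comb_tooth by measurable
  qed
qed

lemma measurable_tp [measurable]: "(\<lambda>\<eta>. tp (comb \<eta>) n x t) \<in> borel_measurable Q"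
proof (induction n arbitrary: x)
  case (Suc n) then show ?case unfolding tp_Suc by (rule measurable_avg)
qed (simp add: tp_0)

lemma measurable_gs [measurable]: "(\<lambda>\<eta>. gs \<eta> \<alpha> x t) \<in> borel_measurable Q"
  unfolding gs_def green_def by measurable

lemma measurable_gterm [measurable]: "(\<lambda>\<eta>. gterm \<eta> k x t) \<in> borel_measurable Q"
  unfolding gterm_def by measurable

lemma measurable_csum [measurable]: "(\<lambda>\<eta>. csum \<eta> s x t) \<in> borel_measurable Q"
  unfolding csum_def coll_sum_def by (intro borel_measurable_nn_integral_count_space) auto

lemma measurable_avg2:
  assumes "\<And>p. (\<lambda>\<eta>. g \<eta> p) \<in> borel_measurable Q"
  shows "(\<lambda>\<eta>. avg2 (comb \<eta>) (g \<eta>) p) \<in> borel_measurable Q"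
  unfolding avg2_def by (intro measurable_avg assms)

lemma measurable_ncoll [measurable]: "(\<lambda>\<eta>. ncoll \<eta> m p) \<in> borel_measurable Q"
proof (induction m arbitrary: p)
  case (Suc m)
  have [measurable]: "(\<lambda>\<eta>. avg2 (comb \<eta>) (ncoll \<eta> m) p) \<in> borel_measurable Q"
    by (intro measurable_avg2 Suc)
  show ?case by simp
qed simp

lemma measurable_pow_nevc [measurable]: "(\<lambda>\<eta>. (avg2 (comb \<eta>) ^^ n) (nevc \<eta>) p) \<in> borel_measurable Q"
proof (induction n arbitrary: p)
  case 0 show ?case unfolding funpow_0 nevc_def by measurable
next
  case (Suc n) then show ?case using measurable_avg2[of "\<lambda>\<eta>. (avg2 (comb \<eta>) ^^ n) (nevc \<eta>)"] by simp
qed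

lemma measurable_finp [measurable]: "finp \<in> borel_measurable Q"
  unfolding fpr_def[abs_def] by measurable

lemma distr_shift: "distr Q Q (shift a) = Q"
proof -
  have "distr (PiM UNIV (\<lambda>_. measure_pmf D)) (PiM UNIV (\<lambda>n. (\<lambda>_. measure_pmf D) (n + a)))
      (\<lambda>\<omega>. \<lambda>n\<in>UNIV. \<omega> (n + a)) = PiM UNIV (\<lambda>n. (\<lambda>_. measure_pmf D) (n + a))"
    by (rule distr_PiM_reindex) (auto simp: measure_pmf.prob_space_axioms inj_on_def)
  then show ?thesis unfolding Q_def by (simp add: shift_def[abs_def] restrict_UNIV)
qed

lemma measurable_shift [measurable]: "shift a \<in> Q \<rightarrow>\<^sub>M Q"
proof -
  have "(\<lambda>\<eta>. shift a \<eta>) \<in> Q \<rightarrow>\<^sub>M PiM UNIV (\<lambda>_. measure_pmf D)"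
    by (rule measurable_PiM_single') (auto simp: shift_def intro: measurable_coord_pmf)
  then show ?thesis by (simp add: Q_def)
qed

lemma nn_integral_shift:
  assumes "F \<in> borel_measurable Q"
  shows "(\<integral>\<^sup>+\<eta>. F (shift a \<eta>) \<partial>Q) = (\<integral>\<^sup>+\<eta>. F \<eta> \<partial>Q)"
proof -
  have "(\<integral>\<^sup>+\<eta>. F \<eta> \<partial>Q) = (\<integral>\<^sup>+\<eta>. F \<eta> \<partial>distr Q Q (shift a))" by (simp only: distr_shift)
  also have "\<dots> = (\<integral>\<^sup>+\<eta>. F (shift a \<eta>) \<partial>Q)" using assms by (intro nn_integral_distr) auto
  finally show ?thesis by simp
qed

lemma distr_coord: "distr Q (measure_pmf D) (\<lambda>\<eta>. \<eta> y) = measure_pmf D"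
proof -
  interpret product_prob_space "\<lambda>_ :: int. measure_pmf D" UNIV
    by unfold_locales
  show ?thesis unfolding Q_def using PiM_component[of y] by simp
qed

lemma nn_integral_coord: "(\<integral>\<^sup>+\<eta>. f (\<eta> y) \<partial>Q) = (\<integral>\<^sup>+h. f h \<partial>measure_pmf D)"
proof -
  have "(\<integral>\<^sup>+h. f h \<partial>measure_pmf D) = (\<integral>\<^sup>+h. f h \<partial>distr Q (measure_pmf D) (\<lambda>\<eta>. \<eta> y))"
    by (simp only: distr_coord)
  also have "\<dots> = (\<integral>\<^sup>+\<eta>. f (\<eta> y) \<partial>Q)" by (intro nn_integral_distr measurable_coord_pmf) auto
  finally show ?thesis by simp
qed

lemma indep_coord: "Q.indep_vars (\<lambda>_. measure_pmf D) (\<lambda>y \<eta>. \<eta> y) UNIV"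
proof (subst Q.indep_vars_iff_distr_eq_PiM)
  show "Q.random_variable (measure_pmf D) (\<lambda>\<eta>. \<eta> i)" for i by (rule measurable_coord_pmf)
  have "distr Q (PiM UNIV (\<lambda>_. measure_pmf D)) (\<lambda>\<eta>. \<lambda>i\<in>UNIV. \<eta> i) = Q"
    by (simp add: Q_def[symmetric] distr_id restrict_UNIV)
  then show "distr Q (PiM UNIV (\<lambda>_. measure_pmf D)) (\<lambda>\<eta>. \<lambda>i\<in>UNIV. \<eta> i) =
      PiM UNIV (\<lambda>i. distr Q (measure_pmf D) (\<lambda>\<eta>. \<eta> i))"
    unfolding distr_coord by (simp add: Q_def)
qed simp

lemma indep_blocks:
  assumes "disjoint_family_on K J" "\<And>j. j \<in> J \<Longrightarrow> countable (K j)"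
    and f: "\<And>j. j \<in> J \<Longrightarrow> f j \<in> borel_measurable (PiM (K j) (\<lambda>_. measure_pmf D))"
  shows "Q.indep_vars (\<lambda>_. borel) (\<lambda>j \<eta>. f j (restrict \<eta> (K j))) J"
proof -
  have "Q.indep_vars (\<lambda>j. PiM (K j) (\<lambda>_. measure_pmf D)) (\<lambda>j \<eta>. restrict (\<lambda>i. \<eta> i) (K j)) J"
    by (rule Q.indep_vars_restrict[OF indep_coord]) (use assms in auto)
  then show ?thesis
    by (rule Q.indep_vars_compose2) (use f in auto)
qed

end

text \<open>The potential is of order \<alpha>^2 + \<alpha> min(1, \<alpha> h): a tooth acts in
  proportion to its height until it reaches height 1 / \<alpha>, where its effect saturates. The
  last two bounds translate upper and lower tails of the heights into bounds for the mean
  potential.\<close>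

lemma pot_bounds:
  assumes a: "0 < \<alpha>" "\<alpha> \<le> 1"
  shows "\<alpha>\<^sup>2 \<le> pot \<alpha> h" "pot \<alpha> h \<le> 4 * \<alpha>" "pot \<alpha> h \<le> 2 * \<alpha>\<^sup>2 + 4 * \<alpha> * min 1 (\<alpha> * real h)"
    "1 \<le> \<alpha> * real h \<Longrightarrow> \<alpha> / 2 \<le> pot \<alpha> h"
proof -
  define c where "c = 2 * (cosh \<alpha> - 1)"
  have c: "\<alpha>\<^sup>2 \<le> c" "c \<le> 2 * \<alpha>\<^sup>2"
    using cosh_ge[of \<alpha>] cosh_le[of \<alpha>] a by (auto simp: c_def)
  have a2: "\<alpha>\<^sup>2 \<le> \<alpha>" using a by (simp add: power2_eq_square mult_left_le)
  have s: "\<alpha> \<le> sinh \<alpha>" "sinh \<alpha> \<le> 2 * \<alpha>"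
    using real_le_x_sinh[of \<alpha>] sinh_le[of \<alpha>] a by (auto simp: sinh_field_def exp_minus)
  define t where "t = tanh (\<alpha> * real h)"
  have t: "0 \<le> t" "t \<le> 1" using a tanh_real_lt_1[of "\<alpha> * real h"] by (auto simp: t_def)
  have p: "pot \<alpha> h = c + sinh \<alpha> * t" by (simp add: pot_def c_def t_def)
  have st: "0 \<le> sinh \<alpha> * t" using s t a by simp
  show "\<alpha>\<^sup>2 \<le> pot \<alpha> h" using c st p by linarith
  have "sinh \<alpha> * t \<le> 2 * \<alpha> * 1" using s t a by (intro mult_mono) auto
  then show "pot \<alpha> h \<le> 4 * \<alpha>" using c a2 p by linarith
  have "t \<le> 2 * min 1 (\<alpha> * real h)"
  proof (cases "\<alpha> * real h \<le> 1")
    case True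
    have ah: "0 \<le> \<alpha> * real h" using a by simp
    have "t = sinh (\<alpha> * real h) / cosh (\<alpha> * real h)" by (simp add: t_def tanh_def)
    also have "\<dots> \<le> sinh (\<alpha> * real h) / 1"
      using ah cosh_real_ge_1[of "\<alpha> * real h"] by (intro divide_left_mono) auto
    also have "\<dots> \<le> 2 * (\<alpha> * real h)" using sinh_le[OF ah True] by simp
    finally show ?thesis using True by (simp add: min_def)
  next
    case False
    then show ?thesis using t by (simp add: min_def)
  qed
  then have "sinh \<alpha> * t \<le> (2 * \<alpha>) * (2 * min 1 (\<alpha> * real h))" using s t a by (intro mult_mono) auto
  then show "pot \<alpha> h \<le> 2 * \<alpha>\<^sup>2 + 4 * \<alpha> * min 1 (\<alpha> * real h)" using c p by simp
  assume h: "1 \<le> \<alpha> * real h"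
  have "1 / 2 \<le> tanh (1 :: real)"
  proof -
    have "3 \<le> exp (2 :: real)" using exp_ge_add_one_self[of 2] by simp
    then have "exp (- 2) \<le> 1 / (3 :: real)" by (simp add: exp_minus field_simps)
    then have "1 / 2 * (1 + exp (- 2)) \<le> 1 - exp (- 2 :: real)" by simp
    then show ?thesis by (simp add: tanh_real_altdef pos_le_divide_eq add_pos_pos)
  qed
  also have "\<dots> \<le> t" using h by (simp add: t_def)
  finally have "\<alpha> * (1 / 2) \<le> sinh \<alpha> * t" using s a by (intro mult_mono) auto
  then show "\<alpha> / 2 \<le> pot \<alpha> h" using c p zero_le_power2[of \<alpha>] by linarith
qed

text \<open>Minkowski's inequality in L2 for countable sums: expand the square and apply
  Cauchy-Schwarz to each pair.\<close>

lemma nn_integral_square_sum_le: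
  fixes a :: "'i \<Rightarrow> 'x \<Rightarrow> ennreal" and w :: "'i \<Rightarrow> real"
  assumes I: "countable I" and [measurable]: "\<And>i. i \<in> I \<Longrightarrow> a i \<in> borel_measurable M"
    and w: "\<And>i. i \<in> I \<Longrightarrow> 0 \<le> w i"
    and a2: "\<And>i. i \<in> I \<Longrightarrow> (\<integral>\<^sup>+x. (a i x)\<^sup>2 \<partial>M) \<le> ennreal ((w i)\<^sup>2)"
  shows "(\<integral>\<^sup>+x. (\<integral>\<^sup>+i. a i x \<partial>count_space I)\<^sup>2 \<partial>M) \<le> (\<integral>\<^sup>+i. ennreal (w i) \<partial>count_space I)\<^sup>2"
proof -
  let ?C = "count_space I"
  have pair: "(\<integral>\<^sup>+x. a i x * a j x \<partial>M) \<le> ennreal (w i) * ennreal (w j)" if ij: "i \<in> I" "j \<in> I" for i j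
  proof -
    have "(\<integral>\<^sup>+x. a i x * a j x \<partial>M)\<^sup>2 \<le> (\<integral>\<^sup>+x. (a i x)\<^sup>2 \<partial>M) * (\<integral>\<^sup>+x. (a j x)\<^sup>2 \<partial>M)"
      using ij by (intro Cauchy_Schwarz_nn_integral) auto
    also have "\<dots> \<le> ennreal ((w i)\<^sup>2) * ennreal ((w j)\<^sup>2)"
      using ij by (intro mult_mono a2) auto
    also have "\<dots> = ennreal ((w i * w j)\<^sup>2)"
      by (simp add: ennreal_mult power_mult_distrib)
    finally have le: "(\<integral>\<^sup>+x. a i x * a j x \<partial>M)\<^sup>2 \<le> ennreal ((w i * w j)\<^sup>2)" .
    have "(\<integral>\<^sup>+x. a i x * a j x \<partial>M) \<le> ennreal (w i * w j)"
    proof (cases "(\<integral>\<^sup>+x. a i x * a j x \<partial>M)")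
      case (real r)
      have "r\<^sup>2 \<le> (w i * w j)\<^sup>2" using le real by (simp add: ennreal_power)
      moreover have "0 \<le> w i * w j" using w[OF ij(1)] w[OF ij(2)] by (rule mult_nonneg_nonneg)
      ultimately have "r \<le> w i * w j" by (rule power2_le_imp_le)
      then show ?thesis using real by (simp add: ennreal_leI)
    next
      case top
      then have "(top :: ennreal) * top \<le> ennreal ((w i * w j)\<^sup>2)"
        using le unfolding power2_eq_square[of "\<integral>\<^sup>+x. a i x * a j x \<partial>M"] by simp
      then show ?thesis by (simp add: ennreal_top_mult top_unique)
    qed
    then show ?thesis using w[OF ij(1)] w[OF ij(2)] by (simp add: ennreal_mult)
  qed
  have [measurable]: "(\<lambda>x. \<integral>\<^sup>+j. a i x * a j x \<partial>?C) \<in> borel_measurable M" if "i \<in> I" for i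
    using that I by (intro borel_measurable_nn_integral_count_space) auto
  have "(\<integral>\<^sup>+x. (\<integral>\<^sup>+i. a i x \<partial>?C)\<^sup>2 \<partial>M) = (\<integral>\<^sup>+x. \<integral>\<^sup>+i. \<integral>\<^sup>+j. a i x * a j x \<partial>?C \<partial>?C \<partial>M)"
    by (simp add: power2_eq_square nn_integral_cmult nn_integral_multc)
  also have "\<dots> = (\<integral>\<^sup>+i. \<integral>\<^sup>+x. \<integral>\<^sup>+j. a i x * a j x \<partial>?C \<partial>M \<partial>?C)"
    using I by (intro nn_integral_count_space_nn_integral) auto
  also have "\<dots> = (\<integral>\<^sup>+i. \<integral>\<^sup>+j. \<integral>\<^sup>+x. a i x * a j x \<partial>M \<partial>?C \<partial>?C)"
    using I by (intro nn_integral_cong nn_integral_count_space_nn_integral) auto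
  also have "\<dots> \<le> (\<integral>\<^sup>+i. \<integral>\<^sup>+j. ennreal (w i) * ennreal (w j) \<partial>?C \<partial>?C)"
    by (intro nn_integral_mono pair) auto
  also have "\<dots> = (\<integral>\<^sup>+i. ennreal (w i) \<partial>?C)\<^sup>2"
    by (simp add: power2_eq_square nn_integral_cmult nn_integral_multc)
  finally show ?thesis .
qed

lemma summable_pow8: "summable (\<lambda>j. (24 * real (Suc j)) ^ 8 * (1 / 2) ^ j)"
proof -
  have "summable (\<lambda>j. real (Suc j) ^ 8 * (1 / 2) ^ j)"
  proof (rule summable_ratio_test)
    show "(3 / 4 :: real) < 1" by simp
    fix n :: nat assume n: "20 \<le> n"
    \<comment> \<open>From n = 20 on successive bases have ratio at most 22/21, and (22/21)^8 <=
      3/2, so the terms shrink by 3/4.\<close>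
    have "21 * real (Suc (Suc n)) \<le> 22 * real (Suc n)" using n by simp
    then have "real (Suc (Suc n)) \<le> 22 / 21 * real (Suc n)" by simp
    then have "real (Suc (Suc n)) ^ 8 \<le> (22 / 21 * real (Suc n)) ^ 8" by (intro power_mono) auto
    also have "\<dots> = (22 / 21) ^ 8 * real (Suc n) ^ 8" by (rule power_mult_distrib)
    also have "\<dots> \<le> 3 / 2 * real (Suc n) ^ 8" by (intro mult_right_mono) (simp_all add: field_simps)
    finally have "real (Suc (Suc n)) ^ 8 * (1 / 2) ^ Suc n \<le> 3 / 2 * real (Suc n) ^ 8 * (1 / 2) ^ Suc n"
      by (intro mult_right_mono) auto
    then show "norm (real (Suc (Suc n)) ^ 8 * (1 / 2) ^ Suc n) \<le> 3 / 4 * norm (real (Suc n) ^ 8 * (1 / 2) ^ n)"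
      by simp
  qed
  then have "summable (\<lambda>j. 24 ^ 8 * (real (Suc j) ^ 8 * (1 / 2) ^ j))" by (rule summable_mult)
  then show ?thesis by (simp only: power_mult_distrib mult.assoc)
qed

lemma ennreal_prod_le_power:
  fixes f :: "'i \<Rightarrow> ennreal"
  assumes "\<And>i. i \<in> A \<Longrightarrow> f i \<le> q" "finite A"
  shows "prod f A \<le> q ^ card A"
  using assms(2,1) by (induction A rule: finite_induct) (auto intro: mult_mono)

text \<open>Dominates the eighth moment of 24 (j + 1), where j is the index of the first good block,
  which exceeds n - 1 with probability at most 2^(-n).\<close>

definition M8 :: real where "M8 = (\<Sum>j. (24 * real (Suc j)) ^ 8 * (1 / 2) ^ j)"

lemma M8_nonneg: "0 \<le> M8"
  unfolding M8_def by (intro suminf_nonneg summable_pow8) simp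

section \<open>Good blocks and moments of the Green function\<close>

context iid_env begin

definition ev :: "nat \<Rightarrow> real" where
  "ev k = measure_pmf.expectation D (pot (sc k))"

text \<open>The decay length on the spine at scale \<open>k\<close>. The factor 16 is large enough
  for a block to be good with probability at least 1/2.\<close>

definition len :: "nat \<Rightarrow> nat" where
  "len k = nat \<lceil>16 / sqrt (ev k)\<rceil>"

lemma integrable_pot: "integrable (measure_pmf D) (pot (sc k))"
proof (rule measure_pmf.integrable_const_bound)
  show "AE h in measure_pmf D. norm (pot (sc k) h) \<le> 4 * sc k"
    using pot_bounds(2)[OF sc(1,2)] pot_nonneg[of "sc k"] sc(1)[of k]
    by (intro AE_I2) (simp add: abs_of_nonneg)
qed simp

lemma ev_bounds: "(sc k)\<^sup>2 \<le> ev k" "ev k \<le> 4 * sc k"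
proof -
  have c: "measure_pmf.expectation D (\<lambda>_. c :: real) = c" for c by simp
  have "measure_pmf.expectation D (\<lambda>_. (sc k)\<^sup>2) \<le> ev k"
    unfolding ev_def using pot_bounds(1)[OF sc(1,2)] by (intro integral_mono integrable_pot) auto
  then show "(sc k)\<^sup>2 \<le> ev k" by (simp only: c)
  have "ev k \<le> measure_pmf.expectation D (\<lambda>_. 4 * sc k)"
    unfolding ev_def using pot_bounds(2)[OF sc(1,2)] by (intro integral_mono integrable_pot) auto
  then show "ev k \<le> 4 * sc k" by (simp only: c)
qed

lemma ev_pos: "0 < ev k"
  using ev_bounds(1)[of k] sc(1)[of k] by (meson less_le_trans zero_less_power)

lemma len_ge: "16 / sqrt (ev k) \<le> real (len k)"
  unfolding len_def by linarith

lemma len_le: "real (len k) \<le> 18 / sqrt (ev k)"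
proof -
  have "ev k \<le> 2\<^sup>2" using ev_bounds(2)[of k] sc(2)[of k] by simp
  then have "sqrt (ev k) \<le> 2" using real_sqrt_le_mono by fastforce
  then have "1 \<le> 2 / sqrt (ev k)" using ev_pos[of k] by (simp add: le_divide_eq)
  moreover have "real (len k) \<le> 16 / sqrt (ev k) + 1"
    unfolding len_def using ev_pos[of k] by (simp add: of_nat_nat)
  ultimately show ?thesis by (simp add: field_simps)
qed

lemma len_pos: "0 < len k"
proof -
  have "0 < real (len k)" using len_ge[of k] ev_pos[of k] by (smt (verit) divide_pos_pos real_sqrt_gt_zero)
  then show ?thesis by simp
qed

text \<open>The potential collected in the right half of the \<open>j\<close>-th block of \<open>2 * len k\<close> sites to the right of \<open>a\<close>.
  Once it exceeds \<open>1 / len k\<close>, decreasing convex solutions are halved across the block.\<close>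

definition bsum :: "nat \<Rightarrow> int \<Rightarrow> nat \<Rightarrow> (int \<Rightarrow> nat) \<Rightarrow> real" where
  "bsum k a j \<eta> = (\<Sum>i=1..len k. pot (sc k) (\<eta> (a + int (2 * len k * j + len k + i))))"

lemma measurable_bsum [measurable]: "bsum k a j \<in> borel_measurable Q"
  unfolding bsum_def[abs_def] by measurable

text \<open>Different blocks use disjoint sets of sites and are therefore independent. \<phi> is
  left open because it serves both for runs of bad blocks and for the damping factor.\<close>

lemma block_product_le:
  assumes [measurable]: "\<phi> \<in> borel_measurable borel"
    and q: "\<And>j. (\<integral>\<^sup>+\<eta>. \<phi> (bsum k a j \<eta>) \<partial>Q) \<le> q"
  shows "(\<integral>\<^sup>+\<eta>. (\<Prod>j<n. (\<phi> (bsum k a j \<eta>) :: ennreal)) \<partial>Q) \<le> q ^ n"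
proof -
  define K where "K j = (\<lambda>i. a + int (2 * len k * j + len k + i)) ` {1..len k}" for j
  define f where "f j \<omega> = \<phi> (\<Sum>i=1..len k. pot (sc k) (\<omega> (a + int (2 * len k * j + len k + i))))" for j \<omega>
  have disj: "disjoint_family_on K {..<n}"
  proof -
    have False if "z \<in> K j" "z \<in> K j'" "j < j'" for z j j'
    proof -
      obtain i where z: "z = a + int (2 * len k * j + len k + i)" and i1: "i \<in> {1..len k}"
        using \<open>z \<in> K j\<close> unfolding K_def by (rule imageE)
      obtain i' where z': "z = a + int (2 * len k * j' + len k + i')" and i2: "i' \<in> {1..len k}"
        using \<open>z \<in> K j'\<close> unfolding K_def by (rule imageE)
      have i: "i \<le> len k" "1 \<le> i'" using i1 i2 by auto
      have "a + int (2 * len k * j + len k + i) = a + int (2 * len k * j' + len k + i')"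
        using z z' by (rule trans[OF sym])
      then have e: "2 * len k * j + len k + i = 2 * len k * j' + len k + i'"
        by (simp only: add_left_cancel of_nat_eq_iff)
      have "2 * len k * Suc j \<le> 2 * len k * j'" using \<open>j < j'\<close> by (intro mult_le_mono2) simp
      then have "2 * len k * j + 2 * len k \<le> 2 * len k * j'" by simp
      then show False using i e len_pos[of k] by linarith
    qed
    then show ?thesis unfolding disjoint_family_on_def by (metis disjoint_iff linorder_neqE_nat)
  qed
  have meas: "f j \<in> borel_measurable (PiM (K j) (\<lambda>_. measure_pmf D))" for j
  proof -
    have [measurable]: "(\<lambda>\<omega>. pot (sc k) (\<omega> (a + int (2 * len k * j + len k + i)))) \<in> borel_measurable (PiM (K j) (\<lambda>_. measure_pmf D))"
      if "i \<in> {1..len k}" for i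
    proof (rule measurable_compose[of _ _ "measure_pmf D"])
      show "(\<lambda>\<omega>. \<omega> (a + int (2 * len k * j + len k + i))) \<in> PiM (K j) (\<lambda>_. measure_pmf D) \<rightarrow>\<^sub>M measure_pmf D"
        using that by (intro measurable_component_singleton) (auto simp: K_def)
    qed simp
    show ?thesis unfolding f_def by measurable
  qed
  have "Q.indep_vars (\<lambda>_. borel) (\<lambda>j \<eta>. f j (restrict \<eta> (K j))) {..<n}"
    using disj meas by (intro indep_blocks) auto
  moreover have "f j (restrict \<eta> (K j)) = \<phi> (bsum k a j \<eta>)" for j \<eta>
    unfolding f_def bsum_def K_def by (intro arg_cong[where f=\<phi>] sum.cong) auto
  ultimately have "Q.indep_vars (\<lambda>_. borel) (\<lambda>j \<eta>. \<phi> (bsum k a j \<eta>)) {..<n}" by simp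
  then have "(\<integral>\<^sup>+\<eta>. (\<Prod>j<n. \<phi> (bsum k a j \<eta>)) \<partial>Q) = (\<Prod>j<n. \<integral>\<^sup>+\<eta>. \<phi> (bsum k a j \<eta>) \<partial>Q)"
    by (intro Q.indep_vars_nn_integral) auto
  also have "\<dots> \<le> q ^ card {..<n}" by (intro ennreal_prod_le_power q) simp
  finally show ?thesis by simp
qed

text \<open>Exponential Chebyshev inequality at rate \<open>len k\<close>. On the range of the
  potential the exponential lies below a linear function, so its mean is controlled by
  \<open>ev k\<close> alone; independence over the block gives a total exponent of at least 2, and
  exp(1 - 2) <= 1/2.\<close>

lemma bad_block:
  "(\<integral>\<^sup>+\<eta>. indicator {..<1 / real (len k)} (bsum k a j \<eta>) \<partial>Q) \<le> ennreal (1 / 2)"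
proof -
  define l where "l = real (len k)"
  define B where "B = 4 * sc k"
  have l: "0 < l" and B: "0 < B" using len_pos[of k] sc(1)[of k] by (auto simp: l_def B_def)
  \<comment> \<open>The slope in exp(- l v) <= 1 / (1 + l v) = 1 - l v / (1 + l v) <= 1 - c v for 0
    <= v <= B.\<close>
  define c where "c = l / (1 + l * B)"
  have c0: "0 \<le> c" using l B by (simp add: c_def)
  have e1: "exp (- (l * v)) \<le> 1 - c * v" "0 \<le> 1 - c * v" if "0 \<le> v" "v \<le> B" for v
  proof -
    have lv: "0 \<le> l * v" "l * v \<le> l * B" using that l by auto
    have "exp (- (l * v)) \<le> 1 / (1 + l * v)"
      using exp_ge_add_one_self[of "l * v"] lv by (simp add: exp_minus divide_simps)
    also have "\<dots> = 1 - l * v / (1 + l * v)" using lv by (simp add: field_simps)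
    also have "\<dots> \<le> 1 - l * v / (1 + l * B)" using lv by (intro diff_left_mono divide_left_mono) auto
    finally show 1: "exp (- (l * v)) \<le> 1 - c * v" by (simp add: c_def)
    then show "0 \<le> 1 - c * v" by (meson exp_ge_zero order_trans)
  qed
  have one: "(\<integral>\<^sup>+h. ennreal (exp (- (l * pot (sc k) h))) \<partial>measure_pmf D) \<le> ennreal (exp (- (c * ev k)))"
  proof -
    have pB: "0 \<le> pot (sc k) h" "pot (sc k) h \<le> B" for h
      using pot_bounds(2)[OF sc(1,2)] pot_nonneg sc(1)[of k] by (auto simp: B_def)
    have "(\<integral>\<^sup>+h. ennreal (exp (- (l * pot (sc k) h))) \<partial>measure_pmf D) \<le> (\<integral>\<^sup>+h. ennreal (1 - c * pot (sc k) h) \<partial>measure_pmf D)"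
      using e1(1)[OF pB] by (intro nn_integral_mono ennreal_leI)
    also have "\<dots> = ennreal (measure_pmf.expectation D (\<lambda>h. 1 - c * pot (sc k) h))"
      using e1(2)[OF pB] by (intro nn_integral_eq_integral Bochner_Integration.integrable_diff integrable_mult_right integrable_pot) simp_all
    also have "measure_pmf.expectation D (\<lambda>h. 1 - c * pot (sc k) h) = 1 - c * ev k"
      using integrable_pot[of k] by (simp add: ev_def)
    also have "1 - c * ev k \<le> exp (- (c * ev k))" using exp_ge_add_one_self[of "- (c * ev k)"] by simp
    finally show ?thesis by (simp add: ennreal_leI)
  qed
  have big: "2 \<le> l * (c * ev k)"
  proof -
    have s: "16 \<le> l * sqrt (ev k)" using len_ge[of k] ev_pos[of k] by (simp add: l_def pos_divide_le_eq)
    have a: "sc k \<le> sqrt (ev k)" using ev_bounds(1)[of k] sc(1)[of k] by (intro real_le_rsqrt)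
    have ee: "(l * sqrt (ev k)) * (l * sqrt (ev k)) = l * l * ev k"
      "l * ((l * sqrt (ev k)) * sqrt (ev k)) = l * l * ev k"
      using ev_pos[of k] by (simp_all add: mult.assoc mult.left_commute[of "sqrt (ev k)"])
    have "16 * 16 \<le> (l * sqrt (ev k)) * (l * sqrt (ev k))" using s by (intro mult_mono) auto
    then have 1: "256 \<le> l * l * ev k" unfolding ee by simp
    have "l * (16 * sc k) \<le> l * ((l * sqrt (ev k)) * sqrt (ev k))"
      using s a l sc(1)[of k] by (intro mult_left_mono mult_mono) auto
    then have 2: "4 * (l * B) \<le> l * l * ev k" unfolding ee by (simp add: B_def)
    have "2 * (1 + l * B) \<le> l * l * ev k" using 1 2 by argo
    then show ?thesis using l B unfolding c_def
      by (simp add: pos_le_divide_eq add_pos_pos mult.assoc)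
  qed
  have "(\<integral>\<^sup>+\<eta>. indicator {..<1 / l} (bsum k a j \<eta>) \<partial>Q) \<le>
      (\<integral>\<^sup>+\<eta>. ennreal (exp 1) * ennreal (exp (- (l * bsum k a j \<eta>))) \<partial>Q)"
  proof (intro nn_integral_mono)
    fix \<eta>
    show "indicator {..<1 / l} (bsum k a j \<eta>) \<le> ennreal (exp 1) * ennreal (exp (- (l * bsum k a j \<eta>)))"
    proof (cases "bsum k a j \<eta> < 1 / l")
      case True
      then have "1 \<le> exp (1 + - (l * bsum k a j \<eta>))" using l by (simp add: pos_less_divide_eq mult.commute)
      then have "ennreal 1 \<le> ennreal (exp 1 * exp (- (l * bsum k a j \<eta>)))" unfolding exp_add by (intro ennreal_leI)
      then show ?thesis using True by (simp add: ennreal_mult)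
    qed simp
  qed
  also have "\<dots> = ennreal (exp 1) * (\<integral>\<^sup>+\<eta>. (\<Prod>i\<in>{1..len k}. ennreal (exp (- (l * pot (sc k) (\<eta> (a + int (2 * len k * j + len k + i))))))) \<partial>Q)"
    by (subst nn_integral_cmult) (auto simp: bsum_def sum_distrib_left exp_sum sum_negf[symmetric] prod_ennreal)
  also have "(\<integral>\<^sup>+\<eta>. (\<Prod>i\<in>{1..len k}. ennreal (exp (- (l * pot (sc k) (\<eta> (a + int (2 * len k * j + len k + i))))))) \<partial>Q) =
      (\<Prod>i\<in>{1..len k}. \<integral>\<^sup>+\<eta>. ennreal (exp (- (l * pot (sc k) (\<eta> (a + int (2 * len k * j + len k + i)))))) \<partial>Q)"
  proof (rule Q.indep_vars_nn_integral)
    define K where "K i = {a + int (2 * len k * j + len k + i)}" for i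
    have "Q.indep_vars (\<lambda>_. borel) (\<lambda>i \<eta>. (\<lambda>i \<omega>. ennreal (exp (- (l * pot (sc k) (\<omega> (a + int (2 * len k * j + len k + i))))))) i (restrict \<eta> (K i))) {1..len k}"
    proof (rule indep_blocks)
      fix i assume "i \<in> {1..len k}"
      have [measurable]: "(\<lambda>\<omega>. pot (sc k) (\<omega> (a + int (2 * len k * j + len k + i)))) \<in> borel_measurable (PiM (K i) (\<lambda>_. measure_pmf D))"
      proof (rule measurable_compose[of _ _ "measure_pmf D"])
        show "(\<lambda>\<omega>. \<omega> (a + int (2 * len k * j + len k + i))) \<in> PiM (K i) (\<lambda>_. measure_pmf D) \<rightarrow>\<^sub>M measure_pmf D"
          by (intro measurable_component_singleton) (auto simp: K_def)
      qed simp
      show "(\<lambda>\<omega>. ennreal (exp (- (l * pot (sc k) (\<omega> (a + int (2 * len k * j + len k + i))))))) \<in> borel_measurable (PiM (K i) (\<lambda>_. measure_pmf D))"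
        by measurable
    qed (auto simp: K_def disjoint_family_on_def)
    then show "Q.indep_vars (\<lambda>_. borel) (\<lambda>i \<eta>. ennreal (exp (- (l * pot (sc k) (\<eta> (a + int (2 * len k * j + len k + i))))))) {1..len k}"
      by (simp add: K_def)
  qed auto
  also have "\<dots> \<le> ennreal (exp (- (c * ev k))) ^ card {1..len k}"
    using one nn_integral_coord[of "\<lambda>h. ennreal (exp (- (l * pot (sc k) h)))"]
    by (intro ennreal_prod_le_power) simp_all
  also have "\<dots> = ennreal (exp (- (l * (c * ev k))))"
    by (simp add: ennreal_power exp_of_nat_mult[symmetric] l_def)
  also have "\<dots> \<le> ennreal (exp (- 2))" using big by (intro ennreal_leI) simp
  also have "ennreal (exp 1) * ennreal (exp (- 2)) = ennreal (exp (- 1))"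
    by (simp add: ennreal_mult[symmetric] exp_add[symmetric])
  also have "\<dots> \<le> ennreal (1 / 2)"
    using exp_ge_add_one_self[of 1] by (intro ennreal_leI) (simp add: exp_minus field_simps)
  finally show ?thesis by (simp add: l_def mult_left_mono)
qed

end

lemma cosh_sc_le: "cosh (sc k) \<le> 2"
proof -
  have "cosh (sc k) \<le> 1 + (sc k)\<^sup>2" using sc[of k] by (intro cosh_le) auto
  also have "(sc k)\<^sup>2 \<le> 1" using sc[of k] by (simp add: power_le_one)
  finally show ?thesis by simp
qed

lemma spine_source_le: "cosh (sc k) * deg (comb \<eta>) (t, 0) \<le> 6"
proof -
  have "cosh (sc k) * deg (comb \<eta>) (t, 0) \<le> 2 * 3"
    using cosh_sc_le deg_spine_bounds[of \<eta> t] by (intro mult_mono) auto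
  then show ?thesis by simp
qed

lemma spine_source_ge: "2 \<le> cosh (sc k) * deg (comb \<eta>) (t, 0)"
proof -
  have "1 * 2 \<le> cosh (sc k) * deg (comb \<eta>) (t, 0)"
    using cosh_real_ge_1 deg_spine_bounds[of \<eta> t] by (intro mult_mono) auto
  then show ?thesis by simp
qed

text \<open>Conservation at the source: what is injected leaves to the right, to the left, or is
  killed by the potential at \<open>t\<close>.\<close>

lemma spine_drops:
  "(gs \<eta> (sc k) t t - gs \<eta> (sc k) (t + 1) t) + (gs \<eta> (sc k) t t - gs \<eta> (sc k) (t - 1) t)
    + pot (sc k) (\<eta> t) * gs \<eta> (sc k) t t = cosh (sc k) * deg (comb \<eta>) (t, 0)"
  using gs_equation[OF sc(1), of k \<eta> t t] by (simp add: algebra_simps)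

lemma spine_drop_bounds:
  shows "0 \<le> gs \<eta> (sc k) t t - gs \<eta> (sc k) (t + 1) t" "gs \<eta> (sc k) t t - gs \<eta> (sc k) (t + 1) t \<le> 6"
    "0 \<le> gs \<eta> (sc k) t t - gs \<eta> (sc k) (t - 1) t"
proof -
  interpret r: decaying_solution "\<lambda>i. gs \<eta> (sc k) (t + int i) t" "\<lambda>i. pot (sc k) (\<eta> (t + int i))"
    by (rule gs_decaying(1)[OF sc(1)])
  interpret l: decaying_solution "\<lambda>i. gs \<eta> (sc k) (t - int i) t" "\<lambda>i. pot (sc k) (\<eta> (t - int i))"
    by (rule gs_decaying(2)[OF sc(1)])
  show 1: "0 \<le> gs \<eta> (sc k) t t - gs \<eta> (sc k) (t + 1) t" using r.drop_nonneg[of 0] by (simp add: r.drop_def)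
  show 2: "0 \<le> gs \<eta> (sc k) t t - gs \<eta> (sc k) (t - 1) t" using l.drop_nonneg[of 0] by (simp add: l.drop_def)
  have "0 \<le> pot (sc k) (\<eta> t) * gs \<eta> (sc k) t t"
    using pot_nonneg[of "sc k"] gs_nonneg sc(1)[of k] by (intro mult_nonneg_nonneg) auto
  then show "gs \<eta> (sc k) t t - gs \<eta> (sc k) (t + 1) t \<le> 6"
    using spine_drops[of \<eta> k t] spine_source_le[of k \<eta> t] 2 by linarith
qed

lemma gs_reverse_le: "gs \<eta> (sc k) x y \<le> 3 / 2 * gs \<eta> (sc k) y x"
proof -
  have "2 * gs \<eta> (sc k) x y \<le> deg (comb \<eta>) (x, 0) * gs \<eta> (sc k) x y"
    using deg_spine_bounds[of \<eta> x] gs_nonneg[OF sc(1)] by (intro mult_right_mono) auto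
  also have "\<dots> = deg (comb \<eta>) (y, 0) * gs \<eta> (sc k) y x"
    unfolding gs_eq_green using sk[of k] by (intro comb.green_reversible) auto
  also have "\<dots> \<le> 3 * gs \<eta> (sc k) y x"
    using deg_spine_bounds[of \<eta> y] gs_nonneg[OF sc(1)] by (intro mult_right_mono) auto
  finally show ?thesis by simp
qed

context iid_env begin

definition damp :: "nat \<Rightarrow> int \<Rightarrow> nat \<Rightarrow> (int \<Rightarrow> nat) \<Rightarrow> real" where
  "damp k a n \<eta> = (\<Prod>j<n. if 1 / real (len k) \<le> bsum k a j \<eta> then 1 / 2 else 1)"

lemma damp_nonneg: "0 \<le> damp k a n \<eta>"
  unfolding damp_def by (intro prod_nonneg) auto

text \<open>A good block \<open>j\<close> halves the solution within 2 \<open>len k\<close> (j + 1)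
  sites, and the first drop is at most 6, so \<open>w0_le\<close> gives 2 * 6 * 2 = 24. For the
  second claim each good block passed contributes a factor 1/2 and a bad one at least does not
  increase the solution.\<close>

lemma
  shows gs_le_good: "1 / real (len k) \<le> bsum k t j \<eta> \<Longrightarrow> gs \<eta> (sc k) t t \<le> real (len k) * (24 * real (Suc j))"
    and gs_le_damp: "gs \<eta> (sc k) (t + int y) t \<le> gs \<eta> (sc k) t t * damp k t (y div (2 * len k)) \<eta>"
proof -
  interpret r: decaying_solution "\<lambda>i. gs \<eta> (sc k) (t + int i) t" "\<lambda>i. pot (sc k) (\<eta> (t + int i))"
    by (rule gs_decaying(1)[OF sc(1)])
  let ?w = "\<lambda>i. gs \<eta> (sc k) (t + int i) t"
  have halve: "?w (2 * len k * Suc j) \<le> ?w (2 * len k * j) / 2" if "1 / real (len k) \<le> bsum k t j \<eta>" for j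
  proof -
    have "?w (2 * len k * j + 2 * len k) \<le> ?w (2 * len k * j) / 2"
      using that by (intro r.block_halves len_pos) (simp add: bsum_def)
    then show ?thesis by (simp add: algebra_simps)
  qed
  show "gs \<eta> (sc k) t t \<le> real (len k) * (24 * real (Suc j))" if "1 / real (len k) \<le> bsum k t j \<eta>"
  proof -
    have "?w (2 * len k * Suc j) \<le> ?w 0 / 2"
      using halve[OF that] r.w_antimono[of 0 "2 * len k * j"] by simp
    then have "?w 0 \<le> 2 * 6 * real (2 * len k * Suc j)"
      by (rule r.w0_le) (use spine_drop_bounds(2)[of \<eta> k t] in \<open>simp add: r.drop_def\<close>)
    then show ?thesis by (simp add: algebra_simps)
  qed
  have "?w (2 * len k * n) \<le> ?w 0 * damp k t n \<eta>" for n
  proof (induction n)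
    case 0 then show ?case by (simp add: damp_def)
  next
    case (Suc n)
    show ?case
    proof (cases "1 / real (len k) \<le> bsum k t n \<eta>")
      case True
      then show ?thesis using halve[OF True] Suc by (simp add: damp_def)
    next
      case False
      then show ?thesis using r.w_antimono[of "2 * len k * n" "2 * len k * Suc n"] Suc by (simp add: damp_def)
    qed
  qed
  from this[of "y div (2 * len k)"] r.w_antimono[of "2 * len k * (y div (2 * len k))" y]
  show "gs \<eta> (sc k) (t + int y) t \<le> gs \<eta> (sc k) t t * damp k t (y div (2 * len k)) \<eta>"
    by simp
qed

lemma measurable_damp [measurable]: "damp k a n \<in> borel_measurable Q"
  unfolding damp_def[abs_def] by measurable

text \<open>Per block the mean is at most 1/16 + (15/16) (1/2) = 17/32, rounded up to 9/16 because
  its square root 3/4 is rational.\<close>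

lemma damp_moment: "(\<integral>\<^sup>+\<eta>. ennreal (damp k a n \<eta> ^ 4) \<partial>Q) \<le> ennreal ((9 / 16) ^ n)"
proof -
  define \<phi> :: "real \<Rightarrow> ennreal" where "\<phi> x = (if 1 / real (len k) \<le> x then ennreal (1 / 16) else 1)" for x
  have [measurable]: "\<phi> \<in> borel_measurable borel" unfolding \<phi>_def by measurable
  have "ennreal (damp k a n \<eta> ^ 4) = (\<Prod>j<n. \<phi> (bsum k a j \<eta>))" for \<eta>
  proof -
    have "damp k a n \<eta> ^ 4 = (\<Prod>j<n. (if 1 / real (len k) \<le> bsum k a j \<eta> then 1 / 2 else 1) ^ 4)"
      unfolding damp_def by (rule prod_power_distrib)
    then have "ennreal (damp k a n \<eta> ^ 4) = (\<Prod>j<n. ennreal ((if 1 / real (len k) \<le> bsum k a j \<eta> then 1 / 2 else 1) ^ 4))"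
      by (simp add: prod_ennreal)
    also have "\<dots> = (\<Prod>j<n. \<phi> (bsum k a j \<eta>))"
      by (intro prod.cong refl) (auto simp: \<phi>_def power_divide)
    finally show ?thesis .
  qed
  moreover have "(\<integral>\<^sup>+\<eta>. (\<Prod>j<n. \<phi> (bsum k a j \<eta>)) \<partial>Q) \<le> ennreal (9 / 16) ^ n"
  proof (rule block_product_le)
    fix j
    have "\<phi> x \<le> ennreal (1 / 16) + ennreal (15 / 16) * indicator {..<1 / real (len k)} x" for x
      unfolding \<phi>_def by (auto simp: indicator_def ennreal_plus[symmetric] simp del: ennreal_plus)
    then have "(\<integral>\<^sup>+\<eta>. \<phi> (bsum k a j \<eta>) \<partial>Q) \<le> (\<integral>\<^sup>+\<eta>. ennreal (1 / 16) + ennreal (15 / 16) * indicator {..<1 / real (len k)} (bsum k a j \<eta>) \<partial>Q)"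
      by (intro nn_integral_mono)
    also have "\<dots> = ennreal (1 / 16) + ennreal (15 / 16) * (\<integral>\<^sup>+\<eta>. indicator {..<1 / real (len k)} (bsum k a j \<eta>) \<partial>Q)"
      using Q.emeasure_space_1 by (subst nn_integral_add) (auto simp: nn_integral_cmult)
    also have "\<dots> \<le> ennreal (1 / 16) + ennreal (15 / 16) * ennreal (1 / 2)"
      by (intro add_left_mono mult_left_mono bad_block) auto
    also have "\<dots> = ennreal (1 / 16 + 15 / 16 * (1 / 2))"
      by (subst ennreal_mult[symmetric]) (auto simp: ennreal_plus[symmetric] simp del: ennreal_plus)
    also have "\<dots> \<le> ennreal (9 / 16)" by (intro ennreal_leI) simp
    finally show "(\<integral>\<^sup>+\<eta>. \<phi> (bsum k a j \<eta>) \<partial>Q) \<le> ennreal (9 / 16)" .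
  qed measurable
  ultimately show ?thesis by (simp add: ennreal_power)
qed

text \<open>Decompose by the first good block \<open>j\<close>: the value is then at most 24 (j + 1)
  \<open>len k\<close>, and the \<open>j\<close> blocks before it are bad, which has probability at
  most 2^(-j).\<close>

lemma gs_moment: "(\<integral>\<^sup>+\<eta>. ennreal (gs \<eta> (sc k) t t ^ 8) \<partial>Q) \<le> ennreal (real (len k) ^ 8 * M8)"
proof -
  let ?C = "count_space (UNIV :: nat set)"
  define b where "b j = (real (len k) * (24 * real (Suc j))) ^ 8" for j
  have b0: "0 \<le> b j" for j by (simp add: b_def)
  let ?bad = "\<lambda>j \<eta>. indicator {..<1 / real (len k)} (bsum k t j \<eta>) :: ennreal"
  have pt: "ennreal (gs \<eta> (sc k) t t ^ 8) \<le> (\<integral>\<^sup>+j. ennreal (b j) * (\<Prod>i<j. ?bad i \<eta>) \<partial>?C)" for \<eta>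
  proof (cases "\<exists>j. 1 / real (len k) \<le> bsum k t j \<eta>")
    case True
    define j where "j = (LEAST j. 1 / real (len k) \<le> bsum k t j \<eta>)"
    have j: "1 / real (len k) \<le> bsum k t j \<eta>" unfolding j_def using True by (rule LeastI_ex)
    have before: "?bad i \<eta> = 1" if "i < j" for i
      using not_less_Least[of i "\<lambda>j. 1 / real (len k) \<le> bsum k t j \<eta>"] that by (simp add: j_def)
    have "ennreal (gs \<eta> (sc k) t t ^ 8) \<le> ennreal (b j)"
      unfolding b_def using gs_le_good[OF j] gs_nonneg[OF sc(1)] by (intro ennreal_leI power_mono) auto
    also have "\<dots> = ennreal (b j) * (\<Prod>i<j. ?bad i \<eta>)" using before by simp
    also have "\<dots> \<le> (\<integral>\<^sup>+j. ennreal (b j) * (\<Prod>i<j. ?bad i \<eta>) \<partial>?C)"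
      by (rule nn_integral_ge_point) simp
    finally show ?thesis .
  next
    \<comment> \<open>If no block is good, the right-hand side is a sum of infinitely many terms
      that are at least 1.\<close>
    case False
    then have bad: "?bad i \<eta> = 1" for i by (simp add: not_le)
    have "(\<integral>\<^sup>+j. ennreal (1 :: real) \<partial>?C) \<le> (\<integral>\<^sup>+j. ennreal (b j) * (\<Prod>i<j. ?bad i \<eta>) \<partial>?C)"
    proof (intro nn_integral_mono)
      fix j
      have "1 \<le> real (len k) * (24 * real (Suc j))"
        using mult_mono[of 1 "real (len k)" 1 "24 * real (Suc j)"] len_pos[of k] by simp
      then have "1 \<le> b j" unfolding b_def by (rule one_le_power)
      then show "ennreal 1 \<le> ennreal (b j) * (\<Prod>i<j. ?bad i \<eta>)" by (simp add: bad)
    qed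
    then show ?thesis by (simp add: top_unique)
  qed
  have "(\<integral>\<^sup>+\<eta>. ennreal (gs \<eta> (sc k) t t ^ 8) \<partial>Q) \<le> (\<integral>\<^sup>+\<eta>. \<integral>\<^sup>+j. ennreal (b j) * (\<Prod>i<j. ?bad i \<eta>) \<partial>?C \<partial>Q)"
    by (intro nn_integral_mono pt)
  also have "\<dots> = (\<integral>\<^sup>+j. \<integral>\<^sup>+\<eta>. ennreal (b j) * (\<Prod>i<j. ?bad i \<eta>) \<partial>Q \<partial>?C)"
    by (intro nn_integral_count_space_nn_integral) auto
  also have "\<dots> = (\<integral>\<^sup>+j. ennreal (b j) * (\<integral>\<^sup>+\<eta>. (\<Prod>i<j. ?bad i \<eta>) \<partial>Q) \<partial>?C)"
    by (intro nn_integral_cong nn_integral_cmult) measurable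
  also have "\<dots> \<le> (\<integral>\<^sup>+j. ennreal (b j) * ennreal (1 / 2) ^ j \<partial>?C)"
    by (intro nn_integral_mono mult_left_mono block_product_le bad_block) auto
  also have "\<dots> = (\<Sum>j. ennreal (real (len k) ^ 8 * ((24 * real (Suc j)) ^ 8 * (1 / 2) ^ j)))"
    unfolding nn_integral_count_space_nat
    by (intro arg_cong[where f=suminf] ext)
      (simp only: ennreal_power ennreal_mult[symmetric] b_def power_mult_distrib mult.assoc zero_le_power
        zero_le_mult_iff of_nat_0_le_iff zero_le_numeral simp_thms divide_nonneg_nonneg zero_le_one)
  also have "\<dots> = ennreal (real (len k) ^ 8 * M8)"
    unfolding M8_def using summable_pow8 by (intro suminf_ennreal_eq sums_mult summable_sums) auto
  finally show ?thesis .
qed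

definition Cg :: real where "Cg = sqrt (108 * exp 8 * (1 + M8))"

text \<open>Bound for the L2 norm of \<open>gterm\<close> between 0 and \<open>y\<close>, with a
  fixed rate of decay per block of length 2 \<open>len k\<close>.\<close>

definition gw :: "nat \<Rightarrow> int \<Rightarrow> real" where
  "gw k y = Cg * (1 / 4) ^ k * (real (len k))\<^sup>2 * (9 / 10) ^ (nat \<bar>y\<bar> div (2 * len k))"

text \<open>\<open>damp\<close> describes decay to the right of the source only, so a pair with
  negative \<open>y\<close> is first shifted into position; hence the two orders of the arguments.
  The 6 is 4 times the reversal factor 3/2.\<close>

lemma gterm_le:
  fixes y k :: nat
  defines "h \<equiv> \<lambda>\<eta>. 6 * exp 4 * (1 / 4) ^ k * (gs \<eta> (sc k) 0 0 * damp k 0 (y div (2 * len k)) \<eta>) *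
    (gs \<eta> (sc k) 0 0 + gs \<eta> (sc k) (int y) (int y))"
  shows "gterm \<eta> k 0 (int y) \<le> h \<eta>" "gterm \<eta> k (int y) 0 \<le> h \<eta>"
proof -
  let ?u = "gs \<eta> (sc k) 0 0" and ?v = "gs \<eta> (sc k) (int y) (int y)" and ?D = "damp k 0 (y div (2 * len k)) \<eta>"
  have nn: "0 \<le> ?u" "0 \<le> ?v" "0 \<le> ?u * ?D" using gs_nonneg[OF sc(1)] damp_nonneg by auto
  have 1: "gs \<eta> (sc k) (int y) 0 \<le> ?u * ?D" using gs_le_damp[of \<eta> k 0 y] by simp
  then have 2: "gs \<eta> (sc k) 0 (int y) \<le> 3 / 2 * (?u * ?D)" using gs_reverse_le[of \<eta> k 0 "int y"] by simp
  have 3: "gs \<eta> (sc k) (int y) 0 \<le> 3 / 2 * (?u * ?D)" using 1 nn by simp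
  have main: "4 * exp 4 * (1 / 4) ^ k * g * (?u + ?v) \<le> h \<eta>" if "g \<le> 3 / 2 * (?u * ?D)" for g
  proof -
    have "4 * exp 4 * (1 / 4) ^ k * g * (?u + ?v) \<le> 4 * exp 4 * (1 / 4) ^ k * (3 / 2 * (?u * ?D)) * (?u + ?v)"
      using that nn by (intro mult_right_mono mult_left_mono) auto
    then show ?thesis by (simp add: h_def)
  qed
  show "gterm \<eta> k 0 (int y) \<le> h \<eta>" unfolding gterm_def by (rule main[OF 2])
  show "gterm \<eta> k (int y) 0 \<le> h \<eta>" unfolding gterm_def using main[OF 3] by (simp add: add.commute)
qed

text \<open>The damping factor and the two Green functions are dependent. The inequality of
  arithmetic and geometric means separates them, d^2 x^4 <= (t d^4 + x^8 / t) / 2, so that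
  \<open>damp_moment\<close> and \<open>gs_moment\<close> suffice.\<close>

lemma gterm_moment_aux:
  fixes y :: nat and g :: "(int \<Rightarrow> nat) \<Rightarrow> real"
  assumes g: "\<And>\<eta>. 0 \<le> g \<eta>" "\<And>\<eta>. g \<eta> \<le> 6 * exp 4 * (1 / 4) ^ k * (gs \<eta> (sc k) 0 0 * damp k 0 (y div (2 * len k)) \<eta>) *
    (gs \<eta> (sc k) 0 0 + gs \<eta> (sc k) (int y) (int y))"
  shows "(\<integral>\<^sup>+\<eta>. ennreal ((g \<eta>)\<^sup>2) \<partial>Q) \<le> ennreal ((gw k (int y))\<^sup>2)"
proof -
  define n where "n = y div (2 * len k)"
  define l where "l = real (len k)"
  \<comment> \<open>Balances the two parts: both t (9/16)^n and l^8 / t become l^4 (3/4)^n. Finally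
    3/4 <= (9/10)^2 allows taking a root.\<close>
  define t where "t = l ^ 4 * (4 / 3) ^ n"
  define A where "A = 108 * exp 8 * (1 / 16 :: real) ^ k"
  have l: "0 < l" using len_pos[of k] by (simp add: l_def)
  have t: "0 < t" using l by (simp add: t_def)
  have A: "0 \<le> A" by (simp add: A_def)
  let ?u = "\<lambda>\<eta>. gs \<eta> (sc k) 0 0" and ?v = "\<lambda>\<eta>. gs \<eta> (sc k) (int y) (int y)" and ?D = "damp k 0 n"
  have pt: "(g \<eta>)\<^sup>2 \<le> A * t * ?D \<eta> ^ 4 + A / (2 * t) * ?u \<eta> ^ 8 + A / (2 * t) * ?v \<eta> ^ 8" for \<eta>
  proof -
    define u v d where "u = ?u \<eta>" and "v = ?v \<eta>" and "d = ?D \<eta>"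
    have nn: "0 \<le> u" "0 \<le> v" "0 \<le> d" using gs_nonneg[OF sc(1)] damp_nonneg by (auto simp: u_def v_def d_def)
    have amgm: "d\<^sup>2 * x ^ 4 \<le> (t * d ^ 4 + x ^ 8 / t) / 2" for x :: real
    proof -
      have "0 \<le> (t * d\<^sup>2 - x ^ 4)\<^sup>2 / (2 * t)" using t by simp
      also have "\<dots> = (t * d ^ 4 + x ^ 8 / t) / 2 - d\<^sup>2 * x ^ 4"
        using t by (simp add: power2_eq_square field_simps power_add[symmetric] flip: power_mult)
          (simp add: algebra_simps eval_nat_numeral)
      finally show ?thesis by simp
    qed
    have uv: "u\<^sup>2 * (u + v)\<^sup>2 \<le> 3 * (u ^ 4 + v ^ 4)"
    proof -
      have "(u + v)\<^sup>2 \<le> 2 * (u\<^sup>2 + v\<^sup>2)" using sum_squares_bound[of u v] by (simp add: power2_sum)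
      then have "u\<^sup>2 * (u + v)\<^sup>2 \<le> u\<^sup>2 * (2 * (u\<^sup>2 + v\<^sup>2))" by (intro mult_left_mono) auto
      also have "\<dots> = 2 * u ^ 4 + 2 * (u\<^sup>2 * v\<^sup>2)" by (simp add: algebra_simps power_add[symmetric])
      also have "2 * (u\<^sup>2 * v\<^sup>2) \<le> u ^ 4 + v ^ 4"
        using sum_squares_bound[of "u\<^sup>2" "v\<^sup>2"] by (simp add: power_mult[symmetric])
      finally have "u\<^sup>2 * (u + v)\<^sup>2 \<le> 3 * u ^ 4 + v ^ 4" by simp
      moreover have "0 \<le> v ^ 4" by simp
      ultimately show ?thesis by argo
    qed
    have "(g \<eta>)\<^sup>2 \<le> (6 * exp 4 * (1 / 4) ^ k * (u * d) * (u + v))\<^sup>2"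
      using g[of \<eta>] by (intro power_mono) (auto simp: u_def v_def d_def n_def)
    also have "\<dots> = 36 * (exp 4)\<^sup>2 * ((1 / 4) ^ k)\<^sup>2 * (d\<^sup>2 * (u\<^sup>2 * (u + v)\<^sup>2))"
      by (simp add: power_mult_distrib)
    also have "\<dots> \<le> 36 * (exp 4)\<^sup>2 * ((1 / 4) ^ k)\<^sup>2 * (d\<^sup>2 * (3 * (u ^ 4 + v ^ 4)))"
      using uv by (intro mult_left_mono) auto
    also have "\<dots> = A * (d\<^sup>2 * u ^ 4 + d\<^sup>2 * v ^ 4)"
    proof -
      have "(exp 4 :: real)\<^sup>2 = exp 8" by (simp add: exp_double[symmetric])
      moreover have "((1 / 4 :: real) ^ k)\<^sup>2 = (1 / 16) ^ k"
        unfolding power2_eq_square power_mult_distrib[symmetric] by simp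
      ultimately show ?thesis by (simp add: A_def algebra_simps)
    qed
    also have "\<dots> \<le> A * ((t * d ^ 4 + u ^ 8 / t) / 2 + (t * d ^ 4 + v ^ 8 / t) / 2)"
      using A by (intro mult_left_mono add_mono amgm) auto
    also have "\<dots> = A * t * d ^ 4 + A / (2 * t) * u ^ 8 + A / (2 * t) * v ^ 8"
      using t by (simp add: field_simps)
    finally show ?thesis by (simp add: u_def v_def d_def)
  qed
  have "(\<integral>\<^sup>+\<eta>. ennreal ((g \<eta>)\<^sup>2) \<partial>Q) \<le>
      (\<integral>\<^sup>+\<eta>. ennreal (A * t) * ennreal (?D \<eta> ^ 4) + ennreal (A / (2 * t)) * ennreal (?u \<eta> ^ 8) + ennreal (A / (2 * t)) * ennreal (?v \<eta> ^ 8) \<partial>Q)"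
  proof (intro nn_integral_mono)
    fix \<eta>
    have nn: "0 \<le> ?D \<eta> ^ 4" "0 \<le> ?u \<eta> ^ 8" "0 \<le> ?v \<eta> ^ 8" using gs_nonneg[OF sc(1)] damp_nonneg by auto
    have "ennreal ((g \<eta>)\<^sup>2) \<le> ennreal (A * t * ?D \<eta> ^ 4 + A / (2 * t) * ?u \<eta> ^ 8 + A / (2 * t) * ?v \<eta> ^ 8)"
      by (intro ennreal_leI pt)
    also have "\<dots> = ennreal (A * t) * ennreal (?D \<eta> ^ 4) + ennreal (A / (2 * t)) * ennreal (?u \<eta> ^ 8) + ennreal (A / (2 * t)) * ennreal (?v \<eta> ^ 8)"
      using A t nn by (simp add: ennreal_mult[symmetric] ennreal_plus[symmetric] del: ennreal_plus)
    finally show "ennreal ((g \<eta>)\<^sup>2) \<le> \<dots>" .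
  qed
  also have "\<dots> = ennreal (A * t) * (\<integral>\<^sup>+\<eta>. ennreal (?D \<eta> ^ 4) \<partial>Q) + ennreal (A / (2 * t)) * (\<integral>\<^sup>+\<eta>. ennreal (?u \<eta> ^ 8) \<partial>Q)
      + ennreal (A / (2 * t)) * (\<integral>\<^sup>+\<eta>. ennreal (?v \<eta> ^ 8) \<partial>Q)"
    by (simp add: nn_integral_add nn_integral_cmult)
  also have "\<dots> \<le> ennreal (A * t) * ennreal ((9 / 16) ^ n) + ennreal (A / (2 * t)) * ennreal (l ^ 8 * M8) + ennreal (A / (2 * t)) * ennreal (l ^ 8 * M8)"
    unfolding l_def by (intro add_mono mult_left_mono damp_moment gs_moment) auto
  also have "\<dots> = ennreal (A * t * (9 / 16) ^ n + A / (2 * t) * (l ^ 8 * M8) + A / (2 * t) * (l ^ 8 * M8))"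
    using A t l M8_nonneg by (simp add: ennreal_mult[symmetric] ennreal_plus[symmetric] del: ennreal_plus)
  also have "A * t * (9 / 16) ^ n + A / (2 * t) * (l ^ 8 * M8) + A / (2 * t) * (l ^ 8 * M8) = A * l ^ 4 * (3 / 4) ^ n * (1 + M8)"
  proof -
    have q1: "(4 / 3 :: real) ^ n * (9 / 16) ^ n = (3 / 4) ^ n"
      unfolding power_mult_distrib[symmetric] by simp
    have 1: "t * (9 / 16) ^ n = l ^ 4 * (3 / 4) ^ n"
      unfolding t_def mult.assoc q1 ..
    have "l ^ 8 = (l ^ 4 * (3 / 4) ^ n) * t"
    proof -
      have "(3 / 4 :: real) ^ n * (4 / 3) ^ n = 1" unfolding power_mult_distrib[symmetric] by simp
      then have "(l ^ 4 * (3 / 4) ^ n) * (l ^ 4 * (4 / 3) ^ n) = l ^ 4 * l ^ 4"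
        by (simp add: mult.assoc mult.left_commute[of "(3 / 4) ^ n"])
      then show ?thesis by (simp add: t_def power_add[symmetric])
    qed
    then have 2: "A / (2 * t) * (l ^ 8 * M8) = A * (l ^ 4 * (3 / 4) ^ n) * M8 / 2" using t by simp
    show ?thesis unfolding 2 mult.assoc[of A t] 1 by (simp add: algebra_simps)
  qed
  also have "\<dots> \<le> (gw k (int y))\<^sup>2"
  proof -
    have "(3 / 4 :: real) ^ n \<le> ((9 / 10)\<^sup>2) ^ n" by (intro power_mono) (auto simp: power2_eq_square)
    also have "\<dots> = ((9 / 10) ^ n)\<^sup>2" by (simp only: power_mult[symmetric] mult.commute)
    finally have q: "(3 / 4 :: real) ^ n \<le> ((9 / 10) ^ n)\<^sup>2" .
    have k4: "((1 / 4 :: real) ^ k)\<^sup>2 = (1 / 16) ^ k"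
      unfolding power2_eq_square power_mult_distrib[symmetric] by simp
    have cg: "Cg\<^sup>2 = 108 * exp 8 * (1 + M8)" using M8_nonneg by (simp add: Cg_def)
    have "A * l ^ 4 * (3 / 4) ^ n * (1 + M8) \<le> A * l ^ 4 * ((9 / 10) ^ n)\<^sup>2 * (1 + M8)"
      using A l M8_nonneg q by (intro mult_right_mono mult_left_mono) auto
    also have "\<dots> = (gw k (int y))\<^sup>2"
      unfolding gw_def power_mult_distrib cg k4 A_def l_def n_def by (simp add: power_mult[symmetric])
    finally show ?thesis .
  qed
  finally show ?thesis by (simp add: ennreal_leI)
qed

lemma gterm_moment: "(\<integral>\<^sup>+\<eta>. ennreal ((gterm \<eta> k 0 y)\<^sup>2) \<partial>Q) \<le> ennreal ((gw k y)\<^sup>2)"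
proof (cases "0 \<le> y")
  case True
  then obtain n where y: "y = int n" by (metis nonneg_int_cases)
  show ?thesis unfolding y by (rule gterm_moment_aux[OF gterm_nonneg gterm_le(1)])
next
  case False
  then obtain n where y: "y = - int n" by (metis int_cases2 of_nat_0_le_iff)
  have "(\<integral>\<^sup>+\<eta>. ennreal ((gterm \<eta> k 0 y)\<^sup>2) \<partial>Q) = (\<integral>\<^sup>+\<eta>. ennreal ((gterm (shift y \<eta>) k (int n) 0)\<^sup>2) \<partial>Q)"
    by (simp add: gterm_shift y)
  also have "\<dots> = (\<integral>\<^sup>+\<eta>. ennreal ((gterm \<eta> k (int n) 0)\<^sup>2) \<partial>Q)"
    by (rule nn_integral_shift) measurable
  also have "\<dots> \<le> ennreal ((gw k (int n))\<^sup>2)"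
    by (rule gterm_moment_aux[OF gterm_nonneg gterm_le(2)])
  also have "gw k (int n) = gw k y" by (simp add: gw_def y)
  finally show ?thesis .
qed

end

lemma ennreal_integral_le_nn_integral:
  fixes f :: "'a \<Rightarrow> real"
  assumes f: "integrable M f"
  shows "ennreal (\<integral>x. f x \<partial>M) \<le> (\<integral>\<^sup>+x. ennreal (f x) \<partial>M)"
proof -
  have int: "integrable M (\<lambda>x. max 0 (f x))" using f by auto
  have "ennreal (\<integral>x. f x \<partial>M) \<le> ennreal (\<integral>x. max 0 (f x) \<partial>M)"
    using f int by (intro ennreal_leI integral_mono) auto
  also have "\<dots> = (\<integral>\<^sup>+x. ennreal (max 0 (f x)) \<partial>M)"
    by (rule nn_integral_eq_integral[OF int, symmetric]) simp
  also have "\<dots> = (\<integral>\<^sup>+x. ennreal (f x) \<partial>M)"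
    by (intro nn_integral_cong) (simp add: ennreal_neg max_def)
  finally show ?thesis .
qed

lemma nn_integral_geometric_blocks:
  assumes m: "0 < m"
  shows "(\<integral>\<^sup>+n. ennreal ((9 / 10) ^ (n div m)) \<partial>count_space UNIV) \<le> ennreal (10 * real m)"
proof -
  have part: "(\<Sum>n<N * m. (9 / 10 :: real) ^ (n div m)) \<le> 10 * real m" for N
  proof -
    have "(\<Sum>n<N * m. (9 / 10 :: real) ^ (n div m)) = (\<Sum>q<N. sum (\<lambda>n. (9 / 10) ^ (n div m)) {q * m..<q * m + m})"
      by (rule sum.nat_group[symmetric])
    also have "\<dots> = (\<Sum>q<N. real m * (9 / 10) ^ q)"
    proof (intro sum.cong refl)
      fix q
      have "sum (\<lambda>n. (9 / 10 :: real) ^ (n div m)) {q * m..<q * m + m} = sum (\<lambda>n. (9 / 10) ^ q) {q * m..<q * m + m}"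
      proof (intro sum.cong refl)
        fix n assume "n \<in> {q * m..<q * m + m}"
        then have "n div m = q" using m by (intro div_nat_eqI) (auto simp: mult.commute)
        then show "(9 / 10 :: real) ^ (n div m) = (9 / 10) ^ q" by simp
      qed
      then show "sum (\<lambda>n. (9 / 10 :: real) ^ (n div m)) {q * m..<q * m + m} = real m * (9 / 10) ^ q" by simp
    qed
    also have "\<dots> = real m * (\<Sum>q<N. (9 / 10) ^ q)" by (simp add: sum_distrib_left)
    also have "(\<Sum>q<N. (9 / 10 :: real) ^ q) = 10 * (1 - (9 / 10) ^ N)" by (simp add: sum_gp_strict)
    also have "real m * (10 * (1 - (9 / 10) ^ N)) \<le> real m * 10" by (intro mult_left_mono) auto
    finally show ?thesis by simp
  qed
  have "(\<integral>\<^sup>+n. ennreal ((9 / 10) ^ (n div m)) \<partial>count_space UNIV) = (SUP N. \<Sum>n<N. ennreal ((9 / 10) ^ (n div m)))"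
    unfolding nn_integral_count_space_nat by (rule suminf_eq_SUP)
  also have "\<dots> \<le> ennreal (10 * real m)"
  proof (rule SUP_least)
    fix N
    have "(\<Sum>n<N. ennreal ((9 / 10) ^ (n div m))) = ennreal (\<Sum>n<N. (9 / 10) ^ (n div m))"
      by (intro sum_ennreal) auto
    also have "\<dots> \<le> ennreal (\<Sum>n<N * m. (9 / 10) ^ (n div m))"
      using m by (intro ennreal_leI sum_mono2) auto
    also have "\<dots> \<le> ennreal (10 * real m)" by (intro ennreal_leI part)
    finally show "(\<Sum>n<N. ennreal ((9 / 10) ^ (n div m))) \<le> ennreal (10 * real m)" .
  qed
  finally show ?thesis .
qed

lemma nn_integral_abs_int_le:
  fixes f :: "nat \<Rightarrow> ennreal"
  shows "(\<integral>\<^sup>+y. f (nat \<bar>y\<bar>) \<partial>count_space (UNIV :: int set)) \<le> 2 * (\<integral>\<^sup>+n. f n \<partial>count_space UNIV)"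
proof -
  let ?Y = "count_space (UNIV :: int set)"
  have pos: "(\<integral>\<^sup>+y. f (nat \<bar>y\<bar>) * indicator {0..} y \<partial>?Y) = (\<integral>\<^sup>+n. f n \<partial>count_space UNIV)"
  proof -
    have "(\<integral>\<^sup>+y. f (nat \<bar>y\<bar>) * indicator {0..} y \<partial>?Y) = (\<integral>\<^sup>+y. f (nat \<bar>y\<bar>) \<partial>count_space {0::int..})"
      by (rule nn_integral_count_space_indicator[symmetric]) simp
    also have "\<dots> = (\<integral>\<^sup>+n. f (nat \<bar>int n\<bar>) \<partial>count_space UNIV)"
      by (rule nn_integral_bij_count_space[symmetric])
        (auto simp: bij_betw_def inj_on_def image_iff intro: nonneg_int_cases)
    finally show ?thesis by simp
  qed
  have neg: "(\<integral>\<^sup>+y. f (nat \<bar>y\<bar>) * indicator {..0} y \<partial>?Y) = (\<integral>\<^sup>+n. f n \<partial>count_space UNIV)"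
  proof -
    have "(\<integral>\<^sup>+y. f (nat \<bar>y\<bar>) * indicator {..0} y \<partial>?Y) = (\<integral>\<^sup>+y. f (nat \<bar>y\<bar>) \<partial>count_space {..0::int})"
      by (rule nn_integral_count_space_indicator[symmetric]) simp
    also have "\<dots> = (\<integral>\<^sup>+n. f (nat \<bar>- int n\<bar>) \<partial>count_space UNIV)"
      by (rule nn_integral_bij_count_space[symmetric])
        (auto simp: bij_betw_def inj_on_def image_iff intro: nonpos_int_cases)
    finally show ?thesis by simp
  qed
  have "(\<integral>\<^sup>+y. f (nat \<bar>y\<bar>) \<partial>?Y) \<le> (\<integral>\<^sup>+y. f (nat \<bar>y\<bar>) * indicator {0..} y + f (nat \<bar>y\<bar>) * indicator {..0} y \<partial>?Y)"
    by (intro nn_integral_mono) (auto simp: indicator_def)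
  also have "\<dots> = 2 * (\<integral>\<^sup>+n. f n \<partial>count_space UNIV)"
    by (subst nn_integral_add) (auto simp: pos neg mult_2)
  finally show ?thesis .
qed

lemma one_minus_sk_ge: "(1 / 4) ^ k / 4 \<le> 1 - sk k"
proof -
  have c: "1 + (1 / 4) ^ k / 2 \<le> cosh (sc k)" using cosh_ge[of "sc k"] by (simp add: sc(3))
  have "(1 / 4) ^ k / 4 * cosh (sc k) \<le> (1 / 4) ^ k / 4 * 2"
    using cosh_sc_le[of k] by (intro mult_left_mono) auto
  also have "\<dots> \<le> cosh (sc k) - 1" using c by simp
  finally show ?thesis
    using cosh_real_pos[of "sc k"] by (simp add: sk_def field_simps)
qed

text \<open>At least 2 is injected at the origin. By \<open>drop_le\<close> on both sides the
  outflow is at most the value at the origin times \<open>X\<close>; the rest is the tangent to 2 /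
  X at \<tau>.\<close>

lemma gs_origin_ge:
  fixes \<tau> :: real and k :: nat
  defines "X \<equiv> \<lambda>\<eta> R. (\<Sum>j=1..R. pot (sc k) (\<eta> (int j))) + (\<Sum>j=1..R. pot (sc k) (\<eta> (- int j))) + pot (sc k) (\<eta> 0) + 2 / real R"
  assumes R: "0 < R" and \<tau>: "0 < \<tau>"
  shows "4 / \<tau> - 2 * X \<eta> R / \<tau>\<^sup>2 \<le> gs \<eta> (sc k) 0 0"
proof -
  interpret r: decaying_solution "\<lambda>i. gs \<eta> (sc k) (0 + int i) 0" "\<lambda>i. pot (sc k) (\<eta> (0 + int i))"
    by (rule gs_decaying(1)[OF sc(1)])
  interpret l: decaying_solution "\<lambda>i. gs \<eta> (sc k) (0 - int i) 0" "\<lambda>i. pot (sc k) (\<eta> (0 - int i))"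
    by (rule gs_decaying(2)[OF sc(1)])
  let ?v = "gs \<eta> (sc k) 0 0" and ?X = "X \<eta> R"
  have pos: "0 < ?X"
  proof -
    have "0 < 2 / real R" using R by simp
    then show ?thesis unfolding X_def
      using pot_nonneg[of "sc k"] sc(1)[of k]
      by (intro add_nonneg_pos add_nonneg_nonneg sum_nonneg) auto
  qed
  have "2 \<le> ?v * ?X"
  proof -
    have "2 \<le> (?v - gs \<eta> (sc k) 1 0) + (?v - gs \<eta> (sc k) (- 1) 0) + pot (sc k) (\<eta> 0) * ?v"
      using spine_drops[of \<eta> k 0] spine_source_ge[of k \<eta> 0] by simp
    moreover have "?v - gs \<eta> (sc k) 1 0 \<le> ?v * ((\<Sum>j=1..R. pot (sc k) (\<eta> (int j))) + 1 / real R)"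
      using r.drop_le[OF R] unfolding r.drop_def by simp
    moreover have "?v - gs \<eta> (sc k) (- 1) 0 \<le> ?v * ((\<Sum>j=1..R. pot (sc k) (\<eta> (- int j))) + 1 / real R)"
      using l.drop_le[OF R] unfolding l.drop_def by simp
    moreover have "?v * ?X = ?v * ((\<Sum>j=1..R. pot (sc k) (\<eta> (int j))) + 1 / real R) +
        ?v * ((\<Sum>j=1..R. pot (sc k) (\<eta> (- int j))) + 1 / real R) + pot (sc k) (\<eta> 0) * ?v"
      by (simp add: X_def algebra_simps)
    ultimately show ?thesis by linarith
  qed
  then have v: "2 / ?X \<le> ?v" using pos by (simp add: pos_divide_le_eq)
  have "0 \<le> (?X - \<tau>)\<^sup>2 / (?X * \<tau>\<^sup>2)" using pos by simp
  also have "\<dots> = 1 / ?X - (2 / \<tau> - ?X / \<tau>\<^sup>2)"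
    using pos \<tau> by (simp add: field_simps power2_eq_square)
  finally have "2 / \<tau> - ?X / \<tau>\<^sup>2 \<le> 1 / ?X" by simp
  then have "2 * (2 / \<tau> - ?X / \<tau>\<^sup>2) \<le> 2 / ?X" by simp
  then show ?thesis using v by (simp add: algebra_simps)
qed

section \<open>Upper and lower bounds for the expected number of spine collisions\<close>

context iid_env begin

definition bb :: "nat \<Rightarrow> real" where "bb k = real (len k) ^ 3 * (1 / 4) ^ k"

lemma bb_pos: "0 < bb k"
  using len_pos[of k] by (simp add: bb_def)

lemma Cg_nonneg: "0 \<le> Cg"
  using M8_nonneg by (simp add: Cg_def)

lemma gw_nonneg: "0 \<le> gw k y"
  unfolding gw_def using Cg_nonneg by (intro mult_nonneg_nonneg) auto

lemma gw_sum: "(\<integral>\<^sup>+y. ennreal (gw k y) \<partial>count_space UNIV) \<le> ennreal (40 * Cg * bb k)"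
proof -
  define c where "c = Cg * (1 / 4) ^ k * (real (len k))\<^sup>2"
  have c: "0 \<le> c" using Cg_nonneg by (simp add: c_def)
  have "(\<integral>\<^sup>+y. ennreal (gw k y) \<partial>count_space UNIV) =
      (\<integral>\<^sup>+y. ennreal c * (\<lambda>n. ennreal ((9 / 10) ^ (n div (2 * len k)))) (nat \<bar>y\<bar>) \<partial>count_space UNIV)"
    using c by (intro nn_integral_cong) (simp add: gw_def c_def[symmetric] ennreal_mult)
  also have "\<dots> = ennreal c * (\<integral>\<^sup>+y. (\<lambda>n. ennreal ((9 / 10) ^ (n div (2 * len k)))) (nat \<bar>y\<bar>) \<partial>count_space UNIV)"
    by (rule nn_integral_cmult) simp
  also have "\<dots> \<le> ennreal c * (2 * (\<integral>\<^sup>+n. ennreal ((9 / 10) ^ (n div (2 * len k))) \<partial>count_space UNIV))"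
    by (intro mult_left_mono nn_integral_abs_int_le) auto
  also have "\<dots> \<le> ennreal c * (2 * ennreal (10 * real (2 * len k)))"
    using len_pos[of k] by (intro mult_left_mono nn_integral_geometric_blocks) auto
  also have "\<dots> = ennreal (c * (2 * (10 * real (2 * len k))))"
    using c by (simp add: ennreal_mult)
  also have "c * (2 * (10 * real (2 * len k))) = 40 * Cg * bb k"
    by (simp add: c_def bb_def power2_eq_square power3_eq_cube)
  finally show ?thesis .
qed

definition fsum :: "nat \<Rightarrow> int \<Rightarrow> (int \<Rightarrow> nat) \<Rightarrow> ennreal" where
  "fsum m x \<eta> = (\<integral>\<^sup>+y. csum \<eta> (sk m) x y \<partial>count_space UNIV)"

lemma measurable_fsum [measurable]: "fsum m x \<in> borel_measurable Q"
  unfolding fsum_def[abs_def] by (intro borel_measurable_nn_integral_count_space) auto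

text \<open>Minkowski's inequality is used twice, over the sites \<open>y\<close> within a scale and
  over the scales \<open>k\<close>, so correlations between sites or scales need no
  attention.\<close>

lemma fsum_moment:
  assumes m: "1 \<le> m"
  shows "(\<integral>\<^sup>+\<eta>. (fsum m 0 \<eta>)\<^sup>2 \<partial>Q) \<le> ennreal (32 + 2 * (40 * Cg * (\<Sum>k=1..m. bb k))\<^sup>2)"
proof -
  let ?Y = "count_space (UNIV :: int set)" and ?K = "count_space {1..m}"
  define a where "a k \<eta> = (\<integral>\<^sup>+y. ennreal (gterm \<eta> k 0 y) \<partial>?Y)" for k \<eta>
  have [measurable]: "a k \<in> borel_measurable Q" for k
    unfolding a_def[abs_def] by (intro borel_measurable_nn_integral_count_space) auto
  define w where "w k = 40 * Cg * bb k" for k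
  have w: "0 \<le> w k" for k using Cg_nonneg bb_pos[of k] by (simp add: w_def)
  have ak: "(\<integral>\<^sup>+\<eta>. (a k \<eta>)\<^sup>2 \<partial>Q) \<le> ennreal ((w k)\<^sup>2)" for k
  proof -
    have "(\<integral>\<^sup>+\<eta>. (a k \<eta>)\<^sup>2 \<partial>Q) \<le> (\<integral>\<^sup>+y. ennreal (gw k y) \<partial>?Y)\<^sup>2"
      unfolding a_def
      by (rule nn_integral_square_sum_le)
        (use gterm_moment[of k] gterm_nonneg gw_nonneg in \<open>auto simp: ennreal_power\<close>)
    also have "\<dots> \<le> (ennreal (w k))\<^sup>2"
      unfolding w_def by (intro power_mono gw_sum) auto
    finally show ?thesis using w[of k] by (simp add: ennreal_power)
  qed
  define S where "S \<eta> = (\<integral>\<^sup>+k. a k \<eta> \<partial>?K)" for \<eta>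
  have [measurable]: "S \<in> borel_measurable Q"
    unfolding S_def[abs_def] by (intro borel_measurable_nn_integral_count_space) auto
  have S2: "(\<integral>\<^sup>+\<eta>. (S \<eta>)\<^sup>2 \<partial>Q) \<le> ennreal ((40 * Cg * (\<Sum>k=1..m. bb k))\<^sup>2)"
  proof -
    have "(\<integral>\<^sup>+\<eta>. (S \<eta>)\<^sup>2 \<partial>Q) \<le> (\<integral>\<^sup>+k. ennreal (w k) \<partial>?K)\<^sup>2"
      unfolding S_def by (rule nn_integral_square_sum_le) (use ak w in auto)
    also have "(\<integral>\<^sup>+k. ennreal (w k) \<partial>?K) = ennreal (\<Sum>k=1..m. w k)"
      using w by (simp add: nn_integral_count_space_finite sum_ennreal)
    also have "(\<Sum>k=1..m. w k) = 40 * Cg * (\<Sum>k=1..m. bb k)"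
      by (simp add: w_def sum_distrib_left)
    also have "(ennreal (40 * Cg * (\<Sum>k=1..m. bb k)))\<^sup>2 = ennreal ((40 * Cg * (\<Sum>k=1..m. bb k))\<^sup>2)"
      using Cg_nonneg bb_pos by (intro ennreal_power mult_nonneg_nonneg sum_nonneg) (auto intro: less_imp_le)
    finally show ?thesis .
  qed
  have pt: "(fsum m 0 \<eta>)\<^sup>2 \<le> 32 + 2 * (S \<eta>)\<^sup>2" for \<eta>
  proof -
    have "fsum m 0 \<eta> \<le> 4 + S \<eta>"
      unfolding fsum_def S_def a_def by (rule csum_le[OF m])
    then have "(fsum m 0 \<eta>)\<^sup>2 \<le> (4 + S \<eta>)\<^sup>2" by (intro power_mono) auto
    also have "\<dots> \<le> 32 + 2 * (S \<eta>)\<^sup>2"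
    proof (cases "S \<eta>")
      case (real r)
      have "(4 + r)\<^sup>2 \<le> 32 + 2 * r\<^sup>2"
        using zero_le_power2[of "r - 4"] by (simp add: power2_eq_square algebra_simps)
      then have "ennreal ((4 + r)\<^sup>2) \<le> ennreal (32 + 2 * r\<^sup>2)" by (rule ennreal_leI)
      moreover have "(4 + S \<eta>)\<^sup>2 = ennreal ((4 + r)\<^sup>2)"
        using real by (simp add: ennreal_power[symmetric])
      moreover have "32 + 2 * (S \<eta>)\<^sup>2 = ennreal (32 + 2 * r\<^sup>2)"
        using real by (simp add: ennreal_power ennreal_mult)
      ultimately show ?thesis by simp
    next
      case top
      then show ?thesis by (simp add: power2_eq_square ennreal_mult_top)
    qed
    finally show ?thesis .
  qed
  have "(\<integral>\<^sup>+\<eta>. (fsum m 0 \<eta>)\<^sup>2 \<partial>Q) \<le> (\<integral>\<^sup>+\<eta>. 32 + 2 * (S \<eta>)\<^sup>2 \<partial>Q)"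
    by (intro nn_integral_mono pt)
  also have "\<dots> = 32 + 2 * (\<integral>\<^sup>+\<eta>. (S \<eta>)\<^sup>2 \<partial>Q)"
    using Q.emeasure_space_1 by (simp add: nn_integral_add nn_integral_cmult)
  also have "\<dots> \<le> 32 + 2 * ennreal ((40 * Cg * (\<Sum>k=1..m. bb k))\<^sup>2)"
    by (intro add_left_mono mult_left_mono S2) auto
  also have "\<dots> = ennreal (32 + 2 * (40 * Cg * (\<Sum>k=1..m. bb k))\<^sup>2)"
    by (simp add: ennreal_mult)
  finally show ?thesis .
qed

lemma expectation_pot: "Q.expectation (\<lambda>\<eta>. pot (sc k) (\<eta> y)) = ev k" "integrable Q (\<lambda>\<eta>. pot (sc k) (\<eta> y))"
proof -
  have "Q.expectation (\<lambda>\<eta>. pot (sc k) (\<eta> y)) = integral\<^sup>L (distr Q (measure_pmf D) (\<lambda>\<eta>. \<eta> y)) (pot (sc k))"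
    by (rule integral_distr[symmetric]) (auto intro: measurable_coord_pmf)
  then show "Q.expectation (\<lambda>\<eta>. pot (sc k) (\<eta> y)) = ev k" by (simp add: distr_coord ev_def)
  show "integrable Q (\<lambda>\<eta>. pot (sc k) (\<eta> y))"
  proof (rule Q.integrable_const_bound)
    show "AE \<eta> in Q. norm (pot (sc k) (\<eta> y)) \<le> 4 * sc k"
      using pot_bounds(2)[OF sc(1,2)] pot_nonneg[of "sc k"] sc(1)[of k]
      by (intro AE_I2) (simp add: abs_of_nonneg)
  qed measurable
qed

lemma ev_le_len: "ev k \<le> 324 / (real (len k))\<^sup>2"
proof -
  have "real (len k) * sqrt (ev k) \<le> 18" using len_le[of k] ev_pos[of k] by (simp add: pos_le_divide_eq)
  then have "(real (len k) * sqrt (ev k))\<^sup>2 \<le> 18\<^sup>2" using ev_pos[of k] by (intro power_mono) auto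
  then have "(real (len k))\<^sup>2 * ev k \<le> 324" using ev_pos[of k] by (simp add: power_mult_distrib)
  then show ?thesis using len_pos[of k] by (simp add: pos_le_divide_eq mult.commute)
qed

text \<open>The value of \<open>gs\<close> at the origin is at least \<open>2 / X\<close>, hence above the tangent line
  \<open>4 / \<tau> - 2 * X / \<tau>\<^sup>2\<close>, which is linear in the environment; \<open>\<tau>\<close> is chosen with \<open>E X \<le> p * \<tau>\<close>.\<close>

lemma fsum_lower:
  assumes A: "A \<in> sets Q" and p: "0 < Q.prob A"
  shows "ennreal ((Q.prob A) ^ 6 / (4 * 5844 * 1461\<^sup>2) * bb m) \<le> (\<integral>\<^sup>+\<eta>. indicator A \<eta> * fsum m 0 \<eta> \<partial>Q)"
proof -
  define p where "p = Q.prob A"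
  have p01: "0 < p" "p \<le> 1" using p by (auto simp: p_def)
  define l where "l = real (len m)"
  have l: "1 \<le> l" using len_pos[of m] by (simp add: l_def)
  \<comment> \<open>974 = 3 * 324 + 2: at most 3 l sites of mean potential at most 324 / l^2, plus
    the term 2 / l. With this choice the mean of \<open>X\<close> is at most p \<tau>.\<close>
  define \<tau> where "\<tau> = 974 / (p * l)"
  have \<tau>: "0 < \<tau>" using p01 l by (simp add: \<tau>_def)
  define X where "X \<eta> = (\<Sum>j=1..len m. pot (sc m) (\<eta> (int j))) + (\<Sum>j=1..len m. pot (sc m) (\<eta> (- int j)))
      + pot (sc m) (\<eta> 0) + 2 / real (len m)" for \<eta>
  have intX: "integrable Q X" unfolding X_def[abs_def]
    by (intro Bochner_Integration.integrable_add Bochner_Integration.integrable_sum expectation_pot) auto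
  have X0: "0 \<le> X \<eta>" for \<eta>
    unfolding X_def using pot_nonneg[of "sc m"] sc(1)[of m] by (intro add_nonneg_nonneg sum_nonneg) auto
  have EX: "Q.expectation X \<le> p * \<tau>"
  proof -
    have "Q.expectation X = (2 * l + 1) * ev m + 2 / l"
      unfolding X_def[abs_def] l_def
      by (simp add: Bochner_Integration.integral_sum Bochner_Integration.integral_add expectation_pot
          Bochner_Integration.integrable_sum Q.prob_space[unfolded space_Q] algebra_simps)
    also have "\<dots> \<le> (3 * l) * (324 / l\<^sup>2) + 2 / l"
      using l ev_le_len[of m] ev_pos[of m] unfolding l_def by (intro add_right_mono mult_mono) auto
    also have "\<dots> = p * \<tau>" using l p01 by (simp add: \<tau>_def power2_eq_square field_simps)
    finally show ?thesis .
  qed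
  let ?g = "\<lambda>y \<eta>. gs \<eta> (sc m) 0 (int y)"
  have intg: "integrable Q (\<lambda>\<eta>. gs \<eta> (sc m) x y)" for x y
  proof (rule Q.integrable_const_bound)
    show "AE \<eta> in Q. norm (gs \<eta> (sc m) x y) \<le> 1 / (1 - sk m)"
      using green_le[of "sk m"] sk[of m] gs_nonneg[OF sc(1)]
      by (intro AE_I2) (simp add: abs_of_nonneg gs_eq_green)
  qed measurable
  have intA: "integrable Q (\<lambda>\<eta>. indicator A \<eta> * F \<eta>)" if "integrable Q F" for F :: "(int \<Rightarrow> nat) \<Rightarrow> real"
    using integrable_mult_indicator[OF A that] by (simp add: mult.commute)
  have EA: "Q.expectation (\<lambda>\<eta>. indicator A \<eta> * c) = p * c" for c :: real
    using A by (simp add: p_def)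
  \<comment> \<open>Since p / \<tau> = p^2 l / 974, the mean below is at least (8/3 - 4/3 - 2/3) p^2
    l / 974, and 1461 = 974 * 3/2.\<close>
  define c0 where "c0 = p\<^sup>2 * l / 1461"
  have c0: "0 \<le> c0" using p01 l by (simp add: c0_def)
  \<comment> \<open>5844 = 6 * 974: up to this distance the linear loss, at most 6 per site, stays
    below p^2 l / 974.\<close>
  define Y where "Y = nat \<lfloor>p\<^sup>2 * l / 5844\<rfloor>"
  have mean: "c0 \<le> Q.expectation (\<lambda>\<eta>. indicator A \<eta> * ?g y \<eta>)" if y: "y \<le> Y" for y
  proof -
    have yl: "6 * real y \<le> p\<^sup>2 * l / 974"
    proof -
      have "0 \<le> p\<^sup>2 * l / 5844" using l by simp
      then have "real Y \<le> p\<^sup>2 * l / 5844" unfolding Y_def by (rule of_nat_floor)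
      then show ?thesis using y by (simp add: of_nat_mono)
    qed
    have low: "2 / 3 * (4 / \<tau> - 2 * X \<eta> / \<tau>\<^sup>2 - 6 * real y) \<le> ?g y \<eta>" for \<eta>
    proof -
      interpret r: decaying_solution "\<lambda>i. gs \<eta> (sc m) (0 + int i) 0" "\<lambda>i. pot (sc m) (\<eta> (0 + int i))"
        by (rule gs_decaying(1)[OF sc(1)])
      have d: "gs \<eta> (sc m) 0 0 - gs \<eta> (sc m) 1 0 \<le> 6" using spine_drop_bounds(2)[of \<eta> m 0] by simp
      have "gs \<eta> (sc m) 0 0 - real y * (gs \<eta> (sc m) 0 0 - gs \<eta> (sc m) 1 0) \<le> gs \<eta> (sc m) (int y) 0"
        using r.w_ge[of y] unfolding r.drop_def by simp
      moreover have "real y * (gs \<eta> (sc m) 0 0 - gs \<eta> (sc m) 1 0) \<le> real y * 6"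
        using d by (intro mult_left_mono) auto
      moreover have "4 / \<tau> - 2 * X \<eta> / \<tau>\<^sup>2 \<le> gs \<eta> (sc m) 0 0"
        unfolding X_def by (rule gs_origin_ge[OF len_pos \<tau>])
      moreover have "gs \<eta> (sc m) (int y) 0 \<le> 3 / 2 * ?g y \<eta>" by (rule gs_reverse_le)
      ultimately show ?thesis by simp
    qed
    define K where "K = 4 / \<tau> - 6 * real y"
    \<comment> \<open>\<open>X\<close> is subtracted also off \<open>A\<close>, where this only
      lowers the left side. So the full mean of \<open>X\<close> suffices, whatever the dependence
      between \<open>A\<close> and the environment.\<close>
    have pw: "indicator A \<eta> * (2 / 3 * K) - 4 / (3 * \<tau>\<^sup>2) * X \<eta> \<le> indicator A \<eta> * ?g y \<eta>" for \<eta>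
    proof (cases "\<eta> \<in> A")
      case True
      then show ?thesis using low[of \<eta>] by (simp add: K_def algebra_simps)
    next
      case False
      then show ?thesis using X0[of \<eta>] by simp
    qed
    have "c0 \<le> p * (2 / 3 * K) - 4 / (3 * \<tau>\<^sup>2) * (p * \<tau>)"
    proof -
      have t1: "4 / (3 * \<tau>\<^sup>2) * (p * \<tau>) = 4 / 3 * (p / \<tau>)" using \<tau> by (simp add: power2_eq_square)
      have t2: "p / \<tau> = p\<^sup>2 * l / 974" using p01 l by (simp add: \<tau>_def power2_eq_square)
      have t3: "p * (2 / 3 * K) = 8 / 3 * (p / \<tau>) - 2 / 3 * (p * (6 * real y))"
        by (simp add: K_def algebra_simps)
      have "p * (6 * real y) \<le> 1 * (6 * real y)" using p01 by (intro mult_right_mono) auto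
      then have "p * (6 * real y) \<le> p\<^sup>2 * l / 974" using yl by simp
      then show ?thesis unfolding t1 t3 t2 c0_def by linarith
    qed
    also have "\<dots> \<le> p * (2 / 3 * K) - 4 / (3 * \<tau>\<^sup>2) * Q.expectation X"
      using EX \<tau> by (intro diff_left_mono mult_left_mono) auto
    also have "\<dots> = Q.expectation (\<lambda>\<eta>. indicator A \<eta> * (2 / 3 * K) - 4 / (3 * \<tau>\<^sup>2) * X \<eta>)"
      using intX intA[of "\<lambda>_. 2 / 3 * K"] EA[of "2 / 3 * K"]
      by (subst Bochner_Integration.integral_diff) auto
    also have "\<dots> \<le> Q.expectation (\<lambda>\<eta>. indicator A \<eta> * ?g y \<eta>)"
      using intX intA[of "\<lambda>_. 2 / 3 * K"] intA[OF intg] pw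
      by (intro integral_mono Bochner_Integration.integrable_diff) auto
    finally show ?thesis .
  qed
  have sq: "ennreal (c0\<^sup>2) \<le> (\<integral>\<^sup>+\<eta>. indicator A \<eta> * ennreal ((?g y \<eta>)\<^sup>2) \<partial>Q)" if y: "y \<le> Y" for y
  proof -
    \<comment> \<open>From the mean to the second moment by the tangent to the square at
      \<open>c0\<close>; off \<open>A\<close> the left side is - c0^2.\<close>
    have pw: "2 * c0 * (indicator A \<eta> * ?g y \<eta>) - c0\<^sup>2 \<le> indicator A \<eta> * (?g y \<eta>)\<^sup>2" for \<eta>
      using zero_le_power2[of "?g y \<eta> - c0"] by (cases "\<eta> \<in> A") (auto simp: power2_eq_square algebra_simps)
    have "c0\<^sup>2 = 2 * c0 * c0 - c0\<^sup>2" by (simp add: power2_eq_square)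
    also have "\<dots> \<le> 2 * c0 * Q.expectation (\<lambda>\<eta>. indicator A \<eta> * ?g y \<eta>) - c0\<^sup>2"
      using mean[OF y] c0 by (intro diff_right_mono mult_left_mono) auto
    also have "\<dots> = Q.expectation (\<lambda>\<eta>. 2 * c0 * (indicator A \<eta> * ?g y \<eta>) - c0\<^sup>2)"
      using intA[OF intg] Q.prob_space by (subst Bochner_Integration.integral_diff) auto
    finally have 1: "c0\<^sup>2 \<le> Q.expectation (\<lambda>\<eta>. 2 * c0 * (indicator A \<eta> * ?g y \<eta>) - c0\<^sup>2)" .
    have "ennreal (c0\<^sup>2) \<le> ennreal (Q.expectation (\<lambda>\<eta>. 2 * c0 * (indicator A \<eta> * ?g y \<eta>) - c0\<^sup>2))"
      using 1 by (rule ennreal_leI)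
    also have "\<dots> \<le> (\<integral>\<^sup>+\<eta>. ennreal (2 * c0 * (indicator A \<eta> * ?g y \<eta>) - c0\<^sup>2) \<partial>Q)"
      using intA[OF intg] by (intro ennreal_integral_le_nn_integral) auto
    also have "\<dots> \<le> (\<integral>\<^sup>+\<eta>. ennreal (indicator A \<eta> * (?g y \<eta>)\<^sup>2) \<partial>Q)"
      by (intro nn_integral_mono ennreal_leI pw)
    also have "\<dots> = (\<integral>\<^sup>+\<eta>. indicator A \<eta> * ennreal ((?g y \<eta>)\<^sup>2) \<partial>Q)"
      by (intro nn_integral_cong) (auto simp: indicator_def)
    finally show ?thesis .
  qed
  have card: "p\<^sup>2 * l / 5844 \<le> real (Suc Y)" unfolding Y_def by linarith
  have "p ^ 6 / (4 * 5844 * 1461\<^sup>2) * bb m \<le> (1 - sk m) * (real (Suc Y) * c0\<^sup>2)"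
  proof -
    have "p ^ 6 / (4 * 5844 * 1461\<^sup>2) * bb m = (1 / 4) ^ m / 4 * (p\<^sup>2 * l / 5844 * c0\<^sup>2)"
      by (simp add: c0_def bb_def l_def power2_eq_square eval_nat_numeral)
    also have "\<dots> \<le> (1 - sk m) * (real (Suc Y) * c0\<^sup>2)"
      using card sk[of m] one_minus_sk_ge[of m] l by (intro mult_mono mult_right_mono) auto
    finally show ?thesis .
  qed
  then have "ennreal (p ^ 6 / (4 * 5844 * 1461\<^sup>2) * bb m) \<le> ennreal ((1 - sk m) * (real (Suc Y) * c0\<^sup>2))"
    by (rule ennreal_leI)
  also have "\<dots> = ennreal (1 - sk m) * (\<Sum>y\<le>Y. ennreal (c0\<^sup>2))"
    using sk[of m] by (simp add: ennreal_mult ennreal_of_nat_eq_real_of_nat[symmetric] del: of_nat_Suc)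
  also have "\<dots> \<le> ennreal (1 - sk m) * (\<Sum>y\<le>Y. \<integral>\<^sup>+\<eta>. indicator A \<eta> * ennreal ((?g y \<eta>)\<^sup>2) \<partial>Q)"
    by (intro mult_left_mono sum_mono sq) auto
  also have "\<dots> = (\<integral>\<^sup>+\<eta>. indicator A \<eta> * (\<Sum>y\<le>Y. ennreal ((1 - sk m) * (?g y \<eta>)\<^sup>2)) \<partial>Q)"
  proof -
    have eq: "ennreal (1 - sk m) * (indicator A \<eta> * ennreal ((?g y \<eta>)\<^sup>2)) =
        indicator A \<eta> * ennreal ((1 - sk m) * (?g y \<eta>)\<^sup>2)" for y :: nat and \<eta>
      using sk[of m] by (simp add: ennreal_mult mult_ac)
    have "ennreal (1 - sk m) * (\<Sum>y\<le>Y. \<integral>\<^sup>+\<eta>. indicator A \<eta> * ennreal ((?g y \<eta>)\<^sup>2) \<partial>Q) =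
        (\<Sum>y\<le>Y. \<integral>\<^sup>+\<eta>. ennreal (1 - sk m) * (indicator A \<eta> * ennreal ((?g y \<eta>)\<^sup>2)) \<partial>Q)"
      unfolding sum_distrib_left using A by (intro sum.cong refl nn_integral_cmult[symmetric]) auto
    also have "\<dots> = (\<integral>\<^sup>+\<eta>. (\<Sum>y\<le>Y. indicator A \<eta> * ennreal ((1 - sk m) * (?g y \<eta>)\<^sup>2)) \<partial>Q)"
      unfolding eq using A by (intro nn_integral_sum[symmetric]) auto
    finally show ?thesis by (simp only: sum_distrib_left)
  qed
  also have "\<dots> \<le> (\<integral>\<^sup>+\<eta>. indicator A \<eta> * fsum m 0 \<eta> \<partial>Q)"
  proof (intro nn_integral_mono mult_left_mono)
    fix \<eta>
    have "(\<Sum>y\<le>Y. ennreal ((1 - sk m) * (?g y \<eta>)\<^sup>2)) \<le> (\<Sum>y\<le>Y. csum \<eta> (sk m) 0 (int y))"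
      by (intro sum_mono csum_ge)
    also have "\<dots> = (\<Sum>y\<in>int ` {..Y}. csum \<eta> (sk m) 0 y)" by (subst sum.reindex) auto
    also have "\<dots> = (\<integral>\<^sup>+y. csum \<eta> (sk m) 0 y \<partial>count_space (int ` {..Y}))"
      by (rule nn_integral_count_space_finite[symmetric]) simp
    also have "\<dots> \<le> fsum m 0 \<eta>"
      unfolding fsum_def by (subst nn_integral_count_space_indicator) (auto intro!: nn_integral_mono simp: indicator_def)
    finally show "(\<Sum>y\<le>Y. ennreal ((1 - sk m) * (?g y \<eta>)\<^sup>2)) \<le> fsum m 0 \<eta>" .
  qed simp
  finally show ?thesis by (simp add: p_def)
qed

end

section \<open>Recurrence and transience of collisions\<close>

lemma csum_reverse_le:
  assumes "0 \<le> s"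
  shows "csum \<eta> s x y \<le> ennreal (9 / 4) * csum \<eta> s y x"
proof -
  have "ennreal (s ^ n * (cp \<eta> n x y)\<^sup>2) \<le> ennreal (9 / 4) * ennreal (s ^ n * (cp \<eta> n y x)\<^sup>2)" for n
  proof -
    have "2 * cp \<eta> n x y \<le> deg (comb \<eta>) (x, 0) * cp \<eta> n x y"
      by (intro mult_right_mono deg_spine_bounds tp_nonneg)
    also have "\<dots> = deg (comb \<eta>) (y, 0) * cp \<eta> n y x" by (rule comb.tp_reversible)
    also have "\<dots> \<le> 3 * cp \<eta> n y x" by (intro mult_right_mono deg_spine_bounds tp_nonneg)
    finally have "cp \<eta> n x y \<le> 3 / 2 * cp \<eta> n y x" by simp
    then have "(cp \<eta> n x y)\<^sup>2 \<le> (3 / 2 * cp \<eta> n y x)\<^sup>2" by (intro power_mono tp_nonneg)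
    then have "s ^ n * (cp \<eta> n x y)\<^sup>2 \<le> s ^ n * (9 / 4 * (cp \<eta> n y x)\<^sup>2)"
      using assms by (intro mult_left_mono) (auto simp: power_mult_distrib power2_eq_square)
    then have "ennreal (s ^ n * (cp \<eta> n x y)\<^sup>2) \<le> ennreal (9 / 4 * (s ^ n * (cp \<eta> n y x)\<^sup>2))"
      by (intro ennreal_leI) (simp add: mult_ac)
    also have "\<dots> = ennreal (9 / 4) * ennreal (s ^ n * (cp \<eta> n y x)\<^sup>2)"
      using assms by (intro ennreal_mult) auto
    finally show ?thesis .
  qed
  then have "csum \<eta> s x y \<le> (\<integral>\<^sup>+n. ennreal (9 / 4) * ennreal (s ^ n * (cp \<eta> n y x)\<^sup>2) \<partial>count_space UNIV)"
    unfolding csum_def coll_sum_def by (intro nn_integral_mono)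
  then show ?thesis by (simp add: nn_integral_cmult csum_def coll_sum_def)
qed

lemma nn_integral_spine:
  "(\<integral>\<^sup>+v. g v \<partial>count_space (range (\<lambda>y. (y, 0 :: nat)))) = (\<integral>\<^sup>+y. g (y, 0) \<partial>count_space (UNIV :: int set))"
  by (rule nn_integral_bij_count_space[symmetric]) (auto simp: bij_betw_def inj_on_def)

lemma ennreal_mult_le_sum_squares: "a * b \<le> a\<^sup>2 + b\<^sup>2" for a b :: ennreal
proof (cases "a \<le> b")
  case True
  then have "a * b \<le> b\<^sup>2" unfolding power2_eq_square by (intro mult_right_mono) auto
  then show ?thesis by (simp add: add_increasing)
next
  case False
  then have "a * b \<le> a\<^sup>2" unfolding power2_eq_square by (intro mult_left_mono) auto
  then show ?thesis by (simp add: add_increasing2)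
qed

text \<open>Only a lower bound on \<open>b\<close> is known, so the partial sums need not be
  comparable to the last term at every scale. If comparability failed at all large scales, the sums
  would grow at most at the rate \<theta> < \<beta>, against the lower bound; it thus holds at
  arbitrarily large ones.\<close>

lemma exponential_growth_comparable_scales:
  fixes b :: "nat \<Rightarrow> real"
  assumes b0: "\<And>k. 0 \<le> b k" and c: "0 < c" and \<beta>: "1 < \<beta>" and b: "\<And>k. c * \<beta> ^ k \<le> b k"
  obtains K where "0 < K" "\<And>M. \<exists>m\<ge>1. M \<le> b m \<and> (\<Sum>k=1..m. b k) \<le> K * b m"
proof
  define \<theta> where "\<theta> = (1 + \<beta>) / 2"
  have \<theta>: "1 < \<theta>" "\<theta> < \<beta>" using \<beta> by (auto simp: \<theta>_def)
  let ?K = "\<theta> / (\<theta> - 1)"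
  show "0 < ?K" using \<theta> by simp
  fix M
  show "\<exists>m\<ge>1. M \<le> b m \<and> (\<Sum>k=1..m. b k) \<le> ?K * b m"
  proof (rule ccontr)
    assume no: "\<not> ?thesis"
    define S where "S m = (\<Sum>k=1..m. b k)" for m
    obtain m0 where m0: "M / c < \<beta> ^ m0" using real_arch_pow[OF \<beta>] by blast
    have big: "M \<le> b m" if "m0 \<le> m" for m
    proof -
      have "M / c \<le> \<beta> ^ m" using m0 power_increasing[OF that, of \<beta>] \<beta> by linarith
      then have "M \<le> c * \<beta> ^ m" using c by (simp add: pos_divide_le_eq mult.commute)
      then show ?thesis using b[of m] by linarith
    qed
    have step: "S (Suc m) \<le> \<theta> * S m" if "m0 \<le> m" for m
    proof -
      have "?K * b (Suc m) < S (Suc m)" using no big[of "Suc m"] that unfolding S_def by force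
      then have "\<theta> * b (Suc m) < (\<theta> - 1) * S (Suc m)" using \<theta> by (simp add: pos_divide_less_eq mult.commute)
      moreover have "S (Suc m) = S m + b (Suc m)" by (simp add: S_def)
      ultimately show ?thesis by (simp add: algebra_simps)
    qed
    have S: "S (m0 + j) \<le> \<theta> ^ j * S m0" for j
    proof (induction j)
      case (Suc j)
      have "S (Suc (m0 + j)) \<le> \<theta> * (\<theta> ^ j * S m0)"
        by (rule order_trans[OF step mult_left_mono[OF Suc]]) (use \<theta> in auto)
      then show ?case by (simp add: mult.assoc)
    qed simp
    have le: "(\<beta> / \<theta>) ^ j \<le> S m0 / (c * \<beta> ^ m0)" if "1 \<le> j" for j
    proof -
      have "c * \<beta> ^ (m0 + j) \<le> b (m0 + j)" by (rule b)
      also have "\<dots> \<le> S (m0 + j)" unfolding S_def using that b0 by (intro member_le_sum) auto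
      also have "\<dots> \<le> \<theta> ^ j * S m0" by (rule S)
      finally have "\<beta> ^ j * (c * \<beta> ^ m0) \<le> S m0 * \<theta> ^ j" by (simp add: power_add mult_ac)
      then show ?thesis using \<theta> \<beta> c by (simp add: power_divide frac_le_eq pos_divide_le_eq pos_le_divide_eq)
    qed
    obtain j where j: "S m0 / (c * \<beta> ^ m0) < (\<beta> / \<theta>) ^ j" using real_arch_pow[of "\<beta> / \<theta>"] \<theta> by auto
    have "(\<beta> / \<theta>) ^ j \<le> (\<beta> / \<theta>) ^ Suc j" using \<theta> by (intro power_increasing) auto
    then show False using le[of "Suc j"] j by simp
  qed
qed

context iid_env begin

lemma fsum_shift: "fsum m x (shift a \<eta>) = fsum m (x + a) \<eta>"
proof -
  have "(\<integral>\<^sup>+y. csum \<eta> (sk m) (x + a) (y + a) \<partial>count_space UNIV) = (\<integral>\<^sup>+y. csum \<eta> (sk m) (x + a) y \<partial>count_space UNIV)"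
    by (rule nn_integral_bij_count_space[of "\<lambda>y. y + a"])
      (auto simp: bij_betw_def inj_on_def image_iff intro: exI[of _ "_ - a"])
  then show ?thesis by (simp add: fsum_def csum_shift)
qed

text \<open>Shifting the environment by \<open>y\<close> turns the expected mass sent from
  \<open>y\<close> to 0 into the mass sent from 0 to - y.\<close>

lemma mass_transport:
  assumes [measurable]: "\<And>x y. F x y \<in> borel_measurable Q"
    and F: "\<And>x y a \<eta>. F x y (shift a \<eta>) = F (x + a) (y + a) \<eta>"
  shows "(\<integral>\<^sup>+\<eta>. \<integral>\<^sup>+y. F y 0 \<eta> \<partial>count_space UNIV \<partial>Q) = (\<integral>\<^sup>+\<eta>. \<integral>\<^sup>+y. F 0 y \<eta> \<partial>count_space UNIV \<partial>Q)"
proof -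
  let ?Y = "count_space (UNIV :: int set)"
  have "(\<integral>\<^sup>+\<eta>. \<integral>\<^sup>+y. F y 0 \<eta> \<partial>?Y \<partial>Q) = (\<integral>\<^sup>+y. \<integral>\<^sup>+\<eta>. F y 0 \<eta> \<partial>Q \<partial>?Y)"
    by (intro nn_integral_count_space_nn_integral) auto
  also have "\<dots> = (\<integral>\<^sup>+y. \<integral>\<^sup>+\<eta>. F 0 (- y) \<eta> \<partial>Q \<partial>?Y)"
  proof (rule nn_integral_cong)
    fix y
    have "(\<integral>\<^sup>+\<eta>. F 0 (- y) (shift y \<eta>) \<partial>Q) = (\<integral>\<^sup>+\<eta>. F 0 (- y) \<eta> \<partial>Q)" by (rule nn_integral_shift[where F = "F 0 (- y)"]) auto
    then show "(\<integral>\<^sup>+\<eta>. F y 0 \<eta> \<partial>Q) = (\<integral>\<^sup>+\<eta>. F 0 (- y) \<eta> \<partial>Q)" by (simp add: F)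
  qed
  also have "\<dots> = (\<integral>\<^sup>+y. \<integral>\<^sup>+\<eta>. F 0 y \<eta> \<partial>Q \<partial>?Y)"
    by (rule nn_integral_bij_count_space[of uminus]) (auto simp: bij_uminus)
  also have "\<dots> = (\<integral>\<^sup>+\<eta>. \<integral>\<^sup>+y. F 0 y \<eta> \<partial>?Y \<partial>Q)"
    by (intro nn_integral_count_space_nn_integral[symmetric]) auto
  finally show ?thesis .
qed

lemma finp_0_or_1: "finp \<eta> = 0 \<or> finp \<eta> = 1"
  by (intro comb.fin_prob_0_or_1) auto

definition late :: "nat \<Rightarrow> (int \<Rightarrow> nat) \<Rightarrow> real" where
  "late N \<eta> = 1 - (avg2 (comb \<eta>) ^^ N) (nevc \<eta>) ((0, 0), (0, 0))"

lemma measurable_late [measurable]: "late N \<in> borel_measurable Q"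
  unfolding late_def[abs_def] by measurable

lemma late_01: "0 \<le> late N \<eta>" "late N \<eta> \<le> 1"
  using comb.avg2_pow_01[where f = "nevc \<eta>" and k = N and p = "((0, 0), (0, 0))", OF comb.never_collide_01] by (auto simp: late_def)

lemma late_tendsto: "(\<lambda>N. late N \<eta>) \<longlonglongrightarrow> 1 - finp \<eta>"
  unfolding late_def by (intro tendsto_intros comb.fin_prob_tendsto)

text \<open>\<open>csum\<close> is reversed, at the cost 9/4, so that the intermediate site
  \<open>y\<close> becomes the starting point of both factors; \<open>mass_transport\<close> can
  then move it to the origin and leave the square of \<open>fsum m 0\<close>.\<close>

lemma fsum_le_collisions:
  assumes "0 < t"
  shows "fsum m 0 \<eta> \<le> of_nat N
    + ennreal t * (\<integral>\<^sup>+y. ennreal (9 / 4) * (csum \<eta> (sk m) y 0 * fsum m y \<eta>) \<partial>count_space UNIV)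
    + ennreal (1 / (2 * t)) * ennreal (late N \<eta>)"
proof -
  have s: "0 \<le> sk m" "sk m \<le> 1" using sk[of m] by auto
  have v: "(0, 0) \<in> verts (comb \<eta>)" by simp
  have "fsum m 0 \<eta> \<le> of_nat N + ennreal t * (\<integral>\<^sup>+y. csum \<eta> (sk m) 0 y * fsum m y \<eta> \<partial>count_space UNIV)
      + ennreal (1 / (2 * t)) * ennreal (late N \<eta>)"
    using comb.collisions_second_moment[OF v s assms, of "range (\<lambda>y. (y, 0))" N]
    unfolding comb.emeasure_collision_from[OF v] nn_integral_spine
    by (simp add: fsum_def csum_def late_def)
  also have "\<dots> \<le> of_nat N
    + ennreal t * (\<integral>\<^sup>+y. ennreal (9 / 4) * (csum \<eta> (sk m) y 0 * fsum m y \<eta>) \<partial>count_space UNIV)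
    + ennreal (1 / (2 * t)) * ennreal (late N \<eta>)"
    using csum_reverse_le[OF s(1)]
    by (intro add_mono mult_left_mono nn_integral_mono) (auto simp: mult.assoc[symmetric] intro: mult_right_mono)
  finally show ?thesis .
qed

lemma expectation_fsum_le:
  assumes t: "0 < t" and [measurable]: "A \<in> sets Q"
  shows "(\<integral>\<^sup>+\<eta>. indicator A \<eta> * fsum m 0 \<eta> \<partial>Q) \<le> of_nat N
    + ennreal t * (ennreal (9 / 4) * (\<integral>\<^sup>+\<eta>. (fsum m 0 \<eta>)\<^sup>2 \<partial>Q))
    + ennreal (1 / (2 * t)) * (\<integral>\<^sup>+\<eta>. indicator A \<eta> * ennreal (late N \<eta>) \<partial>Q)"
proof -
  let ?Y = "count_space (UNIV :: int set)"
  have [measurable]: "(\<lambda>\<eta>. \<integral>\<^sup>+y. csum \<eta> (sk m) y 0 * fsum m y \<eta> \<partial>?Y) \<in> borel_measurable Q"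
    by (intro borel_measurable_nn_integral_count_space) auto
  have "(\<integral>\<^sup>+\<eta>. indicator A \<eta> * fsum m 0 \<eta> \<partial>Q) \<le> (\<integral>\<^sup>+\<eta>. of_nat N
    + ennreal t * (ennreal (9 / 4) * (\<integral>\<^sup>+y. csum \<eta> (sk m) y 0 * fsum m y \<eta> \<partial>?Y))
    + ennreal (1 / (2 * t)) * (indicator A \<eta> * ennreal (late N \<eta>)) \<partial>Q)"
  proof (intro nn_integral_mono)
    fix \<eta>
    show "indicator A \<eta> * fsum m 0 \<eta> \<le> of_nat N
      + ennreal t * (ennreal (9 / 4) * (\<integral>\<^sup>+y. csum \<eta> (sk m) y 0 * fsum m y \<eta> \<partial>?Y))
      + ennreal (1 / (2 * t)) * (indicator A \<eta> * ennreal (late N \<eta>))"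
      using fsum_le_collisions[OF t, of m \<eta> N] by (cases "\<eta> \<in> A") (simp_all add: nn_integral_cmult)
  qed
  also have "\<dots> = of_nat N
    + ennreal t * (ennreal (9 / 4) * (\<integral>\<^sup>+\<eta>. \<integral>\<^sup>+y. csum \<eta> (sk m) y 0 * fsum m y \<eta> \<partial>?Y \<partial>Q))
    + ennreal (1 / (2 * t)) * (\<integral>\<^sup>+\<eta>. indicator A \<eta> * ennreal (late N \<eta>) \<partial>Q)"
    by (simp add: nn_integral_add nn_integral_cmult Q.emeasure_space_1[unfolded space_Q])
  also have "(\<integral>\<^sup>+\<eta>. \<integral>\<^sup>+y. csum \<eta> (sk m) y 0 * fsum m y \<eta> \<partial>?Y \<partial>Q) =
      (\<integral>\<^sup>+\<eta>. \<integral>\<^sup>+y. csum \<eta> (sk m) 0 y * fsum m 0 \<eta> \<partial>?Y \<partial>Q)"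
    by (rule mass_transport[where F = "\<lambda>x y \<eta>. csum \<eta> (sk m) x y * fsum m x \<eta>"])
      (auto simp: csum_shift fsum_shift)
  also have "\<dots> = (\<integral>\<^sup>+\<eta>. (fsum m 0 \<eta>)\<^sup>2 \<partial>Q)"
    by (intro nn_integral_cong) (simp add: nn_integral_multc fsum_def power2_eq_square)
  finally show ?thesis .
qed

theorem AE_finp_eq_0:
  assumes c: "0 < c" and \<beta>: "1 < \<beta>" and growth: "\<And>k. c * \<beta> ^ k \<le> bb k"
  shows "AE \<eta> in Q. finp \<eta> = 0"
proof -
  define A where "A = {\<eta>. finp \<eta> = 1}"
  have A [measurable]: "A \<in> sets Q"
    using measurable_sets[OF measurable_finp, of "{1}"] by (simp add: A_def vimage_def)
  have "Q.prob A = 0"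
  proof (rule ccontr)
    assume "Q.prob A \<noteq> 0"
    then have p: "0 < Q.prob A" using measure_nonneg[of Q A] by linarith
    define a where "a = (Q.prob A) ^ 6 / (4 * 5844 * 1461\<^sup>2)"
    have a: "0 < a" using p by (simp add: a_def)
    obtain K where K: "0 < K" "\<And>M. \<exists>m\<ge>1. M \<le> bb m \<and> (\<Sum>k=1..m. bb k) \<le> K * bb m"
      using exponential_growth_comparable_scales[of bb, OF _ c \<beta> growth] bb_pos less_imp_le by metis
    define L where "L = 32 + 2 * (40 * Cg * K)\<^sup>2"
    have L: "0 < L" unfolding L_def by (intro add_pos_nonneg) auto
    have "(\<lambda>N. \<integral>\<^sup>+\<eta>. indicator A \<eta> * ennreal (late N \<eta>) \<partial>Q) \<longlonglongrightarrow> (\<integral>\<^sup>+\<eta>. 0 \<partial>Q)"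
    proof (rule nn_integral_dominated_convergence[where w = "\<lambda>_. 1"])
      show "AE \<eta> in Q. indicator A \<eta> * ennreal (late N \<eta>) \<le> 1" for N
        using late_01 by (intro AE_I2) (auto simp: indicator_def)
      show "AE \<eta> in Q. (\<lambda>N. indicator A \<eta> * ennreal (late N \<eta>)) \<longlonglongrightarrow> 0"
      proof (intro AE_I2)
        fix \<eta>
        show "(\<lambda>N. indicator A \<eta> * ennreal (late N \<eta>)) \<longlonglongrightarrow> 0"
        proof (cases "\<eta> \<in> A")
          case True
          then have "(\<lambda>N. ennreal (late N \<eta>)) \<longlonglongrightarrow> ennreal 0"
            using late_tendsto[of \<eta>] by (intro tendsto_ennrealI) (simp add: A_def)
          then show ?thesis using True by simp
        qed simp
      qed
      show "(\<integral>\<^sup>+\<eta>. 1 \<partial>Q) < \<infinity>" by (simp add: Q.emeasure_space_1[unfolded space_Q])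
    qed auto
    then have "(\<lambda>N. \<integral>\<^sup>+\<eta>. indicator A \<eta> * ennreal (late N \<eta>) \<partial>Q) \<longlonglongrightarrow> 0" by simp
    moreover have "0 < ennreal (a\<^sup>2 / (18 * L))" using a L by (simp add: ennreal_zero_less_divide)
    ultimately have "eventually (\<lambda>N. (\<integral>\<^sup>+\<eta>. indicator A \<eta> * ennreal (late N \<eta>) \<partial>Q) < ennreal (a\<^sup>2 / (18 * L))) sequentially"
      by (rule order_tendstoD(2))
    then obtain N where N: "(\<integral>\<^sup>+\<eta>. indicator A \<eta> * ennreal (late N \<eta>) \<partial>Q) < ennreal (a\<^sup>2 / (18 * L))"
      by (auto simp: eventually_sequentially)
    obtain m where m: "1 \<le> m" "max 1 (2 * real N / a + 1) \<le> bb m" "(\<Sum>k=1..m. bb k) \<le> K * bb m"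
      using K(2) by blast
    define b where "b = bb m"
    have b: "1 \<le> b" "2 * real N / a + 1 \<le> b" using m(2) by (auto simp: b_def)
    \<comment> \<open>Both error terms become a b / 4: the quadratic one directly, the late
      collisions through the threshold a^2 / (18 L). As this threshold does not involve b,
      \<open>N\<close> could be fixed before the scale \<open>m\<close>.\<close>
    define t where "t = a / (9 * L * b)"
    have t: "0 < t" using a L b by (simp add: t_def)
    have moment: "(\<integral>\<^sup>+\<eta>. (fsum m 0 \<eta>)\<^sup>2 \<partial>Q) \<le> ennreal (L * b\<^sup>2)"
    proof -
      have "40 * Cg * (\<Sum>k=1..m. bb k) \<le> 40 * Cg * (K * b)"
        using m(3) Cg_nonneg unfolding b_def by (intro mult_left_mono) auto
      then have "(40 * Cg * (\<Sum>k=1..m. bb k))\<^sup>2 \<le> (40 * Cg * (K * b))\<^sup>2"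
        using Cg_nonneg bb_pos by (intro power_mono mult_nonneg_nonneg sum_nonneg) (auto intro: less_imp_le)
      moreover have "1\<^sup>2 \<le> b\<^sup>2" using b by (intro power_mono) auto
      ultimately have "32 + 2 * (40 * Cg * (\<Sum>k=1..m. bb k))\<^sup>2 \<le> L * b\<^sup>2"
        by (simp add: L_def power_mult_distrib algebra_simps)
      then show ?thesis using fsum_moment[OF m(1)] by (meson ennreal_leI order_trans)
    qed
    have "ennreal (a * b) \<le> of_nat N + ennreal t * (ennreal (9 / 4) * ennreal (L * b\<^sup>2))
        + ennreal (1 / (2 * t)) * ennreal (a\<^sup>2 / (18 * L))"
    proof -
      have "ennreal (a * b) \<le> (\<integral>\<^sup>+\<eta>. indicator A \<eta> * fsum m 0 \<eta> \<partial>Q)"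
        unfolding a_def b_def by (rule fsum_lower[OF A p])
      also note expectation_fsum_le[OF t A, of m N]
      finally show ?thesis
        using moment N by (elim order_trans) (intro add_mono mult_left_mono, auto)
    qed
    also have "\<dots> = ennreal (real N + t * (9 / 4 * (L * b\<^sup>2)) + 1 / (2 * t) * (a\<^sup>2 / (18 * L)))"
    proof -
      have "ennreal t * (ennreal (9 / 4) * ennreal (L * b\<^sup>2)) = ennreal (t * (9 / 4 * (L * b\<^sup>2)))"
        using t L b by (simp add: ennreal_mult[symmetric])
      moreover have "ennreal (1 / (2 * t)) * ennreal (a\<^sup>2 / (18 * L)) = ennreal (1 / (2 * t) * (a\<^sup>2 / (18 * L)))"
        using t L by (intro ennreal_mult[symmetric]) auto
      moreover have "0 \<le> t * (9 / 4 * (L * b\<^sup>2))" "0 \<le> 1 / (2 * t) * (a\<^sup>2 / (18 * L))"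
        using t L by auto
      ultimately show ?thesis by (simp only: ennreal_plus ennreal_of_nat_eq_real_of_nat of_nat_0_le_iff add_nonneg_nonneg)
    qed
    also have "t * (9 / 4 * (L * b\<^sup>2)) = a * b / 4" using L b by (simp add: t_def power2_eq_square)
    also have "1 / (2 * t) * (a\<^sup>2 / (18 * L)) = a * b / 4" using a L b by (simp add: t_def power2_eq_square)
    finally have "a * b \<le> real N + a * b / 4 + a * b / 4"
      using a b by (subst (asm) ennreal_le_iff) auto
    then have "b \<le> 2 * real N / a" using a by (simp add: pos_le_divide_eq mult.commute)
    then show False using b by simp
  qed
  then have "AE \<eta> in Q. \<eta> \<notin> A"
    using A by (simp add: AE_iff_measurable[OF A] Q.emeasure_eq_measure)
  then show ?thesis
    by eventually_elim (use finp_0_or_1 in \<open>auto simp: A_def\<close>)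
qed

end

section \<open>Removing the killing, and translating tails of the heights into the size of
  \<open>bb\<close>\<close>

lemma sk_mono: "sk m \<le> sk (Suc m)"
proof -
  have "cosh (sc (Suc m)) \<le> cosh (sc m)"
    using sc(1)[of "Suc m"] by (subst cosh_real_nonneg_le_iff) (auto simp: sc_def)
  then show ?thesis
    unfolding sk_def using cosh_real_pos[of "sc (Suc m)"] by (intro divide_left_mono mult_pos_pos cosh_real_pos) auto
qed

lemma sk_tendsto: "sk \<longlonglongrightarrow> 1"
proof -
  have "(\<lambda>k. 1 / cosh (sc k)) \<longlonglongrightarrow> 1 / cosh 0"
    unfolding sc_def by (intro tendsto_intros LIMSEQ_realpow_zero) auto
  then show ?thesis by (simp add: sk_def[abs_def])
qed

lemma csum_mono: "csum \<eta> (sk m) x y \<le> csum \<eta> (sk (Suc m)) x y"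
  unfolding csum_def coll_sum_def using sk[of m]
  by (intro nn_integral_mono ennreal_leI mult_right_mono power_mono sk_mono) auto

lemma csum_1: "csum \<eta> 1 x y = (SUP m. csum \<eta> (sk m) x y)"
proof -
  have "(SUP m. ennreal (sk m ^ n * (cp \<eta> n x y)\<^sup>2)) = ennreal (1 ^ n * (cp \<eta> n x y)\<^sup>2)" for n
  proof (rule LIMSEQ_unique[OF LIMSEQ_SUP])
    show "incseq (\<lambda>m. ennreal (sk m ^ n * (cp \<eta> n x y)\<^sup>2))"
      using sk by (intro incseq_SucI ennreal_leI mult_right_mono power_mono sk_mono) (auto intro: less_imp_le)
    show "(\<lambda>m. ennreal (sk m ^ n * (cp \<eta> n x y)\<^sup>2)) \<longlonglongrightarrow> ennreal (1 ^ n * (cp \<eta> n x y)\<^sup>2)"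
      by (intro tendsto_ennrealI tendsto_intros sk_tendsto)
  qed
  then have "csum \<eta> 1 x y = (\<integral>\<^sup>+n. (SUP m. ennreal (sk m ^ n * (cp \<eta> n x y)\<^sup>2)) \<partial>count_space UNIV)"
    by (simp add: csum_def coll_sum_def)
  also have "\<dots> = (SUP m. csum \<eta> (sk m) x y)"
    unfolding csum_def coll_sum_def
  proof (rule nn_integral_monotone_convergence_SUP)
    show "incseq (\<lambda>m n. ennreal (sk m ^ n * (cp \<eta> n x y)\<^sup>2))"
      using sk by (intro incseq_SucI le_funI ennreal_leI mult_right_mono power_mono sk_mono) (auto intro: less_imp_le)
  qed auto
  finally show ?thesis .
qed

lemma integrable_indicator_pmf: "integrable (measure_pmf p) (indicat_real A)"
  by (rule integrable_real_indicator) (auto simp: measure_pmf.emeasure_eq_measure)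

context iid_env begin

text \<open>Doubling the truncation level 2^k raises the truncated mean height by at most 2^k times
  the tail, that is C \<rho>^k. As \<rho> > 1 these increments sum geometrically, and c (\<rho> - 1)
  >= C closes the induction.\<close>

lemma ev_le:
  assumes \<rho>: "1 < \<rho>" and C: "0 \<le> C" and tail: "\<And>k. measure_pmf.prob D {2 ^ k..} \<le> C * (\<rho> / 2) ^ k"
  obtains c where "0 < c" "\<And>k. ev k \<le> c * (\<rho> / 4) ^ k"
proof
  define g where "g k = measure_pmf.expectation D (\<lambda>h. min (2 ^ k) (real h))" for k :: nat
  have int: "integrable (measure_pmf D) (\<lambda>h. min (2 ^ k) (real h))" for k :: nat
    by (rule measure_pmf.integrable_const_bound[where B = "2 ^ k"]) auto
  define c where "c = max 1 (C / (\<rho> - 1))"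
  have c: "1 \<le> c" "C \<le> c * (\<rho> - 1)" using \<rho> by (auto simp: c_def pos_divide_le_eq[symmetric])
  have E1: "measure_pmf.expectation D (\<lambda>_. r) = r" for r :: real by simp
  have g: "g k \<le> c * \<rho> ^ k" for k
  proof (induction k)
    case 0
    have "g 0 \<le> measure_pmf.expectation D (\<lambda>_. 1)"
      unfolding g_def by (intro integral_mono int) auto
    then show ?case using c(1) by (simp only: E1) simp
  next
    case (Suc k)
    have pw: "min (2 ^ Suc k) (real h) \<le> min (2 ^ k) (real h) + 2 ^ k * indicator {2 ^ k..} h" for h :: nat
    proof (cases "2 ^ k \<le> h")
      case True
      then have "real (2 ^ k) \<le> real h" by (simp only: of_nat_le_iff)
      then show ?thesis using True by simp
    next
      case False
      then have "real h < real (2 ^ k)" by (simp only: of_nat_less_iff not_le)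
      then show ?thesis using False by simp
    qed
    have "g (Suc k) \<le> measure_pmf.expectation D (\<lambda>h. min (2 ^ k) (real h) + 2 ^ k * indicator {2 ^ k..} h)"
      unfolding g_def using pw
      by (intro integral_mono int Bochner_Integration.integrable_add integrable_mult_right integrable_indicator_pmf) auto
    also have "\<dots> = g k + 2 ^ k * measure_pmf.prob D {2 ^ k..}"
      unfolding g_def using int integrable_indicator_pmf[of D "{2 ^ k..}"]
      by (subst Bochner_Integration.integral_add) auto
    also have "\<dots> \<le> c * \<rho> ^ k + 2 ^ k * (C * (\<rho> / 2) ^ k)"
      by (intro add_mono Suc mult_left_mono tail) auto
    also have "\<dots> = c * \<rho> ^ k + C * \<rho> ^ k" by (simp add: power_divide)
    also have "\<dots> \<le> c * \<rho> ^ k + c * (\<rho> - 1) * \<rho> ^ k"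
      using c \<rho> by (intro add_left_mono mult_right_mono) auto
    finally show ?case by (simp add: algebra_simps)
  qed
  show "0 < 2 + 4 * c" using c by simp
  fix k
  have pw: "pot (sc k) h \<le> 2 * (1 / 4) ^ k + 4 * (1 / 4) ^ k * min (2 ^ k) (real h)" for h
  proof -
    have "min 1 (sc k * real h) = sc k * min (2 ^ k) (real h)"
    proof -
      have "sc k * min (2 ^ k) (real h) = min (sc k * 2 ^ k) (sc k * real h)"
        using sc(1)[of k] by (subst min_mult_distrib_left) auto
      also have "sc k * 2 ^ k = 1" by (simp add: sc_def power_mult_distrib[symmetric])
      finally show ?thesis by simp
    qed
    then show ?thesis using pot_bounds(3)[OF sc(1,2), of k h]
      by (simp add: sc(3)[symmetric] power2_eq_square mult_ac)
  qed
  have "ev k \<le> measure_pmf.expectation D (\<lambda>h. 2 * (1 / 4) ^ k + 4 * (1 / 4) ^ k * min (2 ^ k) (real h))"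
    unfolding ev_def using pw int
    by (intro integral_mono integrable_pot Bochner_Integration.integrable_add) auto
  also have "\<dots> = 2 * (1 / 4) ^ k + 4 * (1 / 4) ^ k * g k"
    unfolding g_def using int by (subst Bochner_Integration.integral_add) auto
  also have "\<dots> \<le> 2 * ((1 / 4) ^ k * \<rho> ^ k) + 4 * (1 / 4) ^ k * (c * \<rho> ^ k)"
  proof -
    have "(1 / 4 :: real) ^ k * 1 \<le> (1 / 4) ^ k * \<rho> ^ k"
      using \<rho> by (intro mult_left_mono one_le_power) auto
    moreover have "4 * (1 / 4) ^ k * g k \<le> 4 * (1 / 4) ^ k * (c * \<rho> ^ k)"
      by (intro mult_left_mono g) auto
    ultimately show ?thesis by linarith
  qed
  also have "\<dots> = (2 + 4 * c) * (\<rho> / 4) ^ k" by (simp add: power_divide field_simps)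
  finally show "ev k \<le> (2 + 4 * c) * (\<rho> / 4) ^ k" .
qed

text \<open>\<open>bb k\<close> grows at least at the rate 1 / (4 r^3) with r^2 = \<rho> / 4, which
  exceeds 1 precisely when \<rho>^3 < 4.\<close>

lemma AE_finp_eq_0_if_tail:
  assumes \<rho>: "1 < \<rho>" "\<rho> ^ 3 < 4" and C: "0 \<le> C"
    and tail: "\<And>k. measure_pmf.prob D {2 ^ k..} \<le> C * (\<rho> / 2) ^ k"
  shows "AE \<eta> in Q. finp \<eta> = 0"
proof -
  obtain c where c: "0 < c" "\<And>k. ev k \<le> c * (\<rho> / 4) ^ k" using ev_le[OF \<rho>(1) C tail] by blast
  define r where "r = sqrt (\<rho> / 4)"
  have r: "0 < r" using \<rho> by (simp add: r_def)
  have r2: "r\<^sup>2 = \<rho> / 4" using \<rho> by (simp add: r_def)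
  have r3: "4 * r ^ 3 < 1"
  proof -
    have "(4 * r ^ 3)\<^sup>2 = 16 * (r\<^sup>2) ^ 3" by (simp add: power_mult_distrib flip: power_mult)
    also have "\<dots> < 1\<^sup>2" unfolding r2 using \<rho>(2) by (simp add: power_divide)
    finally show ?thesis by (rule power2_less_imp_less) simp
  qed
  have growth: "4096 / sqrt c ^ 3 * (1 / (4 * r ^ 3)) ^ k \<le> bb k" for k
  proof -
    have "sqrt (ev k) \<le> sqrt c * r ^ k"
      using real_sqrt_le_mono[OF c(2)[of k]] by (simp add: real_sqrt_mult real_sqrt_power r_def)
    then have "16 / (sqrt c * r ^ k) \<le> 16 / sqrt (ev k)"
      using ev_pos[of k] by (intro divide_left_mono mult_pos_pos) (use c(1) r in auto)
    also have "\<dots> \<le> real (len k)" by (rule len_ge)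
    finally have "(16 / (sqrt c * r ^ k)) ^ 3 \<le> real (len k) ^ 3"
      using c(1) r by (intro power_mono) auto
    then have "(16 / (sqrt c * r ^ k)) ^ 3 * (1 / 4) ^ k \<le> bb k"
      unfolding bb_def by (intro mult_right_mono) auto
    moreover have "(16 / (sqrt c * r ^ k)) ^ 3 * (1 / 4) ^ k = 4096 / sqrt c ^ 3 * (1 / (4 * r ^ 3)) ^ k"
      by (simp add: power_divide power_mult_distrib power_mult[symmetric] mult.commute)
    ultimately show ?thesis by simp
  qed
  show ?thesis
    by (rule AE_finp_eq_0[OF _ _ growth]) (use c(1) r r3 in auto)
qed

text \<open>Teeth of height at least 2^k alone give mean potential of order (\<theta> / 2)^k. The
  rate 1 / (4 r^3) with r^2 = \<theta> / 2 is below 1 precisely when \<theta>^3 > 1/2.\<close>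

lemma summable_bb_if_tail:
  assumes \<theta>: "0 < \<theta>" "1 / 2 < \<theta> ^ 3" and C: "0 < C"
    and tail: "eventually (\<lambda>k. C * \<theta> ^ k \<le> measure_pmf.prob D {2 ^ k..}) sequentially"
  shows "summable bb"
proof -
  define r where "r = sqrt (\<theta> / 2)"
  have r: "0 < r" using \<theta> by (simp add: r_def)
  have r2: "r\<^sup>2 = \<theta> / 2" using \<theta> by (simp add: r_def)
  have r3: "1 < 4 * r ^ 3"
  proof -
    have "1\<^sup>2 < 16 * (r\<^sup>2) ^ 3" unfolding r2 using \<theta>(2) by (simp add: power_divide)
    also have "\<dots> = (4 * r ^ 3)\<^sup>2" by (simp add: power_mult_distrib flip: power_mult)
    finally show ?thesis by (rule power2_less_imp_less) (use r in simp)
  qed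
  have bound: "bb k \<le> (18 / sqrt (C / 2)) ^ 3 * (1 / (4 * r ^ 3)) ^ k"
    if k: "C * \<theta> ^ k \<le> measure_pmf.prob D {2 ^ k..}" for k
  proof -
    have pw: "sc k / 2 * indicator {2 ^ k..} h \<le> pot (sc k) h" for h
    proof (cases "2 ^ k \<le> h")
      case True
      then have "real (2 ^ k) \<le> real h" by (simp only: of_nat_le_iff)
      then have "sc k * 2 ^ k \<le> sc k * real h" using sc(1)[of k] by (intro mult_left_mono) auto
      moreover have "sc k * 2 ^ k = 1" by (simp add: sc_def power_mult_distrib[symmetric])
      ultimately show ?thesis using True pot_bounds(4)[OF sc(1,2), of k h] by simp
    qed (use pot_nonneg[of "sc k"] sc(1)[of k] in simp)
    have "C / 2 * (\<theta> / 2) ^ k = sc k / 2 * (C * \<theta> ^ k)" by (simp add: sc_def power_divide)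
    also have "\<dots> \<le> sc k / 2 * measure_pmf.prob D {2 ^ k..}"
      using k sc(1)[of k] by (intro mult_left_mono) auto
    also have "\<dots> = measure_pmf.expectation D (\<lambda>h. sc k / 2 * indicator {2 ^ k..} h)" by simp
    also have "\<dots> \<le> ev k"
      unfolding ev_def using pw
      by (intro integral_mono integrable_pot integrable_mult_right integrable_indicator_pmf) (auto simp: mult.commute)
    finally have "sqrt (C / 2 * (\<theta> / 2) ^ k) \<le> sqrt (ev k)" by simp
    then have "sqrt (C / 2) * r ^ k \<le> sqrt (ev k)" by (simp only: real_sqrt_mult real_sqrt_power r_def)
    then have "18 / sqrt (ev k) \<le> 18 / (sqrt (C / 2) * r ^ k)"
      using ev_pos[of k] C r by (intro divide_left_mono mult_pos_pos) auto
    then have "real (len k) \<le> 18 / (sqrt (C / 2) * r ^ k)" using len_le[of k] by linarith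
    then have "real (len k) ^ 3 \<le> (18 / (sqrt (C / 2) * r ^ k)) ^ 3" by (intro power_mono) auto
    then have "bb k \<le> (18 / (sqrt (C / 2) * r ^ k)) ^ 3 * (1 / 4) ^ k"
      unfolding bb_def by (intro mult_right_mono) auto
    also have "\<dots> = (18 / sqrt (C / 2)) ^ 3 * (1 / (4 * r ^ 3)) ^ k"
      by (simp add: power_divide power_mult_distrib power_mult[symmetric] mult.commute)
    finally show ?thesis .
  qed
  show ?thesis
  proof (rule summable_comparison_test_ev)
    show "eventually (\<lambda>k. norm (bb k) \<le> (18 / sqrt (C / 2)) ^ 3 * (1 / (4 * r ^ 3)) ^ k) sequentially"
      using tail by eventually_elim (use bound bb_pos in \<open>simp add: less_imp_le\<close>)
    show "summable (\<lambda>k. (18 / sqrt (C / 2)) ^ 3 * (1 / (4 * r ^ 3)) ^ k)"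
      using r3 r by (intro summable_mult summable_geometric) auto
  qed
qed

text \<open>\<open>hsum h\<close> is the sum over l of [l <= h] / (l + 1), and the L2 norm of the
  indicator is the root of the tail, so Minkowski's inequality applies.\<close>

lemma hsum_moment:
  assumes "summable (\<lambda>l. sqrt (measure_pmf.prob D {l..}) / real (Suc l))"
  shows "(\<integral>\<^sup>+\<eta>. (hsum (\<eta> 0))\<^sup>2 \<partial>Q) < \<infinity>"
proof -
  let ?w = "\<lambda>l. sqrt (measure_pmf.prob D {l..}) / real (Suc l)"
  let ?a = "\<lambda>l h. indicator {l..} h * ennreal (1 / real (Suc l))"
  have hs: "hsum h = (\<integral>\<^sup>+l. ?a l h \<partial>count_space UNIV)" for h :: nat
  proof -
    have "(\<integral>\<^sup>+l. ?a l h \<partial>count_space UNIV) = (\<Sum>l\<in>{..h}. ?a l h)"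
      by (rule nn_integral_count_space') (auto simp: indicator_def)
    then show ?thesis by (simp add: hsum_def)
  qed
  have "(\<integral>\<^sup>+\<eta>. (hsum (\<eta> 0))\<^sup>2 \<partial>Q) = (\<integral>\<^sup>+h. (hsum h)\<^sup>2 \<partial>measure_pmf D)"
    by (rule nn_integral_coord[where f = "\<lambda>h. (hsum h)\<^sup>2"])
  also have "\<dots> = (\<integral>\<^sup>+h. (\<integral>\<^sup>+l. ?a l h \<partial>count_space UNIV)\<^sup>2 \<partial>measure_pmf D)" by (simp only: hs)
  also have "\<dots> \<le> (\<integral>\<^sup>+l. ennreal (?w l) \<partial>count_space UNIV)\<^sup>2"
  proof (rule nn_integral_square_sum_le)
    fix l :: nat
    have "(\<integral>\<^sup>+h. (?a l h)\<^sup>2 \<partial>measure_pmf D) = (\<integral>\<^sup>+h. ennreal ((1 / real (Suc l))\<^sup>2) * indicator {l..} h \<partial>measure_pmf D)"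
      by (intro nn_integral_cong) (simp add: indicator_def ennreal_power)
    also have "\<dots> = ennreal ((1 / real (Suc l))\<^sup>2) * ennreal (measure_pmf.prob D {l..})"
      by (simp add: nn_integral_cmult_indicator measure_pmf.emeasure_eq_measure)
    also have "\<dots> = ennreal ((?w l)\<^sup>2)"
      by (simp add: ennreal_mult[symmetric] power_divide)
    finally show "(\<integral>\<^sup>+h. (?a l h)\<^sup>2 \<partial>measure_pmf D) \<le> ennreal ((?w l)\<^sup>2)" by simp
  qed auto
  also have "\<dots> < \<infinity>"
  proof -
    have "(\<integral>\<^sup>+l. ennreal (?w l) \<partial>count_space UNIV) = ennreal (\<Sum>l. ?w l)"
      unfolding nn_integral_count_space_nat using assms by (intro suminf_ennreal_eq summable_sums) auto
    then show ?thesis by (simp add: power2_eq_square ennreal_mult_less_top)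
  qed
  finally show ?thesis .
qed

text \<open>\<open>mass_transport\<close> moves the tooth weight to the starting point of the walks,
  where a b <= a^2 + b^2 separates it from \<open>fsum\<close> without independence. The bound is
  uniform in \<open>m\<close>, so monotone convergence removes the killing.\<close>

lemma AE_finp_eq_1:
  assumes bb: "summable bb" and h: "summable (\<lambda>l. sqrt (measure_pmf.prob D {l..}) / real (Suc l))"
  shows "AE \<eta> in Q. finp \<eta> = 1"
proof -
  let ?Y = "count_space (UNIV :: int set)"
  have [measurable]: "(\<lambda>\<eta>. hsum (\<eta> y)) \<in> borel_measurable Q" for y
    by (rule measurable_compose[OF measurable_coord]) simp
  define W where "W m \<eta> = (\<integral>\<^sup>+y. csum \<eta> (sk m) y 0 * hsum (\<eta> y) \<partial>?Y)" for m \<eta>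
  have [measurable]: "W m \<in> borel_measurable Q" for m
    unfolding W_def[abs_def] by (intro borel_measurable_nn_integral_count_space) auto
  have incW: "incseq (\<lambda>m. W m \<eta>)" for \<eta>
    unfolding W_def by (intro incseq_SucI nn_integral_mono mult_right_mono csum_mono) auto
  have W1: "(\<integral>\<^sup>+y. csum \<eta> 1 y 0 * hsum (\<eta> y) \<partial>?Y) = (SUP m. W m \<eta>)" for \<eta>
  proof -
    have "(\<integral>\<^sup>+y. csum \<eta> 1 y 0 * hsum (\<eta> y) \<partial>?Y) = (\<integral>\<^sup>+y. (SUP m. csum \<eta> (sk m) y 0 * hsum (\<eta> y)) \<partial>?Y)"
      by (simp add: csum_1 SUP_mult_right_ennreal)
    also have "\<dots> = (SUP m. W m \<eta>)"
      unfolding W_def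
    proof (rule nn_integral_monotone_convergence_SUP)
      show "incseq (\<lambda>m y. csum \<eta> (sk m) y 0 * hsum (\<eta> y))"
        by (intro incseq_SucI le_funI mult_right_mono csum_mono) auto
    qed auto
    finally show ?thesis .
  qed
  define B where "B = 32 + 2 * (40 * Cg * (\<Sum>k. bb k))\<^sup>2"
  have bound: "(\<integral>\<^sup>+\<eta>. W m \<eta> \<partial>Q) \<le> (\<integral>\<^sup>+\<eta>. (hsum (\<eta> 0))\<^sup>2 \<partial>Q) + ennreal B" if m: "1 \<le> m" for m
  proof -
    have "(\<integral>\<^sup>+\<eta>. W m \<eta> \<partial>Q) = (\<integral>\<^sup>+\<eta>. \<integral>\<^sup>+y. csum \<eta> (sk m) 0 y * hsum (\<eta> 0) \<partial>?Y \<partial>Q)"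
      unfolding W_def
      by (rule mass_transport[where F = "\<lambda>x y \<eta>. csum \<eta> (sk m) x y * hsum (\<eta> x)"])
        (auto simp: csum_shift shift_def)
    also have "\<dots> = (\<integral>\<^sup>+\<eta>. hsum (\<eta> 0) * fsum m 0 \<eta> \<partial>Q)"
      by (intro nn_integral_cong) (simp add: nn_integral_multc fsum_def mult.commute[of "hsum _"])
    also have "\<dots> \<le> (\<integral>\<^sup>+\<eta>. (hsum (\<eta> 0))\<^sup>2 + (fsum m 0 \<eta>)\<^sup>2 \<partial>Q)"
      by (intro nn_integral_mono ennreal_mult_le_sum_squares)
    also have "\<dots> = (\<integral>\<^sup>+\<eta>. (hsum (\<eta> 0))\<^sup>2 \<partial>Q) + (\<integral>\<^sup>+\<eta>. (fsum m 0 \<eta>)\<^sup>2 \<partial>Q)"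
      by (intro nn_integral_add) auto
    also have "\<dots> \<le> (\<integral>\<^sup>+\<eta>. (hsum (\<eta> 0))\<^sup>2 \<partial>Q) + ennreal B"
    proof (intro add_left_mono)
      have "(\<Sum>k=1..m. bb k) \<le> (\<Sum>k. bb k)" using bb bb_pos by (intro sum_le_suminf) (auto intro: less_imp_le)
      then have "(40 * Cg * (\<Sum>k=1..m. bb k))\<^sup>2 \<le> (40 * Cg * (\<Sum>k. bb k))\<^sup>2"
        using Cg_nonneg bb_pos
        by (intro power_mono mult_left_mono mult_nonneg_nonneg sum_nonneg) (auto intro: less_imp_le)
      then have "ennreal (32 + 2 * (40 * Cg * (\<Sum>k=1..m. bb k))\<^sup>2) \<le> ennreal B"
        unfolding B_def by (intro ennreal_leI) simp
      then show "(\<integral>\<^sup>+\<eta>. (fsum m 0 \<eta>)\<^sup>2 \<partial>Q) \<le> ennreal B" using fsum_moment[OF m] by (rule order_trans[rotated])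
    qed
    finally show ?thesis .
  qed
  have "(\<integral>\<^sup>+\<eta>. (SUP m. W m \<eta>) \<partial>Q) = (SUP m. \<integral>\<^sup>+\<eta>. W m \<eta> \<partial>Q)"
    using incW by (intro nn_integral_monotone_convergence_SUP) (auto simp: incseq_def le_fun_def)
  also have "\<dots> \<le> (\<integral>\<^sup>+\<eta>. (hsum (\<eta> 0))\<^sup>2 \<partial>Q) + ennreal B"
  proof (rule SUP_least)
    fix m
    have "(\<integral>\<^sup>+\<eta>. W m \<eta> \<partial>Q) \<le> (\<integral>\<^sup>+\<eta>. W (Suc m) \<eta> \<partial>Q)"
      using incW by (intro nn_integral_mono) (auto simp: incseq_def)
    also have "\<dots> \<le> (\<integral>\<^sup>+\<eta>. (hsum (\<eta> 0))\<^sup>2 \<partial>Q) + ennreal B" by (rule bound) simp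
    finally show "(\<integral>\<^sup>+\<eta>. W m \<eta> \<partial>Q) \<le> (\<integral>\<^sup>+\<eta>. (hsum (\<eta> 0))\<^sup>2 \<partial>Q) + ennreal B" .
  qed
  also have "\<dots> < \<infinity>" using hsum_moment[OF h] by (simp add: ennreal_add_less_top)
  finally have "AE \<eta> in Q. (SUP m. W m \<eta>) \<noteq> \<infinity>"
    by (intro nn_integral_PInf_AE) auto
  then show ?thesis
  proof eventually_elim
    case (elim \<eta>)
    then show ?case by (intro finp_eq_1) (simp only: W1 infinity_ennreal_def less_top)
  qed
qed

end

section \<open>From the given heights to the integer environment\<close>

lemma measure_pmf_Abs_pmf_countable:
  fixes M :: "'c :: countable measure"
  assumes M: "prob_space M" and sets: "sets M = UNIV"
  shows "measure_pmf (Abs_pmf M) = M"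
proof (rule Abs_pmf_inverse, intro CollectI conjI M sets)
  interpret prob_space M by fact
  have "AE x in M. measure M {i} = 0 \<longrightarrow> x \<noteq> i" for i
  proof (cases "measure M {i} = 0")
    case True
    then have "{i} \<in> null_sets M" by (simp add: null_sets_def sets emeasure_eq_measure)
    then show ?thesis by (auto dest: AE_not_in)
  qed simp
  then have "AE x in M. \<forall>i. measure M {i} = 0 \<longrightarrow> x \<noteq> i" by (simp add: AE_all_countable)
  then show "AE x in M. measure M {x} \<noteq> 0" by eventually_elim auto
qed

lemma (in prob_space) distr_iid_eq_PiM:
  fixes D :: "nat pmf"
  assumes indep: "indep_vars (\<lambda>_. measure_pmf D) h (UNIV :: int set)"
    and distr: "\<And>y. distr M (measure_pmf D) (h y) = measure_pmf D"
  shows "distr M (iid_env.Q D) (\<lambda>\<omega> y. h y \<omega>) = iid_env.Q D" "(\<lambda>\<omega> y. h y \<omega>) \<in> M \<rightarrow>\<^sub>M iid_env.Q D"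
proof -
  have rv: "h y \<in> M \<rightarrow>\<^sub>M measure_pmf D" for y using indep by (auto simp: indep_vars_def2)
  have "distr M (PiM UNIV (\<lambda>_. measure_pmf D)) (\<lambda>\<omega>. \<lambda>y\<in>UNIV. h y \<omega>) = PiM UNIV (\<lambda>y. distr M (measure_pmf D) (h y))"
    using indep by (subst (asm) indep_vars_iff_distr_eq_PiM[OF _ rv]) simp_all
  then show "distr M (iid_env.Q D) (\<lambda>\<omega> y. h y \<omega>) = iid_env.Q D"
    unfolding distr iid_env.Q_def by (simp add: restrict_UNIV)
  show "(\<lambda>\<omega> y. h y \<omega>) \<in> M \<rightarrow>\<^sub>M iid_env.Q D"
    unfolding iid_env.Q_def by (rule measurable_PiM_single'[OF rv]) simp
qed

text \<open>Below the threshold, where the limit gives no information, the trivial bound 1 is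
  absorbed into the constant by \<open>z0 powr \<gamma>\<close>.\<close>

lemma regular_tail_bounds:
  fixes f :: "real \<Rightarrow> real"
  assumes \<gamma>: "0 < \<gamma>" and C: "0 < C" and f: "\<And>z. f z \<le> 1"
    and lim: "((\<lambda>z. z powr \<gamma> * f z) \<longlongrightarrow> C) at_top"
  obtains B z0 where "0 < B" "\<And>z. 0 < z \<Longrightarrow> f z \<le> B * z powr (- \<gamma>)"
    "\<And>z. z0 \<le> z \<Longrightarrow> C / 2 * z powr (- \<gamma>) \<le> f z"
proof -
  have "eventually (\<lambda>z. z powr \<gamma> * f z < 2 * C) at_top" "eventually (\<lambda>z. C / 2 < z powr \<gamma> * f z) at_top"
    using C by (intro order_tendstoD[OF lim], simp)+
  then have "eventually (\<lambda>z. C / 2 < z powr \<gamma> * f z \<and> z powr \<gamma> * f z < 2 * C) at_top"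
    by eventually_elim simp
  then obtain z1 where z1: "\<And>z. z1 \<le> z \<Longrightarrow> C / 2 < z powr \<gamma> * f z \<and> z powr \<gamma> * f z < 2 * C"
    by (auto simp: eventually_at_top_linorder)
  define z0 where "z0 = max 1 z1"
  have inv: "f z = z powr \<gamma> * f z * z powr (- \<gamma>)" if "0 < z" for z
    using that by (simp add: powr_minus)
  show thesis
  proof (rule that[of "max (2 * C) (z0 powr \<gamma>)" z0])
    show "0 < max (2 * C) (z0 powr \<gamma>)" using C by simp
  next
    fix z :: real assume z: "0 < z"
    show "f z \<le> max (2 * C) (z0 powr \<gamma>) * z powr (- \<gamma>)"
    proof (cases "z0 \<le> z")
      case True
      then have "z powr \<gamma> * f z \<le> max (2 * C) (z0 powr \<gamma>)" using z1[of z] by (simp add: z0_def le_max_iff_disj)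
      then show ?thesis by (subst inv[OF z]) (intro mult_right_mono, auto)
    next
      case False
      have "f z \<le> 1" by (rule f)
      also have "1 = z powr \<gamma> * z powr (- \<gamma>)" using z by (simp add: powr_minus)
      also have "\<dots> \<le> max (2 * C) (z0 powr \<gamma>) * z powr (- \<gamma>)"
        using False z \<gamma> by (intro mult_right_mono max.coboundedI2 powr_mono2) auto
      finally show ?thesis .
    qed
  next
    fix z assume z: "z0 \<le> z"
    then have "0 < z" by (simp add: z0_def)
    have "C / 2 * z powr (- \<gamma>) \<le> z powr \<gamma> * f z * z powr (- \<gamma>)"
      using z1[of z] z by (intro mult_right_mono) (auto simp: z0_def)
    then show "C / 2 * z powr (- \<gamma>) \<le> f z" using inv[OF \<open>0 < z\<close>] by simp
  qed
qed

lemma powr_of_power_2: "(2 ^ k) powr a = (2 powr a) ^ k" for a :: real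
proof -
  have "(2 ^ k) powr a = (2 powr real k) powr a" by (simp add: powr_realpow)
  also have "\<dots> = (2 powr a) powr real k" by (simp only: powr_powr mult.commute)
  also have "\<dots> = (2 powr a) ^ k" by (simp add: powr_realpow)
  finally show ?thesis .
qed

theorem theorem4p1:
  fixes \<gamma> C :: real
    and P :: "'a measure"
    and H :: "int \<Rightarrow> 'a \<Rightarrow> real"
  assumes "0 < \<gamma>" and "\<gamma> \<le> 1" and "0 < C"
    and "prob_space P"
    and "prob_space.indep_vars P (\<lambda>_. borel) H UNIV"
    and "\<And>x. distr P borel (H x) = distr P borel (H 0)"
    and "\<And>x \<omega>. \<omega> \<in> space P \<Longrightarrow> 0 \<le> H x \<omega>"
    and "((\<lambda>z. z powr \<gamma> * measure P {\<omega> \<in> space P. H 0 \<omega> > z}) \<longlongrightarrow> C) at_top"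
  shows "AE \<omega> in P.
    (\<gamma> > 1/3 \<longrightarrow> infinite_collision_property (Comb (\<lambda>x. H x \<omega>))) \<and>
    (\<gamma> < 1/3 \<longrightarrow> finite_collision_property (Comb (\<lambda>x. H x \<omega>)))"
proof -
  note \<gamma> = assms(1,2) and H0 = assms(7)
  interpret P: prob_space P by fact
  have [measurable]: "H x \<in> borel_measurable P" for x
    using assms(5) by (auto simp: P.indep_vars_def2)
  define h where "h x \<omega> = nat \<lfloor>H x \<omega>\<rfloor>" for x \<omega>
  have nf: "(\<lambda>r :: real. nat \<lfloor>r\<rfloor>) \<in> borel \<rightarrow>\<^sub>M count_space UNIV" by measurable
  have hm [measurable]: "h x \<in> P \<rightarrow>\<^sub>M count_space UNIV" for x
    unfolding h_def[abs_def] by measurable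
  define D where "D = Abs_pmf (distr P (count_space UNIV) (h 0))"
  have D: "measure_pmf D = distr P (count_space UNIV) (h 0)"
    unfolding D_def by (intro measure_pmf_Abs_pmf_countable P.prob_space_distr hm) simp
  interpret iid_env D .
  have distr_h: "distr P (measure_pmf D) (h x) = measure_pmf D" for x
  proof -
    have "distr P (measure_pmf D) (h x) = distr P (count_space UNIV) (h x)"
      by (rule distr_cong) auto
    also have "\<dots> = distr (distr P borel (H x)) (count_space UNIV) (\<lambda>r. nat \<lfloor>r\<rfloor>)"
      by (subst distr_distr[OF nf]) (auto simp: comp_def h_def[abs_def])
    also have "\<dots> = distr (distr P borel (H 0)) (count_space UNIV) (\<lambda>r. nat \<lfloor>r\<rfloor>)" by (simp only: assms(6)[of x])
    also have "\<dots> = measure_pmf D"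
      unfolding D by (subst distr_distr[OF nf]) (auto simp: comp_def h_def[abs_def])
    finally show ?thesis .
  qed
  have "P.indep_vars (\<lambda>_. measure_pmf D) (\<lambda>x \<omega>. nat \<lfloor>H x \<omega>\<rfloor>) UNIV"
    by (rule P.indep_vars_compose2[OF assms(5)]) (use nf in simp)
  then have "P.indep_vars (\<lambda>_. measure_pmf D) h UNIV" by (simp add: h_def[abs_def])
  note law = P.distr_iid_eq_PiM[OF this distr_h]
  have transfer: "AE \<omega> in P. R (\<lambda>y. h y \<omega>)" if "AE \<eta> in Q. R \<eta>" for R
  proof (rule AE_distrD[OF law(2)])
    show "AE \<eta> in distr P Q (\<lambda>\<omega> y. h y \<omega>). R \<eta>" using that by (simp only: law(1))
  qed
  have comb: "Comb (\<lambda>x. H x \<omega>) = comb (\<lambda>y. h y \<omega>)" if "\<omega> \<in> space P" for \<omega>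
    using Comb_eq_comb[of "\<lambda>x. H x \<omega>"] H0[OF that] by (simp add: h_def)
  have graph: "simple_graph (comb (\<lambda>y. h y \<omega>))" "connected_graph (comb (\<lambda>y. h y \<omega>))"
      "locally_finite_graph (comb (\<lambda>y. h y \<omega>))" if "\<omega> \<in> space P" for \<omega>
    using simple_graph_Comb[of "\<lambda>x. H x \<omega>", OF H0[OF that]] connected_graph_Comb[of "\<lambda>x. H x \<omega>"]
      locally_finite_graph_Comb[of "\<lambda>x. H x \<omega>"]
    unfolding comb[OF that] .

  define f where "f z = measure P {\<omega> \<in> space P. H 0 \<omega> > z}" for z
  have prob_D: "measure_pmf.prob D {l..} = P.prob {\<omega> \<in> space P. real l \<le> H 0 \<omega>}" for l
  proof -
    have "measure_pmf.prob D {l..} = P.prob (h 0 -` {l..} \<inter> space P)"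
      unfolding D by (rule measure_distr) auto
    also have "h 0 -` {l..} \<inter> space P = {\<omega> \<in> space P. real l \<le> H 0 \<omega>}"
      using H0 by (auto simp: h_def le_nat_iff le_floor_iff)
    finally show ?thesis .
  qed
  have f1: "f z \<le> 1" for z unfolding f_def by simp
  have lim: "((\<lambda>z. z powr \<gamma> * f z) \<longlongrightarrow> C) at_top" using assms(8) by (simp only: f_def)
  obtain B z0 where B: "0 < B" "\<And>z. 0 < z \<Longrightarrow> f z \<le> B * z powr (- \<gamma>)"
      and z0: "\<And>z. z0 \<le> z \<Longrightarrow> C / 2 * z powr (- \<gamma>) \<le> f z"
    using regular_tail_bounds[OF \<gamma>(1) assms(3) f1 lim] by blast
  have upper: "measure_pmf.prob D {l..} \<le> 2 * B * real l powr (- \<gamma>)" if "1 \<le> l" for l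
  proof -
    \<comment> \<open>The hypothesis concerns strict exceedance; passing to half the threshold costs
      a factor 2^\<gamma> <= 2.\<close>
    have "measure_pmf.prob D {l..} \<le> f (real l / 2)"
      unfolding prob_D f_def using that by (intro P.finite_measure_mono) auto
    also have "\<dots> \<le> B * (real l / 2) powr (- \<gamma>)" using that by (intro B) auto
    also have "\<dots> = B * (2 powr \<gamma> * real l powr (- \<gamma>))" by (simp add: powr_divide) (simp only: powr_minus[of 2] divide_inverse inverse_inverse_eq mult_ac)
    also have "\<dots> \<le> B * (2 powr 1 * real l powr (- \<gamma>))"
      using B(1) \<gamma> by (intro mult_left_mono mult_right_mono powr_mono) auto
    finally show ?thesis by simp
  qed

  show ?thesis
  proof (cases \<gamma> "1 / 3 :: real" rule: linorder_cases)
    case equal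
    then show ?thesis by simp
  next
    case greater
    \<comment> \<open>For \<gamma> = 1 the first entry equals 1 and the truncated mean may grow
      logarithmically; any value above 1 whose cube is below 4 absorbs this.\<close>
    define \<rho> where "\<rho> = max (2 powr (1 - \<gamma>)) (11 / 10)"
    have \<rho>: "1 < \<rho>" "\<rho> ^ 3 < 4"
    proof -
      have "(2 powr (1 - \<gamma>)) ^ 3 = 2 powr (3 * (1 - \<gamma>))" by (simp add: powr_power)
      also have "\<dots> < 2 powr 2" using greater by (intro powr_less_mono) auto
      finally have "(2 powr (1 - \<gamma>)) ^ 3 < 4" by simp
      then show "\<rho> ^ 3 < 4" by (simp add: \<rho>_def max_def power3_eq_cube)
    qed (simp add: \<rho>_def)
    have "measure_pmf.prob D {2 ^ k..} \<le> 2 * B * (\<rho> / 2) ^ k" for k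
    proof -
      have "measure_pmf.prob D {2 ^ k..} \<le> 2 * B * (2 powr (- \<gamma>)) ^ k"
        using upper[of "2 ^ k"] by (simp add: powr_of_power_2)
      also have "\<dots> \<le> 2 * B * (\<rho> / 2) ^ k"
      proof (intro mult_left_mono power_mono)
        have "2 powr (- \<gamma>) = 2 powr (1 - \<gamma>) / 2" using powr_add[of 2 1 "- \<gamma>"] by simp
        then show "2 powr (- \<gamma>) \<le> \<rho> / 2" by (simp add: \<rho>_def)
      qed (use B(1) in auto)
      finally show ?thesis .
    qed
    then have "AE \<eta> in Q. finp \<eta> = 0" using \<rho> B(1) by (intro AE_finp_eq_0_if_tail[of \<rho> "2 * B"]) auto
    from transfer[OF this] AE_space show ?thesis
    proof eventually_elim
      case (elim \<omega>)
      have "infinite_collision_property (Comb (\<lambda>x. H x \<omega>))"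
        unfolding infinite_collision_property_def comb[OF elim(2)]
        using graph[OF elim(2)] comb.AE_infinite_collisions[of "(0, 0)" "\<lambda>y. h y \<omega>"] elim(1)
        by (intro conjI bexI[of _ "(0, 0)"]) simp_all
      then show ?case using greater by simp
    qed
  next
    case less
    have summ: "summable (\<lambda>l. sqrt (measure_pmf.prob D {l..}) / real (Suc l))"
    proof (rule summable_comparison_test_ev)
      show "eventually (\<lambda>l. norm (sqrt (measure_pmf.prob D {l..}) / real (Suc l)) \<le>
          sqrt (2 * B) * real l powr (- \<gamma> / 2 - 1)) sequentially"
        using eventually_ge_at_top[of 1]
      proof eventually_elim
        case (elim l)
        have "sqrt (measure_pmf.prob D {l..}) \<le> sqrt (2 * B * real l powr (- \<gamma>))"
          by (intro real_sqrt_le_mono upper elim)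
        also have "\<dots> = sqrt (2 * B) * real l powr (- \<gamma> / 2)"
        proof -
          have "sqrt (real l powr (- \<gamma>)) = (real l powr (- \<gamma>)) powr (1 / 2)" by (rule powr_half_sqrt[symmetric]) simp
          also have "\<dots> = real l powr (- \<gamma> / 2)" by (simp only: powr_powr) simp
          finally show ?thesis by (simp only: real_sqrt_mult)
        qed
        finally have "sqrt (measure_pmf.prob D {l..}) / real (Suc l) \<le> sqrt (2 * B) * real l powr (- \<gamma> / 2) / real l"
          using elim B(1) by (intro frac_le) auto
        also have "\<dots> = sqrt (2 * B) * real l powr (- \<gamma> / 2 - 1)"
          using elim by (simp add: powr_diff)
        finally show ?case by simp
      qed
      show "summable (\<lambda>l. sqrt (2 * B) * real l powr (- \<gamma> / 2 - 1))"
        using \<gamma> by (intro summable_mult) (simp add: summable_real_powr_iff)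
    qed
    have "summable bb"
    proof (rule summable_bb_if_tail)
      show "0 < (2 :: real) powr (- \<gamma>)" by simp
      have "1 / 2 = (2 :: real) powr (- 1)" by simp
      also have "\<dots> < 2 powr (3 * (- \<gamma>))" using less by (intro powr_less_mono) auto
      also have "\<dots> = (2 powr (- \<gamma>)) ^ 3" by (simp add: powr_power)
      finally show "1 / 2 < ((2 :: real) powr (- \<gamma>)) ^ 3" .
      show "0 < C / 2" using assms(3) by simp
      obtain k0 where k0: "z0 < 2 ^ k0" using real_arch_pow[of 2 z0] by auto
      show "eventually (\<lambda>k. C / 2 * (2 powr (- \<gamma>)) ^ k \<le> measure_pmf.prob D {2 ^ k..}) sequentially"
        using eventually_ge_at_top[of k0]
      proof eventually_elim
        case (elim k)
        have "z0 \<le> 2 ^ k" using k0 power_increasing[OF elim, of "2 :: real"] by linarith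
        then have "C / 2 * (2 powr (- \<gamma>)) ^ k \<le> f (2 ^ k)" using z0[of "2 ^ k"] by (simp add: powr_of_power_2)
        also have "\<dots> \<le> measure_pmf.prob D {2 ^ k..}"
          unfolding prob_D f_def by (intro P.finite_measure_mono) auto
        finally show ?case .
      qed
    qed
    then have "AE \<eta> in Q. finp \<eta> = 1" using summ by (rule AE_finp_eq_1)
    from transfer[OF this] AE_space show ?thesis
    proof eventually_elim
      case (elim \<omega>)
      have "finite_collision_property (Comb (\<lambda>x. H x \<omega>))"
        unfolding finite_collision_property_def comb[OF elim(2)]
        using graph[OF elim(2)] comb.AE_finite_collisions[of "(0, 0)" "\<lambda>y. h y \<omega>"] elim(1)
        by (intro conjI bexI[of _ "(0, 0)"]) simp_all
      then show ?case using less by simp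
    qed
  qed
qed

end
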